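(* Let $X$ be a smooth vector field on a compact connected manifold $M$ (without boundary), and let $\mathcal{G}_X=(M,A,\|\cdot\|,\sharp)$ be the associated geometric structure, where $A=\mathbb{R}\times M$ is the trivial line bundle over $M$, $\|\cdot\|$ is the absolute value on each fiber $\mathbb{R}$, and the anchor map $\sharp$ sends the unit section of $A$ to $X$. Then $$h(\mathcal{G}_X)=H(\mathcal{G}_X)=2\,h_{top}(X),$$ where $h_{top}(X)$ denotes the topological entropy of $X$.
   Context: A geometric structure is a quadruple $\mathcal{G}=(M,A,\|\cdot\|,\sharp)$ where $M$ is a smooth finite-dimensional connected manifold, $A$ is a smooth finite-rank real vector bundle over $M$, $\|\cdot\|$ is a norm on the fibers of $A$ (depending continuously on the base point), and $\sharp:A\to TM$ is a smooth vector bundle morphism over the identity (the anchor map). A piecewise-smooth continuous path $\gamma:[0,1]\to M$ is an $A$-path if there is a piecewise-smooth (not necessarily continuous) $\Gamma:[0,1]\to A$ with $\Gamma(t)\in A_{\gamma(t)}$ and $\sharp(\Gamma(t))=\frac{d\gamma(t)}{dt}$ for almost all $t\in[0,1]$. It has $A$-speed at most $r$ if $\Gamma$ can be chosen with $\|\Gamma(t)\|\le r$ for almost all $t$. $\mathcal{P}(x,r)$ denotes the set of all $A$-paths of $A$-speed at most $r$ with $\gamma(0)=x$, and $\mathcal{P}(x,\infty)$ the set of all $A$-paths with $\gamma(0)=x$, with no restriction on the $A$-speed. Fix a Riemannian metric on $M$ with distance function $d$. For $x,y\in M$ and $r>0$ put $$\delta_r(x,y)=\sup_{\gamma\in\mathcal{P}(x,r)}\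 \inf_{\mu\in\mathcal{P}(y,r)}\ \sup_{t\in[0,1]} d(\gamma(t),\mu(t)),\qquad d_r(x,y)=\delta_r(x,y)+\delta_r(y,x),$$ $$\Delta_r(x,y)=\sup_{\gamma\in\mathcal{P}(x,r)}\ \inf_{\mu\in\mathcal{P}(y,\infty)}\ \sup_{t\in[0,1]} d(\gamma(t),\mu(t)),\qquad D_r(x,y)=\Delta_r(x,y)+\Delta_r(y,x).$$ For $\epsilon>0$ and $\mathbf{d}\in\{d_r,D_r\}$ let $N(\mathbf{d},\epsilon)$ be the maximal cardinality of a subset of $M$ any two distinct points $x,y$ of which satisfy $\mathbf{d}(x,y)\ge\epsilon$. Then $$h(\mathcal{G})=\lim_{\epsilon\to0+}\limsup_{r\to\infty}\frac{\ln N(d_r,\epsilon)}{r},\qquad H(\mathcal{G})=\lim_{\epsilon\to0+}\limsup_{r\to\infty}\frac{\ln N(D_r,\epsilon)}{r};$$ $h(\mathcal{G})$ is called the entropy of $\mathcal{G}$. These do not depend on the choice of the Riemannian metric on the compact manifold $M$. Topological entropy (Bowen–Dinaburg formula): let $\phi^t_X$ be the flow of $X$, $d^X_r(x,y)=\max_{t\in[0,r]}d(\phi^t_X(x),\phi^t_X(y))$, and let $N(X,r,\epsilon)$ be the maximal number of points of $M$ that are pairwise at $d^X_r$-distance at least $\epsilon$. Then $h_{top}(X)=\lim_{\epsilon\to0+}\limsup_{r\to\infty}\frac{\ln N(X,r,\epsilon)}{r}$. *)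

theory Defs
  imports "HOL-Analysis.Analysis"
begin

section \<open>Smooth maps between subsets of Euclidean spaces\<close>

primrec Ck_on :: "nat \<Rightarrow> 'x::euclidean_space set \<Rightarrow> ('x \<Rightarrow> 'y::euclidean_space) \<Rightarrow> bool" where
  "Ck_on 0 U f \<longleftrightarrow> continuous_on U f"
| "Ck_on (Suc k) U f \<longleftrightarrow> (\<forall>x\<in>U. f differentiable (at x)) \<and>
     (\<forall>v. Ck_on k U (\<lambda>x. frechet_derivative f (at x) v))"

definition Cinf_on :: "'x::euclidean_space set \<Rightarrow> ('x \<Rightarrow> 'y::euclidean_space) \<Rightarrow> bool" where
  "Cinf_on U f \<longleftrightarrow> (\<forall>k. Ck_on k U f)"

text \<open>Smoothness on an arbitrary subset of a Euclidean space: local smooth extendability.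
  It is applied to relatively open subsets of linear subspaces and to intervals.\<close>

definition smooth_on :: "'x::euclidean_space set \<Rightarrow> ('x \<Rightarrow> 'y::euclidean_space) \<Rightarrow> bool" where
  "smooth_on S f \<longleftrightarrow>
     (\<forall>x\<in>S. \<exists>U h. open U \<and> x \<in> U \<and> Cinf_on U h \<and> (\<forall>y\<in>S \<inter> U. h y = f y))"


section \<open>Smooth manifolds\<close>

text \<open>A chart is a domain together with a coordinate map. Coordinates take values in a linear
  subspace \<open>model\<close> of the Euclidean space \<open>'e\<close>, whose dimension is the dimension of
  the manifold. The type class \<^class>\<open>euclidean_space\<close> has no 0-dimensional instance; the
  subspace makes dimension 0 available.\<close>

type_synonym ('a, 'e) chart = "'a set \<times> ('a \<Rightarrow> 'e)"

abbreviation cdom :: "('a, 'e) chart \<Rightarrow> 'a set" where "cdom \<equiv> fst"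
abbreviation cmap :: "('a, 'e) chart \<Rightarrow> 'a \<Rightarrow> 'e" where "cmap \<equiv> snd"

definition cinv :: "('a, 'e) chart \<Rightarrow> 'e \<Rightarrow> 'a" where
  "cinv c = inv_into (cdom c) (cmap c)"

definition cimage :: "('a, 'e) chart \<Rightarrow> 'e set" where
  "cimage c = cmap c ` cdom c"

record ('a, 'e) manifold =
  model :: "'e set"
  charts :: "('a, 'e) chart set"

definition points :: "('a, 'e) manifold \<Rightarrow> 'a set" where
  "points M = (\<Union>c\<in>charts M. cdom c)"

definition smooth_atlas :: "('a, 'e::euclidean_space) manifold \<Rightarrow> bool" where
  "smooth_atlas M \<longleftrightarrow> subspace (model M) \<and>
     (\<forall>c\<in>charts M. inj_on (cmap c) (cdom c)) \<and>
     (\<forall>c\<in>charts M. \<forall>c'\<in>charts M.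
        openin (top_of_set (model M)) (cmap c ` (cdom c \<inter> cdom c')) \<and>
        smooth_on (cmap c ` (cdom c \<inter> cdom c')) (cmap c' \<circ> cinv c))"

text \<open>The topology for which all charts are homeomorphisms onto open subsets of the model space.\<close>

definition manifold_topology :: "('a, 'e::euclidean_space) manifold \<Rightarrow> 'a topology" where
  "manifold_topology M = topology (\<lambda>U. U \<subseteq> points M \<and>
     (\<forall>c\<in>charts M. openin (top_of_set (model M)) (cmap c ` (U \<inter> cdom c))))"

lemma openin_manifold_topology:
  assumes "smooth_atlas M"
  shows "openin (manifold_topology M) U \<longleftrightarrow> U \<subseteq> points M \<and>
     (\<forall>c\<in>charts M. openin (top_of_set (model M)) (cmap c ` (U \<inter> cdom c)))"
proof -
  let ?P = "\<lambda>U. U \<subseteq> points M \<and>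
     (\<forall>c\<in>charts M. openin (top_of_set (model M)) (cmap c ` (U \<inter> cdom c)))"
  have "istopology ?P"
    unfolding istopology_def
  proof (intro conjI allI impI)
    fix S T assume S: "?P S" and T: "?P T"
    show "S \<inter> T \<subseteq> points M" using S by blast
    show "\<forall>c\<in>charts M. openin (top_of_set (model M)) (cmap c ` (S \<inter> T \<inter> cdom c))"
    proof
      fix c assume c: "c \<in> charts M"
      with assms have "inj_on (cmap c) (cdom c)" by (simp add: smooth_atlas_def)
      then have "cmap c ` (S \<inter> T \<inter> cdom c) = cmap c ` (S \<inter> cdom c) \<inter> cmap c ` (T \<inter> cdom c)"
        by (auto simp: inj_on_def)
      with S T c show "openin (top_of_set (model M)) (cmap c ` (S \<inter> T \<inter> cdom c))"
        by auto
    qed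
  next
    fix \<K> assume K: "\<forall>K\<in>\<K>. ?P K"
    show "\<Union>\<K> \<subseteq> points M" using K by blast
    show "\<forall>c\<in>charts M. openin (top_of_set (model M)) (cmap c ` (\<Union>\<K> \<inter> cdom c))"
    proof
      fix c assume c: "c \<in> charts M"
      have "cmap c ` (\<Union>\<K> \<inter> cdom c) = (\<Union>K\<in>\<K>. cmap c ` (K \<inter> cdom c))" by blast
      with K c show "openin (top_of_set (model M)) (cmap c ` (\<Union>\<K> \<inter> cdom c))"
        by auto
    qed
  qed
  then show ?thesis
    by (simp add: manifold_topology_def topology_inverse')
qed

definition smooth_manifold :: "('a, 'e::euclidean_space) manifold \<Rightarrow> bool" where
  "smooth_manifold M \<longleftrightarrow> smooth_atlas M \<and>
     Hausdorff_space (manifold_topology M) \<and> second_countable (manifold_topology M)"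

text \<open>Smooth maps from a subset of a Euclidean space (e.g. a closed interval) into a manifold,
  and smooth maps between manifolds.\<close>

definition smooth_into ::
  "('a, 'e::euclidean_space) manifold \<Rightarrow> 'x::euclidean_space set \<Rightarrow> ('x \<Rightarrow> 'a) \<Rightarrow> bool" where
  "smooth_into M S f \<longleftrightarrow> f ` S \<subseteq> points M \<and>
     (\<forall>c\<in>charts M. openin (top_of_set S) (S \<inter> f -` cdom c) \<and>
        smooth_on (S \<inter> f -` cdom c) (cmap c \<circ> f))"

definition smooth_map ::
  "('a, 'e::euclidean_space) manifold \<Rightarrow> ('b, 'f::euclidean_space) manifold \<Rightarrow> ('a \<Rightarrow> 'b) \<Rightarrow> bool" where
  "smooth_map M N f \<longleftrightarrow> (\<forall>c\<in>charts M. smooth_into N (cimage c) (f \<circ> cinv c))"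


section \<open>Vector bundles and the tangent bundle\<close>

text \<open>A local trivialization is given by an open subset of the base and the fibre coordinate,
  a map from the part of the total space over that subset to the typical fibre
  \<open>fmodel\<close>.\<close>

record ('v, 'a, 'e, 'f) vbundle =
  base :: "('a, 'e) manifold"
  total_space :: "'v set"
  bproj :: "'v \<Rightarrow> 'a"
  fadd :: "'v \<Rightarrow> 'v \<Rightarrow> 'v"
  fscale :: "real \<Rightarrow> 'v \<Rightarrow> 'v"
  fmodel :: "'f set"
  trivs :: "('a set \<times> ('v \<Rightarrow> 'f)) set"

definition fibre :: "('v, 'a, 'e, 'f, 'z) vbundle_scheme \<Rightarrow> 'a \<Rightarrow> 'v set" where
  "fibre B p = {v \<in> total_space B. bproj B v = p}"

definition total_manifold ::
  "('v, 'a, 'e, 'f, 'z) vbundle_scheme \<Rightarrow> ('v, 'e \<times> 'f) manifold" where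
  "total_manifold B = \<lparr> model = model (base B) \<times> fmodel B,
     charts = {({v \<in> total_space B. bproj B v \<in> cdom c \<inter> U}, \<lambda>v. (cmap c (bproj B v), \<Phi> v))
                 | c U \<Phi>. c \<in> charts (base B) \<and> (U, \<Phi>) \<in> trivs B} \<rparr>"

definition smooth_vector_bundle ::
  "('v, 'a, 'e::euclidean_space, 'f::euclidean_space, 'z) vbundle_scheme \<Rightarrow> bool" where
  "smooth_vector_bundle B \<longleftrightarrow> smooth_manifold (base B) \<and> subspace (fmodel B) \<and>
     bproj B ` total_space B \<subseteq> points (base B) \<and>
     (\<Union>(U, \<Phi>)\<in>trivs B. U) = points (base B) \<and>
     (\<forall>(U, \<Phi>)\<in>trivs B. openin (manifold_topology (base B)) U \<and>
        (\<forall>p\<in>U. bij_betw \<Phi> (fibre B p) (fmodel B) \<and>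
           (\<forall>v\<in>fibre B p. \<forall>w\<in>fibre B p. fadd B v w \<in> fibre B p \<and> \<Phi> (fadd B v w) = \<Phi> v + \<Phi> w) \<and>
           (\<forall>a. \<forall>v\<in>fibre B p. fscale B a v \<in> fibre B p \<and> \<Phi> (fscale B a v) = a *\<^sub>R \<Phi> v))) \<and>
     smooth_atlas (total_manifold B)"

definition smooth_section ::
  "('v, 'a, 'e::euclidean_space, 'f::euclidean_space, 'z) vbundle_scheme \<Rightarrow> ('a \<Rightarrow> 'v) \<Rightarrow> bool" where
  "smooth_section B s \<longleftrightarrow> smooth_map (base B) (total_manifold B) s \<and>
     (\<forall>p\<in>points (base B). s p \<in> fibre B p)"

text \<open>Morphisms over the identity of the common base.\<close>

definition bundle_morphism ::
  "('v, 'a, 'e::euclidean_space, 'f::euclidean_space, 'y) vbundle_scheme \<Rightarrow>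
   ('w, 'a, 'e, 'g::euclidean_space, 'z) vbundle_scheme \<Rightarrow> ('v \<Rightarrow> 'w) \<Rightarrow> bool" where
  "bundle_morphism A B F \<longleftrightarrow> base A = base B \<and>
     smooth_map (total_manifold A) (total_manifold B) F \<and>
     (\<forall>p\<in>points (base A).
        (\<forall>v\<in>fibre A p. F v \<in> fibre B p) \<and>
        (\<forall>v\<in>fibre A p. \<forall>w\<in>fibre A p. F (fadd A v w) = fadd B (F v) (F w)) \<and>
        (\<forall>a. \<forall>v\<in>fibre A p. F (fscale A a v) = fscale B a (F v)))"

text \<open>A tangent vector is a base point together with its family of coordinate vectors, one for each
  chart around the base point, related by the derivatives of the transition maps.\<close>

type_synonym ('a, 'e) tangent = "'a \<times> (('a, 'e) chart \<Rightarrow> 'e)"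

definition tangent_vectors :: "('a, 'e::euclidean_space) manifold \<Rightarrow> ('a, 'e) tangent set" where
  "tangent_vectors M = {(p, v). p \<in> points M \<and>
     (\<forall>c. c \<in> charts M \<and> p \<in> cdom c \<longrightarrow> v c \<in> model M) \<and>
     (\<forall>c. \<not> (c \<in> charts M \<and> p \<in> cdom c) \<longrightarrow> v c = 0) \<and>
     (\<forall>c\<in>charts M. \<forall>c'\<in>charts M. p \<in> cdom c \<inter> cdom c' \<longrightarrow>
        (\<exists>D. ((cmap c' \<circ> cinv c) has_derivative D)
                (at (cmap c p) within cmap c ` (cdom c \<inter> cdom c')) \<and> v c' = D (v c)))}"

definition tangent_bundle ::
  "('a, 'e::euclidean_space) manifold \<Rightarrow> (('a, 'e) tangent, 'a, 'e, 'e) vbundle" where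
  "tangent_bundle M = \<lparr> base = M, total_space = tangent_vectors M, bproj = fst,
     fadd = (\<lambda>\<xi> \<eta>. (fst \<xi>, \<lambda>c. snd \<xi> c + snd \<eta> c)),
     fscale = (\<lambda>a \<xi>. (fst \<xi>, \<lambda>c. a *\<^sub>R snd \<xi> c)),
     fmodel = model M,
     trivs = {(cdom c, \<lambda>\<xi>. snd \<xi> c) | c. c \<in> charts M} \<rparr>"

definition smooth_vector_field ::
  "('a, 'e::euclidean_space) manifold \<Rightarrow> ('a \<Rightarrow> ('a, 'e) tangent) \<Rightarrow> bool" where
  "smooth_vector_field M X \<longleftrightarrow> smooth_section (tangent_bundle M) X"


section \<open>Curves\<close>

text \<open>\<open>has_velocity M \<gamma> \<xi> t\<close>: the two-sided derivative of the curve at \<open>t\<close> is the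
  tangent vector \<open>\<xi>\<close>. Coordinate maps are arbitrary outside of the chart domains, so the curve
  has to be required to stay in the chart domain near \<open>t\<close>.\<close>

definition has_velocity ::
  "('a, 'e::euclidean_space) manifold \<Rightarrow> (real \<Rightarrow> 'a) \<Rightarrow> ('a, 'e) tangent \<Rightarrow> real \<Rightarrow> bool" where
  "has_velocity M \<gamma> \<xi> t \<longleftrightarrow> \<xi> \<in> fibre (tangent_bundle M) (\<gamma> t) \<and>
     (\<forall>c\<in>charts M. \<gamma> t \<in> cdom c \<longrightarrow>
        (\<forall>\<^sub>F s in nhds t. \<gamma> s \<in> cdom c) \<and>
        ((cmap c \<circ> \<gamma>) has_vector_derivative snd \<xi> c) (at t))"

definition partition01 :: "nat \<Rightarrow> (nat \<Rightarrow> real) \<Rightarrow> bool" where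
  "partition01 n \<tau> \<longleftrightarrow> \<tau> 0 = 0 \<and> \<tau> n = 1 \<and> (\<forall>i<n. \<tau> i < \<tau> (Suc i))"

text \<open>Continuous piecewise-smooth curves are smooth on each closed piece, which entails continuity.
  Without continuity, the curve agrees on each open piece with one that is smooth on the
  closed piece.\<close>

definition piecewise_smooth_path :: "('a, 'e::euclidean_space) manifold \<Rightarrow> (real \<Rightarrow> 'a) \<Rightarrow> bool" where
  "piecewise_smooth_path M \<gamma> \<longleftrightarrow>
     (\<exists>n \<tau>. partition01 n \<tau> \<and> (\<forall>i<n. smooth_into M {\<tau> i..\<tau> (Suc i)} \<gamma>))"

definition piecewise_smooth_discont :: "('a, 'e::euclidean_space) manifold \<Rightarrow> (real \<Rightarrow> 'a) \<Rightarrow> bool" where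
  "piecewise_smooth_discont M \<Gamma> \<longleftrightarrow> \<Gamma> ` {0..1} \<subseteq> points M \<and>
     (\<exists>n \<tau>. partition01 n \<tau> \<and>
        (\<forall>i<n. \<exists>\<Gamma>'. smooth_into M {\<tau> i..\<tau> (Suc i)} \<Gamma>' \<and>
           (\<forall>t\<in>{\<tau> i<..<\<tau> (Suc i)}. \<Gamma> t = \<Gamma>' t)))"


section \<open>Riemannian metrics\<close>

text \<open>The tangent vector at \<open>p\<close> with coordinate vector \<open>u\<close> in the chart \<open>c\<close>.\<close>

definition coord_tangent ::
  "('a, 'e::euclidean_space) manifold \<Rightarrow> ('a, 'e) chart \<Rightarrow> 'a \<Rightarrow> 'e \<Rightarrow> ('a, 'e) tangent" where
  "coord_tangent M c p u = (THE \<xi>. \<xi> \<in> fibre (tangent_bundle M) p \<and> snd \<xi> c = u)"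

definition riemannian_metric ::
  "('a, 'e::euclidean_space) manifold \<Rightarrow> (('a, 'e) tangent \<Rightarrow> ('a, 'e) tangent \<Rightarrow> real) \<Rightarrow> bool" where
  "riemannian_metric M g \<longleftrightarrow>
     (\<forall>p\<in>points M. \<forall>\<xi>\<in>fibre (tangent_bundle M) p.
        (\<forall>\<eta>\<in>fibre (tangent_bundle M) p. g \<xi> \<eta> = g \<eta> \<xi> \<and>
           (\<forall>\<zeta>\<in>fibre (tangent_bundle M) p.
              g (fadd (tangent_bundle M) \<xi> \<eta>) \<zeta> = g \<xi> \<zeta> + g \<eta> \<zeta>) \<and>
           (\<forall>a. g (fscale (tangent_bundle M) a \<xi>) \<eta> = a * g \<xi> \<eta>)) \<and>
        (snd \<xi> \<noteq> (\<lambda>_. 0) \<longrightarrow> g \<xi> \<xi> > 0)) \<and>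
     (\<forall>c\<in>charts M. \<forall>u\<in>model M. \<forall>w\<in>model M. smooth_on (cimage c)
        (\<lambda>x. g (coord_tangent M c (cinv c x) u) (coord_tangent M c (cinv c x) w)))"

definition path_length ::
  "('a, 'e::euclidean_space) manifold \<Rightarrow> (('a, 'e) tangent \<Rightarrow> ('a, 'e) tangent \<Rightarrow> real) \<Rightarrow>
   (real \<Rightarrow> 'a) \<Rightarrow> real" where
  "path_length M g \<gamma> = integral {0..1}
     (\<lambda>t. let \<xi> = (THE \<xi>. has_velocity M \<gamma> \<xi> t) in sqrt (g \<xi> \<xi>))"

definition riemannian_dist ::
  "('a, 'e::euclidean_space) manifold \<Rightarrow> (('a, 'e) tangent \<Rightarrow> ('a, 'e) tangent \<Rightarrow> real) \<Rightarrow>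
   'a \<Rightarrow> 'a \<Rightarrow> real" where
  "riemannian_dist M g x y =
     Inf {path_length M g \<gamma> | \<gamma>. piecewise_smooth_path M \<gamma> \<and> \<gamma> 0 = x \<and> \<gamma> 1 = y}"


section \<open>Geometric structures and their entropy\<close>

record ('v, 'a, 'e, 'f) geom_structure = "('v, 'a, 'e, 'f) vbundle" +
  fnorm :: "'v \<Rightarrow> real"
  anchor :: "'v \<Rightarrow> ('a, 'e) tangent"

definition geometric_structure ::
  "('v, 'a, 'e::euclidean_space, 'f::euclidean_space) geom_structure \<Rightarrow> bool" where
  "geometric_structure G \<longleftrightarrow> smooth_vector_bundle G \<and>
     connected_space (manifold_topology (base G)) \<and>
     (\<forall>p\<in>points (base G). \<forall>v\<in>fibre G p.
        fnorm G v \<ge> 0 \<and> (fnorm G v = 0 \<longrightarrow> v = fscale G 0 v) \<and>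
        (\<forall>a. fnorm G (fscale G a v) = \<bar>a\<bar> * fnorm G v) \<and>
        (\<forall>w\<in>fibre G p. fnorm G (fadd G v w) \<le> fnorm G v + fnorm G w)) \<and>
     continuous_map (manifold_topology (total_manifold G)) euclideanreal (fnorm G) \<and>
     bundle_morphism G (tangent_bundle (base G)) (anchor G)"

text \<open>\<open>A_paths G x r\<close> is the set of $A$-paths of $A$-speed at most \<open>r\<close> starting at
  \<open>x\<close>; for \<open>r = \<infinity>\<close> the speed is unrestricted. Paths are functions on the real line of
  which only the values on \<open>[0,1]\<close> matter.\<close>

definition A_paths ::
  "('v, 'a, 'e::euclidean_space, 'f::euclidean_space) geom_structure \<Rightarrow> 'a \<Rightarrow> ereal \<Rightarrow> (real \<Rightarrow> 'a) set" where
  "A_paths G x r = {\<gamma>. piecewise_smooth_path (base G) \<gamma> \<and> \<gamma> 0 = x \<and>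
     (\<exists>\<Gamma>. piecewise_smooth_discont (total_manifold G) \<Gamma> \<and>
        (\<forall>t\<in>{0..1}. \<Gamma> t \<in> fibre G (\<gamma> t)) \<and>
        (AE t in lebesgue_on {0..1}. has_velocity (base G) \<gamma> (anchor G (\<Gamma> t)) t) \<and>
        (AE t in lebesgue_on {0..1}. ereal (fnorm G (\<Gamma> t)) \<le> r))}"

text \<open>\<open>delta_paths G d r s\<close> is the asymmetric quantity with speed bound \<open>r\<close> on the given path and
  \<open>s\<close> on the approximating one; \<open>s = r\<close> gives $\delta_r$ and \<open>s = \<infinity>\<close> gives
  $\Delta_r$.\<close>

definition delta_paths ::
  "('v, 'a, 'e::euclidean_space, 'f::euclidean_space) geom_structure \<Rightarrow> ('a \<Rightarrow> 'a \<Rightarrow> real) \<Rightarrow>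
   ereal \<Rightarrow> ereal \<Rightarrow> 'a \<Rightarrow> 'a \<Rightarrow> ereal" where
  "delta_paths G d r s x y =
     (SUP \<gamma>\<in>A_paths G x r. INF \<mu>\<in>A_paths G y s. SUP t\<in>{0..1}. ereal (d (\<gamma> t) (\<mu> t)))"

definition d_paths ::
  "('v, 'a, 'e::euclidean_space, 'f::euclidean_space) geom_structure \<Rightarrow> ('a \<Rightarrow> 'a \<Rightarrow> real) \<Rightarrow>
   real \<Rightarrow> 'a \<Rightarrow> 'a \<Rightarrow> ereal" where
  "d_paths G d r x y =
     delta_paths G d (ereal r) (ereal r) x y + delta_paths G d (ereal r) (ereal r) y x"

definition D_paths ::
  "('v, 'a, 'e::euclidean_space, 'f::euclidean_space) geom_structure \<Rightarrow> ('a \<Rightarrow> 'a \<Rightarrow> real) \<Rightarrow>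
   real \<Rightarrow> 'a \<Rightarrow> 'a \<Rightarrow> ereal" where
  "D_paths G d r x y =
     delta_paths G d (ereal r) \<infinity> x y + delta_paths G d (ereal r) \<infinity> y x"

text \<open>The maximal cardinality of an \<open>\<epsilon>\<close>-separated subset of \<open>S\<close>, infinite if there are
  arbitrarily large finite ones.\<close>

definition sep_number :: "'a set \<Rightarrow> ('a \<Rightarrow> 'a \<Rightarrow> ereal) \<Rightarrow> real \<Rightarrow> ereal" where
  "sep_number S \<rho> \<epsilon> =
     (SUP T\<in>{T. T \<subseteq> S \<and> finite T \<and> (\<forall>x\<in>T. \<forall>y\<in>T. x \<noteq> y \<longrightarrow> ereal \<epsilon> \<le> \<rho> x y)}.
        ereal (real (card T)))"

text \<open>Logarithm of an extended positive number.\<close>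

definition ln_ereal :: "ereal \<Rightarrow> ereal" where
  "ln_ereal x = (if x = \<infinity> then \<infinity> else ereal (ln (real_of_ereal x)))"

definition growth_rate :: "'a set \<Rightarrow> (real \<Rightarrow> 'a \<Rightarrow> 'a \<Rightarrow> ereal) \<Rightarrow> ereal" where
  "growth_rate S \<rho> = Lim (at_right 0)
     (\<lambda>\<epsilon>. Limsup at_top (\<lambda>r. ln_ereal (sep_number S (\<rho> r) \<epsilon>) / ereal r))"

text \<open>The entropies $h(\mathcal G)$ and $H(\mathcal G)$, computed with a Riemannian metric
  \<open>g\<close>.\<close>

definition h_entropy ::
  "('v, 'a, 'e::euclidean_space, 'f::euclidean_space) geom_structure \<Rightarrow>
   (('a, 'e) tangent \<Rightarrow> ('a, 'e) tangent \<Rightarrow> real) \<Rightarrow> ereal" where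
  "h_entropy G g = growth_rate (points (base G)) (d_paths G (riemannian_dist (base G) g))"

definition H_entropy ::
  "('v, 'a, 'e::euclidean_space, 'f::euclidean_space) geom_structure \<Rightarrow>
   (('a, 'e) tangent \<Rightarrow> ('a, 'e) tangent \<Rightarrow> real) \<Rightarrow> ereal" where
  "H_entropy G g = growth_rate (points (base G)) (D_paths G (riemannian_dist (base G) g))"


section \<open>Flows and topological entropy\<close>

definition integral_curve ::
  "('a, 'e::euclidean_space) manifold \<Rightarrow> ('a \<Rightarrow> ('a, 'e) tangent) \<Rightarrow> (real \<Rightarrow> 'a) \<Rightarrow> bool" where
  "integral_curve M X \<gamma> \<longleftrightarrow> (\<forall>t. has_velocity M \<gamma> (X (\<gamma> t)) t)"

text \<open>The flow of a complete vector field.\<close>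

definition flow ::
  "('a, 'e::euclidean_space) manifold \<Rightarrow> ('a \<Rightarrow> ('a, 'e) tangent) \<Rightarrow> real \<Rightarrow> 'a \<Rightarrow> 'a" where
  "flow M X t x = (THE y. \<exists>\<gamma>. integral_curve M X \<gamma> \<and> \<gamma> 0 = x \<and> \<gamma> t = y)"

definition bowen_dist ::
  "('a, 'e::euclidean_space) manifold \<Rightarrow> ('a \<Rightarrow> ('a, 'e) tangent) \<Rightarrow> ('a \<Rightarrow> 'a \<Rightarrow> real) \<Rightarrow>
   real \<Rightarrow> 'a \<Rightarrow> 'a \<Rightarrow> ereal" where
  "bowen_dist M X d r x y = (SUP t\<in>{0..r}. ereal (d (flow M X t x) (flow M X t y)))"

definition topological_entropy ::
  "('a, 'e::euclidean_space) manifold \<Rightarrow> ('a \<Rightarrow> ('a, 'e) tangent) \<Rightarrow>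
   (('a, 'e) tangent \<Rightarrow> ('a, 'e) tangent \<Rightarrow> real) \<Rightarrow> ereal" where
  "topological_entropy M X g = growth_rate (points M) (bowen_dist M X (riemannian_dist M g))"


section \<open>The geometric structure of a vector field\<close>

definition vf_structure ::
  "('a, 'e::euclidean_space) manifold \<Rightarrow> ('a \<Rightarrow> ('a, 'e) tangent) \<Rightarrow>
   (real \<times> 'a, 'a, 'e, real) geom_structure" where
  "vf_structure M X = \<lparr> base = M, total_space = UNIV \<times> points M, bproj = snd,
     fadd = (\<lambda>(a, p) (b, q). (a + b, p)), fscale = (\<lambda>a (b, p). (a * b, p)),
     fmodel = UNIV, trivs = {(points M, fst)},
     fnorm = (\<lambda>(a, p). \<bar>a\<bar>),
     anchor = (\<lambda>(a, p). fscale (tangent_bundle M) a (X p)) \<rparr>"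


subsection \<open>Well-definedness: it is a geometric structure\<close>

lemma Ck_on_subset: "Ck_on k U f \<Longrightarrow> V \<subseteq> U \<Longrightarrow> Ck_on k V f"
  by (induction k arbitrary: f) (auto intro: continuous_on_subset)

lemma Ck_on_cong:
  assumes "open U" "\<And>x. x \<in> U \<Longrightarrow> f x = h x" "Ck_on k U f"
  shows "Ck_on k U h"
  using assms(2,3)
proof (induction k arbitrary: f h)
  case 0
  then show ?case using continuous_on_cong by fastforce
next
  case (Suc k)
  have *: "(h has_derivative frechet_derivative f (at x)) (at x)" if "x \<in> U" for x
  proof -
    have "(f has_derivative frechet_derivative f (at x)) (at x)"
      using Suc.prems(2) that by (simp add: frechet_derivative_works)
    then show ?thesis
      using assms(1) that Suc.prems(1) has_derivative_transform_within_open by blast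
  qed
  then have eq: "frechet_derivative h (at x) = frechet_derivative f (at x)" if "x \<in> U" for x
    using that frechet_derivative_at by metis
  show ?case
    using * Suc.prems(2) eq Suc.IH[of "\<lambda>x. frechet_derivative f (at x) v" "\<lambda>x. frechet_derivative h (at x) v" for v]
    by (auto simp: differentiable_def)
qed

lemma Ck_on_SucI:
  assumes "open U" "\<And>x. x \<in> U \<Longrightarrow> (f has_derivative f' x) (at x)"
    and "\<And>v. Ck_on k U (\<lambda>x. f' x v)"
  shows "Ck_on (Suc k) U f"
proof -
  have "frechet_derivative f (at x) = f' x" if "x \<in> U" for x
    using assms(2)[OF that] frechet_derivative_at by metis
  then have "Ck_on k U (\<lambda>x. frechet_derivative f (at x) v)" for v
    by (intro Ck_on_cong[OF assms(1) _ assms(3)[of v]]) auto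
  then show ?thesis using assms(2) by (auto simp: differentiable_def)
qed

lemma Ck_on_SucD:
  assumes "Ck_on (Suc k) U f"
  shows "\<And>x. x \<in> U \<Longrightarrow> (f has_derivative frechet_derivative f (at x)) (at x)"
    "\<And>v. Ck_on k U (\<lambda>x. frechet_derivative f (at x) v)"
  using assms by (auto simp: frechet_derivative_works)

lemma Ck_on_mono: "Ck_on (Suc k) U f \<Longrightarrow> Ck_on k U f"
proof (induction k arbitrary: f)
  case 0
  then show ?case
    by (auto intro!: continuous_at_imp_continuous_on differentiable_imp_continuous_within)
qed auto

lemma Ck_on_const: "open U \<Longrightarrow> Ck_on k U (\<lambda>x. a)"
  by (induction k arbitrary: a) (auto intro!: Ck_on_SucI[where f' = "\<lambda>_ _. 0"] simp del: Ck_on.simps(2))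

lemma Ck_on_linear:
  assumes "open U" "bounded_linear L" shows "Ck_on k U L"
proof (cases k)
  case 0
  then show ?thesis using assms by (simp add: linear_continuous_on)
next
  case (Suc j)
  show ?thesis unfolding Suc
    by (rule Ck_on_SucI[where f' = "\<lambda>_. L"])
      (use assms in \<open>auto intro: bounded_linear_imp_has_derivative Ck_on_const\<close>)
qed

lemma Ck_on_compose_linear:
  assumes "open U" "bounded_linear L" "Ck_on k U f"
  shows "Ck_on k (L -` U) (\<lambda>x. f (L x))"
  using assms(3)
proof (induction k arbitrary: f)
  case 0
  then show ?case
    using continuous_on_compose2[of U f "L -` U" L] linear_continuous_on[OF assms(2)] by auto
next
  case (Suc k)
  note D = Ck_on_SucD[OF Suc.prems]
  have "(\<lambda>x. f (L x)) = f \<circ> L" by auto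
  show ?case
  proof (rule Ck_on_SucI[where f' = "\<lambda>x v. frechet_derivative f (at (L x)) (L v)"])
    show "open (L -` U)"
      using assms by (simp add: open_vimage linear_continuous_on)
    show "((\<lambda>x. f (L x)) has_derivative (\<lambda>v. frechet_derivative f (at (L x)) (L v))) (at x)"
      if "x \<in> L -` U" for x
      using diff_chain_at[OF bounded_linear_imp_has_derivative[OF assms(2), of "at x"], of f] D(1) that
      by (auto simp: o_def)
    show "Ck_on k (L -` U) (\<lambda>x. frechet_derivative f (at (L x)) (L v))" for v
      using Suc.IH[OF D(2)[of "L v"]] .
  qed
qed

lemma Ck_on_linear_compose:
  assumes "open U" "bounded_linear L" "Ck_on k U f"
  shows "Ck_on k U (\<lambda>x. L (f x))"
  using assms(3)
proof (induction k arbitrary: f)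
  case 0
  then show ?case by (auto intro: bounded_linear.continuous_on assms)
next
  case (Suc k)
  note D = Ck_on_SucD[OF Suc.prems]
  show ?case
    by (rule Ck_on_SucI[where f' = "\<lambda>x v. L (frechet_derivative f (at x) v)"])
      (use D Suc.IH assms in \<open>auto intro: bounded_linear.has_derivative\<close>)
qed

lemma Ck_on_add:
  assumes "open U" "Ck_on k U f" "Ck_on k U h"
  shows "Ck_on k U (\<lambda>x. f x + h x)"
  using assms(2,3)
proof (induction k arbitrary: f h)
  case 0
  then show ?case by (auto intro: continuous_on_add)
next
  case (Suc k)
  note D = Ck_on_SucD[OF Suc.prems(1)] Ck_on_SucD[OF Suc.prems(2)]
  show ?case
    by (rule Ck_on_SucI[where f' = "\<lambda>x v. frechet_derivative f (at x) v + frechet_derivative h (at x) v"])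
      (use D Suc.IH assms in \<open>auto intro: has_derivative_add\<close>)
qed

lemma Ck_on_scaleR:
  assumes "open U" "Ck_on k U f" "Ck_on k U h"
  shows "Ck_on k U (\<lambda>x. f x *\<^sub>R h x)"
  using assms(2,3)
proof (induction k arbitrary: f h)
  case 0
  then show ?case by (auto intro: continuous_on_scaleR)
next
  case (Suc k)
  note D = Ck_on_SucD[OF Suc.prems(1)] Ck_on_SucD[OF Suc.prems(2)]
  show ?case
    by (rule Ck_on_SucI[where f' = "\<lambda>x v. f x *\<^sub>R frechet_derivative h (at x) v + frechet_derivative f (at x) v *\<^sub>R h x"])
      (use D Suc.IH assms Ck_on_mono[OF Suc.prems(1)] Ck_on_mono[OF Suc.prems(2)]
        in \<open>auto intro!: has_derivative_scaleR Ck_on_add\<close>)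
qed

lemma Ck_on_Pair:
  assumes "open U" "Ck_on k U f" "Ck_on k U h"
  shows "Ck_on k U (\<lambda>x. (f x, h x))"
proof -
  have "Ck_on k U (\<lambda>x. (f x, 0) + (0, h x))"
    by (intro Ck_on_add Ck_on_linear_compose[where L = "\<lambda>y. (y, 0)"]
        Ck_on_linear_compose[where L = "\<lambda>y. (0, y)"] assms)
      (auto intro!: bounded_linear_Pair)
  then show ?thesis by simp
qed

lemma smooth_on_triv:
  fixes f :: "'x::euclidean_space \<Rightarrow> 'y::euclidean_space" and h :: "'x \<Rightarrow> 'z::euclidean_space"
  assumes "smooth_on S f" "smooth_on S h"
  shows "smooth_on (S \<times> UNIV) (\<lambda>z. (f (fst z), snd z *\<^sub>R h (fst z)))"
    "smooth_on (S \<times> UNIV) (\<lambda>z. (f (fst z), snd z :: real))"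
  unfolding smooth_on_def
proof safe
  fix x :: 'x and s :: real assume x: "x \<in> S"
  obtain U f' where U: "open U" "x \<in> U" "Cinf_on U f'" "\<And>y. y \<in> S \<inter> U \<Longrightarrow> f' y = f y"
    using assms(1) x unfolding smooth_on_def by metis
  obtain V h' where V: "open V" "x \<in> V" "Cinf_on V h'" "\<And>y. y \<in> S \<inter> V \<Longrightarrow> h' y = h y"
    using assms(2) x unfolding smooth_on_def by metis
  have o: "open (U \<inter> V)" "open ((U \<inter> V) \<times> (UNIV :: real set))" using U V by (auto intro!: open_Times)
  have e: "fst -` (U \<inter> V) = (U \<inter> V) \<times> (UNIV :: real set)" by auto
  have c: "Ck_on k ((U \<inter> V) \<times> (UNIV :: real set)) (\<lambda>z. f' (fst z))"
    "Ck_on k ((U \<inter> V) \<times> (UNIV :: real set)) (\<lambda>z. h' (fst z))"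
    "Ck_on k ((U \<inter> V) \<times> (UNIV :: real set)) snd" for k
  proof -
    have c: "Ck_on k (U \<inter> V) f'" "Ck_on k (U \<inter> V) h'"
      using U(3) V(3) by (auto simp: Cinf_on_def intro: Ck_on_subset)
    show "Ck_on k ((U \<inter> V) \<times> (UNIV :: real set)) (\<lambda>z. f' (fst z))"
      unfolding e[symmetric] by (rule Ck_on_compose_linear[OF o(1) bounded_linear_fst c(1)])
    show "Ck_on k ((U \<inter> V) \<times> (UNIV :: real set)) (\<lambda>z. h' (fst z))"
      unfolding e[symmetric] by (rule Ck_on_compose_linear[OF o(1) bounded_linear_fst c(2)])
    show "Ck_on k ((U \<inter> V) \<times> (UNIV :: real set)) snd"
      using o(2) by (intro Ck_on_linear bounded_linear_snd)
  qed
  have "Cinf_on ((U \<inter> V) \<times> UNIV) (\<lambda>z. (f' (fst z), snd z *\<^sub>R h' (fst z)))"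
    unfolding Cinf_on_def using c by (auto intro!: Ck_on_Pair Ck_on_scaleR o)
  then show "\<exists>W k. open W \<and> (x, s) \<in> W \<and> Cinf_on W k \<and>
      (\<forall>y\<in>S \<times> UNIV \<inter> W. k y = (f (fst y), snd y *\<^sub>R h (fst y)))"
    using o U V by (intro exI[of _ "(U \<inter> V) \<times> UNIV"] exI[of _ "\<lambda>z. (f' (fst z), snd z *\<^sub>R h' (fst z))"]) auto
  have "Cinf_on ((U \<inter> V) \<times> UNIV) (\<lambda>z. (f' (fst z), snd z :: real))"
    unfolding Cinf_on_def using c by (auto intro!: Ck_on_Pair o)
  then show "\<exists>W k. open W \<and> (x, s) \<in> W \<and> Cinf_on W k \<and>
      (\<forall>y\<in>S \<times> UNIV \<inter> W. k y = (f (fst y), snd y))"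
    using o U V by (intro exI[of _ "(U \<inter> V) \<times> UNIV"] exI[of _ "\<lambda>z. (f' (fst z), snd z)"]) auto
qed

lemma smooth_on_linear_compose:
  assumes "bounded_linear L" "smooth_on S f"
  shows "smooth_on S (\<lambda>x. L (f x))"
  unfolding smooth_on_def
proof
  fix x assume "x \<in> S"
  then obtain U h where U: "open U" "x \<in> U" "Cinf_on U h" "\<forall>y\<in>S \<inter> U. h y = f y"
    using assms(2) unfolding smooth_on_def by metis
  then have "Cinf_on U (\<lambda>x. L (h x))" by (simp add: Cinf_on_def Ck_on_linear_compose assms(1))
  with U show "\<exists>U h. open U \<and> x \<in> U \<and> Cinf_on U h \<and> (\<forall>y\<in>S \<inter> U. h y = L (f y))"
    by (intro exI[of _ U] exI[of _ "\<lambda>x. L (h x)"]) auto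
qed

lemma smooth_on_cong: "(\<And>x. x \<in> S \<Longrightarrow> f x = h x) \<Longrightarrow> smooth_on S f \<Longrightarrow> smooth_on S h"
  unfolding smooth_on_def by (metis IntD1)

lemma smooth_atlasD:
  assumes "smooth_atlas M" "c \<in> charts M"
  shows "inj_on (cmap c) (cdom c)" "openin (top_of_set (model M)) (cimage c)"
    "\<And>x. x \<in> cdom c \<Longrightarrow> cinv c (cmap c x) = x" "cdom c \<subseteq> points M"
    "c' \<in> charts M \<Longrightarrow> openin (top_of_set (model M)) (cmap c ` (cdom c \<inter> cdom c'))"
    "c' \<in> charts M \<Longrightarrow> smooth_on (cmap c ` (cdom c \<inter> cdom c')) (cmap c' \<circ> cinv c)"
proof -
  show *: "inj_on (cmap c) (cdom c)" using assms by (auto simp: smooth_atlas_def)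
  have "openin (top_of_set (model M)) (cmap c ` (cdom c \<inter> cdom c))"
    using assms unfolding smooth_atlas_def by blast
  then show "openin (top_of_set (model M)) (cimage c)" by (simp add: cimage_def)
  show "\<And>x. x \<in> cdom c \<Longrightarrow> cinv c (cmap c x) = x" using * by (simp add: cinv_def)
  show "cdom c \<subseteq> points M" using assms by (auto simp: points_def)
  show "c' \<in> charts M \<Longrightarrow> openin (top_of_set (model M)) (cmap c ` (cdom c \<inter> cdom c'))"
    "c' \<in> charts M \<Longrightarrow> smooth_on (cmap c ` (cdom c \<inter> cdom c')) (cmap c' \<circ> cinv c)"
    using assms unfolding smooth_atlas_def by blast+
qed

lemma charts_vf_structure:
  "charts (total_manifold (vf_structure M X)) =
     (\<lambda>c. ((UNIV :: real set) \<times> cdom c, \<lambda>v. (cmap c (snd v), fst v))) ` charts M"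
proof -
  have "{v \<in> UNIV \<times> points M. snd v \<in> cdom c \<inter> points M} = UNIV \<times> cdom c"
    if "c \<in> charts M" for c :: "('a, 'b) chart"
    using that by (auto simp: points_def)
  then have "(\<lambda>c. ({v \<in> (UNIV :: real set) \<times> points M. snd v \<in> cdom c \<inter> points M},
        \<lambda>v. (cmap c (snd v), fst v :: real))) ` charts M =
      (\<lambda>c. ((UNIV :: real set) \<times> cdom c, \<lambda>v. (cmap c (snd v), fst v))) ` charts M"
    by (intro image_cong) auto
  moreover have "charts (total_manifold (vf_structure M X)) =
      (\<lambda>c. ({v \<in> (UNIV :: real set) \<times> points M. snd v \<in> cdom c \<inter> points M},
        \<lambda>v. (cmap c (snd v), fst v :: real))) ` charts M"
    unfolding total_manifold_def vf_structure_def by (auto simp: image_def Bex_def)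
  ultimately show ?thesis by simp
qed

lemma model_vf_structure: "model (total_manifold (vf_structure M X)) = model M \<times> UNIV"
  by (simp add: total_manifold_def vf_structure_def)

lemma points_vf_structure: "points (total_manifold (vf_structure M X)) = UNIV \<times> points M"
  by (auto simp: points_def charts_vf_structure)

lemma cinv_vf_structure:
  assumes "smooth_atlas M" "c \<in> charts M" "x \<in> cimage c"
  shows "cinv ((UNIV :: real set) \<times> cdom c, \<lambda>v. (cmap c (snd v), fst v)) (x, s) = (s, cinv c x)"
proof -
  obtain p where p: "p \<in> cdom c" "x = cmap c p" using assms(3) by (auto simp: cimage_def)
  have inj: "inj_on (\<lambda>v. (cmap c (snd v), fst v)) (UNIV \<times> cdom c)"
    using smooth_atlasD(1)[OF assms(1,2)] by (auto simp: inj_on_def)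
  have "inv_into (UNIV \<times> cdom c) (\<lambda>v. (cmap c (snd v), fst v)) ((\<lambda>v. (cmap c (snd v), fst v)) (s, p)) = (s, p)"
    using p by (intro inv_into_f_f inj) auto
  then show ?thesis using p smooth_atlasD(3)[OF assms(1,2) p(1)] by (simp add: cinv_def)
qed

lemma smooth_atlas_vf_structure:
  assumes "smooth_atlas M"
  shows "smooth_atlas (total_manifold (vf_structure M X))"
  unfolding smooth_atlas_def charts_vf_structure model_vf_structure
proof (intro conjI ballI)
  show "subspace (model M \<times> (UNIV :: real set))"
    using assms by (auto simp: smooth_atlas_def intro: subspace_Times)
  fix C assume "C \<in> (\<lambda>c. ((UNIV :: real set) \<times> cdom c, \<lambda>v. (cmap c (snd v), fst v :: real))) ` charts M"
  then obtain c where c: "c \<in> charts M"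
    and C: "C = ((UNIV :: real set) \<times> cdom c, \<lambda>v. (cmap c (snd v), fst v :: real))" by blast
  note cD = smooth_atlasD[OF assms c]
  show "inj_on (cmap C) (cdom C)" using cD(1) by (auto simp: C inj_on_def)
  fix C' assume "C' \<in> (\<lambda>c. ((UNIV :: real set) \<times> cdom c, \<lambda>v. (cmap c (snd v), fst v :: real))) ` charts M"
  then obtain c' where c': "c' \<in> charts M"
    and C': "C' = ((UNIV :: real set) \<times> cdom c', \<lambda>v. (cmap c' (snd v), fst v :: real))" by blast
  have im: "cmap C ` (cdom C \<inter> cdom C') = (cmap c ` (cdom c \<inter> cdom c')) \<times> UNIV"
    by (force simp: C C' image_iff)
  show "openin (top_of_set (model M \<times> (UNIV :: real set))) (cmap C ` (cdom C \<inter> cdom C'))"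
    unfolding im by (intro openin_Times cD(5) c') auto
  show "smooth_on (cmap C ` (cdom C \<inter> cdom C')) (cmap C' \<circ> cinv C)"
    unfolding im
  proof (rule smooth_on_cong[OF _ smooth_on_triv(2)])
    show "smooth_on (cmap c ` (cdom c \<inter> cdom c')) (cmap c' \<circ> cinv c)"
      "smooth_on (cmap c ` (cdom c \<inter> cdom c')) (cmap c' \<circ> cinv c)"
      using cD(6) c' by auto
    show "((cmap c' \<circ> cinv c) (fst z), snd z) = (cmap C' \<circ> cinv C) z"
      if "z \<in> cmap c ` (cdom c \<inter> cdom c') \<times> UNIV" for z
      using that cinv_vf_structure[OF assms c, of "fst z" "snd z"]
      by (auto simp: C C' cimage_def)
  qed
qed

lemma topspace_manifold_topology:
  assumes "smooth_atlas M" shows "topspace (manifold_topology M) = points M"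
proof -
  have "openin (manifold_topology M) (points M)"
    unfolding openin_manifold_topology[OF assms]
    using smooth_atlasD(2,4)[OF assms] by (auto simp: cimage_def Int_absorb1)
  moreover have "U \<subseteq> points M" if "openin (manifold_topology M) U" for U
    using that openin_manifold_topology[OF assms] by blast
  ultimately show ?thesis by (auto simp: topspace_def)
qed

lemma charts_tangent_bundle:
  "charts (total_manifold (tangent_bundle M)) =
     {({v \<in> tangent_vectors M. fst v \<in> cdom d \<inter> cdom d'}, \<lambda>v. (cmap d (fst v), snd v d'))
        | d d'. d \<in> charts M \<and> d' \<in> charts M}"
  (is "_ = ?R")
proof
  have "charts (total_manifold (tangent_bundle M)) =
     {({v \<in> tangent_vectors M. fst v \<in> cdom d \<inter> U}, \<lambda>v. (cmap d (fst v), \<Phi> v))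
        | d U \<Phi>. d \<in> charts M \<and> (U, \<Phi>) \<in> {(cdom c, \<lambda>\<xi>. snd \<xi> c) | c. c \<in> charts M}}"
    (is "_ = ?L") by (simp add: total_manifold_def tangent_bundle_def)
  moreover have "?L \<subseteq> ?R"
  proof
    fix C assume "C \<in> ?L"
    then obtain d U \<Phi> d' where "C = ({v \<in> tangent_vectors M. fst v \<in> cdom d \<inter> U}, \<lambda>v. (cmap d (fst v), \<Phi> v))"
      "d \<in> charts M" "(U, \<Phi>) = (cdom d', \<lambda>\<xi>. snd \<xi> d')" "d' \<in> charts M"
      by (elim CollectE exE conjE) (rule that)
    then show "C \<in> ?R"
      by (intro CollectI exI[of _ d] exI[of _ d'] conjI) simp_all
  qed
  moreover have "?R \<subseteq> ?L"
  proof
    fix C assume "C \<in> ?R"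
    then obtain d d' where *: "C = ({v \<in> tangent_vectors M. fst v \<in> cdom d \<inter> cdom d'}, \<lambda>v. (cmap d (fst v), snd v d'))"
      "d \<in> charts M" "d' \<in> charts M" by (elim CollectE exE conjE) (rule that)
    show "C \<in> ?L"
      by (rule CollectI, rule exI[of _ d], rule exI[of _ "cdom d'"], rule exI[of _ "\<lambda>\<xi>. snd \<xi> d'"])
        (intro conjI CollectI exI[of _ d'] refl *)
  qed
  ultimately show "charts (total_manifold (tangent_bundle M)) \<subseteq> ?R"
    "?R \<subseteq> charts (total_manifold (tangent_bundle M))" by simp_all
qed

lemma fibre_tangent_bundle:
  fixes M :: "('a, 'e::euclidean_space) manifold"
  assumes "smooth_atlas M" "\<xi> \<in> fibre (tangent_bundle M) p"
  shows "fscale (tangent_bundle M) a \<xi> \<in> fibre (tangent_bundle M) p"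
proof -
  have E: "subspace (model M)" using assms(1) by (simp add: smooth_atlas_def)
  obtain v where v: "\<xi> = (p, v)" "(p, v) \<in> tangent_vectors M"
    using assms(2) by (cases \<xi>) (auto simp: fibre_def tangent_bundle_def)
  have "\<exists>D. ((cmap c' \<circ> cinv c) has_derivative D)
        (at (cmap c p) within cmap c ` (cdom c \<inter> cdom c')) \<and> a *\<^sub>R v c' = D (a *\<^sub>R v c)"
    if "c \<in> charts M" "c' \<in> charts M" "p \<in> cdom c \<inter> cdom c'" for c c'
  proof -
    have "\<exists>D. ((cmap c' \<circ> cinv c) has_derivative D)
        (at (cmap c p) within cmap c ` (cdom c \<inter> cdom c')) \<and> v c' = D (v c)"
      using v(2) that unfolding tangent_vectors_def by blast
    then show ?thesis
      by (metis has_derivative_bounded_linear linear_simps(5))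
  qed
  then show ?thesis
    using v E by (auto simp: tangent_vectors_def fibre_def tangent_bundle_def subspace_scale)
qed

lemma geometric_structure_vf_structure:
  assumes M: "smooth_manifold M" and con: "connected_space (manifold_topology M)"
    and X: "smooth_vector_field M X"
  shows "geometric_structure (vf_structure M X)"
proof -
  let ?G = "vf_structure M X"
  have at: "smooth_atlas M" using M by (simp add: smooth_manifold_def)
  note top = topspace_manifold_topology[OF at]
  have fib: "fibre ?G p = UNIV \<times> {p}" if "p \<in> points M" for p
    using that by (auto simp: fibre_def vf_structure_def)
  have "openin (manifold_topology M) (points M)" by (metis openin_topspace top)
  then have vb: "smooth_vector_bundle ?G"
    using M smooth_atlas_vf_structure[OF at, of X]
    by (auto simp: smooth_vector_bundle_def vf_structure_def fibre_def bij_betw_def inj_on_def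
        image_iff)
  have norm: "continuous_map (manifold_topology (total_manifold ?G)) euclideanreal (fnorm ?G)"
    unfolding continuous_map topspace_manifold_topology[OF smooth_atlas_vf_structure[OF at]]
  proof (intro conjI allI impI)
    fix V :: "real set" assume "openin euclideanreal V"
    then have V: "open {a. \<bar>a\<bar> \<in> V}"
      using open_vimage[of V "abs :: real \<Rightarrow> real"] by (simp add: vimage_def continuous_on_rabs)
    show "openin (manifold_topology (total_manifold ?G))
        {x \<in> points (total_manifold ?G). fnorm ?G x \<in> V}"
      unfolding openin_manifold_topology[OF smooth_atlas_vf_structure[OF at]]
        charts_vf_structure model_vf_structure points_vf_structure
    proof (intro conjI ballI)
      fix C assume "C \<in> (\<lambda>c. ((UNIV :: real set) \<times> cdom c, \<lambda>v. (cmap c (snd v), fst v :: real))) ` charts M"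
      then obtain c where c: "c \<in> charts M"
        and C: "C = ((UNIV :: real set) \<times> cdom c, \<lambda>v. (cmap c (snd v), fst v :: real))" by blast
      have "cmap C ` ({x \<in> UNIV \<times> points M. fnorm ?G x \<in> V} \<inter> cdom C) = cimage c \<times> {a. \<bar>a\<bar> \<in> V}"
        using smooth_atlasD(4)[OF at c] by (force simp: C vf_structure_def cimage_def image_iff)
      then show "openin (top_of_set (model M \<times> UNIV))
          (cmap C ` ({x \<in> UNIV \<times> points M. fnorm ?G x \<in> V} \<inter> cdom C))"
        using V smooth_atlasD(2)[OF at c] by (auto intro!: openin_Times)
    qed auto
  qed auto
  have Xs: "smooth_map M (total_manifold (tangent_bundle M)) X"
    and Xf: "\<And>p. p \<in> points M \<Longrightarrow> X p \<in> fibre (tangent_bundle M) p"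
    using X by (auto simp: smooth_vector_field_def smooth_section_def tangent_bundle_def)
  let ?T = "total_manifold (tangent_bundle M)"
  have fstT: "fst ` tangent_vectors M \<subseteq> points M" by (auto simp: tangent_vectors_def)
  have ptsT: "points ?T = tangent_vectors M"
  proof (intro equalityI subsetI)
    fix \<xi> assume "\<xi> \<in> points ?T"
    then show "\<xi> \<in> tangent_vectors M"
      by (auto simp: points_def charts_tangent_bundle)
  next
    fix \<xi> assume \<xi>: "\<xi> \<in> tangent_vectors M"
    with fstT obtain c where c: "c \<in> charts M" "fst \<xi> \<in> cdom c" unfolding points_def by blast
    have "({v \<in> tangent_vectors M. fst v \<in> cdom c \<inter> cdom c}, \<lambda>v. (cmap c (fst v), snd v c))
        \<in> charts ?T"
      unfolding charts_tangent_bundle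
      by (intro CollectI exI[of _ c] conjI refl c(1))
    then show "\<xi> \<in> points ?T" unfolding points_def using \<xi> c(2) by force
  qed
  have baseG: "base ?G = M" by (simp add: vf_structure_def)
  have baseT: "base (tangent_bundle M) = M" by (simp add: tangent_bundle_def)
  define sc where "sc = fscale (tangent_bundle M)"
  have fibT: "\<xi> \<in> fibre (tangent_bundle M) p \<longleftrightarrow> \<xi> \<in> tangent_vectors M \<and> fst \<xi> = p" for \<xi> p
    by (simp add: fibre_def tangent_bundle_def)
  have XT: "X p \<in> tangent_vectors M" "fst (X p) = p" "sc s (X p) \<in> tangent_vectors M"
    "fst (sc s (X p)) = p" if "p \<in> points M" for p s
    using Xf[OF that] fibre_tangent_bundle[OF at Xf[OF that], of s] unfolding fibT sc_def by auto
  have sc_snd: "snd (sc s \<xi>) c = s *\<^sub>R snd \<xi> c" for s \<xi> c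
    by (simp add: sc_def tangent_bundle_def)
  have anc: "anchor ?G v = sc (fst v) (X (snd v))" for v
    by (simp add: vf_structure_def sc_def split_beta)
  have "smooth_map (total_manifold ?G) ?T (anchor ?G)"
    unfolding smooth_map_def charts_vf_structure
  proof
    fix C assume "C \<in> (\<lambda>c. ((UNIV :: real set) \<times> cdom c, \<lambda>v. (cmap c (snd v), fst v :: real))) ` charts M"
    then obtain c where c: "c \<in> charts M"
      and C: "C = ((UNIV :: real set) \<times> cdom c, \<lambda>v. (cmap c (snd v), fst v :: real))" by blast
    have im: "cimage C = cimage c \<times> UNIV" by (force simp: C cimage_def image_iff)
    have pt: "cinv c x \<in> points M" if "x \<in> cimage c" for x
      using that smooth_atlasD(3,4)[OF at c] by (auto simp: cimage_def)
    have val: "(anchor ?G \<circ> cinv C) z = sc (snd z) (X (cinv c (fst z)))" if "z \<in> cimage C" for z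
    proof -
      have "cinv C (fst z, snd z) = (snd z, cinv c (fst z))"
        unfolding C by (rule cinv_vf_structure[OF at c]) (use that im in auto)
      then show ?thesis by (simp add: anc)
    qed
    have sX: "smooth_into ?T (cimage c) (X \<circ> cinv c)" using Xs c by (auto simp: smooth_map_def)
    show "smooth_into ?T (cimage C) (anchor ?G \<circ> cinv C)"
      unfolding smooth_into_def
    proof (intro conjI ballI)
      show "(anchor ?G \<circ> cinv C) ` cimage C \<subseteq> points ?T"
      proof
        fix \<xi> assume "\<xi> \<in> (anchor ?G \<circ> cinv C) ` cimage C"
        then obtain z where z: "z \<in> cimage C" "\<xi> = (anchor ?G \<circ> cinv C) z" by blast
        then have "fst z \<in> cimage c" using im by auto
        then show "\<xi> \<in> points ?T" unfolding ptsT z(2) val[OF z(1)] by (intro XT pt)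
      qed
      fix D assume D: "D \<in> charts ?T"
      then obtain d d' where
        Deq: "D = ({v \<in> tangent_vectors M. fst v \<in> cdom d \<inter> cdom d'}, \<lambda>v. (cmap d (fst v), snd v d'))"
        unfolding charts_tangent_bundle by (elim CollectE exE conjE) (rule that)
      let ?S = "cimage c \<inter> (X \<circ> cinv c) -` cdom D"
      have mem: "(anchor ?G \<circ> cinv C) z \<in> cdom D \<longleftrightarrow> (X \<circ> cinv c) (fst z) \<in> cdom D"
        if "z \<in> cimage C" for z
      proof -
        have "fst z \<in> cimage c" using that im by auto
        from XT[OF pt[OF this]] show ?thesis unfolding val[OF that] by (simp add: Deq)
      qed
      have sets: "cimage C \<inter> (anchor ?G \<circ> cinv C) -` cdom D = ?S \<times> UNIV"
      proof -
        have "cimage C \<inter> (anchor ?G \<circ> cinv C) -` cdom D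
            = {z \<in> cimage C. (X \<circ> cinv c) (fst z) \<in> cdom D}"
          using mem by blast
        also have "\<dots> = ?S \<times> UNIV" unfolding im by auto
        finally show ?thesis .
      qed
      have op: "openin (top_of_set (cimage c)) ?S" and sm: "smooth_on ?S (cmap D \<circ> (X \<circ> cinv c))"
        using sX D unfolding smooth_into_def by blast+
      show "openin (top_of_set (cimage C)) (cimage C \<inter> (anchor ?G \<circ> cinv C) -` cdom D)"
        unfolding sets unfolding im by (rule openin_Times[OF op]) simp
      have s12: "smooth_on ?S (\<lambda>x. fst ((cmap D \<circ> (X \<circ> cinv c)) x))"
        "smooth_on ?S (\<lambda>x. snd ((cmap D \<circ> (X \<circ> cinv c)) x))"
        by (rule smooth_on_linear_compose[OF bounded_linear_fst sm]
            smooth_on_linear_compose[OF bounded_linear_snd sm])+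
      show "smooth_on (cimage C \<inter> (anchor ?G \<circ> cinv C) -` cdom D) (cmap D \<circ> (anchor ?G \<circ> cinv C))"
        unfolding sets
      proof (rule smooth_on_cong[OF _ smooth_on_triv(1)[OF s12]])
        fix z assume "z \<in> ?S \<times> (UNIV :: real set)"
        then have z: "fst z \<in> cimage c" "z \<in> cimage C" using im by auto
        show "(fst ((cmap D \<circ> (X \<circ> cinv c)) (fst z)), snd z *\<^sub>R snd ((cmap D \<circ> (X \<circ> cinv c)) (fst z)))
            = (cmap D \<circ> (anchor ?G \<circ> cinv C)) z"
          using val[OF z(2)] XT[OF pt[OF z(1)]] by (simp add: Deq sc_snd)
      qed
    qed
  qed
  moreover have "anchor ?G v \<in> fibre (tangent_bundle M) p" if "p \<in> points M" "v \<in> fibre ?G p" for p v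
    using XT[OF that(1)] that(2) unfolding fib[OF that(1)] anc fibT by auto
  moreover have "anchor ?G (fadd ?G v w) = fadd (tangent_bundle M) (anchor ?G v) (anchor ?G w)"
    "anchor ?G (fscale ?G a v) = fscale (tangent_bundle M) a (anchor ?G v)"
    if "p \<in> points M" "v \<in> fibre ?G p" "w \<in> fibre ?G p" for p v w a
    using that(2,3) unfolding fib[OF that(1)]
    by (auto simp: vf_structure_def tangent_bundle_def scaleR_add_left)
  ultimately have mor: "bundle_morphism ?G (tangent_bundle (base ?G)) (anchor ?G)"
    unfolding bundle_morphism_def baseG baseT by blast
  have "0 \<le> fnorm ?G v \<and> (fnorm ?G v = 0 \<longrightarrow> v = fscale ?G 0 v) \<and>
      (\<forall>a. fnorm ?G (fscale ?G a v) = \<bar>a\<bar> * fnorm ?G v) \<and>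
      (\<forall>w\<in>fibre ?G p. fnorm ?G (fadd ?G v w) \<le> fnorm ?G v + fnorm ?G w)"
    if "p \<in> points M" "v \<in> fibre ?G p" for p v
    using that(2) unfolding fib[OF that(1)] by (auto simp: vf_structure_def abs_mult)
  then show ?thesis
    unfolding geometric_structure_def using vb norm con mor unfolding baseG by blast
qed

end

theory Submission
  imports Defs
begin

text \<open>Every $A$-path from \<open>x\<close> is a reparametrized orbit \<open>t \<mapsto> \<phi>\<^bsub>s(t)\<^esub>(x)\<close>, where
  \<open>s\<close> is piecewise smooth with \<open>s(0) = 0\<close>, and speed at most \<open>r\<close> means $|s'| \le r$.
  Moving \<open>x\<close> and \<open>y\<close> with the same \<open>s\<close> bounds $d_r$ by twice the two-sided Bowen distance
  on \<open>[-r,r]\<close>, which is the one-sided one on \<open>[0,2r]\<close> up to the bijection \<open>\<phi>\<^bsub>-r\<^esub>\<close>; hence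
  $H \le h \le 2\,h_{top}$.

  For $2\,h_{top} \le H$, testing with the paths of constant speed \<open>\<plusminus>r\<close> shows that
  $D_r(x,y) < \eta$ makes the forward and the backward orbit of \<open>x\<close> on \<open>[0,r]\<close> shadowed by
  reparametrized orbits of \<open>y\<close>. So one has to see that, for each \<open>x\<close>, the orbits shadowed by
  reparametrizations of the orbit of \<open>x\<close> contain at most $C e^{\alpha r}$ Bowen-separated
  ones, with \<open>\<alpha>\<close> as small as desired. Cut \<open>[0,r]\<close> into blocks of a long fixed length \<open>T\<close>. On a
  block where the shadowed orbit hardly moves, its position up to a small error takes boundedly
  many values. On any other block the displacement is bounded below, the reparametrization runs
  at speed almost 1, and the block is determined by the starting phase up to \<open>\<delta>\<close>. Phases are
  recorded by their increments on a clock that stands still where the orbit of \<open>x\<close> barely moves,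
  and these take \<open>O(T/\<delta>)\<close> values. So there are only \<open>O(T)\<close> symbols per block of length \<open>T\<close>.\<close>

section \<open>Continuous flows on compact metric spaces\<close>

text \<open>The obstacle is that reparametrizations are arbitrary: near a fixed point of the flow
  \<sigma> can wander by any amount, in either direction and at no cost in distance, so neither
  \<sigma>(t) nor its increments take boundedly many values. What can be recorded is the part of the
  motion that the orbit of x resolves. Away from fixed points there are no short periods, so
  shadowing pins the increments of \<sigma> down to any prescribed error; close to them the clock
  stands still and absorbs the uncontrolled drift. A clock reading does not determine the phase in
  general, only on blocks that move, and only there is it used to recover it. The alphabet has size
  affine in T, so ln(aT+b)/T can be pushed below \<alpha>; this is why the blocks are long. The
  order of choice matters: the error e, the phase tolerance \<delta>, the length T, the threshold c
  for moving, the step h and the drift \<kappa>, and then \<eta>. All of them precede r and x, so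
  the shadowing tolerance does not depend on r. The forward and the backward reparametrization are
  unrelated, and each direction gets its own code of growth \<alpha>/2.\<close>

locale compact_flow =
  fixes S :: "'a set" and d :: "'a \<Rightarrow> 'a \<Rightarrow> real" and \<phi> :: "real \<Rightarrow> 'a \<Rightarrow> 'a"
  assumes d_nonneg: "\<lbrakk>x \<in> S; y \<in> S\<rbrakk> \<Longrightarrow> 0 \<le> d x y"
    and d_pos: "\<lbrakk>x \<in> S; y \<in> S\<rbrakk> \<Longrightarrow> d x y = 0 \<longleftrightarrow> x = y"
    and d_commute: "\<lbrakk>x \<in> S; y \<in> S\<rbrakk> \<Longrightarrow> d x y = d y x"
    and d_triangle: "\<lbrakk>x \<in> S; y \<in> S; z \<in> S\<rbrakk> \<Longrightarrow> d x z \<le> d x y + d y z"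
    and seq_compact: "\<And>f :: nat \<Rightarrow> 'a. range f \<subseteq> S \<Longrightarrow>
          \<exists>l\<in>S. \<exists>k. strict_mono k \<and> (\<lambda>n. d (f (k n)) l) \<longlonglongrightarrow> 0"
    and totally_bounded: "\<And>e. e > 0 \<Longrightarrow> \<exists>C. finite C \<and> C \<subseteq> S \<and> (\<forall>x\<in>S. \<exists>c\<in>C. d x c < e)"
    and flow_in: "x \<in> S \<Longrightarrow> \<phi> t x \<in> S"
    and flow_0: "x \<in> S \<Longrightarrow> \<phi> 0 x = x"
    and flow_add: "x \<in> S \<Longrightarrow> \<phi> (s + t) x = \<phi> s (\<phi> t x)"
    and flow_cont: "\<And>f l \<tau> t. \<lbrakk>range f \<subseteq> S; l \<in> S; (\<lambda>n. d (f n) l) \<longlonglongrightarrow> 0; \<tau> \<longlonglongrightarrow> t\<rbrakk> \<Longrightarrow>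
          (\<lambda>n. d (\<phi> (\<tau> n) (f n)) (\<phi> t l)) \<longlonglongrightarrow> 0"
begin

section \<open>Compactness and uniform continuity of the flow\<close>

lemma d_self: "x \<in> S \<Longrightarrow> d x x = 0"
  using d_pos by blast

lemma flow_uminus:
  assumes "x \<in> S" shows "\<phi> (- t) (\<phi> t x) = x" "\<phi> t (\<phi> (- t) x) = x"
  using flow_add[OF assms, of "-t" t] flow_add[OF assms, of t "-t"] flow_0[OF assms] by auto

lemma d_lim:
  assumes "range f \<subseteq> S" "range h \<subseteq> S" "a \<in> S" "b \<in> S"
    and "(\<lambda>n. d (f n) a) \<longlonglongrightarrow> 0" "(\<lambda>n. d (h n) b) \<longlonglongrightarrow> 0"
  shows "(\<lambda>n. d (f n) (h n)) \<longlonglongrightarrow> d a b"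
proof (rule tendsto_sandwich)
  have m: "f n \<in> S" "h n \<in> S" for n using assms by auto
  show "\<forall>\<^sub>F n in sequentially. d a b - d (f n) a - d (h n) b \<le> d (f n) (h n)"
  proof (intro always_eventually allI)
    fix n
    show "d a b - d (f n) a - d (h n) b \<le> d (f n) (h n)"
      using d_triangle[OF assms(3) m(1)[of n] assms(4)] d_triangle[OF m(1)[of n] m(2)[of n] assms(4)]
        d_commute[OF assms(3) m(1)[of n]] by linarith
  qed
  show "\<forall>\<^sub>F n in sequentially. d (f n) (h n) \<le> d a b + d (f n) a + d (h n) b"
  proof (intro always_eventually allI)
    fix n
    show "d (f n) (h n) \<le> d a b + d (f n) a + d (h n) b"
      using d_triangle[OF m(1)[of n] assms(3) m(2)[of n]] d_triangle[OF assms(3,4) m(2)[of n]]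
        d_commute[OF assms(4) m(2)[of n]] by linarith
  qed
  show "(\<lambda>n. d a b - d (f n) a - d (h n) b) \<longlonglongrightarrow> d a b"
    using tendsto_diff[OF tendsto_diff[OF tendsto_const assms(5)] assms(6), of "d a b"] by simp
  show "(\<lambda>n. d a b + d (f n) a + d (h n) b) \<longlonglongrightarrow> d a b"
    using tendsto_add[OF tendsto_add[OF tendsto_const assms(5)] assms(6), of "d a b"] by simp
qed

lemma seq_compact_pair:
  fixes f :: "nat \<Rightarrow> 'a" and \<tau> :: "nat \<Rightarrow> real"
  assumes "range f \<subseteq> S" "range \<tau> \<subseteq> {-b..b}"
  obtains l t k where "l \<in> S" "t \<in> {-b..b}" "strict_mono (k :: nat \<Rightarrow> nat)"
    "(\<lambda>n. d (f (k n)) l) \<longlonglongrightarrow> 0" "(\<lambda>n. \<tau> (k n)) \<longlonglongrightarrow> t"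
proof -
  obtain l k1 where 1: "l \<in> S" "strict_mono k1" "(\<lambda>n. d (f (k1 n)) l) \<longlonglongrightarrow> 0"
    using seq_compact[OF assms(1)] by blast
  obtain t k2 where 2: "t \<in> {-b..b}" "strict_mono k2" "((\<tau> \<circ> k1) \<circ> k2) \<longlonglongrightarrow> t"
    using compact_Icc[of "-b" b] assms(2) unfolding compact_eq_seq_compact_metric seq_compact_def
    by (metis (no_types, lifting) comp_apply range_subsetD)
  have "(\<lambda>n. d (f ((k1 \<circ> k2) n)) l) \<longlonglongrightarrow> 0"
    using LIMSEQ_subseq_LIMSEQ[OF 1(3) 2(2)] by (simp add: o_def)
  with 1 2 show thesis
    by (intro that[of l t "k1 \<circ> k2"]) (auto simp: o_def strict_mono_def)
qed

text \<open>Heine-Cantor for the map taking (t, z) to \<phi>_t z on [-b,b] x S, by contradiction: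
  along a common convergent subsequence both perturbed points converge to the same
  \<open>\<phi> \<tau> l\<close>. The bound b on the times matters, since nearby orbits may separate
  in the long run.\<close>

lemma flow_uniform:
  assumes "e > 0"
  obtains \<eta> where "\<eta> > 0"
    "\<And>x y s t. \<lbrakk>x \<in> S; y \<in> S; \<bar>s\<bar> \<le> b; \<bar>t\<bar> \<le> b; \<bar>s - t\<bar> < \<eta>; d x y < \<eta>\<rbrakk> \<Longrightarrow> d (\<phi> s x) (\<phi> t y) < e"
proof (rule ccontr)
  assume "\<not> thesis"
  then have H: "\<And>\<eta>. \<eta> > 0 \<Longrightarrow> \<exists>x y s t. x \<in> S \<and> y \<in> S \<and> \<bar>s\<bar> \<le> b \<and> \<bar>t\<bar> \<le> b \<and> \<bar>s - t\<bar> < \<eta> \<and>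
      d x y < \<eta> \<and> e \<le> d (\<phi> s x) (\<phi> t y)"
    using that by (metis not_less)
  have "\<forall>n::nat. \<exists>x y s t. x \<in> S \<and> y \<in> S \<and> \<bar>s\<bar> \<le> b \<and> \<bar>t\<bar> \<le> b \<and> \<bar>s - t\<bar> < inverse (Suc n) \<and>
      d x y < inverse (Suc n) \<and> e \<le> d (\<phi> s x) (\<phi> t y)"
    by (intro allI H) simp
  then obtain x y s t where x: "\<And>n::nat. x n \<in> S" "\<And>n. y n \<in> S" "\<And>n. \<bar>s n\<bar> \<le> b"
      "\<And>n. \<bar>s n - t n\<bar> < inverse (Suc n)" "\<And>n. d (x n) (y n) < inverse (Suc n)"
      "\<And>n. e \<le> d (\<phi> (s n) (x n)) (\<phi> (t n) (y n))"
    by metis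
  have "range s \<subseteq> {-b..b}" using x(3) by (auto simp: abs_le_iff minus_le_iff)
  then obtain l \<tau> k where k: "l \<in> S" "strict_mono k" "(\<lambda>n. d (x (k n)) l) \<longlonglongrightarrow> 0" "(\<lambda>n. s (k n)) \<longlonglongrightarrow> \<tau>"
    by (rule seq_compact_pair[of x s b, rotated]) (use x(1) in auto)
  have i: "(\<lambda>n. inverse (real (Suc (k n)))) \<longlonglongrightarrow> 0"
    using LIMSEQ_subseq_LIMSEQ[OF LIMSEQ_inverse_real_of_nat k(2)] by (simp add: o_def)
  have "(\<lambda>n. s (k n) - (s (k n) - t (k n))) \<longlonglongrightarrow> \<tau> - 0"
    by (rule tendsto_diff[OF k(4) Lim_null_comparison[OF _ i]]) (use less_imp_le[OF x(4)] in auto)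
  then have t: "(\<lambda>n. t (k n)) \<longlonglongrightarrow> \<tau>" by simp
  have y: "(\<lambda>n. d (y (k n)) l) \<longlonglongrightarrow> 0"
  proof (rule Lim_null_comparison)
    show "(\<lambda>n. inverse (real (Suc (k n))) + d (x (k n)) l) \<longlonglongrightarrow> 0"
      using tendsto_add[OF i k(3)] by simp
    show "\<forall>\<^sub>F n in sequentially. norm (d (y (k n)) l) \<le> inverse (real (Suc (k n))) + d (x (k n)) l"
    proof (intro always_eventually allI)
      fix n
      show "norm (d (y (k n)) l) \<le> inverse (real (Suc (k n))) + d (x (k n)) l"
        using d_triangle[OF x(2)[of "k n"] x(1)[of "k n"] k(1)] x(5)[of "k n"]
          d_commute[OF x(2)[of "k n"] x(1)[of "k n"]] d_nonneg[OF x(2)[of "k n"] k(1)] by simp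
    qed
  qed
  have "(\<lambda>n. d (\<phi> (s (k n)) (x (k n))) (\<phi> (t (k n)) (y (k n)))) \<longlonglongrightarrow> d (\<phi> \<tau> l) (\<phi> \<tau> l)"
    by (intro d_lim flow_cont k t y) (use x flow_in k in auto)
  then have "(\<lambda>n. d (\<phi> (s (k n)) (x (k n))) (\<phi> (t (k n)) (y (k n)))) \<longlonglongrightarrow> 0"
    using d_self flow_in k by simp
  then have "e \<le> 0" using x(6) LIMSEQ_le_const by fastforce
  with assms show False by simp
qed

lemma flow_small_time:
  assumes "e > 0"
  obtains \<delta> where "0 < \<delta>" "\<delta> \<le> 1" "\<And>z s. z \<in> S \<Longrightarrow> \<bar>s\<bar> \<le> \<delta> \<Longrightarrow> d z (\<phi> s z) < e"
proof -
  obtain \<eta> where \<eta>: "\<eta> > 0"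
    "\<And>x y s t. \<lbrakk>x \<in> S; y \<in> S; \<bar>s\<bar> \<le> 1; \<bar>t\<bar> \<le> 1; \<bar>s - t\<bar> < \<eta>; d x y < \<eta>\<rbrakk> \<Longrightarrow> d (\<phi> s x) (\<phi> t y) < e"
    using flow_uniform[OF assms, of 1] by metis
  show thesis
  proof (rule that[of "min 1 (\<eta>/2)"])
    fix z s assume z: "z \<in> S" and s: "\<bar>s\<bar> \<le> min 1 (\<eta>/2)"
    then show "d z (\<phi> s z) < e" using \<eta>(2)[of z z 0 s] \<eta>(1) flow_0 d_self by force
  qed (use \<eta> in auto)
qed

text \<open>Truncation at 1 keeps the supremum meaningful at points outside of \<open>S\<close>.\<close>

definition displ :: "'a \<Rightarrow> real" where
  "displ z = (SUP s\<in>{-1..1}. min 1 (d z (\<phi> s z)))"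

lemma displ_upper: "z \<in> S \<Longrightarrow> \<bar>s\<bar> \<le> 1 \<Longrightarrow> min 1 (d z (\<phi> s z)) \<le> displ z"
  unfolding displ_def by (rule cSUP_upper) (auto intro!: bdd_aboveI[of _ 1] simp: abs_le_iff)

lemma displ_le: "(\<And>s. \<bar>s\<bar> \<le> 1 \<Longrightarrow> min 1 (d z (\<phi> s z)) \<le> K) \<Longrightarrow> displ z \<le> K"
  unfolding displ_def by (rule cSUP_least) (auto simp: abs_le_iff)

lemma displ_uniform:
  assumes "e > 0"
  obtains \<eta> where "\<eta> > 0" "\<And>x y. \<lbrakk>x \<in> S; y \<in> S; d x y < \<eta>\<rbrakk> \<Longrightarrow> \<bar>displ x - displ y\<bar> < e"
proof -
  obtain \<eta> where \<eta>: "\<eta> > 0"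
    "\<And>x y s t. \<lbrakk>x \<in> S; y \<in> S; \<bar>s\<bar> \<le> 1; \<bar>t\<bar> \<le> 1; \<bar>s - t\<bar> < \<eta>; d x y < \<eta>\<rbrakk> \<Longrightarrow> d (\<phi> s x) (\<phi> t y) < e/4"
    using flow_uniform[of "e/4" 1] assms by (metis zero_less_divide_iff zero_less_numeral)
  have *: "displ x \<le> displ y + e/2" if xy: "x \<in> S" "y \<in> S" "d x y < min \<eta> (e/4)" for x y
  proof (rule displ_le)
    fix s :: real assume s: "\<bar>s\<bar> \<le> 1"
    have "d (\<phi> s x) (\<phi> s y) < e/4" using \<eta> xy s by simp
    moreover have "d x (\<phi> s x) \<le> d x y + d y (\<phi> s y) + d (\<phi> s y) (\<phi> s x)"
      using d_triangle[OF xy(1,2) flow_in[OF xy(1)], of s]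
        d_triangle[OF xy(2) flow_in[OF xy(2)] flow_in[OF xy(1)], of s s] by linarith
    ultimately have "d x (\<phi> s x) \<le> d y (\<phi> s y) + e/2"
      using d_commute[OF flow_in[OF xy(1), of s] flow_in[OF xy(2), of s]] xy(3) by simp
    then show "min 1 (d x (\<phi> s x)) \<le> displ y + e/2" using displ_upper[OF xy(2) s] assms by linarith
  qed
  show thesis
  proof (rule that[of "min \<eta> (e/4)"])
    fix x y assume "x \<in> S" "y \<in> S" "d x y < min \<eta> (e/4)"
    then show "\<bar>displ x - displ y\<bar> < e"
      using *[of x y] *[of y x] d_commute[of x y] assms by (simp add: abs_if)
  qed (use \<eta> assms in auto)
qed

lemma displ_lim:
  assumes "range f \<subseteq> S" "l \<in> S" "(\<lambda>n. d (f n) l) \<longlonglongrightarrow> 0"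
  shows "(\<lambda>n. displ (f n)) \<longlonglongrightarrow> displ l"
proof (rule LIMSEQ_I)
  fix e :: real assume "0 < e"
  then obtain \<eta> where \<eta>: "\<eta> > 0" "\<And>x y. \<lbrakk>x \<in> S; y \<in> S; d x y < \<eta>\<rbrakk> \<Longrightarrow> \<bar>displ x - displ y\<bar> < e"
    using displ_uniform by metis
  then have "\<forall>\<^sub>F n in sequentially. d (f n) l < \<eta>" using assms(3) by (simp add: order_tendstoD)
  then show "\<exists>no. \<forall>n\<ge>no. norm (displ (f n) - displ l) < e"
    unfolding eventually_sequentially using \<eta> assms by (metis range_subsetD real_norm_def)
qed

text \<open>\<open>displ\<close> only looks at times up to 1, but an arbitrary s is n steps of size
  s/n, each of which fixes z. So \<open>displ\<close> vanishes exactly at the fixed points of the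
  flow, and its size measures how far a point is from being fixed.\<close>

lemma displ_zero_fixed:
  assumes "z \<in> S" "displ z \<le> 0" shows "\<phi> s z = z"
proof -
  have small: "\<phi> t z = z" if "\<bar>t\<bar> \<le> 1" for t
  proof -
    have "min 1 (d z (\<phi> t z)) \<le> 0" using displ_upper[OF assms(1) that] assms(2) by linarith
    then have "d z (\<phi> t z) = 0" using d_nonneg[OF assms(1) flow_in[OF assms(1)], of t] by linarith
    then show ?thesis using d_pos[OF assms(1) flow_in[OF assms(1)], of t] by simp
  qed
  have rep: "\<phi> (real n * t) z = z" if "\<bar>t\<bar> \<le> 1" for n t
    by (induction n) (auto simp: flow_0[OF assms(1)] small[OF that] distrib_right flow_add[OF assms(1)])
  obtain n where n: "\<bar>s\<bar> < real n" using reals_Archimedean2 by blast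
  then have "\<phi> (real n * (s / real n)) z = z" by (intro rep) (auto simp: field_simps)
  then show ?thesis using n by auto
qed

lemma fixed_displ_zero:
  assumes "z \<in> S" "\<And>s. \<phi> s z = z" shows "displ z = 0"
  unfolding displ_def using assms d_self by simp

section \<open>Absence of short periods and its consequences for shadowing\<close>

lemma flow_multiple_period:
  assumes "z \<in> S" "\<phi> p z = z" shows "\<phi> (of_int k * p) z = z"
proof -
  have n: "\<phi> (real n * q) z = z" if "\<phi> q z = z" for n q
    by (induction n) (auto simp: flow_0[OF assms(1)] that distrib_right flow_add[OF assms(1)])
  show ?thesis
  proof (cases "k \<ge> 0")
    case True then show ?thesis using n[OF assms(2), of "nat k"] by simp
  next
    case False
    have "\<phi> (- p) z = z" using flow_uminus(1)[OF assms(1), of p] assms(2) by simp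
    from n[OF this, of "nat (-k)"] False show ?thesis by simp
  qed
qed

text \<open>With periods p_n tending to 0, every time s differs from a multiple of p_n by a
  remainder tending to 0. Hence the limit point is fixed by the whole flow, while its
  \<open>displ\<close> is still at least c.\<close>

lemma no_short_period:
  assumes "c > 0"
  obtains h where "h > 0" "\<And>z s. \<lbrakk>z \<in> S; displ z \<ge> c; s \<noteq> 0; \<bar>s\<bar> \<le> h\<rbrakk> \<Longrightarrow> \<phi> s z \<noteq> z"
proof (rule ccontr)
  assume "\<not> thesis"
  then have H: "\<And>h. h > 0 \<Longrightarrow> \<exists>z s. z \<in> S \<and> displ z \<ge> c \<and> s \<noteq> 0 \<and> \<bar>s\<bar> \<le> h \<and> \<phi> s z = z"
    using that by metis
  have "\<forall>n::nat. \<exists>z s. z \<in> S \<and> displ z \<ge> c \<and> s \<noteq> 0 \<and> \<bar>s\<bar> \<le> inverse (Suc n) \<and> \<phi> s z = z"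
    by (intro allI H) simp
  then obtain z p where z: "\<And>n::nat. z n \<in> S" "\<And>n. displ (z n) \<ge> c" "\<And>n. p n \<noteq> 0"
      "\<And>n. \<bar>p n\<bar> \<le> inverse (Suc n)" "\<And>n. \<phi> (p n) (z n) = z n"
    by metis
  obtain l k where k: "l \<in> S" "strict_mono k" "(\<lambda>n. d (z (k n)) l) \<longlonglongrightarrow> 0"
    using seq_compact[of z] z(1) by blast
  have i: "(\<lambda>n. inverse (real (Suc (k n)))) \<longlonglongrightarrow> 0"
    using LIMSEQ_subseq_LIMSEQ[OF LIMSEQ_inverse_real_of_nat k(2)] by (simp add: o_def)
  have "\<phi> s l = l" for s
  proof -
    define q where "q = (\<lambda>n. s - of_int \<lfloor>s / p n\<rfloor> * p n)"
    have qp: "\<bar>q n\<bar> \<le> \<bar>p n\<bar>" for n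
    proof -
      have "q n = p n * frac (s / p n)" using z(3)[of n] by (simp add: q_def frac_def field_simps)
      then show ?thesis using frac_lt_1[of "s / p n"] by (simp add: abs_mult mult_left_le)
    qed
    have q: "(\<lambda>n. q (k n)) \<longlonglongrightarrow> 0"
      by (rule Lim_null_comparison[OF _ i]) (use order_trans[OF qp z(4)] in \<open>auto intro!: always_eventually\<close>)
    have eq: "\<phi> (q n) (z n) = \<phi> s (z n)" for n
    proof -
      have "\<phi> s (z n) = \<phi> (q n + of_int \<lfloor>s / p n\<rfloor> * p n) (z n)" by (simp add: q_def)
      also have "\<dots> = \<phi> (q n) (z n)"
        unfolding flow_add[OF z(1)] flow_multiple_period[OF z(1) z(5)] ..
      finally show ?thesis by simp
    qed
    have "(\<lambda>n. d (\<phi> s (z (k n))) (\<phi> s l)) \<longlonglongrightarrow> 0"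
      by (rule flow_cont[OF _ k(1,3)]) (use z in auto)
    moreover have "(\<lambda>n. d (\<phi> s (z (k n))) l) \<longlonglongrightarrow> 0"
      using flow_cont[OF _ k(1,3) q] z(1) flow_0[OF k(1)] unfolding eq by auto
    ultimately have "(\<lambda>n. d (\<phi> s (z (k n))) (\<phi> s (z (k n)))) \<longlonglongrightarrow> d (\<phi> s l) l"
      by (intro d_lim) (use z k flow_in in auto)
    then have "(\<lambda>n. 0) \<longlonglongrightarrow> d (\<phi> s l) l" using d_self flow_in z by simp
    then have "d (\<phi> s l) l = 0" using LIMSEQ_unique by blast
    then show ?thesis using d_pos flow_in k by blast
  qed
  then have "displ l = 0" using fixed_displ_zero k(1) by blast
  moreover have "c \<le> displ l"
    using displ_lim[of "\<lambda>n. z (k n)" l] k z by (intro LIMSEQ_le_const[of "\<lambda>n. displ (z (k n))"]) auto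
  ultimately show False using assms by simp
qed

text \<open>Without short periods, compactness turns the absence of returns into a lower bound on
  the displacement. The times are restricted to |s| = \<kappa> exactly: a bound would degenerate as
  s tends to 0, and a continuous drift that becomes too large passes through this value.\<close>

lemma short_time_displacement:
  assumes "c > 0"
  obtains h where "h > 0" "h \<le> 1" "\<And>\<kappa>. \<lbrakk>0 < \<kappa>; \<kappa> \<le> h\<rbrakk> \<Longrightarrow>
    \<exists>e>0. \<forall>z\<in>S. displ z \<ge> c \<longrightarrow> (\<forall>s. \<bar>s\<bar> = \<kappa> \<longrightarrow> e \<le> d z (\<phi> s z))"
proof -
  obtain h where h: "h > 0" "\<And>z s. \<lbrakk>z \<in> S; displ z \<ge> c; s \<noteq> 0; \<bar>s\<bar> \<le> h\<rbrakk> \<Longrightarrow> \<phi> s z \<noteq> z"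
    using no_short_period[OF assms] by metis
  have "\<exists>e>0. \<forall>z\<in>S. displ z \<ge> c \<longrightarrow> (\<forall>s. \<bar>s\<bar> = \<kappa> \<longrightarrow> e \<le> d z (\<phi> s z))"
    if \<kappa>: "0 < \<kappa>" "\<kappa> \<le> h" for \<kappa>
  proof (rule ccontr)
    assume N: "\<not> ?thesis"
    have "\<forall>n::nat. \<exists>z s. z \<in> S \<and> displ z \<ge> c \<and> \<bar>s\<bar> = \<kappa> \<and> d z (\<phi> s z) < inverse (Suc n)"
    proof
      fix n :: nat
      have "inverse (real (Suc n)) > 0" by simp
      with N show "\<exists>z s. z \<in> S \<and> displ z \<ge> c \<and> \<bar>s\<bar> = \<kappa> \<and> d z (\<phi> s z) < inverse (Suc n)"
        by (meson not_less)
    qed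
    then obtain z s where z: "\<And>n::nat. z n \<in> S" "\<And>n. displ (z n) \<ge> c" "\<And>n. \<bar>s n\<bar> = \<kappa>"
        "\<And>n. d (z n) (\<phi> (s n) (z n)) < inverse (Suc n)"
      by metis
    have "s n \<in> {-\<kappa>..\<kappa>}" for n using z(3)[of n] by auto
    then have "range s \<subseteq> {-\<kappa>..\<kappa>}" by blast
    then obtain l \<tau> k where k: "l \<in> S" "strict_mono k" "(\<lambda>n. d (z (k n)) l) \<longlonglongrightarrow> 0" "(\<lambda>n. s (k n)) \<longlonglongrightarrow> \<tau>"
      by (rule seq_compact_pair[of z s \<kappa>, rotated]) (use z(1) in auto)
    have i: "(\<lambda>n. inverse (real (Suc (k n)))) \<longlonglongrightarrow> 0"
      using LIMSEQ_subseq_LIMSEQ[OF LIMSEQ_inverse_real_of_nat k(2)] by (simp add: o_def)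
    have "(\<lambda>n. \<bar>s (k n)\<bar>) \<longlonglongrightarrow> \<bar>\<tau>\<bar>" using k(4) by (rule tendsto_rabs)
    then have \<tau>: "\<bar>\<tau>\<bar> = \<kappa>" using z(3) LIMSEQ_unique tendsto_const by (metis (lifting) ext)
    have "(\<lambda>n. d (z (k n)) (\<phi> (s (k n)) (z (k n)))) \<longlonglongrightarrow> d l (\<phi> \<tau> l)"
      by (intro d_lim flow_cont k) (use z flow_in k in auto)
    moreover have "(\<lambda>n. d (z (k n)) (\<phi> (s (k n)) (z (k n)))) \<longlonglongrightarrow> 0"
    proof (rule Lim_null_comparison[OF _ i], intro always_eventually allI)
      fix n show "norm (d (z (k n)) (\<phi> (s (k n)) (z (k n)))) \<le> inverse (real (Suc (k n)))"
        using d_nonneg[OF z(1) flow_in[OF z(1)]] z(4)[of "k n"] by (simp add: less_imp_le)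
    qed
    ultimately have "d l (\<phi> \<tau> l) = 0" using LIMSEQ_unique by blast
    then have "\<phi> \<tau> l = l" using d_pos[of l "\<phi> \<tau> l"] flow_in k by simp
    moreover have "c \<le> displ l"
      using displ_lim[of "\<lambda>n. z (k n)" l] k z by (intro LIMSEQ_le_const[of "\<lambda>n. displ (z (k n))"]) auto
    ultimately show False using h(2)[OF k(1)] \<tau> \<kappa> by auto
  qed
  then show thesis using h(1) by (intro that[of "min h 1"]) auto
qed

text \<open>If the drift \<sigma>(t) - \<sigma>(0) - t became too large, it would equal some s with
  |s| = \<kappa>' at an intermediate time t. Put x' = \<phi>_{\<sigma>(0)} x. Pulling the closeness
  at time t back by t shows that y is near \<phi>_s x', and pushing the closeness at time 0 forward
  by s shows that \<phi>_s y is near the same point. So y almost returns after time s, which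
  \<open>short_time_displacement\<close> excludes.\<close>

lemma shadowing_step:
  assumes "c > 0"
  obtains h0 where "h0 > 0" "h0 \<le> 1"
    "\<And>h \<kappa>. \<lbrakk>0 < h; h \<le> h0; 0 < \<kappa>\<rbrakk> \<Longrightarrow> \<exists>\<eta>>0. \<forall>x\<in>S. \<forall>y\<in>S. \<forall>\<sigma>. displ y \<ge> c \<longrightarrow> continuous_on {0..h} \<sigma> \<longrightarrow>
        (\<forall>t\<in>{0..h}. d (\<phi> t y) (\<phi> (\<sigma> t) x) < \<eta>) \<longrightarrow> \<bar>\<sigma> h - \<sigma> 0 - h\<bar> \<le> \<kappa>"
proof -
  obtain h0 where h0: "h0 > 0" "h0 \<le> 1" "\<And>\<kappa>. \<lbrakk>0 < \<kappa>; \<kappa> \<le> h0\<rbrakk> \<Longrightarrow>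
    \<exists>e>0. \<forall>z\<in>S. displ z \<ge> c \<longrightarrow> (\<forall>s. \<bar>s\<bar> = \<kappa> \<longrightarrow> e \<le> d z (\<phi> s z))"
    using short_time_displacement[OF assms] by metis
  have "\<exists>\<eta>>0. \<forall>x\<in>S. \<forall>y\<in>S. \<forall>\<sigma>. displ y \<ge> c \<longrightarrow> continuous_on {0..h} \<sigma> \<longrightarrow>
        (\<forall>t\<in>{0..h}. d (\<phi> t y) (\<phi> (\<sigma> t) x) < \<eta>) \<longrightarrow> \<bar>\<sigma> h - \<sigma> 0 - h\<bar> \<le> \<kappa>"
    if h: "0 < h" "h \<le> h0" "0 < \<kappa>" for h \<kappa>
  proof -
    \<comment> \<open>A drift beyond \<kappa> also passes through any smaller value, so the value
      tested may be cut down to the range h0 in which displacement bounds are available.\<close>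
    define \<kappa>' where "\<kappa>' = min \<kappa> h0"
    have \<kappa>': "0 < \<kappa>'" "\<kappa>' \<le> h0" "\<kappa>' \<le> \<kappa>" using h h0 by (auto simp: \<kappa>'_def)
    obtain e where e: "e > 0" "\<And>z s. \<lbrakk>z \<in> S; displ z \<ge> c; \<bar>s\<bar> = \<kappa>'\<rbrakk> \<Longrightarrow> e \<le> d z (\<phi> s z)"
      using h0(3)[OF \<kappa>'(1,2)] by metis
    obtain \<eta> where \<eta>: "\<eta> > 0"
      "\<And>x y s t. \<lbrakk>x \<in> S; y \<in> S; \<bar>s\<bar> \<le> 1; \<bar>t\<bar> \<le> 1; \<bar>s - t\<bar> < \<eta>; d x y < \<eta>\<rbrakk> \<Longrightarrow> d (\<phi> s x) (\<phi> t y) < e/2"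
      using flow_uniform[of "e/2" 1] e(1) by (metis half_gt_zero)
    show ?thesis
    proof (intro exI conjI ballI allI impI)
      show "\<eta> > 0" by (rule \<eta>)
      fix x y \<sigma> assume xy: "x \<in> S" "y \<in> S" "displ y \<ge> c" and cont: "continuous_on {0..h} \<sigma>"
        and close: "\<forall>t\<in>{0..h}. d (\<phi> t y) (\<phi> (\<sigma> t) x) < \<eta>"
      show "\<bar>\<sigma> h - \<sigma> 0 - h\<bar> \<le> \<kappa>"
      proof (rule ccontr)
        assume "\<not> ?thesis"
        then have "\<kappa>' \<le> \<bar>\<sigma> h - \<sigma> 0 - h\<bar>" using \<kappa>' by linarith
        moreover have "continuous_on {0..h} (\<lambda>t. \<bar>\<sigma> t - \<sigma> 0 - t\<bar>)"
          by (intro continuous_intros cont)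
        ultimately obtain t where t: "t \<in> {0..h}" "\<bar>\<sigma> t - \<sigma> 0 - t\<bar> = \<kappa>'"
          using IVT'[of "\<lambda>t. \<bar>\<sigma> t - \<sigma> 0 - t\<bar>" 0 \<kappa>' h] h \<kappa>' by force
        define s where "s = \<sigma> t - \<sigma> 0 - t"
        define x' where "x' = \<phi> (\<sigma> 0) x"
        have x': "x' \<in> S" using xy flow_in by (simp add: x'_def)
        have s1: "\<bar>s\<bar> \<le> 1" and t1: "\<bar>-t\<bar> \<le> 1" using t \<kappa>' h h0 by (auto simp: s_def)
        have sx: "\<phi> s x' = \<phi> (-t) (\<phi> (\<sigma> t) x)"
          unfolding x'_def using flow_add[OF xy(1), of s "\<sigma> 0"] flow_add[OF xy(1), of "-t" "\<sigma> t"]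
          by (simp add: s_def)
        have "d (\<phi> t y) (\<phi> (\<sigma> t) x) < \<eta>" using close t by blast
        then have "d (\<phi> (-t) (\<phi> t y)) (\<phi> (-t) (\<phi> (\<sigma> t) x)) < e/2"
          using \<eta> flow_in xy t1 by simp
        then have 1: "d y (\<phi> s x') < e/2" using sx flow_uminus(1)[OF xy(2)] by simp
        have "d y x' < \<eta>" using close[rule_format, of 0] h flow_0[OF xy(2)] by (simp add: x'_def)
        then have 2: "d (\<phi> s y) (\<phi> s x') < e/2" using \<eta> xy x' s1 by simp
        have "d y (\<phi> s y) \<le> d y (\<phi> s x') + d (\<phi> s x') (\<phi> s y)"
          using d_triangle xy x' flow_in by blast
        also have "d (\<phi> s x') (\<phi> s y) = d (\<phi> s y) (\<phi> s x')" using d_commute xy x' flow_in by blast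
        finally have "d y (\<phi> s y) < e" using 1 2 by simp
        then show False using e(2)[OF xy(2,3), of s] t by (simp add: s_def)
      qed
    qed
  qed
  with h0 show thesis using that by blast
qed

text \<open>A block of length T on which the orbit moves by e stays uniformly away from the fixed
  points. In the limit of counterexamples, the orbit of l would meet a fixed point at time \<omega>;
  then l is that fixed point and its orbit is constant, although it moves by e.\<close>

lemma moving_displ_bound:
  assumes "e > 0"
  obtains c where "c > 0"
    "\<And>y t s. \<lbrakk>y \<in> S; 0 \<le> t; t \<le> T; e \<le> d y (\<phi> t y); 0 \<le> s; s \<le> T\<rbrakk> \<Longrightarrow> c \<le> displ (\<phi> s y)"
proof (rule ccontr)
  assume "\<not> thesis"
  then have H: "\<And>c. c > 0 \<Longrightarrow> \<exists>y t s. y \<in> S \<and> 0 \<le> t \<and> t \<le> T \<and> e \<le> d y (\<phi> t y) \<and> 0 \<le> s \<and> s \<le> T \<and> displ (\<phi> s y) < c"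
    using that by (metis not_less)
  have "\<forall>n::nat. \<exists>y t s. y \<in> S \<and> 0 \<le> t \<and> t \<le> T \<and> e \<le> d y (\<phi> t y) \<and> 0 \<le> s \<and> s \<le> T \<and> displ (\<phi> s y) < inverse (Suc n)"
    by (intro allI H) simp
  then obtain y t s where y: "\<And>n::nat. y n \<in> S" "\<And>n. 0 \<le> t n" "\<And>n. t n \<le> T" "\<And>n. e \<le> d (y n) (\<phi> (t n) (y n))"
      "\<And>n. 0 \<le> s n" "\<And>n. s n \<le> T" "\<And>n. displ (\<phi> (s n) (y n)) < inverse (Suc n)"
    by metis
  have "t n \<in> {-T..T}" "s n \<in> {-T..T}" for n using y(2,3,5,6)[of n] by auto
  then have rg: "range t \<subseteq> {-T..T}" "range s \<subseteq> {-T..T}" by auto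
  obtain l1 \<tau> k1 where k1: "l1 \<in> S" "strict_mono k1" "(\<lambda>n. d (y (k1 n)) l1) \<longlonglongrightarrow> 0" "(\<lambda>n. t (k1 n)) \<longlonglongrightarrow> \<tau>"
    by (rule seq_compact_pair[of y t T]) (use y(1) rg in auto)
  obtain l \<omega> k2 where k2: "l \<in> S" "strict_mono k2" "(\<lambda>n. d (y (k1 (k2 n))) l) \<longlonglongrightarrow> 0" "(\<lambda>n. s (k1 (k2 n))) \<longlonglongrightarrow> \<omega>"
    by (rule seq_compact_pair[of "\<lambda>n. y (k1 n)" "\<lambda>n. s (k1 n)" T]) (use y(1) rg in auto)
  have t: "(\<lambda>n. t (k1 (k2 n))) \<longlonglongrightarrow> \<tau>"
    using LIMSEQ_subseq_LIMSEQ[OF k1(4) k2(2)] by (simp add: o_def)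
  have i: "(\<lambda>n. inverse (real (Suc (k1 (k2 n))))) \<longlonglongrightarrow> 0"
    using LIMSEQ_subseq_LIMSEQ[OF LIMSEQ_subseq_LIMSEQ[OF LIMSEQ_inverse_real_of_nat k1(2)] k2(2)]
    by (simp add: o_def)
  have "(\<lambda>n. d (\<phi> (s (k1 (k2 n))) (y (k1 (k2 n)))) (\<phi> \<omega> l)) \<longlonglongrightarrow> 0"
    using y(1) by (intro flow_cont k2) auto
  then have "(\<lambda>n. displ (\<phi> (s (k1 (k2 n))) (y (k1 (k2 n))))) \<longlonglongrightarrow> displ (\<phi> \<omega> l)"
    using y(1) flow_in k2(1) by (intro displ_lim) auto
  then have "displ (\<phi> \<omega> l) \<le> 0"
    by (rule LIMSEQ_le[OF _ i]) (use less_imp_le[OF y(7)] in blast)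
  then have f: "\<phi> r (\<phi> \<omega> l) = \<phi> \<omega> l" for r using displ_zero_fixed flow_in k2 by blast
  have "\<phi> \<omega> l = l" using f[of "-\<omega>"] flow_uminus(1)[OF k2(1)] by simp
  then have fl: "\<phi> \<tau> l = l" using f by simp
  have "(\<lambda>n. d (y (k1 (k2 n))) (\<phi> (t (k1 (k2 n))) (y (k1 (k2 n))))) \<longlonglongrightarrow> d l (\<phi> \<tau> l)"
    by (intro d_lim flow_cont k2 t) (use y flow_in k2 in auto)
  then have "e \<le> d l (\<phi> \<tau> l)"
    by (rule LIMSEQ_le_const) (use y(4) in blast)
  with fl d_self[OF k2(1)] assms show False by simp
qed

end

section \<open>Coding shadowed orbits\<close>

text \<open>m is the integral of g from 0. The inequalities and the two equalities are the mean
  value theorem applied to an antiderivative of g.\<close>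

lemma unit_clock_exists:
  fixes g :: "real \<Rightarrow> real"
  assumes cont: "continuous_on UNIV g" and g: "\<And>s. 0 \<le> g s" "\<And>s. g s \<le> 1"
  obtains m where "m 0 = 0" "\<And>s t. s \<le> t \<Longrightarrow> m s \<le> m t" "\<And>s t. s \<le> t \<Longrightarrow> m t \<le> m s + (t - s)"
    "\<And>s t. \<lbrakk>s \<le> t; \<And>u. \<lbrakk>s \<le> u; u \<le> t\<rbrakk> \<Longrightarrow> g u = 0\<rbrakk> \<Longrightarrow> m t = m s"
    "\<And>s t. \<lbrakk>s \<le> t; \<And>u. \<lbrakk>s \<le> u; u \<le> t\<rbrakk> \<Longrightarrow> g u = 1\<rbrakk> \<Longrightarrow> m t = m s + (t - s)"
proof -
  have "\<exists>F. \<forall>x::real. -\<infinity> < ereal x \<longrightarrow> ereal x < \<infinity> \<longrightarrow> (F has_vector_derivative g x) (at x)"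
    using cont by (intro einterval_antiderivative) (auto simp: continuous_on_eq_continuous_at)
  then obtain F where F: "\<And>x. (F has_real_derivative g x) (at x)"
    by (auto simp: has_real_derivative_iff_has_vector_derivative)
  have mvt: "\<exists>u. s \<le> u \<and> u \<le> t \<and> F t - F s = (t - s) * g u" if "s \<le> t" for s t
  proof (cases "s = t")
    case False
    with that have "s < t" by simp
    then obtain u where "s < u" "u < t" "F t - F s = (t - s) * g u" using MVT2[of s t F g] F by blast
    then show ?thesis by (intro exI[of _ u]) auto
  qed auto
  show thesis
  proof (rule that[of "\<lambda>s. F s - F 0"])
    fix s t :: real assume st: "s \<le> t"
    then obtain u where u: "s \<le> u" "u \<le> t" "F t - F s = (t - s) * g u" using mvt by blast
    have "0 \<le> (t - s) * g u" "(t - s) * g u \<le> (t - s) * 1"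
      using st g(1)[of u] mult_left_mono[OF g(2)[of u], of "t - s"] by auto
    then show "F s - F 0 \<le> F t - F 0" "F t - F 0 \<le> F s - F 0 + (t - s)" using u by auto
    show "F t - F 0 = F s - F 0" if "\<And>u. \<lbrakk>s \<le> u; u \<le> t\<rbrakk> \<Longrightarrow> g u = 0"
      using u that by auto
    show "F t - F 0 = F s - F 0 + (t - s)" if "\<And>u. \<lbrakk>s \<le> u; u \<le> t\<rbrakk> \<Longrightarrow> g u = 1"
      using u that by auto
  qed simp
qed

lemma IVT_between:
  fixes \<sigma> :: "real \<Rightarrow> real"
  assumes "continuous_on {a..b} \<sigma>" "a \<le> b" "s \<in> {\<sigma> a..\<sigma> b} \<union> {\<sigma> b..\<sigma> a}"
  obtains u where "u \<in> {a..b}" "\<sigma> u = s"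
proof (cases "\<sigma> a \<le> s \<and> s \<le> \<sigma> b")
  case True
  then show thesis using IVT'[of \<sigma> a s b] assms that by auto
next
  case False
  then show thesis using IVT2'[of \<sigma> b s a] assms that by auto
qed

section \<open>Clock readings along a shadowing orbit\<close>

context compact_flow
begin

text \<open>The clock \<open>m\<close> runs at unit speed where the orbit of \<open>x\<close> moves and stops near fixed
  points, where a reparametrization \<open>\<sigma>\<close> of a shadowing orbit is uncontrolled.\<close>

definition gate :: "real \<Rightarrow> 'a \<Rightarrow> real" where
  "gate c z = max 0 (min 1 ((displ z - c/2) * (4/c)))"

text \<open>The ramp runs from c/2 to 3c/4 so that both thresholds survive the errors c/8 of
  \<open>good_scales\<close>: a value below c/4 on the shadowed orbit stays below c/2 after two such
  errors, and a value of at least c stays above 3c/4 after one.\<close>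

lemma gate_simps:
  assumes "c > 0" shows "displ z \<le> c/2 \<Longrightarrow> gate c z = 0" "displ z \<ge> 3*c/4 \<Longrightarrow> gate c z = 1"
    "0 \<le> gate c z" "gate c z \<le> 1"
proof -
  show "displ z \<le> c/2 \<Longrightarrow> gate c z = 0"
    using assms mult_nonpos_nonneg[of "displ z - c/2" "4/c"] by (simp add: gate_def)
  assume "displ z \<ge> 3*c/4"
  then have "c/4 * (4/c) \<le> (displ z - c/2) * (4/c)" using assms by (intro mult_right_mono) auto
  then show "gate c z = 1" using assms by (simp add: gate_def)
qed (auto simp: gate_def)

lemma continuous_gate_orbit:
  assumes "c > 0" "x \<in> S" shows "continuous_on UNIV (\<lambda>s. gate c (\<phi> s x))"
proof -
  have "continuous_on UNIV (\<lambda>s. displ (\<phi> s x))"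
  proof (rule continuous_on_sequentiallyI)
    fix u a assume u: "u \<longlonglongrightarrow> (a::real)"
    have "(\<lambda>n. d (\<phi> (u n) x) (\<phi> a x)) \<longlonglongrightarrow> 0"
      using flow_cont[of "\<lambda>_. x" x u a] assms u d_self by auto
    then show "(\<lambda>n. displ (\<phi> (u n) x)) \<longlonglongrightarrow> displ (\<phi> a x)"
      using assms flow_in by (intro displ_lim) auto
  qed
  then show ?thesis unfolding gate_def by (intro continuous_intros)
qed

text \<open>The clock depends on c and x only, not on the shadowed orbit, so the readings
  m(\<sigma>(t)) for different y are comparable.\<close>

definition clock_for :: "real \<Rightarrow> 'a \<Rightarrow> (real \<Rightarrow> real) \<Rightarrow> bool" where
  "clock_for c x m \<longleftrightarrow> m 0 = 0 \<and> (\<forall>s t. s \<le> t \<longrightarrow> m s \<le> m t \<and> m t \<le> m s + (t - s) \<and>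
     ((\<forall>u. s \<le> u \<and> u \<le> t \<longrightarrow> gate c (\<phi> u x) = 0) \<longrightarrow> m t = m s) \<and>
     ((\<forall>u. s \<le> u \<and> u \<le> t \<longrightarrow> gate c (\<phi> u x) = 1) \<longrightarrow> m t = m s + (t - s)))"

lemma clock_for_exists:
  assumes "c > 0" "x \<in> S" obtains m where "clock_for c x m"
proof (rule unit_clock_exists[OF continuous_gate_orbit[OF assms] gate_simps(3,4)[OF assms(1)]])
  fix m :: "real \<Rightarrow> real"
  assume "m 0 = 0" "\<And>s t. s \<le> t \<Longrightarrow> m s \<le> m t" "\<And>s t. s \<le> t \<Longrightarrow> m t \<le> m s + (t - s)"
    "\<And>s t. \<lbrakk>s \<le> t; \<And>u. \<lbrakk>s \<le> u; u \<le> t\<rbrakk> \<Longrightarrow> gate c (\<phi> u x) = 0\<rbrakk> \<Longrightarrow> m t = m s"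
    "\<And>s t. \<lbrakk>s \<le> t; \<And>u. \<lbrakk>s \<le> u; u \<le> t\<rbrakk> \<Longrightarrow> gate c (\<phi> u x) = 1\<rbrakk> \<Longrightarrow> m t = m s + (t - s)"
  then show thesis by (intro that[of m]) (simp add: clock_for_def)
qed

text \<open>It is the orbit of x that is reparametrized, in order to follow y. Only continuity of
  \<sigma> is kept, because the approximating path in D_r has no speed bound; \<sigma> may also run
  backwards.\<close>

definition shadows :: "real \<Rightarrow> real \<Rightarrow> 'a \<Rightarrow> 'a \<Rightarrow> (real \<Rightarrow> real) \<Rightarrow> bool" where
  "shadows r \<eta> x y \<sigma> \<longleftrightarrow> continuous_on {0..r} \<sigma> \<and> \<sigma> 0 = 0 \<and> (\<forall>t\<in>{0..r}. d (\<phi> t y) (\<phi> (\<sigma> t) x) < \<eta>)"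

text \<open>Control over one step of length h: \<open>displ\<close> changes by less than c/8 both
  between \<eta>-close points and along an orbit for time h, and on a moving orbit the
  reparametrization advances by h up to \<kappa>. The last clause asks only for c/4, so that the
  remaining case, \<open>displ\<close> below c/4, leads to a vanishing gate.\<close>

definition good_scales :: "real \<Rightarrow> real \<Rightarrow> real \<Rightarrow> real \<Rightarrow> bool" where
  "good_scales c h \<kappa> \<eta> \<longleftrightarrow> c > 0 \<and> h > 0 \<and> \<kappa> > 0 \<and> \<kappa> \<le> h/2 \<and>
     (\<forall>z\<in>S. \<forall>w\<in>S. d z w < \<eta> \<longrightarrow> \<bar>displ z - displ w\<bar> < c/8) \<and>
     (\<forall>z\<in>S. \<forall>s. \<bar>s\<bar> \<le> h \<longrightarrow> \<bar>displ (\<phi> s z) - displ z\<bar> < c/8) \<and>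
     (\<forall>x\<in>S. \<forall>y\<in>S. \<forall>\<sigma>. displ y \<ge> c/4 \<longrightarrow> continuous_on {0..h} \<sigma> \<longrightarrow>
        (\<forall>t\<in>{0..h}. d (\<phi> t y) (\<phi> (\<sigma> t) x) < \<eta>) \<longrightarrow> \<bar>\<sigma> h - \<sigma> 0 - h\<bar> \<le> \<kappa>)"

lemma shadowing_rate_step:
  assumes sc: "good_scales c h \<kappa> \<eta>" and xy: "x \<in> S" "y \<in> S" and sh: "shadows r \<eta> x y \<sigma>"
    and t: "0 \<le> t" "t + h \<le> r" and v: "displ (\<phi> t y) \<ge> c/4"
  shows "\<bar>\<sigma> (t + h) - \<sigma> t - h\<bar> \<le> \<kappa>"
proof -
  have "continuous_on {0..h} (\<lambda>u. \<sigma> (t + u))"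
    by (rule continuous_on_compose2[of "{0..r}" \<sigma>])
      (use sh t in \<open>auto simp: shadows_def intro!: continuous_intros\<close>)
  moreover have "d (\<phi> u (\<phi> t y)) (\<phi> (\<sigma> (t + u)) x) < \<eta>" if "u \<in> {0..h}" for u
  proof -
    have "d (\<phi> (t + u) y) (\<phi> (\<sigma> (t + u)) x) < \<eta>" using sh that t by (auto simp: shadows_def)
    then show ?thesis using flow_add[OF xy(2), of u t] by (simp add: add.commute)
  qed
  ultimately have "\<bar>\<sigma> (t + h) - \<sigma> (t + 0) - h\<bar> \<le> \<kappa>"
    using sc xy v flow_in unfolding good_scales_def by blast
  then show ?thesis by simp
qed

text \<open>If y moves, \<sigma> advances by between 0 and 2h, since \<kappa> \<le> h/2, and the
  clock is monotone and 1-Lipschitz. If y hardly moves, the orbit of x is near fixed points along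
  the whole range of \<sigma> and the clock stands still there, however far \<sigma> wanders. So the
  reading never decreases over a step of length h, although \<sigma> may.\<close>

lemma shadowing_clock_step:
  assumes sc: "good_scales c h \<kappa> \<eta>" and xy: "x \<in> S" "y \<in> S" and sh: "shadows r \<eta> x y \<sigma>"
    and m: "clock_for c x m" and t: "0 \<le> t" "t + h \<le> r"
  shows "m (\<sigma> t) \<le> m (\<sigma> (t + h)) \<and> m (\<sigma> (t + h)) \<le> m (\<sigma> t) + 2 * h"
proof (cases "displ (\<phi> t y) \<ge> c/4")
  case True
  have "\<bar>\<sigma> (t + h) - \<sigma> t - h\<bar> \<le> h/2"
    using shadowing_rate_step[OF sc xy sh t True] sc unfolding good_scales_def by linarith
  then have s: "\<sigma> t \<le> \<sigma> (t + h)" "\<sigma> (t + h) - \<sigma> t \<le> 2 * h" using sc unfolding good_scales_def abs_le_iff by linarith+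
  then have "m (\<sigma> t) \<le> m (\<sigma> (t + h))" "m (\<sigma> (t + h)) \<le> m (\<sigma> t) + (\<sigma> (t + h) - \<sigma> t)"
    using m unfolding clock_for_def by blast+
  with s show ?thesis by linarith
next
  case False
  have c: "c > 0" "h > 0" using sc by (auto simp: good_scales_def)
  have g: "gate c (\<phi> (\<sigma> u) x) = 0" if u: "u \<in> {t..t+h}" for u
  proof -
    have "\<phi> u y = \<phi> (u - t) (\<phi> t y)" using flow_add[OF xy(2), of "u - t" t] by simp
    then have "\<bar>displ (\<phi> u y) - displ (\<phi> t y)\<bar> < c/8"
      using sc u flow_in[OF xy(2)] unfolding good_scales_def by auto
    moreover have "\<bar>displ (\<phi> u y) - displ (\<phi> (\<sigma> u) x)\<bar> < c/8"
      using sc u t sh flow_in xy unfolding good_scales_def shadows_def by auto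
    ultimately show ?thesis using False c(1) by (intro gate_simps) (auto simp: field_simps abs_if split: if_splits)
  qed
  have co: "continuous_on {t..t+h} \<sigma>" using sh t by (auto simp: shadows_def intro: continuous_on_subset)
  \<comment> \<open>The clock sees the interval between \<sigma>(t) and \<sigma>(t+h), not the graph
    of \<sigma>; by the intermediate value theorem every point of that interval is some
    \<sigma>(u).\<close>
  have z: "gate c (\<phi> s x) = 0" if s: "s \<in> {\<sigma> t..\<sigma> (t+h)} \<union> {\<sigma> (t+h)..\<sigma> t}" for s
  proof -
    obtain u where "u \<in> {t..t+h}" "\<sigma> u = s" using IVT_between[OF co _ s] c by auto
    then show ?thesis using g by blast
  qed
  have "m (\<sigma> (t+h)) = m (\<sigma> t)"
  proof (cases "\<sigma> t \<le> \<sigma> (t+h)")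
    case True then show ?thesis using m z unfolding clock_for_def by simp
  next
    case False
    then have "\<sigma> (t+h) \<le> \<sigma> t" by simp
    then have "m (\<sigma> t) = m (\<sigma> (t+h))" using m z unfolding clock_for_def by simp
    then show ?thesis by simp
  qed
  then show ?thesis using c by simp
qed

lemma shadowing_clock_steps:
  assumes sc: "good_scales c h \<kappa> \<eta>" and xy: "x \<in> S" "y \<in> S" and sh: "shadows r \<eta> x y \<sigma>"
    and m: "clock_for c x m" and t: "0 \<le> t" "t + real n * h \<le> r"
  shows "m (\<sigma> t) \<le> m (\<sigma> (t + real n * h)) \<and> m (\<sigma> (t + real n * h)) \<le> m (\<sigma> t) + 2 * (real n * h)"
  using t(2)
proof (induction n)
  case (Suc n)
  have h: "h > 0" using sc by (auto simp: good_scales_def)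
  have e: "t + real (Suc n) * h = (t + real n * h) + h" by (simp add: algebra_simps)
  have "m (\<sigma> (t + real n * h)) \<le> m (\<sigma> (t + real (Suc n) * h)) \<and>
      m (\<sigma> (t + real (Suc n) * h)) \<le> m (\<sigma> (t + real n * h)) + 2 * h"
    unfolding e using shadowing_clock_step[OF sc xy sh m, of "t + real n * h"] Suc.prems t(1) h e by simp
  with Suc h e show ?case by (simp add: algebra_simps)
qed simp

lemma shadowing_rate_steps:
  assumes sc: "good_scales c h \<kappa> \<eta>" and xy: "x \<in> S" "y \<in> S" and sh: "shadows r \<eta> x y \<sigma>"
    and t: "0 \<le> t" "t + real n * h \<le> r"
    and v: "\<And>u. \<lbrakk>0 \<le> u; u \<le> real n * h\<rbrakk> \<Longrightarrow> displ (\<phi> (t + u) y) \<ge> c"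
  shows "\<bar>\<sigma> (t + real n * h) - \<sigma> t - real n * h\<bar> \<le> real n * \<kappa>"
  using t(2) v
proof (induction n)
  case (Suc n)
  have h: "h > 0" "c > 0" using sc by (auto simp: good_scales_def)
  have e: "t + real (Suc n) * h = (t + real n * h) + h" by (simp add: algebra_simps)
  have "displ (\<phi> (t + real n * h) y) \<ge> c" by (rule Suc.prems(2)) (use h in \<open>auto simp: field_simps\<close>)
  then have "\<bar>\<sigma> (t + real (Suc n) * h) - \<sigma> (t + real n * h) - h\<bar> \<le> \<kappa>"
    unfolding e using shadowing_rate_step[OF sc xy sh, of "t + real n * h"] Suc.prems(1) t(1) h e by simp
  moreover have "\<bar>\<sigma> (t + real n * h) - \<sigma> t - real n * h\<bar> \<le> real n * \<kappa>"
    by (rule Suc.IH) (use Suc.prems h in \<open>auto simp: field_simps\<close>)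
  ultimately show ?case by (simp add: algebra_simps)
qed simp

text \<open>The clock is not injective: where it is flat, equal readings say nothing about the
  phase. On a moving block it runs at unit speed on all of [\<sigma>(t), \<sigma>(t) + \<delta>], so
  a reading less than \<delta> ahead can only come from a phase less than \<delta> ahead.\<close>

lemma clock_determines_reparam:
  assumes sc: "good_scales c h \<kappa> \<eta>" and xy: "x \<in> S" "y \<in> S" and sh: "shadows r \<eta> x y \<sigma>"
    and m: "clock_for c x m" and t: "0 \<le> t" "t + real n * h \<le> r"
    and v: "\<And>u. \<lbrakk>0 \<le> u; u \<le> real n * h\<rbrakk> \<Longrightarrow> displ (\<phi> (t + u) y) \<ge> c"
    and \<delta>: "0 < \<delta>" "\<delta> \<le> 1" "real n * \<kappa> \<le> \<delta>/2" "2 \<le> real n * h"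
    and close: "m s < m (\<sigma> t) + \<delta>"
  shows "s < \<sigma> t + \<delta>"
proof (rule ccontr)
  assume N: "\<not> ?thesis"
  have c: "c > 0" using sc by (simp add: good_scales_def)
  \<comment> \<open>The block has length at least 2 and loses at most \<delta>/2 to drift, so
    \<sigma> advances by at least 3/2 \<ge> \<delta> and covers the interval on which the clock is
    compared.\<close>
  have "\<sigma> t + \<delta> \<le> \<sigma> (t + real n * h)"
    using shadowing_rate_steps[OF sc xy sh t v] \<delta> by (simp add: abs_le_iff)
  moreover have co: "continuous_on {t..t + real n * h} \<sigma>"
    using sh t by (auto simp: shadows_def intro: continuous_on_subset)
  ultimately have "gate c (\<phi> u x) = 1" if u: "\<sigma> t \<le> u" "u \<le> \<sigma> t + \<delta>" for u
  proof -
    obtain w where w: "w \<in> {t..t + real n * h}" "\<sigma> w = u"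
      using IVT_between[OF co, of u] u \<open>\<sigma> t + \<delta> \<le> \<sigma> (t + real n * h)\<close> \<delta>(4) by auto
    have "displ (\<phi> w y) \<ge> c" using v[of "w - t"] w(1) by simp
    moreover have "\<bar>displ (\<phi> w y) - displ (\<phi> (\<sigma> w) x)\<bar> < c/8"
      using sc w t sh flow_in xy unfolding good_scales_def shadows_def by auto
    ultimately show ?thesis using w c by (intro gate_simps) (auto simp: field_simps abs_if split: if_splits)
  qed
  then have "m (\<sigma> t + \<delta>) = m (\<sigma> t) + (\<sigma> t + \<delta> - \<sigma> t)"
    using m \<delta>(1) unfolding clock_for_def by (smt (verit))
  moreover have "m (\<sigma> t + \<delta>) \<le> m s" using m N unfolding clock_for_def by simp
  ultimately show False using close by simp
qed

text \<open>Equal cells of the clock give phases within \<delta> at the start of the block, by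
  \<open>clock_determines_reparam\<close> in both directions. Each reparametrization then deviates
  by at most \<delta>/2 from unit speed, so at the grid times the phases stay within 2\<delta>. The
  factor 5 counts the legs of the triangle inequality: from time t + u to a grid time, across to the
  orbit of x, along it, across to the orbit of y', and back to time t + u.\<close>

lemma equal_code_moving_block:
  assumes sc: "good_scales c h \<kappa> \<eta>" and xy: "x \<in> S" "y \<in> S" "y' \<in> S"
    and sh: "shadows r \<eta> x y \<sigma>" "shadows r \<eta> x y' \<sigma>'"
    and m: "clock_for c x m" and t: "0 \<le> t" "t + real n * h \<le> r"
    and v: "\<And>u. \<lbrakk>0 \<le> u; u \<le> real n * h\<rbrakk> \<Longrightarrow> displ (\<phi> (t + u) y) \<ge> c"
      "\<And>u. \<lbrakk>0 \<le> u; u \<le> real n * h\<rbrakk> \<Longrightarrow> displ (\<phi> (t + u) y') \<ge> c"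
    and \<delta>: "0 < \<delta>" "\<delta> \<le> 1" "real n * \<kappa> \<le> \<delta>/2" "2 \<le> real n * h" "h \<le> \<delta>"
    and fl: "\<lfloor>m (\<sigma> t) / \<delta>\<rfloor> = \<lfloor>m (\<sigma>' t) / \<delta>\<rfloor>"
    and small: "\<And>z s. \<lbrakk>z \<in> S; \<bar>s\<bar> \<le> 2 * \<delta>\<rbrakk> \<Longrightarrow> d z (\<phi> s z) < e" and \<eta>: "\<eta> \<le> e"
    and u: "0 \<le> u" "u \<le> real n * h"
  shows "d (\<phi> (t + u) y) (\<phi> (t + u) y') < 5 * e"
proof -
  have "\<bar>m (\<sigma> t) / \<delta> - m (\<sigma>' t) / \<delta>\<bar> < 1" using fl by linarith
  then have "\<bar>m (\<sigma> t) - m (\<sigma>' t)\<bar> < \<delta>" using \<delta>(1) by (simp add: diff_divide_distrib[symmetric] abs_divide)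
  then have base: "\<bar>\<sigma> t - \<sigma>' t\<bar> < \<delta>"
    using clock_determines_reparam[OF sc xy(1,2) sh(1) m t v(1) \<delta>(1-4), of "\<sigma>' t"]
      clock_determines_reparam[OF sc xy(1,3) sh(2) m t v(2) \<delta>(1-4), of "\<sigma> t"] unfolding abs_less_iff by linarith
  have h: "h > 0" "\<kappa> > 0" using sc by (auto simp: good_scales_def)
  \<comment> \<open>Drift is controlled only at the grid times t + jh; the last one before t + u is
    at most h \<le> \<delta> away.\<close>
  define j where "j = nat \<lfloor>u / h\<rfloor>"
  have j: "real j * h \<le> u" "u \<le> real j * h + h"
  proof -
    have "real j = of_int \<lfloor>u / h\<rfloor>" using u h by (simp add: j_def)
    then have "real j \<le> u / h" "u / h \<le> real j + 1" by linarith+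
    then show "real j * h \<le> u" "u \<le> real j * h + h" using h by (auto simp: field_simps)
  qed
  have jn: "j \<le> n"
  proof -
    have "real j * h \<le> real n * h" using j u by linarith
    then show ?thesis using h by simp
  qed
  have jnh: "real j * h \<le> real n * h" "real j * \<kappa> \<le> real n * \<kappa>" using jn h by (auto simp: mult_right_mono)
  define w where "w = t + real j * h"
  have w: "0 \<le> w" "w \<le> r"
    using t(1) h order_trans[OF add_left_mono[OF jnh(1)] t(2)] unfolding w_def by simp_all
  have "\<bar>\<sigma> w - \<sigma> t - real j * h\<bar> \<le> real j * \<kappa>" unfolding w_def
    by (rule shadowing_rate_steps[OF sc xy(1,2) sh(1) t(1)]) (use t jnh v in auto)
  moreover have "\<bar>\<sigma>' w - \<sigma>' t - real j * h\<bar> \<le> real j * \<kappa>" unfolding w_def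
    by (rule shadowing_rate_steps[OF sc xy(1,3) sh(2) t(1)]) (use t jnh v in auto)
  ultimately have sw: "\<bar>\<sigma>' w - \<sigma> w\<bar> \<le> 2 * \<delta>" using base jnh \<delta> by linarith
  have a: "d (\<phi> w z) (\<phi> (t + u) z) < e" if "z \<in> S" for z
  proof -
    have "\<phi> (t + u) z = \<phi> (u - real j * h) (\<phi> w z)"
      using flow_add[OF that, of "u - real j * h" w] by (simp add: w_def add.commute)
    then show ?thesis using small[OF flow_in[OF that], of "u - real j * h" w] j \<delta> by simp
  qed
  have b: "d (\<phi> w y) (\<phi> (\<sigma> w) x) < e" "d (\<phi> w y') (\<phi> (\<sigma>' w) x) < e"
    using sh w \<eta> unfolding shadows_def by force+
  have "\<phi> (\<sigma>' w) x = \<phi> (\<sigma>' w - \<sigma> w) (\<phi> (\<sigma> w) x)" using flow_add[OF xy(1), of "\<sigma>' w - \<sigma> w" "\<sigma> w"] by simp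
  then have c: "d (\<phi> (\<sigma> w) x) (\<phi> (\<sigma>' w) x) < e" using small[OF flow_in[OF xy(1)] sw] by simp
  note fi = flow_in[OF xy(1)] flow_in[OF xy(2)] flow_in[OF xy(3)]
  have "d (\<phi> (t + u) y) (\<phi> (t + u) y') \<le> d (\<phi> (t + u) y) (\<phi> w y) + d (\<phi> w y) (\<phi> (t + u) y')"
    by (intro d_triangle fi)
  also have "d (\<phi> w y) (\<phi> (t + u) y') \<le> d (\<phi> w y) (\<phi> (\<sigma> w) x) + d (\<phi> (\<sigma> w) x) (\<phi> (t + u) y')"
    by (intro d_triangle fi)
  also have "d (\<phi> (\<sigma> w) x) (\<phi> (t + u) y') \<le> d (\<phi> (\<sigma> w) x) (\<phi> (\<sigma>' w) x) + d (\<phi> (\<sigma>' w) x) (\<phi> (t + u) y')"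
    by (intro d_triangle fi)
  also have "d (\<phi> (\<sigma>' w) x) (\<phi> (t + u) y') \<le> d (\<phi> (\<sigma>' w) x) (\<phi> w y') + d (\<phi> w y') (\<phi> (t + u) y')"
    by (intro d_triangle fi)
  finally have "d (\<phi> (t + u) y) (\<phi> (t + u) y') \<le> d (\<phi> (t + u) y) (\<phi> w y) + (d (\<phi> w y) (\<phi> (\<sigma> w) x) +
      (d (\<phi> (\<sigma> w) x) (\<phi> (\<sigma>' w) x) + (d (\<phi> (\<sigma>' w) x) (\<phi> w y') + d (\<phi> w y') (\<phi> (t + u) y'))))"
    by simp
  then show ?thesis
    using a[OF xy(2)] a[OF xy(3)] b c d_commute[OF fi(2)[of "t+u"] fi(2)[of w]] d_commute[OF fi(1)[of "\<sigma>' w"] fi(3)[of w]]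
    by linarith
qed

text \<open>Both orbits hardly move, so closeness of the two starting points to one common centre q
  is enough; there are four legs.\<close>

lemma equal_code_slow_block:
  assumes y: "y \<in> S" "y' \<in> S" "q \<in> S" and q: "d (\<phi> t y) q < e" "d (\<phi> t y') q < e"
    and sl: "d (\<phi> t y) (\<phi> u (\<phi> t y)) < e" "d (\<phi> t y') (\<phi> u (\<phi> t y')) < e"
  shows "d (\<phi> (t + u) y) (\<phi> (t + u) y') < 4 * e"
proof -
  have e: "\<phi> u (\<phi> t z) = \<phi> (t + u) z" if "z \<in> S" for z using flow_add[OF that, of u t] by (simp add: add.commute)
  note fi = flow_in[OF y(1)] flow_in[OF y(2)] y(3)
  have "d (\<phi> (t + u) y) (\<phi> (t + u) y') \<le> d (\<phi> (t + u) y) (\<phi> t y) + d (\<phi> t y) (\<phi> (t + u) y')"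
    by (intro d_triangle fi)
  also have "d (\<phi> t y) (\<phi> (t + u) y') \<le> d (\<phi> t y) q + d q (\<phi> (t + u) y')"
    by (intro d_triangle fi)
  also have "d q (\<phi> (t + u) y') \<le> d q (\<phi> t y') + d (\<phi> t y') (\<phi> (t + u) y')"
    by (intro d_triangle fi)
  finally show ?thesis
    using sl q d_commute[OF fi(3) fi(2)[of t]] d_commute[OF fi(1)[of "t+u"] fi(1)[of t]]
    unfolding e[OF y(1)] e[OF y(2)] by linarith
qed

end

text \<open>It fixes the length T of the blocks, whose alphabet has size affine in T. The value of T
  makes (a + b) T \<le> (\<alpha> T)^2 / 2, a term of the exponential series; T \<ge> 2 is what
  \<open>clock_determines_reparam\<close> asks of a block.\<close>

lemma linear_times_const_le_exp:
  fixes a b \<alpha> :: real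
  assumes "a > 0" "b > 0" "\<alpha> > 0"
  obtains T where "T \<ge> 2" "a * T + b \<le> exp (\<alpha> * T)"
proof -
  define T where "T = max 2 (2 * (a + b) / \<alpha>\<^sup>2)"
  have T: "T \<ge> 2" "2 * (a + b) / \<alpha>\<^sup>2 \<le> T" by (auto simp: T_def)
  have "2 * (a + b) \<le> T * \<alpha>\<^sup>2" using T(2) assms by (simp add: field_simps)
  then have "2 * (a + b) * T \<le> T * \<alpha>\<^sup>2 * T" using T(1) by (intro mult_right_mono) auto
  moreover have "b \<le> b * T" using T assms by auto
  ultimately have "a * T + b \<le> (\<alpha> * T)\<^sup>2 / 2" by (simp add: power2_eq_square algebra_simps)
  also have "\<dots> \<le> exp (\<alpha> * T)"
    using exp_lower_Taylor_quadratic[of "\<alpha> * T"] assms T(1) by (smt (verit) mult_nonneg_nonneg)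
  finally show thesis using that T by blast
qed

lemma floor_diff_bounds:
  fixes a b \<delta> c :: real
  assumes "\<delta> > 0" "a \<le> b" "b \<le> a + c"
  shows "\<lfloor>b / \<delta>\<rfloor> - \<lfloor>a / \<delta>\<rfloor> \<in> {0..\<lceil>c / \<delta>\<rceil> + 1}"
proof -
  have "a / \<delta> \<le> b / \<delta>" "b / \<delta> \<le> a / \<delta> + c / \<delta>"
    using assms by (auto simp: divide_right_mono add_divide_distrib[symmetric])
  then show ?thesis by (auto simp: floor_mono) linarith
qed

section \<open>The symbolic code of a shadowed orbit\<close>

context compact_flow
begin

text \<open>The block length T must be an exact multiple of the step, so h = T/n with n large. Once
  n is known, \<kappa> is taken at most \<delta>/(2n), which keeps the drift over a whole block
  within \<delta>/2; \<eta> depends on h and \<kappa> and comes last.\<close>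

lemma good_scales_exist:
  assumes "c > 0" "\<delta> > 0" "T > 0" "e > 0"
  obtains h n \<kappa> \<eta> where "good_scales c h \<kappa> \<eta>" "real n * h = T" "h \<le> \<delta>" "real n * \<kappa> \<le> \<delta>/2"
    "\<eta> > 0" "\<eta> \<le> e"
proof -
  obtain h0 where h0: "h0 > 0"
    "\<And>h \<kappa>. \<lbrakk>0 < h; h \<le> h0; 0 < \<kappa>\<rbrakk> \<Longrightarrow> \<exists>\<eta>>0. \<forall>x\<in>S. \<forall>y\<in>S. \<forall>\<sigma>. displ y \<ge> c/4 \<longrightarrow> continuous_on {0..h} \<sigma> \<longrightarrow>
        (\<forall>t\<in>{0..h}. d (\<phi> t y) (\<phi> (\<sigma> t) x) < \<eta>) \<longrightarrow> \<bar>\<sigma> h - \<sigma> 0 - h\<bar> \<le> \<kappa>"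
    by (rule shadowing_step[of "c/4"]) (use assms in auto)
  obtain \<eta>1 where \<eta>1: "\<eta>1 > 0" "\<And>x y. \<lbrakk>x \<in> S; y \<in> S; d x y < \<eta>1\<rbrakk> \<Longrightarrow> \<bar>displ x - displ y\<bar> < c/8"
    by (rule displ_uniform[of "c/8"]) (use assms in auto)
  obtain h1 where h1: "h1 > 0" "\<And>z s. z \<in> S \<Longrightarrow> \<bar>s\<bar> \<le> h1 \<Longrightarrow> d z (\<phi> s z) < \<eta>1"
    using flow_small_time[OF \<eta>1(1)] by metis
  define hm where "hm = min h0 (min h1 \<delta>)"
  have hm: "hm > 0" "hm \<le> h0" "hm \<le> h1" "hm \<le> \<delta>" using h0 h1 assms by (auto simp: hm_def)
  obtain n where n: "T / hm < real n" using reals_Archimedean2 by blast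
  have n0: "n > 0" using n hm assms by (metis divide_pos_pos gr0I of_nat_0 order_less_asym)
  define h where "h = T / real n"
  have h: "h > 0" "h \<le> hm" "real n * h = T" using n n0 hm assms by (auto simp: h_def field_simps)
  define \<kappa> where "\<kappa> = min (h/2) (\<delta> / (2 * real n))"
  have \<kappa>: "\<kappa> > 0" "\<kappa> \<le> h/2" "\<kappa> \<le> \<delta> / (2 * real n)" using h n0 assms by (auto simp: \<kappa>_def)
  have "real n * \<kappa> \<le> real n * (\<delta> / (2 * real n))" using \<kappa> by (intro mult_left_mono) auto
  then have n\<kappa>: "real n * \<kappa> \<le> \<delta>/2" using n0 by simp
  obtain \<eta>2 where \<eta>2: "\<eta>2 > 0" "\<forall>x\<in>S. \<forall>y\<in>S. \<forall>\<sigma>. displ y \<ge> c/4 \<longrightarrow> continuous_on {0..h} \<sigma> \<longrightarrow>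
        (\<forall>t\<in>{0..h}. d (\<phi> t y) (\<phi> (\<sigma> t) x) < \<eta>2) \<longrightarrow> \<bar>\<sigma> h - \<sigma> 0 - h\<bar> \<le> \<kappa>"
    using h0(2)[of h \<kappa>] h hm \<kappa> by auto
  have "good_scales c h \<kappa> (min e (min \<eta>1 \<eta>2))"
    unfolding good_scales_def
  proof (intro conjI)
    show "\<forall>z\<in>S. \<forall>w\<in>S. d z w < min e (min \<eta>1 \<eta>2) \<longrightarrow> \<bar>displ z - displ w\<bar> < c/8" using \<eta>1 by simp
    show "\<forall>z\<in>S. \<forall>s. \<bar>s\<bar> \<le> h \<longrightarrow> \<bar>displ (\<phi> s z) - displ z\<bar> < c / 8"
    proof (intro ballI allI impI)
      fix z s assume z: "z \<in> S" "\<bar>s\<bar> \<le> h"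
      then have "d z (\<phi> s z) < \<eta>1" using h1 h hm by simp
      then show "\<bar>displ (\<phi> s z) - displ z\<bar> < c / 8"
        using \<eta>1(2)[OF z(1) flow_in[OF z(1)], of s] by (simp add: abs_minus_commute)
    qed
    show "\<forall>x\<in>S. \<forall>y\<in>S. \<forall>\<sigma>. displ y \<ge> c/4 \<longrightarrow> continuous_on {0..h} \<sigma> \<longrightarrow>
        (\<forall>t\<in>{0..h}. d (\<phi> t y) (\<phi> (\<sigma> t) x) < min e (min \<eta>1 \<eta>2)) \<longrightarrow> \<bar>\<sigma> h - \<sigma> 0 - h\<bar> \<le> \<kappa>"
      using \<eta>2(2) by (meson min_less_iff_conj)
  qed (use assms h \<kappa> in auto)
  with h hm n\<kappa> \<eta>1 \<eta>2 assms show thesis by (intro that[of h \<kappa> "min e (min \<eta>1 \<eta>2)" n]) auto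
qed

definition is_slow :: "real \<Rightarrow> real \<Rightarrow> 'a \<Rightarrow> bool" where
  "is_slow e T z \<longleftrightarrow> (\<forall>u\<in>{0..T}. d z (\<phi> u z) < e)"

text \<open>\<eta> and B are chosen before r and x. A code is a word of \<lfloor>r/T\<rfloor>
  symbols from an alphabet of at most exp(\<alpha> T) letters, together with a final position from a
  fixed set of at most B points; hence the bound B exp(\<alpha> r). Equal codes force closeness
  because the word determines the clock cell at the start of every block, and then each block falls
  under one of the two block lemmas.\<close>

lemma shadowing_code:
  assumes "\<epsilon> > 0" "\<alpha> > 0"
  obtains \<eta> B where "\<eta> > 0" "B \<ge> 1"
    "\<And>r x. \<lbrakk>r > 0; x \<in> S\<rbrakk> \<Longrightarrow> \<exists>(code :: 'a \<Rightarrow> (nat \<Rightarrow> int \<times> 'a option) \<times> 'a) Cd.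
       finite Cd \<and> real (card Cd) \<le> B * exp (\<alpha> * r) \<and>
       (\<forall>y\<in>S. (\<exists>\<sigma>. shadows r \<eta> x y \<sigma>) \<longrightarrow> code y \<in> Cd) \<and>
       (\<forall>y\<in>S. \<forall>y'\<in>S. (\<exists>\<sigma>. shadows r \<eta> x y \<sigma>) \<longrightarrow> (\<exists>\<sigma>. shadows r \<eta> x y' \<sigma>) \<longrightarrow> code y = code y' \<longrightarrow>
          (\<forall>t\<in>{0..r}. d (\<phi> t y) (\<phi> t y') < \<epsilon>))"
proof -
  \<comment> \<open>Small enough for the five legs of a moving block and the four of a slow
    one.\<close>
  define e where "e = \<epsilon> / 8"
  have e: "e > 0" "5 * e < \<epsilon>" "4 * e < \<epsilon>" using assms by (auto simp: e_def)
  obtain \<delta>0 where \<delta>0: "0 < \<delta>0" "\<delta>0 \<le> 1" "\<And>z s. z \<in> S \<Longrightarrow> \<bar>s\<bar> \<le> \<delta>0 \<Longrightarrow> d z (\<phi> s z) < e"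
    using flow_small_time[OF e(1)] by metis
  define \<delta> where "\<delta> = \<delta>0 / 2"
  have \<delta>: "0 < \<delta>" "\<delta> \<le> 1" "\<And>z s. z \<in> S \<Longrightarrow> \<bar>s\<bar> \<le> 2 * \<delta> \<Longrightarrow> d z (\<phi> s z) < e"
    using \<delta>0 by (auto simp: \<delta>_def)
  obtain C1 where C1: "finite C1" "C1 \<subseteq> S" "\<And>x. x \<in> S \<Longrightarrow> \<exists>c\<in>C1. d x c < e"
    using totally_bounded[OF e(1)] by metis
  \<comment> \<open>Counts the second components of a symbol: a centre in \<open>C1\<close> for a
    slow block, or \<open>None\<close> for a moving one.\<close>
  define N where "N = real (card C1) + 1"
  have N: "N > 0" by (simp add: N_def)
  obtain T where T: "T \<ge> 2" "2 / \<delta> * N * T + 3 * N \<le> exp (\<alpha> * T)"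
    by (rule linear_times_const_le_exp[of "2 / \<delta> * N" "3 * N" \<alpha>]) (use \<delta> N assms in auto)
  obtain c where c: "c > 0"
    "\<And>y t s. \<lbrakk>y \<in> S; 0 \<le> t; t \<le> T; e \<le> d y (\<phi> t y); 0 \<le> s; s \<le> T\<rbrakk> \<Longrightarrow> c \<le> displ (\<phi> s y)"
    by (rule moving_displ_bound[OF e(1), of T]) (rule that)
  obtain h n \<kappa> \<eta> where sc: "good_scales c h \<kappa> \<eta>" and nh: "real n * h = T" "h \<le> \<delta>" "real n * \<kappa> \<le> \<delta>/2"
    and \<eta>: "\<eta> > 0" "\<eta> \<le> e"
    by (rule good_scales_exist[of c \<delta> T e]) (use c \<delta> T e in auto)
  \<comment> \<open>The incomplete last block lasts at most T, so uniform continuity of the flow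
    over [-T,T] turns closeness at its start into closeness throughout.\<close>
  obtain \<rho> where \<rho>: "\<rho> > 0"
    "\<And>x y s t. \<lbrakk>x \<in> S; y \<in> S; \<bar>s\<bar> \<le> T; \<bar>t\<bar> \<le> T; \<bar>s - t\<bar> < \<rho>; d x y < \<rho>\<rbrakk> \<Longrightarrow> d (\<phi> s x) (\<phi> t y) < \<epsilon>/2"
    by (rule flow_uniform[of "\<epsilon>/2" T]) (use assms in auto)
  obtain C2 where C2: "finite C2" "C2 \<subseteq> S" "\<And>x. x \<in> S \<Longrightarrow> \<exists>c\<in>C2. d x c < \<rho>"
    using totally_bounded[OF \<rho>(1)] by metis
  obtain ctr1 where ctr1: "\<And>x. x \<in> S \<Longrightarrow> ctr1 x \<in> C1 \<and> d x (ctr1 x) < e" using C1(3) by metis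
  obtain ctr2 where ctr2: "\<And>x. x \<in> S \<Longrightarrow> ctr2 x \<in> C2 \<and> d x (ctr2 x) < \<rho>" using C2(3) by metis
  \<comment> \<open>Over a block of length T the clock gains between 0 and 2T, so the index of its
    \<delta>-cell rises by at most \<lceil>2T/\<delta>\<rceil> + 1.\<close>
  define A where "A = {0..\<lceil>2 * T / \<delta>\<rceil> + 1} \<times> insert None (Some ` C1)"
  have A: "finite A" "real (card A) \<le> exp (\<alpha> * T)"
  proof -
    show "finite A" using C1 by (simp add: A_def)
    have "card (insert None (Some ` C1)) = card C1 + 1"
      using C1(1) by (subst card_insert_disjoint) (auto simp: card_image)
    then have "real (card A) = real (nat (\<lceil>2 * T / \<delta>\<rceil> + 2)) * N"
      by (simp add: A_def card_cartesian_product N_def algebra_simps)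
    also have "\<dots> \<le> (2 * T / \<delta> + 3) * N"
    proof (intro mult_right_mono)
      have "0 \<le> 2 * T / \<delta>" using T \<delta> by simp
      then show "real (nat (\<lceil>2 * T / \<delta>\<rceil> + 2)) \<le> 2 * T / \<delta> + 3" by linarith
    qed (use N in simp)
    also have "\<dots> \<le> exp (\<alpha> * T)" using T(2) by (simp add: algebra_simps)
    finally show "real (card A) \<le> exp (\<alpha> * T)" .
  qed
  define B where "B = max 1 (real (card C2))"
  show thesis
  proof (rule that[OF \<eta>(1), of B])
    show "B \<ge> 1" by (simp add: B_def)
    fix r :: real and x assume r: "r > 0" and x: "x \<in> S"
    obtain m where m: "clock_for c x m" using clock_for_exists[OF c(1) x] by metis
    define K where "K = nat \<lfloor>r / T\<rfloor>"
    have K: "real K * T \<le> r" "r \<le> real K * T + T"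
    proof -
      have "real K = of_int \<lfloor>r / T\<rfloor>" using r T by (simp add: K_def)
      then have "real K \<le> r / T" "r / T \<le> real K + 1" by linarith+
      then show "real K * T \<le> r" "r \<le> real K * T + T" using T by (auto simp: field_simps)
    qed
    \<comment> \<open>One reparametrization is fixed for each y, so that the clock readings, and
      with them the code, are functions of y.\<close>
    define sg where "sg = (\<lambda>y. SOME \<sigma>. shadows r \<eta> x y \<sigma>)"
    have sg: "shadows r \<eta> x y (sg y)" if "\<exists>\<sigma>. shadows r \<eta> x y \<sigma>" for y
      using that unfolding sg_def by (rule someI_ex)
    define code where "code = (\<lambda>y. (\<lambda>k\<in>{..<K}. (\<lfloor>m (sg y (real k * T + T)) / \<delta>\<rfloor> - \<lfloor>m (sg y (real k * T)) / \<delta>\<rfloor>,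
        if is_slow e T (\<phi> (real k * T) y) then Some (ctr1 (\<phi> (real k * T) y)) else None), ctr2 (\<phi> (real K * T) y)))"
    \<comment> \<open>One symbol per block: the increment of the clock, and the approximate starting point if the
      block is slow. The last component takes care of the incomplete block at the end.\<close>
    define Cd where "Cd = ({..<K} \<rightarrow>\<^sub>E A) \<times> C2"
    have kT: "0 \<le> real k * T" "real k * T + T \<le> r" if "k < K" for k
    proof -
      have "real k + 1 \<le> real K" using that by linarith
      then have "(real k + 1) * T \<le> real K * T" using T by (intro mult_right_mono) auto
      then show "real k * T + T \<le> r" using K by (simp add: algebra_simps)
    qed (use T in simp)
    show "\<exists>(code :: 'a \<Rightarrow> (nat \<Rightarrow> int \<times> 'a option) \<times> 'a) Cd.
       finite Cd \<and> real (card Cd) \<le> B * exp (\<alpha> * r) \<and>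
       (\<forall>y\<in>S. (\<exists>\<sigma>. shadows r \<eta> x y \<sigma>) \<longrightarrow> code y \<in> Cd) \<and>
       (\<forall>y\<in>S. \<forall>y'\<in>S. (\<exists>\<sigma>. shadows r \<eta> x y \<sigma>) \<longrightarrow> (\<exists>\<sigma>. shadows r \<eta> x y' \<sigma>) \<longrightarrow> code y = code y' \<longrightarrow>
          (\<forall>t\<in>{0..r}. d (\<phi> t y) (\<phi> t y') < \<epsilon>))"
    proof (rule exI[of _ code], rule exI[of _ Cd], intro conjI ballI impI)
      show "finite Cd" using A C2 by (auto simp: Cd_def intro!: finite_PiE)
      have "exp (\<alpha> * T) ^ K = exp (\<alpha> * (real K * T))" by (simp add: exp_of_nat_mult[symmetric] mult_ac)
      also have "\<dots> \<le> exp (\<alpha> * r)" using K assms by simp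
      finally have KE: "exp (\<alpha> * T) ^ K \<le> exp (\<alpha> * r)" .
      have "real (card Cd) = real (card A) ^ K * real (card C2)"
        by (simp add: Cd_def card_cartesian_product card_PiE)
      also have "\<dots> \<le> exp (\<alpha> * T) ^ K * B"
        using A by (intro mult_mono power_mono) (auto simp: B_def)
      also have "\<dots> \<le> exp (\<alpha> * r) * B" using KE by (intro mult_right_mono) (auto simp: B_def)
      finally show "real (card Cd) \<le> B * exp (\<alpha> * r)" by (simp add: B_def mult.commute)
    next
      fix y assume y: "y \<in> S" "\<exists>\<sigma>. shadows r \<eta> x y \<sigma>"
      have "\<lfloor>m (sg y (real k * T + T)) / \<delta>\<rfloor> - \<lfloor>m (sg y (real k * T)) / \<delta>\<rfloor> \<in> {0..\<lceil>2 * T / \<delta>\<rceil> + 1}" if "k < K" for k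
        using shadowing_clock_steps[OF sc x y(1) sg[OF y(2)] m, of "real k * T" n] kT[OF that] \<delta>(1)
        by (intro floor_diff_bounds) (auto simp: nh)
      then show "code y \<in> Cd"
        using ctr1 ctr2 flow_in y(1) by (auto simp: code_def Cd_def A_def)
    next
      fix y y' t assume y: "y \<in> S" "y' \<in> S" "\<exists>\<sigma>. shadows r \<eta> x y \<sigma>" "\<exists>\<sigma>. shadows r \<eta> x y' \<sigma>"
        and eq: "code y = code y'" and t: "t \<in> {0..r}"
      have diff: "\<lfloor>m (sg y (real k * T + T)) / \<delta>\<rfloor> - \<lfloor>m (sg y (real k * T)) / \<delta>\<rfloor> =
          \<lfloor>m (sg y' (real k * T + T)) / \<delta>\<rfloor> - \<lfloor>m (sg y' (real k * T)) / \<delta>\<rfloor>"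
        "(if is_slow e T (\<phi> (real k * T) y) then Some (ctr1 (\<phi> (real k * T) y)) else None) =
         (if is_slow e T (\<phi> (real k * T) y') then Some (ctr1 (\<phi> (real k * T) y')) else None)"
        if "k < K" for k
      proof -
        have "fst (code y) k = fst (code y') k" using eq by simp
        then have "(\<lfloor>m (sg y (real k * T + T)) / \<delta>\<rfloor> - \<lfloor>m (sg y (real k * T)) / \<delta>\<rfloor>,
            if is_slow e T (\<phi> (real k * T) y) then Some (ctr1 (\<phi> (real k * T) y)) else None) =
          (\<lfloor>m (sg y' (real k * T + T)) / \<delta>\<rfloor> - \<lfloor>m (sg y' (real k * T)) / \<delta>\<rfloor>,
            if is_slow e T (\<phi> (real k * T) y') then Some (ctr1 (\<phi> (real k * T) y')) else None)"
          unfolding code_def fst_conv restrict_apply using that by simp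
        then show "\<lfloor>m (sg y (real k * T + T)) / \<delta>\<rfloor> - \<lfloor>m (sg y (real k * T)) / \<delta>\<rfloor> =
            \<lfloor>m (sg y' (real k * T + T)) / \<delta>\<rfloor> - \<lfloor>m (sg y' (real k * T)) / \<delta>\<rfloor>"
          "(if is_slow e T (\<phi> (real k * T) y) then Some (ctr1 (\<phi> (real k * T) y)) else None) =
           (if is_slow e T (\<phi> (real k * T) y') then Some (ctr1 (\<phi> (real k * T) y')) else None)"
          unfolding prod.inject by blast+
      qed
      \<comment> \<open>Only increments are coded. All reparametrizations start at \<sigma>(0) = 0,
        so equal increments add up to equal cells at every block boundary.\<close>
      have fl: "\<lfloor>m (sg y (real k * T)) / \<delta>\<rfloor> = \<lfloor>m (sg y' (real k * T)) / \<delta>\<rfloor>" if "k \<le> K" for k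
        using that
      proof (induction k)
        case 0
        then show ?case using sg[OF y(3)] sg[OF y(4)] by (simp add: shadows_def)
      next
        case (Suc k)
        then show ?case using diff(1)[of k] by (simp add: algebra_simps)
      qed
      show "d (\<phi> t y) (\<phi> t y') < \<epsilon>"
      proof (cases "t < real K * T")
        case False
        have "ctr2 (\<phi> (real K * T) y) = ctr2 (\<phi> (real K * T) y')" using eq by (simp add: code_def)
        then obtain q where q: "q \<in> S" "d (\<phi> (real K * T) y) q < \<rho>" "d (\<phi> (real K * T) y') q < \<rho>"
          using ctr2 flow_in y C2(2) by (metis subset_iff)
        define u where "u = t - real K * T"
        have u: "\<bar>u\<bar> \<le> T" using False t K by (auto simp: u_def)
        have "d (\<phi> u (\<phi> (real K * T) z)) (\<phi> u q) < \<epsilon>/2" if "z \<in> S" "d (\<phi> (real K * T) z) q < \<rho>" for z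
          using \<rho>(2)[OF flow_in[OF that(1)] q(1) u u] \<rho>(1) that by simp
        moreover have "\<phi> u (\<phi> (real K * T) z) = \<phi> t z" if "z \<in> S" for z
          using flow_add[OF that, of u "real K * T"] by (simp add: u_def)
        ultimately have "d (\<phi> t y) (\<phi> u q) < \<epsilon>/2" "d (\<phi> t y') (\<phi> u q) < \<epsilon>/2" using y q by auto
        moreover have "d (\<phi> t y) (\<phi> t y') \<le> d (\<phi> t y) (\<phi> u q) + d (\<phi> u q) (\<phi> t y')"
          using d_triangle flow_in y q by blast
        ultimately show ?thesis using d_commute[of "\<phi> u q" "\<phi> t y'"] flow_in y q by simp
      next
        case True
        define k where "k = nat \<lfloor>t / T\<rfloor>"
        have k: "real k * T \<le> t" "t \<le> real k * T + T" "k < K"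
        proof -
          have *: "real k = of_int \<lfloor>t / T\<rfloor>" using t T by (simp add: k_def)
          then have "real k \<le> t / T" "t / T \<le> real k + 1" by linarith+
          then show "real k * T \<le> t" "t \<le> real k * T + T" using T by (auto simp: field_simps)
          then have "real k * T < real K * T" using True by simp
          then show "k < K" using T by simp
        qed
        define u where "u = t - real k * T"
        have u: "0 \<le> u" "u \<le> real n * h" "t = real k * T + u" using k nh by (auto simp: u_def)
        show ?thesis
        \<comment> \<open>Equality of the option components also says whether a block is slow, so y
          and y' fall into the same case.\<close>
        proof (cases "is_slow e T (\<phi> (real k * T) y)")
          case True
          then have s: "is_slow e T (\<phi> (real k * T) y')" "ctr1 (\<phi> (real k * T) y) = ctr1 (\<phi> (real k * T) y')"
            using diff(2)[OF k(3)] by (auto split: if_splits)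
          have "d (\<phi> (real k * T + u) y) (\<phi> (real k * T + u) y') < 4 * e"
          proof (rule equal_code_slow_block)
            show "d (\<phi> (real k * T) y) (ctr1 (\<phi> (real k * T) y)) < e"
              using ctr1 flow_in y by blast
            show "d (\<phi> (real k * T) y') (ctr1 (\<phi> (real k * T) y)) < e"
              unfolding s(2) using ctr1 flow_in y by blast
            show "ctr1 (\<phi> (real k * T) y) \<in> S" using ctr1 flow_in y C1(2) by blast
          qed (use True s y u nh in \<open>auto simp: is_slow_def\<close>)
          then show ?thesis using u e by simp
        next
          case False
          then have s: "\<not> is_slow e T (\<phi> (real k * T) y')"
            using diff(2)[OF k(3)] by (auto split: if_splits)
          have mv: "c \<le> displ (\<phi> (real k * T + v) z)"
            if z: "z \<in> S" "\<not> is_slow e T (\<phi> (real k * T) z)" "0 \<le> v" "v \<le> real n * h" for z v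
          proof -
            obtain w where "0 \<le> w" "w \<le> T" "e \<le> d (\<phi> (real k * T) z) (\<phi> w (\<phi> (real k * T) z))"
              using z(2) by (auto simp: is_slow_def not_less)
            then have "c \<le> displ (\<phi> v (\<phi> (real k * T) z))"
              using c(2)[OF flow_in[OF z(1)], of w "real k * T" v] z nh by simp
            then show ?thesis using flow_add[OF z(1), of v "real k * T"] by (simp add: add.commute)
          qed
          have "d (\<phi> (real k * T + u) y) (\<phi> (real k * T + u) y') < 5 * e"
            by (rule equal_code_moving_block[OF sc x y(1,2) sg[OF y(3)] sg[OF y(4)] m _ _ mv mv \<delta>(1,2) nh(3) _ nh(2) fl \<delta>(3) \<eta>(2) u(1,2)])
              (use kT[OF k(3)] k(3) nh T y False s in auto)
          then show ?thesis using u e by simp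
        qed
      qed
    qed
  qed
qed

end

section \<open>Separated sets and growth rates\<close>

definition rate :: "'a set \<Rightarrow> (real \<Rightarrow> 'a \<Rightarrow> 'a \<Rightarrow> ereal) \<Rightarrow> real \<Rightarrow> ereal" where
  "rate S \<rho> \<epsilon> = Limsup at_top (\<lambda>r. ln_ereal (sep_number S (\<rho> r) \<epsilon>) / ereal r)"

lemma sep_number_empty: "sep_number {} \<rho> \<epsilon> = 0"
proof -
  have "{T. T \<subseteq> {} \<and> finite T \<and> (\<forall>x\<in>T. \<forall>y\<in>T. x \<noteq> y \<longrightarrow> ereal \<epsilon> \<le> \<rho> x y)} = {{}}" by auto
  then show ?thesis unfolding sep_number_def by (simp add: zero_ereal_def)
qed

text \<open>Values strictly between 0 and 1, where the logarithm is negative, do not occur. The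
  value 0 belongs to S = {}, where \<open>ln 0 = 0\<close> takes over; this makes
  \<open>ln_ereal\<close> monotone on all separation numbers.\<close>

lemma sep_number_cases: "sep_number S \<rho> \<epsilon> = 0 \<or> 1 \<le> sep_number S \<rho> \<epsilon>"
proof (cases "S = {}")
  case True
  then show ?thesis by (simp add: sep_number_empty)
next
  case False
  then obtain x where "x \<in> S" by blast
  then have "ereal (real (card {x})) \<le> sep_number S \<rho> \<epsilon>"
    unfolding sep_number_def by (intro SUP_upper) auto
  then show ?thesis by (simp add: one_ereal_def)
qed

lemma card_le_sep_number:
  assumes "T \<subseteq> S" "finite T" "\<And>x y. \<lbrakk>x \<in> T; y \<in> T; x \<noteq> y\<rbrakk> \<Longrightarrow> ereal \<epsilon> \<le> \<rho> x y"
  shows "ereal (real (card T)) \<le> sep_number S \<rho> \<epsilon>"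
  unfolding sep_number_def using assms by (intro SUP_upper) auto

lemma sep_number_le:
  assumes "\<And>T. \<lbrakk>T \<subseteq> S; finite T; \<And>x y. \<lbrakk>x \<in> T; y \<in> T; x \<noteq> y\<rbrakk> \<Longrightarrow> ereal \<epsilon> \<le> \<rho> x y\<rbrakk> \<Longrightarrow> ereal (real (card T)) \<le> K"
  shows "sep_number S \<rho> \<epsilon> \<le> K"
  unfolding sep_number_def using assms by (intro SUP_least) auto

lemma sep_number_mono:
  assumes "\<And>x y. \<lbrakk>x \<in> S; y \<in> S; x \<noteq> y; ereal \<epsilon> \<le> \<rho> x y\<rbrakk> \<Longrightarrow> ereal \<epsilon>' \<le> \<rho>' x y"
  shows "sep_number S \<rho> \<epsilon> \<le> sep_number S \<rho>' \<epsilon>'"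
proof (rule sep_number_le, rule card_le_sep_number)
  fix T x y
  assume "T \<subseteq> S" "\<And>x y. \<lbrakk>x \<in> T; y \<in> T; x \<noteq> y\<rbrakk> \<Longrightarrow> ereal \<epsilon> \<le> \<rho> x y" "x \<in> T" "y \<in> T" "x \<noteq> y"
  then show "ereal \<epsilon>' \<le> \<rho>' x y" using assms[of x y] by blast
qed

text \<open>A separated set of maximal cardinality is spanning, because a point far from all of it
  could be added. Points of F itself are left out of the conclusion, since the value of \<rho> on
  the diagonal is not known here.\<close>

lemma sep_number_maximal:
  assumes "sep_number S \<rho> \<epsilon> \<noteq> \<infinity>" and sym: "\<And>x y. \<lbrakk>x \<in> S; y \<in> S\<rbrakk> \<Longrightarrow> \<rho> x y = \<rho> y x"
  obtains F where "F \<subseteq> S" "finite F" "ereal (real (card F)) \<le> sep_number S \<rho> \<epsilon>"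
    "\<And>x. x \<in> S \<Longrightarrow> x \<notin> F \<Longrightarrow> \<exists>f\<in>F. \<rho> x f < ereal \<epsilon>"
proof -
  define P where "P = (\<lambda>T. T \<subseteq> S \<and> finite T \<and> (\<forall>x\<in>T. \<forall>y\<in>T. x \<noteq> y \<longrightarrow> ereal \<epsilon> \<le> \<rho> x y))"
  have le: "ereal (real (card T)) \<le> sep_number S \<rho> \<epsilon>" if "P T" for T
    using that by (intro card_le_sep_number) (auto simp: P_def)
  obtain n :: nat where n: "sep_number S \<rho> \<epsilon> \<le> ereal (real n)"
    using assms(1) real_arch_simple
    by (metis (no_types) ereal_cases ereal_less_eq(2) ereal_less_eq(3))
  have "\<exists>T. P T" by (rule exI[of _ "{}"]) (simp add: P_def)
  moreover have "\<forall>T. P T \<longrightarrow> card T < Suc n"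
  proof (intro allI impI)
    fix T assume "P T"
    from order_trans[OF le[OF this] n] show "card T < Suc n" by simp
  qed
  ultimately obtain F where F: "P F" "\<And>T. P T \<Longrightarrow> card T \<le> card F"
    using ex_has_greatest_nat[of P _ card] by blast
  show thesis
  proof (rule that[of F])
    fix x assume x: "x \<in> S" "x \<notin> F"
    show "\<exists>f\<in>F. \<rho> x f < ereal \<epsilon>"
    proof (rule ccontr)
      assume N: "\<not> ?thesis"
      have far: "ereal \<epsilon> \<le> \<rho> x f" "ereal \<epsilon> \<le> \<rho> f x" if "f \<in> F" for f
      proof -
        show "ereal \<epsilon> \<le> \<rho> x f" using that N by (auto simp: not_less)
        moreover have "\<rho> x f = \<rho> f x" using sym x F(1) that by (auto simp: P_def)
        ultimately show "ereal \<epsilon> \<le> \<rho> f x" by simp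
      qed
      then have "P (insert x F)" using F(1) x by (auto simp: P_def)
      from F(2)[OF this] show False using F(1) x by (simp add: P_def)
    qed
  qed (use F le in \<open>auto simp: P_def\<close>)
qed

lemma ln_ereal_mono:
  assumes "x \<le> y" "x = 0 \<or> 1 \<le> x" "y = 0 \<or> 1 \<le> y" shows "ln_ereal x \<le> ln_ereal y"
proof (cases "y = \<infinity>")
  case True
  then show ?thesis by (simp add: ln_ereal_def)
next
  case False
  then obtain b where b: "y = ereal b" "b = 0 \<or> 1 \<le> b"
    using assms(3) by (cases y) (auto simp: one_ereal_def zero_ereal_def)
  then obtain a where a: "x = ereal a" "a = 0 \<or> 1 \<le> a"
    using assms(1,2) by (cases x) (auto simp: one_ereal_def zero_ereal_def)
  have "ln a \<le> ln b" using a b assms(1) by auto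
  then show ?thesis by (simp add: ln_ereal_def a b)
qed

lemma ln_sep_number_mono:
  "sep_number S \<rho> \<epsilon> \<le> sep_number S' \<rho>' \<epsilon>' \<Longrightarrow> ln_ereal (sep_number S \<rho> \<epsilon>) \<le> ln_ereal (sep_number S' \<rho>' \<epsilon>')"
  by (rule ln_ereal_mono[OF _ sep_number_cases sep_number_cases])

lemma rate_mono:
  assumes "\<And>r. r > 0 \<Longrightarrow> sep_number S (\<rho> r) \<epsilon> \<le> sep_number S (\<rho>' r) \<epsilon>'"
  shows "rate S \<rho> \<epsilon> \<le> rate S \<rho>' \<epsilon>'"
  unfolding rate_def
proof (rule Limsup_mono)
  show "\<forall>\<^sub>F r in at_top. ln_ereal (sep_number S (\<rho> r) \<epsilon>) / ereal r \<le> ln_ereal (sep_number S (\<rho>' r) \<epsilon>') / ereal r"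
    using eventually_gt_at_top[of 0]
    by eventually_elim (intro ereal_divide_right_mono ln_sep_number_mono assms, auto)
qed

lemma rate_antimono: "\<epsilon> \<le> \<epsilon>' \<Longrightarrow> rate S \<rho> \<epsilon>' \<le> rate S \<rho> \<epsilon>"
  by (intro rate_mono sep_number_mono) (auto intro: order_trans[of "ereal \<epsilon>" "ereal \<epsilon>'"])

lemma rate_nonneg: "0 \<le> rate S \<rho> \<epsilon>"
  unfolding rate_def
proof (rule le_Limsup)
  have *: "0 \<le> ln_ereal (sep_number S (\<rho> r) \<epsilon>)" for r
    using sep_number_cases[of S "\<rho> r" \<epsilon>] ln_ereal_mono[of 1 "sep_number S (\<rho> r) \<epsilon>"]
    by (auto simp: ln_ereal_def)
  show "\<forall>\<^sub>F r in at_top. 0 \<le> ln_ereal (sep_number S (\<rho> r) \<epsilon>) / ereal r"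
    using eventually_gt_at_top[of "0::real"]
  proof eventually_elim
    case (elim r)
    then show ?case using ereal_divide_right_mono[OF *[of r], of "ereal r"] by simp
  qed
qed simp

text \<open>Smaller \<epsilon> allows more separated points, so the limit at 0+ is a supremum.
  Inequalities between entropies can then be proved for one \<epsilon> at a time, each against a
  tolerance of its own on the other side.\<close>

lemma growth_rate_eq_SUP: "growth_rate S \<rho> = (SUP \<epsilon>\<in>{0<..}. rate S \<rho> \<epsilon>)"
proof -
  have "(rate S \<rho> \<longlongrightarrow> (SUP \<epsilon>\<in>{0<..}. rate S \<rho> \<epsilon>)) (at_right 0)"
  proof (rule order_tendstoI)
    fix a assume "a < (SUP \<epsilon>\<in>{0<..}. rate S \<rho> \<epsilon>)"
    then obtain e where e: "e > 0" "a < rate S \<rho> e" by (auto simp: less_SUP_iff)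
    have "\<forall>\<^sub>F x in at_right 0. x \<in> {0<..<e}" by (rule eventually_at_right_real[OF e(1)])
    then show "\<forall>\<^sub>F x in at_right 0. a < rate S \<rho> x"
    proof eventually_elim
      case (elim x)
      then show ?case using e(2) rate_antimono[of x e S \<rho>] by auto
    qed
  next
    fix a assume a: "(SUP \<epsilon>\<in>{0<..}. rate S \<rho> \<epsilon>) < a"
    have "\<forall>\<^sub>F x in at_right 0. x \<in> {0<..<(1::real)}" by (rule eventually_at_right_real) simp
    then show "\<forall>\<^sub>F x in at_right 0. rate S \<rho> x < a"
      by eventually_elim (use a SUP_upper[of _ "{0<..}" "rate S \<rho>"] in \<open>auto intro: le_less_trans\<close>)
  qed
  then show ?thesis unfolding growth_rate_def rate_def by (intro tendsto_Lim) auto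
qed

text \<open>The factor 2 of the theorem arises here: a time window of length 2r is measured against
  r. Rescaling the variable does not change a limit superior at infinity.\<close>

lemma rate_double:
  "Limsup at_top (\<lambda>r. ln_ereal (sep_number S (\<rho> (2 * r)) \<epsilon>) / ereal r) = 2 * rate S \<rho> \<epsilon>"
proof -
  define f where "f = (\<lambda>r. ln_ereal (sep_number S (\<rho> r) \<epsilon>) / ereal r)"
  have f2: "filtermap (\<lambda>r::real. 2 * r) at_top = at_top"
  proof (rule antisym)
    show "filtermap (\<lambda>r::real. 2 * r) at_top \<le> at_top"
      using filterlim_tendsto_pos_mult_at_top[OF tendsto_const _ filterlim_ident, of "2::real"]
      by (simp add: filterlim_def)
    show "at_top \<le> filtermap (\<lambda>r::real. 2 * r) at_top"
      unfolding le_filter_def eventually_filtermap eventually_at_top_linorder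
    proof (intro allI impI)
      fix P :: "real \<Rightarrow> bool" assume "\<exists>N. \<forall>n\<ge>N. P (2 * n)"
      then obtain N where N: "\<And>n. n \<ge> N \<Longrightarrow> P (2 * n)" by blast
      show "\<exists>N. \<forall>n\<ge>N. P n" by (rule exI[of _ "2 * N"]) (use N[of "n / 2" for n] in fastforce)
    qed
  qed
  have "Limsup at_top (\<lambda>r. ln_ereal (sep_number S (\<rho> (2 * r)) \<epsilon>) / ereal r) = Limsup at_top (\<lambda>r. 2 * f (2 * r))"
  proof (rule Limsup_eq)
    show "\<forall>\<^sub>F r in at_top. ln_ereal (sep_number S (\<rho> (2 * r)) \<epsilon>) / ereal r = 2 * f (2 * r)"
      using eventually_gt_at_top[of 0]
    proof eventually_elim
      case (elim r)
      then show ?case unfolding f_def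
        by (cases "ln_ereal (sep_number S (\<rho> (2 * r)) \<epsilon>)") (auto simp: numeral_eq_ereal)
    qed
  qed
  also have "\<dots> = 2 * Limsup at_top (\<lambda>r. f (2 * r))"
    using Limsup_ereal_mult_left[of at_top 2 "\<lambda>r. f (2 * r)"] by simp
  also have "Limsup at_top (\<lambda>r. f (2 * r)) = Limsup (filtermap (\<lambda>r. 2 * r) at_top) f"
    by (rule Limsup_filtermap_eq[symmetric]) (simp add: inj_def)
  finally show ?thesis by (simp add: f2 f_def rate_def)
qed

text \<open>E injects into the disjoint union of the code sets: an element is determined by its
  centre and its code relative to that centre.\<close>

lemma card_le_of_code:
  fixes K :: real
  assumes "finite F" "\<And>f. f \<in> F \<Longrightarrow> finite (Cd f) \<and> real (card (Cd f)) \<le> K"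
    and "\<And>e. e \<in> E \<Longrightarrow> ctr e \<in> F \<and> code (ctr e) e \<in> Cd (ctr e)"
    and "\<And>e e'. \<lbrakk>e \<in> E; e' \<in> E; ctr e = ctr e'; code (ctr e) e = code (ctr e) e'\<rbrakk> \<Longrightarrow> e = e'"
  shows "real (card E) \<le> real (card F) * K"
proof -
  have "card E \<le> card (Sigma F Cd)"
  proof (rule card_inj_on_le[of "\<lambda>e. (ctr e, code (ctr e) e)"])
    show "inj_on (\<lambda>e. (ctr e, code (ctr e) e)) E" by (intro inj_onI) (use assms(4) in auto)
  qed (use assms in auto)
  also have "\<dots> = (\<Sum>f\<in>F. card (Cd f))" by (rule card_SigmaI) (use assms in auto)
  finally have "real (card E) \<le> (\<Sum>f\<in>F. real (card (Cd f)))" by (metis of_nat_le_iff of_nat_sum)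
  also have "\<dots> \<le> (\<Sum>f\<in>F. K)" by (intro sum_mono) (use assms in auto)
  finally show ?thesis by simp
qed

section \<open>Comparison of the growth rates\<close>

context compact_flow
begin

lemma reverse_flow: "compact_flow S d (\<lambda>t. \<phi> (- t))"
proof
  show "\<phi> (- (s + t)) x = \<phi> (- s) (\<phi> (- t) x)" if "x \<in> S" for x s t
    using flow_add[OF that, of "-s" "-t"] by simp
  show "(\<lambda>n. d (\<phi> (- \<tau> n) (f n)) (\<phi> (- t) l)) \<longlonglongrightarrow> 0"
    if "range f \<subseteq> S" "l \<in> S" "(\<lambda>n. d (f n) l) \<longlonglongrightarrow> 0" "\<tau> \<longlonglongrightarrow> t" for f :: "nat \<Rightarrow> 'a" and l \<tau> t
    using that by (intro flow_cont tendsto_minus)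
qed (use d_nonneg d_pos d_commute d_triangle seq_compact totally_bounded flow_in flow_0 in auto)

definition bowen :: "real \<Rightarrow> 'a \<Rightarrow> 'a \<Rightarrow> ereal" where
  "bowen r x y = (SUP t\<in>{0..r}. ereal (d (\<phi> t x) (\<phi> t y)))"

text \<open>Points of E are counted by a centre in F, a forward code and a backward code. The two
  reparametrizations are unrelated, so the numbers of codes multiply, each with growth \<alpha>/2.
  Separation at some t in [-r,r] is seen by the forward code if t \<ge> 0 and by the backward one
  otherwise.\<close>

lemma separated_card_bound:
  assumes "\<epsilon> > 0" "\<alpha> > 0"
  obtains \<eta> B where "\<eta> > 0" "B \<ge> 1"
    "\<forall>r F E. r > 0 \<longrightarrow> finite F \<longrightarrow> F \<subseteq> S \<longrightarrow> finite E \<longrightarrow> E \<subseteq> S \<longrightarrow>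
       (\<forall>y\<in>E. \<exists>x\<in>F. (\<exists>\<sigma>. shadows r \<eta> x y \<sigma>) \<and> (\<exists>\<sigma>. compact_flow.shadows d (\<lambda>t. \<phi> (- t)) r \<eta> x y \<sigma>)) \<longrightarrow>
       (\<forall>y\<in>E. \<forall>y'\<in>E. y \<noteq> y' \<longrightarrow> (\<exists>t\<in>{-r..r}. \<epsilon> \<le> d (\<phi> t y) (\<phi> t y'))) \<longrightarrow>
       real (card E) \<le> real (card F) * (B * exp (\<alpha> * r))"
proof -
  interpret rev: compact_flow S d "\<lambda>t. \<phi> (- t)" by (rule reverse_flow)
  obtain \<eta>1 B1 where 1: "\<eta>1 > 0" "B1 \<ge> 1"
    "\<And>r x. \<lbrakk>r > 0; x \<in> S\<rbrakk> \<Longrightarrow> \<exists>(code :: 'a \<Rightarrow> (nat \<Rightarrow> int \<times> 'a option) \<times> 'a) Cd.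
       finite Cd \<and> real (card Cd) \<le> B1 * exp (\<alpha>/2 * r) \<and>
       (\<forall>y\<in>S. (\<exists>\<sigma>. shadows r \<eta>1 x y \<sigma>) \<longrightarrow> code y \<in> Cd) \<and>
       (\<forall>y\<in>S. \<forall>y'\<in>S. (\<exists>\<sigma>. shadows r \<eta>1 x y \<sigma>) \<longrightarrow> (\<exists>\<sigma>. shadows r \<eta>1 x y' \<sigma>) \<longrightarrow> code y = code y' \<longrightarrow>
          (\<forall>t\<in>{0..r}. d (\<phi> t y) (\<phi> t y') < \<epsilon>))"
    by (rule shadowing_code[OF assms(1) half_gt_zero[OF assms(2)]]) (rule that)
  obtain \<eta>2 B2 where 2: "\<eta>2 > 0" "B2 \<ge> 1"
    "\<And>r x. \<lbrakk>r > 0; x \<in> S\<rbrakk> \<Longrightarrow> \<exists>(code :: 'a \<Rightarrow> (nat \<Rightarrow> int \<times> 'a option) \<times> 'a) Cd.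
       finite Cd \<and> real (card Cd) \<le> B2 * exp (\<alpha>/2 * r) \<and>
       (\<forall>y\<in>S. (\<exists>\<sigma>. rev.shadows r \<eta>2 x y \<sigma>) \<longrightarrow> code y \<in> Cd) \<and>
       (\<forall>y\<in>S. \<forall>y'\<in>S. (\<exists>\<sigma>. rev.shadows r \<eta>2 x y \<sigma>) \<longrightarrow> (\<exists>\<sigma>. rev.shadows r \<eta>2 x y' \<sigma>) \<longrightarrow> code y = code y' \<longrightarrow>
          (\<forall>t\<in>{0..r}. d (\<phi> (-t) y) (\<phi> (-t) y') < \<epsilon>))"
    by (rule rev.shadowing_code[OF assms(1) half_gt_zero[OF assms(2)]]) (rule that)
  define \<eta> where "\<eta> = min \<eta>1 \<eta>2"
  have w1: "\<exists>\<sigma>. shadows r \<eta>1 x y \<sigma>" if "\<exists>\<sigma>. shadows r \<eta> x y \<sigma>" for r x y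
    using that unfolding shadows_def \<eta>_def by (meson min_less_iff_conj)
  have w2: "\<exists>\<sigma>. rev.shadows r \<eta>2 x y \<sigma>" if "\<exists>\<sigma>. rev.shadows r \<eta> x y \<sigma>" for r x y
    using that unfolding rev.shadows_def \<eta>_def by (meson min_less_iff_conj)
  show thesis
  proof (rule that[of \<eta> "B1 * B2"]; (intro allI impI)?)
    show "1 \<le> B1 * B2" using 1(2) 2(2) mult_mono[of 1 B1 1 B2] by simp
    fix r F E
    assume r: "(r::real) > 0" and F: "finite F" "F \<subseteq> S" and E: "finite E" "E \<subseteq> S"
      and sh: "\<forall>y\<in>E. \<exists>x\<in>F. (\<exists>\<sigma>. shadows r \<eta> x y \<sigma>) \<and> (\<exists>\<sigma>. rev.shadows r \<eta> x y \<sigma>)"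
      and sep: "\<forall>y\<in>E. \<forall>y'\<in>E. y \<noteq> y' \<longrightarrow> (\<exists>t\<in>{-r..r}. \<epsilon> \<le> d (\<phi> t y) (\<phi> t y'))"
    obtain ctr where ctr: "\<And>y. y \<in> E \<Longrightarrow> ctr y \<in> F \<and> (\<exists>\<sigma>. shadows r \<eta> (ctr y) y \<sigma>) \<and> (\<exists>\<sigma>. rev.shadows r \<eta> (ctr y) y \<sigma>)"
      using sh by metis
    define Q where "Q = (\<lambda>sh (\<psi> :: real \<Rightarrow> 'a \<Rightarrow> 'a) B (x :: 'a) (code :: 'a \<Rightarrow> (nat \<Rightarrow> int \<times> 'a option) \<times> 'a) Cd.
       finite Cd \<and> real (card Cd) \<le> B * exp (\<alpha>/2 * r) \<and>
       (\<forall>y\<in>S. (\<exists>\<sigma> :: real \<Rightarrow> real. sh x y \<sigma>) \<longrightarrow> code y \<in> Cd) \<and>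
       (\<forall>y\<in>S. \<forall>y'\<in>S. (\<exists>\<sigma>. sh x y \<sigma>) \<longrightarrow> (\<exists>\<sigma>. sh x y' \<sigma>) \<longrightarrow> code y = code y' \<longrightarrow>
          (\<forall>t\<in>{0..r}. d (\<psi> t y) (\<psi> t y') < \<epsilon>)))"
    have "\<exists>c C. Q (shadows r \<eta>1) \<phi> B1 x c C" if "x \<in> S" for x using 1(3)[OF r that] unfolding Q_def .
    then obtain c1 C1 where "\<And>x. x \<in> S \<Longrightarrow> Q (shadows r \<eta>1) \<phi> B1 x (c1 x) (C1 x)" by metis
    then have
      c1: "\<And>x. x \<in> S \<Longrightarrow> finite (C1 x) \<and> real (card (C1 x)) \<le> B1 * exp (\<alpha>/2 * r)"
        "\<And>x y. \<lbrakk>x \<in> S; y \<in> S; \<exists>\<sigma>. shadows r \<eta>1 x y \<sigma>\<rbrakk> \<Longrightarrow> c1 x y \<in> C1 x"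
        "\<And>x y y' t. \<lbrakk>x \<in> S; y \<in> S; y' \<in> S; \<exists>\<sigma>. shadows r \<eta>1 x y \<sigma>; \<exists>\<sigma>. shadows r \<eta>1 x y' \<sigma>; c1 x y = c1 x y';
           t \<in> {0..r}\<rbrakk> \<Longrightarrow> d (\<phi> t y) (\<phi> t y') < \<epsilon>"
      unfolding Q_def by blast+
    have "\<exists>c C. Q (rev.shadows r \<eta>2) (\<lambda>t. \<phi> (-t)) B2 x c C" if "x \<in> S" for x
      using 2(3)[OF r that] unfolding Q_def .
    then obtain c2 C2 where "\<And>x. x \<in> S \<Longrightarrow> Q (rev.shadows r \<eta>2) (\<lambda>t. \<phi> (-t)) B2 x (c2 x) (C2 x)" by metis
    then have
      c2: "\<And>x. x \<in> S \<Longrightarrow> finite (C2 x) \<and> real (card (C2 x)) \<le> B2 * exp (\<alpha>/2 * r)"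
        "\<And>x y. \<lbrakk>x \<in> S; y \<in> S; \<exists>\<sigma>. rev.shadows r \<eta>2 x y \<sigma>\<rbrakk> \<Longrightarrow> c2 x y \<in> C2 x"
        "\<And>x y y' t. \<lbrakk>x \<in> S; y \<in> S; y' \<in> S; \<exists>\<sigma>. rev.shadows r \<eta>2 x y \<sigma>; \<exists>\<sigma>. rev.shadows r \<eta>2 x y' \<sigma>; c2 x y = c2 x y';
           t \<in> {0..r}\<rbrakk> \<Longrightarrow> d (\<phi> (-t) y) (\<phi> (-t) y') < \<epsilon>"
      unfolding Q_def by blast+
    show "real (card E) \<le> real (card F) * (B1 * B2 * exp (\<alpha> * r))"
    proof (rule card_le_of_code[where ctr = ctr and code = "\<lambda>x y. (c1 x y, c2 x y)" and Cd = "\<lambda>x. C1 x \<times> C2 x"])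
      fix f assume "f \<in> F"
      then have f: "f \<in> S" using F by blast
      have "real (card (C1 f \<times> C2 f)) \<le> (B1 * exp (\<alpha>/2 * r)) * (B2 * exp (\<alpha>/2 * r))"
        using c1(1)[OF f] c2(1)[OF f] 1(2) by (auto simp: card_cartesian_product intro!: mult_mono)
      also have "\<dots> = B1 * B2 * (exp (\<alpha>/2 * r) * exp (\<alpha>/2 * r))" by simp
      also have "exp (\<alpha>/2 * r) * exp (\<alpha>/2 * r) = exp (\<alpha> * r)" by (simp add: exp_add[symmetric])
      finally show "finite (C1 f \<times> C2 f) \<and> real (card (C1 f \<times> C2 f)) \<le> B1 * B2 * exp (\<alpha> * r)"
        using c1(1)[OF f] c2(1)[OF f] by simp
    next
      fix e assume e: "e \<in> E"
      then show "ctr e \<in> F \<and> (c1 (ctr e) e, c2 (ctr e) e) \<in> C1 (ctr e) \<times> C2 (ctr e)"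
        using ctr[OF e] c1(2)[of "ctr e" e] c2(2)[of "ctr e" e] w1[of r "ctr e" e] w2[of r "ctr e" e] E F by auto
    next
      fix e e' assume e: "e \<in> E" "e' \<in> E" "ctr e = ctr e'"
        and eq: "(c1 (ctr e) e, c2 (ctr e) e) = (c1 (ctr e) e', c2 (ctr e) e')"
      have in_S: "ctr e \<in> S" "e \<in> S" "e' \<in> S" using e ctr E F by auto
      have s: "\<exists>\<sigma>. shadows r \<eta>1 (ctr e) e \<sigma>" "\<exists>\<sigma>. shadows r \<eta>1 (ctr e) e' \<sigma>"
        "\<exists>\<sigma>. rev.shadows r \<eta>2 (ctr e) e \<sigma>" "\<exists>\<sigma>. rev.shadows r \<eta>2 (ctr e) e' \<sigma>"
        using ctr[OF e(1)] ctr[OF e(2)] e(3) w1 w2 by metis+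
      show "e = e'"
      proof (rule ccontr)
        assume "e \<noteq> e'"
        then obtain t where t: "t \<in> {-r..r}" "\<epsilon> \<le> d (\<phi> t e) (\<phi> t e')" using sep e by blast
        show False
        proof (cases "t \<ge> 0")
          case True
          then show False using c1(3)[OF in_S s(1,2), of t] eq t by auto
        next
          case False
          then show False using c2(3)[OF in_S s(3,4), of "-t"] eq t by auto
        qed
      qed
    qed (rule F(1))
  qed (use 1 2 in \<open>auto simp: \<eta>_def\<close>)
qed

lemma two_sided_to_bowen:
  assumes "x \<in> S" "y \<in> S"
  shows "(SUP t\<in>{-r..r}. ereal (d (\<phi> t x) (\<phi> t y))) = bowen (2 * r) (\<phi> (-r) x) (\<phi> (-r) y)"
proof -
  have im: "{-r..r} = (\<lambda>t. t - r) ` {0..2*r}"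
    using image_diff_atLeastAtMost[of r 0 "2*r"] by simp
  show ?thesis unfolding bowen_def im image_image
    by (intro SUP_cong) (auto simp: flow_add[OF assms(1), symmetric] flow_add[OF assms(2), symmetric])
qed

lemma inj_on_flow: "inj_on (\<phi> t) S"
  by (rule inj_on_inverseI[of _ "\<phi> (-t)"]) (rule flow_uminus)

text \<open>The geometry enters only through these four properties. The essential inequality bounds
  twice the Bowen growth by that of \<open>Dr\<close>: every point lies within \<eta> of a maximal
  \<eta>-separated set F for \<open>Dr\<close>, so each point of a Bowen-separated set is shadowed
  by an element of F and is counted by its code, at the price of a factor B exp(\<alpha> r).\<close>

theorem entropy_comparison:
  fixes dr Dr :: "real \<Rightarrow> 'a \<Rightarrow> 'a \<Rightarrow> ereal"
  assumes le: "\<And>r x y. \<lbrakk>r > 0; x \<in> S; y \<in> S\<rbrakk> \<Longrightarrow> Dr r x y \<le> dr r x y"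
    and up: "\<And>r x y. \<lbrakk>r > 0; x \<in> S; y \<in> S\<rbrakk> \<Longrightarrow> dr r x y \<le> 2 * (SUP t\<in>{-r..r}. ereal (d (\<phi> t x) (\<phi> t y)))"
    and sym: "\<And>r x y. Dr r x y = Dr r y x"
    and sh: "\<And>r x y \<eta>. \<lbrakk>r > 0; x \<in> S; y \<in> S; \<eta> > 0; Dr r x y < ereal \<eta>\<rbrakk> \<Longrightarrow>
      (\<exists>\<sigma>. shadows r \<eta> y x \<sigma>) \<and> (\<exists>\<sigma>. compact_flow.shadows d (\<lambda>t. \<phi> (- t)) r \<eta> y x \<sigma>)"
  shows "growth_rate S dr = growth_rate S Dr \<and> growth_rate S Dr = 2 * growth_rate S bowen"
proof -
  have 1: "growth_rate S Dr \<le> growth_rate S dr"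
    unfolding growth_rate_eq_SUP
    by (intro SUP_mono' rate_mono sep_number_mono) (auto intro: order_trans[OF _ le])
  have 2: "growth_rate S dr \<le> 2 * growth_rate S bowen"
    unfolding growth_rate_eq_SUP
  proof (rule SUP_least)
    fix \<epsilon> :: real assume "\<epsilon> \<in> {0<..}"
    then have \<epsilon>: "\<epsilon> > 0" by simp
    \<comment> \<open>\<open>dr\<close> is at most twice the two-sided Bowen distance, hence
      \<epsilon>/2; the bijection \<phi>_{-r} moves the window [-r,r] to [0,2r].\<close>
    have "rate S dr \<epsilon> \<le> Limsup at_top (\<lambda>r. ln_ereal (sep_number S (bowen (2 * r)) (\<epsilon>/2)) / ereal r)"
      unfolding rate_def
    proof (rule Limsup_mono)
      show "\<forall>\<^sub>F r in at_top. ln_ereal (sep_number S (dr r) \<epsilon>) / ereal r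
          \<le> ln_ereal (sep_number S (bowen (2 * r)) (\<epsilon>/2)) / ereal r"
        using eventually_gt_at_top[of 0]
      proof eventually_elim
        case (elim r)
        have "sep_number S (dr r) \<epsilon> \<le> sep_number S (bowen (2 * r)) (\<epsilon>/2)"
        proof (rule sep_number_le)
          fix T assume T: "T \<subseteq> S" "finite T" and s: "\<And>x y. \<lbrakk>x \<in> T; y \<in> T; x \<noteq> y\<rbrakk> \<Longrightarrow> ereal \<epsilon> \<le> dr r x y"
          have "ereal (real (card (\<phi> (-r) ` T))) \<le> sep_number S (bowen (2 * r)) (\<epsilon>/2)"
          proof (rule card_le_sep_number)
            fix x y assume "x \<in> \<phi> (-r) ` T" "y \<in> \<phi> (-r) ` T" "x \<noteq> y"
            then obtain x' y' where xy: "x' \<in> T" "y' \<in> T" "x' \<noteq> y'" "x = \<phi> (-r) x'" "y = \<phi> (-r) y'" by blast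
            then have S: "x' \<in> S" "y' \<in> S" using T by auto
            have "ereal \<epsilon> \<le> 2 * bowen (2 * r) x y"
              using order_trans[OF s[OF xy(1-3)] up[OF elim S]] unfolding two_sided_to_bowen[OF S] xy(4,5) .
            then show "ereal (\<epsilon>/2) \<le> bowen (2 * r) x y"
              by (cases "bowen (2 * r) x y") (auto simp: numeral_eq_ereal)
          qed (use T flow_in in auto)
          also have "card (\<phi> (-r) ` T) = card T"
            by (rule card_image) (rule inj_on_subset[OF inj_on_flow T(1)])
          finally show "ereal (real (card T)) \<le> sep_number S (bowen (2 * r)) (\<epsilon>/2)" .
        qed
        then show ?case using elim by (intro ereal_divide_right_mono ln_sep_number_mono) auto
      qed
    qed
    also have "\<dots> = 2 * rate S bowen (\<epsilon>/2)" by (rule rate_double)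
    also have "\<dots> \<le> 2 * (SUP \<epsilon>\<in>{0<..}. rate S bowen \<epsilon>)"
      using \<epsilon> by (intro ereal_mult_left_mono SUP_upper) auto
    finally show "rate S dr \<epsilon> \<le> 2 * (SUP \<epsilon>\<in>{0<..}. rate S bowen \<epsilon>)" .
  qed
  have 3: "2 * rate S bowen \<epsilon> \<le> growth_rate S Dr + ereal (2 * \<alpha>)" if pos: "\<epsilon> > 0" "\<alpha> > 0" for \<epsilon> \<alpha>
  proof -
    obtain \<eta> B where \<eta>: "\<eta> > 0" "B \<ge> 1"
      "\<forall>r F E. r > 0 \<longrightarrow> finite F \<longrightarrow> F \<subseteq> S \<longrightarrow> finite E \<longrightarrow> E \<subseteq> S \<longrightarrow>
       (\<forall>y\<in>E. \<exists>x\<in>F. (\<exists>\<sigma>. shadows r \<eta> x y \<sigma>) \<and> (\<exists>\<sigma>. compact_flow.shadows d (\<lambda>t. \<phi> (- t)) r \<eta> x y \<sigma>)) \<longrightarrow>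
       (\<forall>y\<in>E. \<forall>y'\<in>E. y \<noteq> y' \<longrightarrow> (\<exists>t\<in>{-r..r}. \<epsilon>/2 \<le> d (\<phi> t y) (\<phi> t y'))) \<longrightarrow>
       real (card E) \<le> real (card F) * (B * exp (\<alpha> * r))"
      by (rule separated_card_bound[OF half_gt_zero[OF pos(1)] pos(2)]) (rule that)
    \<comment> \<open>Once r \<ge> ln B / \<alpha>, the constant B costs no more than a further
      factor exp(\<alpha> r), whence 2\<alpha>.\<close>
    have main: "ln_ereal (sep_number S (bowen (2 * r)) \<epsilon>) / ereal r \<le> ln_ereal (sep_number S (Dr r) \<eta>) / ereal r + ereal (2 * \<alpha>)"
      if r: "r > 0" "r \<ge> ln B / \<alpha>" for r
    proof (cases "sep_number S (Dr r) \<eta> = \<infinity>")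
      case True
      then show ?thesis using r by (simp add: ln_ereal_def)
    next
      case False
      obtain F where F: "F \<subseteq> S" "finite F" "ereal (real (card F)) \<le> sep_number S (Dr r) \<eta>"
        "\<And>x. x \<in> S \<Longrightarrow> x \<notin> F \<Longrightarrow> \<exists>f\<in>F. Dr r x f < ereal \<eta>"
        by (rule sep_number_maximal[OF False sym]) (rule that)
      have near: "\<exists>f\<in>F. Dr r x f < ereal \<eta>" if x: "x \<in> S" for x
      proof (cases "x \<in> F")
        case True
        \<comment> \<open>The maximal set says nothing about its own points; for these the upper
          bound gives a distance of at most 0 from the point to itself.\<close>
        have "Dr r x x \<le> 2 * (SUP t\<in>{-r..r}. ereal (d (\<phi> t x) (\<phi> t x)))"
          by (rule order_trans[OF le up]) (use r x in auto)
        also have "(SUP t\<in>{-r..r}. ereal (d (\<phi> t x) (\<phi> t x))) = 0"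
          using d_self flow_in x r(1) by (simp add: zero_ereal_def)
        finally have "Dr r x x < ereal \<eta>" using \<eta>(1) by (simp add: le_less_trans)
        then show ?thesis using True by blast
      qed (rule F(4)[OF x])
      have bound: "sep_number S (bowen (2 * r)) \<epsilon> \<le> ereal (real (card F) * (B * exp (\<alpha> * r)))"
      proof (rule sep_number_le)
        fix T assume T: "T \<subseteq> S" "finite T"
          and s: "\<And>x y. \<lbrakk>x \<in> T; y \<in> T; x \<noteq> y\<rbrakk> \<Longrightarrow> ereal \<epsilon> \<le> bowen (2 * r) x y"
        \<comment> \<open>Shifting by \<phi>_r centres the window [0,2r], so that forward and
          backward shadowing from the midpoint cover it.\<close>
        have "real (card (\<phi> r ` T)) \<le> real (card F) * (B * exp (\<alpha> * r))"
        proof (rule \<eta>(3)[rule_format, OF r(1) F(2,1)])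
          show "\<exists>x\<in>F. (\<exists>\<sigma>. shadows r \<eta> x y \<sigma>) \<and> (\<exists>\<sigma>. compact_flow.shadows d (\<lambda>t. \<phi> (- t)) r \<eta> x y \<sigma>)"
            if "y \<in> \<phi> r ` T" for y
          proof -
            have y: "y \<in> S" using that T flow_in by auto
            then obtain f where "f \<in> F" "Dr r y f < ereal \<eta>" using near by blast
            then show ?thesis using sh[OF r(1) y _ \<eta>(1), of f] F(1) by blast
          qed
          \<comment> \<open>The Bowen distance is a supremum, and \<epsilon>/2 leaves room for it
            not to be attained; this is why the code was requested for \<epsilon>/2.\<close>
          show "\<exists>t\<in>{-r..r}. \<epsilon>/2 \<le> d (\<phi> t y) (\<phi> t y')" if y: "y \<in> \<phi> r ` T" "y' \<in> \<phi> r ` T" "y \<noteq> y'" for y y'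
          proof (rule ccontr)
            assume N: "\<not> ?thesis"
            obtain z z' where z: "z \<in> T" "z' \<in> T" "z \<noteq> z'" "y = \<phi> r z" "y' = \<phi> r z'" using y by blast
            then have zS: "z \<in> S" "z' \<in> S" using T by auto
            have "bowen (2 * r) z z' = (SUP t\<in>{-r..r}. ereal (d (\<phi> t y) (\<phi> t y')))"
              using two_sided_to_bowen[of y y' r] z zS flow_in flow_uminus by simp
            also have "\<dots> \<le> ereal (\<epsilon>/2)" using N by (intro SUP_least) (auto simp: not_le less_imp_le)
            also have "\<dots> < ereal \<epsilon>" using \<open>\<epsilon> > 0\<close> by simp
            finally show False using s[OF z(1-3)] by simp
          qed
        qed (use T flow_in in auto)
        also have "card (\<phi> r ` T) = card T"
          by (rule card_image) (rule inj_on_subset[OF inj_on_flow T(1)])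
        finally show "ereal (real (card T)) \<le> ereal (real (card F) * (B * exp (\<alpha> * r)))" by simp
      qed
      have "ln_ereal (sep_number S (bowen (2 * r)) \<epsilon>) \<le> ln_ereal (sep_number S (Dr r) \<eta>) + ereal (ln B + \<alpha> * r)"
      \<comment> \<open>S may be empty; the separation numbers are then 0, and so are their
        logarithms.\<close>
      proof (cases "F = {}")
        case True
        then have "S = {}" using near by blast
        moreover have "0 \<le> ereal (ln B + \<alpha> * r)" using \<eta>(2) r \<open>\<alpha> > 0\<close> by simp
        ultimately show ?thesis by (simp add: ln_ereal_def sep_number_empty)
      next
        case False
        then have cF: "real (card F) \<ge> 1" using F(2) by (simp add: Suc_le_eq card_gt_0_iff)
        have Be: "B * exp (\<alpha> * r) \<ge> 1" using \<eta>(2) r(1) \<open>\<alpha> > 0\<close> mult_mono[of 1 B 1 "exp (\<alpha> * r)"] by simp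
        have "ln_ereal (sep_number S (bowen (2 * r)) \<epsilon>) \<le> ln_ereal (ereal (real (card F) * (B * exp (\<alpha> * r))))"
          using bound sep_number_cases[of S "bowen (2 * r)" \<epsilon>] mult_mono[OF cF Be] cF
          by (intro ln_ereal_mono) (auto simp: one_ereal_def)
        also have "\<dots> = ereal (ln (real (card F))) + ereal (ln B + \<alpha> * r)"
          using cF \<eta>(2) by (simp add: ln_ereal_def ln_mult)
        also have "ereal (ln (real (card F))) = ln_ereal (ereal (real (card F)))" by (simp add: ln_ereal_def)
        also have "\<dots> \<le> ln_ereal (sep_number S (Dr r) \<eta>)"
          using F(3) cF sep_number_cases[of S "Dr r" \<eta>] by (intro ln_ereal_mono) (auto simp: one_ereal_def)
        finally show ?thesis by (simp add: add_right_mono)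
      qed
      also have "\<dots> \<le> ln_ereal (sep_number S (Dr r) \<eta>) + ereal (2 * \<alpha> * r)"
        using r \<open>\<alpha> > 0\<close> by (intro add_left_mono) (simp add: field_simps)
      finally have "ln_ereal (sep_number S (bowen (2 * r)) \<epsilon>) / ereal r \<le> (ln_ereal (sep_number S (Dr r) \<eta>) + ereal (2 * \<alpha> * r)) / ereal r"
        using r by (intro ereal_divide_right_mono) auto
      also have "\<dots> = ln_ereal (sep_number S (Dr r) \<eta>) / ereal r + ereal (2 * \<alpha>)"
        using r by (cases "ln_ereal (sep_number S (Dr r) \<eta>)") (auto simp: add_divide_distrib)
      finally show ?thesis .
    qed
    have "2 * rate S bowen \<epsilon> = Limsup at_top (\<lambda>r. ln_ereal (sep_number S (bowen (2 * r)) \<epsilon>) / ereal r)"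
      by (rule rate_double[symmetric])
    also have "\<dots> \<le> Limsup at_top (\<lambda>r. ln_ereal (sep_number S (Dr r) \<eta>) / ereal r + ereal (2 * \<alpha>))"
    proof (rule Limsup_mono)
      show "\<forall>\<^sub>F r in at_top. ln_ereal (sep_number S (bowen (2 * r)) \<epsilon>) / ereal r
          \<le> ln_ereal (sep_number S (Dr r) \<eta>) / ereal r + ereal (2 * \<alpha>)"
        using eventually_gt_at_top[of 0] eventually_ge_at_top[of "ln B / \<alpha>"]
        by eventually_elim (rule main)
    qed
    also have "\<dots> = rate S Dr \<eta> + ereal (2 * \<alpha>)"
      unfolding rate_def by (rule Limsup_add_ereal_right) auto
    also have "\<dots> \<le> growth_rate S Dr + ereal (2 * \<alpha>)"
      unfolding growth_rate_eq_SUP using \<eta>(1) by (intro add_right_mono SUP_upper) auto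
    finally show ?thesis .
  qed
  have "2 * rate S bowen \<epsilon> \<le> growth_rate S Dr" if "\<epsilon> > 0" for \<epsilon>
  proof (rule ereal_le_epsilon2)
    fix e :: real assume "e > 0"
    then show "2 * rate S bowen \<epsilon> \<le> growth_rate S Dr + ereal e" using 3[OF that, of "e/2"] by simp
  qed
  then have "2 * growth_rate S bowen \<le> growth_rate S Dr"
    unfolding growth_rate_eq_SUP[of S bowen]
    by (subst SUP_ereal_mult_left[symmetric]) (auto intro!: SUP_least simp: rate_nonneg)
  with 1 2 show ?thesis by auto
qed

end

section \<open>Smooth functions and differential equations\<close>

lemma nonincreasing_if_deriv_nonpos:
  fixes f f' :: "real \<Rightarrow> real"
  assumes "a \<le> b" "continuous_on {a..b} f" "finite P"
    and "\<And>t. t \<in> {a<..<b} - P \<Longrightarrow> (f has_vector_derivative f' t) (at t)"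
    and "\<And>t. t \<in> {a<..<b} - P \<Longrightarrow> f' t \<le> 0"
  shows "f b \<le> f a"
proof -
  define g where "g = (\<lambda>t. if t \<in> {a<..<b} - P then f' t else 0)"
  have "(g has_integral (f b - f a)) {a..b}"
    by (rule fundamental_theorem_of_calculus_interior_strong[OF assms(3,1)]) (use assms in \<open>auto simp: g_def\<close>)
  moreover have "((\<lambda>_. 0::real) has_integral 0) {a..b}" by simp
  ultimately have "f b - f a \<le> 0" by (rule has_integral_le) (use assms(5) in \<open>auto simp: g_def\<close>)
  then show ?thesis by simp
qed

text \<open>The function exp(-2Lt) |z(t)|^2 is nonincreasing by Cauchy-Schwarz, nonnegative, and 0
  at a. Continuity bridges the finitely many points without a derivative.\<close>

lemma gronwall_zero_right:
  fixes z :: "real \<Rightarrow> 'e::real_inner"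
  assumes cont: "continuous_on {a..b} z" and fin: "finite P" and ab: "a \<le> b"
    and der: "\<And>t. t \<in> {a<..<b} - P \<Longrightarrow> (z has_vector_derivative z' t) (at t)"
    and bd: "\<And>t. t \<in> {a<..<b} - P \<Longrightarrow> norm (z' t) \<le> L * norm (z t)"
    and z0: "z a = 0"
  shows "z b = 0"
proof -
  define w where "w = (\<lambda>t. exp (- (2 * L) * t) * (z t \<bullet> z t))"
  have "w b \<le> w a"
  proof (rule nonincreasing_if_deriv_nonpos[OF ab _ fin])
    show "continuous_on {a..b} w" unfolding w_def by (intro continuous_intros cont)
    fix t assume t: "t \<in> {a<..<b} - P"
    show "(w has_vector_derivative exp (- (2 * L) * t) * (2 * (z t \<bullet> z' t) - 2 * L * (z t \<bullet> z t))) (at t)"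
    proof -
      have "((\<lambda>t. z t \<bullet> z t) has_real_derivative 2 * (z t \<bullet> z' t)) (at t)"
        using has_derivative_inner[OF der[OF t, unfolded has_vector_derivative_def] der[OF t, unfolded has_vector_derivative_def]]
        unfolding has_field_derivative_def by (rule has_derivative_eq_rhs) (auto simp: inner_commute)
      moreover have "((\<lambda>t. exp (- (2 * L) * t)) has_real_derivative exp (- (2 * L) * t) * (- (2 * L))) (at t)"
        by (auto intro!: derivative_eq_intros)
      ultimately have "(w has_real_derivative exp (- (2 * L) * t) * (- (2 * L)) * (z t \<bullet> z t)
          + 2 * (z t \<bullet> z' t) * exp (- (2 * L) * t)) (at t)"
        unfolding w_def by (rule DERIV_mult[rotated])
      then show ?thesis by (simp add: has_real_derivative_iff_has_vector_derivative algebra_simps)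
    qed
    have "z t \<bullet> z' t \<le> norm (z t) * norm (z' t)" by (rule norm_cauchy_schwarz)
    also have "\<dots> \<le> norm (z t) * (L * norm (z t))" by (intro mult_left_mono bd t) auto
    also have "\<dots> = L * (z t \<bullet> z t)" by (simp add: power2_norm_eq_inner[symmetric] power2_eq_square)
    finally show "exp (- (2 * L) * t) * (2 * (z t \<bullet> z' t) - 2 * L * (z t \<bullet> z t)) \<le> 0"
      by (intro mult_nonneg_nonpos) auto
  qed
  then have "exp (- (2 * L) * b) * (z b \<bullet> z b) \<le> 0" by (simp add: w_def z0)
  then have "z b \<bullet> z b \<le> 0" by (simp add: mult_le_0_iff)
  then show ?thesis using inner_ge_zero[of "z b"] by (metis antisym inner_eq_zero_iff)
qed

lemma gronwall_zero:
  fixes z :: "real \<Rightarrow> 'e::real_inner"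
  assumes cont: "continuous_on {a..b} z" and fin: "finite P"
    and der: "\<And>t. t \<in> {a<..<b} - P \<Longrightarrow> (z has_vector_derivative z' t) (at t)"
    and bd: "\<And>t. t \<in> {a<..<b} - P \<Longrightarrow> norm (z' t) \<le> L * norm (z t)"
    and t0: "t0 \<in> {a..b}" "z t0 = 0" and t: "t \<in> {a..b}"
  shows "z t = 0"
proof (cases "t0 \<le> t")
  case True
  show ?thesis
    by (rule gronwall_zero_right[of t0 t z P z' L]) (use assms True in \<open>auto intro: continuous_on_subset\<close>)
next
  case False
  have "(\<lambda>s. z (- s)) (-t) = 0"
  proof (rule gronwall_zero_right[of "-t0" "-t" _ "uminus ` P" "\<lambda>s. - z' (- s)" L])
    show "continuous_on {- t0..- t} (\<lambda>s. z (- s))"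
      by (rule continuous_on_compose2[OF cont]) (use t0 t in \<open>auto intro!: continuous_intros\<close>)
    fix s assume s: "s \<in> {- t0<..<- t} - uminus ` P"
    then have "-s \<notin> P" by (metis DiffD2 image_eqI minus_minus)
    then have s': "-s \<in> {a<..<b} - P" using s t0 t by auto
    have "(z \<circ> uminus has_vector_derivative (-1) *\<^sub>R z' (- s)) (at s)"
      by (rule vector_diff_chain_at) (use der[OF s'] in \<open>auto intro!: derivative_eq_intros\<close>)
    then show "((\<lambda>s. z (- s)) has_vector_derivative - z' (- s)) (at s)" by (simp add: o_def)
    show "norm (- z' (- s)) \<le> L * norm (z (- s))" using bd[OF s'] by simp
  qed (use assms False in auto)
  then show ?thesis by simp
qed

section \<open>Local existence for Lipschitz fields\<close>

lemma antiderivative_from_0: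
  fixes f :: "real \<Rightarrow> 'e::euclidean_space"
  assumes "continuous_on UNIV f"
  obtains A where "A 0 = 0" "\<And>t. (A has_vector_derivative f t) (at t)"
proof -
  have "\<exists>A. \<forall>x::real. -\<infinity> < ereal x \<longrightarrow> ereal x < \<infinity> \<longrightarrow> (A has_vector_derivative f x) (at x)"
    using assms by (intro einterval_antiderivative) (auto simp: continuous_on_eq_continuous_at)
  then obtain A where A: "\<And>t. (A has_vector_derivative f t) (at t)" by auto
  show thesis
    by (rule that[of "\<lambda>t. A t - A 0"]) (use has_vector_derivative_diff[OF A has_vector_derivative_const] in auto)
qed

lemma vector_derivative_bound:
  fixes f :: "real \<Rightarrow> 'e::real_normed_vector"
  assumes "\<And>t. t \<in> S \<Longrightarrow> (f has_vector_derivative f' t) (at t within S)" "convex S"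
    and "\<And>t. t \<in> S \<Longrightarrow> norm (f' t) \<le> B" "x \<in> S" "y \<in> S"
  shows "norm (f x - f y) \<le> B * \<bar>x - y\<bar>"
proof -
  have "norm (f x - f y) \<le> B * norm (x - y)"
  proof (rule differentiable_bound[OF assms(2)])
    show "(f has_derivative (\<lambda>s. s *\<^sub>R f' t)) (at t within S)" if "t \<in> S" for t
      using assms(1)[OF that] by (simp add: has_vector_derivative_def)
    show "onorm (\<lambda>s. s *\<^sub>R f' t) \<le> B" if "t \<in> S" for t
      using assms(3)[OF that] onorm_scaleR_left[OF bounded_linear_ident, of "f' t"] by (simp add: onorm_id)
  qed (use assms in auto)
  then show ?thesis by simp
qed

text \<open>The integral operator is a contraction on bounded continuous functions on the line. A
  globally Lipschitz field gives one existence time a for all initial values. The condition a L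
  \<le> 1/2 yields the factor 1/2, and with it the constant 2 in the dependence on initial values:
  the distance D of two solutions satisfies D \<le> \<open>dist x y\<close> + D/2.\<close>

lemma picard:
  fixes F :: "'e::euclidean_space \<Rightarrow> 'e"
  assumes lip: "\<And>x y. dist (F x) (F y) \<le> L * dist x y" and L: "0 \<le> L" and a: "a > 0" "a * L \<le> 1/2"
  obtains u where "\<And>x. u x 0 = x" "\<And>x. continuous_on {-a..a} (u x)"
    "\<And>x t. t \<in> {-a<..<a} \<Longrightarrow> (u x has_vector_derivative F (u x t)) (at t)"
    "\<And>x y t. t \<in> {-a..a} \<Longrightarrow> dist (u x t) (u y t) \<le> 2 * dist x y"
proof -
  \<comment> \<open>Time is clamped to [-a,a], so that the integrals stay bounded and the operator
    maps bounded functions on the line to bounded ones.\<close>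
  define cl :: "real \<Rightarrow> real" where "cl = (\<lambda>t. max (-a) (min a t))"
  have cl: "cl t \<in> {-a..a}" for t using a by (auto simp: cl_def)
  have contF: "continuous_on UNIV F"
    by (rule lipschitz_on_continuous_on[of L]) (auto simp: lipschitz_on_def lip L)
  have cF: "continuous_on UNIV (\<lambda>t. F (apply_bcontfun v t))" for v :: "real \<Rightarrow>\<^sub>C 'e"
    by (rule continuous_on_compose2[OF contF]) auto
  have "\<forall>v :: real \<Rightarrow>\<^sub>C 'e. \<exists>A. A 0 = 0 \<and> (\<forall>t. (A has_vector_derivative F (apply_bcontfun v t)) (at t))"
    using antiderivative_from_0[OF cF] by metis
  then obtain A where A: "\<And>v. A v 0 = 0" "\<And>v t. (A v has_vector_derivative F (apply_bcontfun v t)) (at t)"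
    by metis
  have contA: "continuous_on UNIV (\<lambda>t. A v (cl t))" for v
  proof (rule continuous_on_compose2[of UNIV "A v"])
    show "continuous_on UNIV (A v)"
      by (rule continuous_on_vector_derivative[of _ _ "\<lambda>t. F (apply_bcontfun v t)"]) (use A in auto)
    show "continuous_on UNIV cl" unfolding cl_def by (intro continuous_intros)
  qed auto
  define P where "P = (\<lambda>x v. Bcontfun (\<lambda>t. x + A v (cl t)))"
  have P: "apply_bcontfun (P x v) t = x + A v (cl t)" for x v t
  proof -
    have "continuous_on {-a..a} (A v)"
      by (rule continuous_on_vector_derivative[of _ _ "\<lambda>t. F (apply_bcontfun v t)"])
        (use A(2)[THEN has_vector_derivative_at_within] in auto)
    then have "bounded (A v ` {-a..a})" by (intro compact_imp_bounded compact_continuous_image) auto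
    then obtain B where B: "\<And>s. s \<in> {-a..a} \<Longrightarrow> norm (A v s) \<le> B" unfolding bounded_iff by (metis image_eqI)
    have "(\<lambda>t. x + A v (cl t)) \<in> bcontfun"
      by (rule bcontfun_normI[of _ "norm x + B"])
        (auto intro!: continuous_intros contA norm_triangle_le add_left_mono B[OF cl])
    then show ?thesis by (simp add: P_def Bcontfun_inverse)
  qed
  have Adiff: "dist (A v (cl t)) (A w (cl t)) \<le> 1/2 * dist v w" for v w t
  proof -
    have "norm ((A v (cl t) - A w (cl t)) - (A v 0 - A w 0)) \<le> (L * dist v w) * \<bar>cl t - 0\<bar>"
    proof (rule vector_derivative_bound[where S = UNIV])
      show "((\<lambda>s. A v s - A w s) has_vector_derivative F (apply_bcontfun v s) - F (apply_bcontfun w s)) (at s within UNIV)" for s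
        by (intro has_vector_derivative_diff A)
      show "norm (F (apply_bcontfun v s) - F (apply_bcontfun w s)) \<le> L * dist v w" for s
        using order_trans[OF lip mult_left_mono[OF dist_bounded L]] by (simp add: dist_norm)
    qed auto
    also have "\<dots> \<le> (L * dist v w) * a" using cl[of t] L by (intro mult_left_mono) auto
    also have "\<dots> = (a * L) * dist v w" by simp
    also have "\<dots> \<le> 1/2 * dist v w" using a by (intro mult_right_mono) auto
    finally show ?thesis by (simp add: dist_norm A)
  qed
  have "\<exists>!v. P x v = v" for x
  proof (rule banach_fix_type[of "1/2"])
    show "\<forall>v w. dist (P x v) (P x w) \<le> 1/2 * dist v w"
      by (intro allI dist_bound) (use Adiff in \<open>simp add: P\<close>)
  qed auto
  then obtain v where v: "\<And>x. P x (v x) = v x" by metis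
  define u where "u = (\<lambda>x t. x + A (v x) (cl t))"
  have u: "apply_bcontfun (v x) t = u x t" for x t using P[of x "v x" t] v[of x] by (simp add: u_def)
  show thesis
  proof (rule that[of u])
    show "u x 0 = x" for x using a by (simp add: u_def cl_def A)
    show "continuous_on {-a..a} (u x)" for x
      unfolding u_def by (intro continuous_intros continuous_on_subset[OF contA]) auto
    show "(u x has_vector_derivative F (u x t)) (at t)" if t: "t \<in> {-a<..<a}" for x t
    proof (rule has_vector_derivative_transform_within_open[of "\<lambda>s. x + A (v x) s" _ _ "{-a<..<a}"])
      show "((\<lambda>s. x + A (v x) s) has_vector_derivative F (u x t)) (at t)"
        using has_vector_derivative_add[OF has_vector_derivative_const[of x] A(2)[of "v x" t]] by (simp add: u)
    qed (use t in \<open>auto simp: u_def cl_def min_def max_def\<close>)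
    show "dist (u x t) (u y t) \<le> 2 * dist x y" for x y t
    proof -
      have "dist (v x) (v y) \<le> dist x y + 1/2 * dist (v x) (v y)"
      proof (rule dist_bound)
        fix s
        have "dist (u x s) (u y s) \<le> dist x y + dist (A (v x) (cl s)) (A (v y) (cl s))"
          unfolding u_def by (rule dist_triangle_add)
        then show "dist (apply_bcontfun (v x) s) (apply_bcontfun (v y) s) \<le> dist x y + 1/2 * dist (v x) (v y)"
          unfolding u using Adiff[of "v x" s "v y"] by linarith
      qed
      then have "dist (v x) (v y) \<le> 2 * dist x y" by simp
      then show ?thesis using dist_bounded[where f = "v x" and g = "v y" and x = t] unfolding u by linarith
    qed
  qed
qed

section \<open>Calculus of smooth functions\<close>

lemma Ck_on_sum:
  assumes "open U" "finite B" "\<And>b. b \<in> B \<Longrightarrow> Ck_on k U (f b)"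
  shows "Ck_on k U (\<lambda>x. \<Sum>b\<in>B. f b x)"
  using assms(2,3)
proof (induction B rule: finite_induct)
  case (insert b B)
  have "Ck_on k U (\<lambda>x. f b x + (\<Sum>b\<in>B. f b x))"
    by (rule Ck_on_add[OF assms(1)]) (use insert in auto)
  then show ?case using insert by simp
qed (simp add: Ck_on_const assms(1))

lemma Ck_on_continuous: "Ck_on k U f \<Longrightarrow> continuous_on U f"
  by (induction k) (use Ck_on_mono in auto)

text \<open>\<open>Ck_on\<close> controls derivatives in a fixed direction v, whereas the chain rule
  evaluates the derivative of f in the direction Dg(x)v, which depends on x. Expanding this
  direction in the basis reduces the matter to products of derivatives of f in fixed directions with
  the coordinates of Dg(x)v.\<close>

lemma Ck_on_compose:
  assumes "open U" "open V" "Ck_on k V f" "Ck_on k U g" "g ` U \<subseteq> V"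
  shows "Ck_on k U (\<lambda>x. f (g x))"
  using assms(3,4)
proof (induction k arbitrary: f)
  case 0
  then show ?case using assms(5) continuous_on_compose2[of V f U g] by auto
next
  case (Suc k)
  note f = Ck_on_SucD[OF Suc.prems(1)] and g = Ck_on_SucD[OF Suc.prems(2)]
  show ?case
  proof (rule Ck_on_SucI[where f' = "\<lambda>x v. frechet_derivative f (at (g x)) (frechet_derivative g (at x) v)"])
    show "((\<lambda>x. f (g x)) has_derivative (\<lambda>v. frechet_derivative f (at (g x)) (frechet_derivative g (at x) v))) (at x)"
      if "x \<in> U" for x
      using diff_chain_at[OF g(1)[OF that] f(1)] that assms(5) by (auto simp: o_def)
    fix v
    have "Ck_on k U (\<lambda>x. \<Sum>b\<in>Basis. (frechet_derivative g (at x) v \<bullet> b) *\<^sub>R frechet_derivative f (at (g x)) b)"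
      using f(2) g(2) Suc.IH Ck_on_mono[OF Suc.prems(2)]
      by (intro Ck_on_sum Ck_on_scaleR Ck_on_linear_compose[where L = "\<lambda>y. y \<bullet> b" for b] assms bounded_linear_inner_left) auto
    moreover have "(\<Sum>b\<in>Basis. (frechet_derivative g (at x) v \<bullet> b) *\<^sub>R frechet_derivative f (at (g x)) b)
        = frechet_derivative f (at (g x)) (frechet_derivative g (at x) v)" if "x \<in> U" for x
    proof -
      have "linear (frechet_derivative f (at (g x)))"
        using f(1)[of "g x"] that assms(5) by (auto intro: has_derivative_linear)
      then have "frechet_derivative f (at (g x)) (\<Sum>b\<in>Basis. (frechet_derivative g (at x) v \<bullet> b) *\<^sub>R b) =
          (\<Sum>b\<in>Basis. (frechet_derivative g (at x) v \<bullet> b) *\<^sub>R frechet_derivative f (at (g x)) b)"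
        by (simp add: linear_sum linear_scale)
      then show ?thesis by (simp add: euclidean_representation)
    qed
    ultimately show "Ck_on k U (\<lambda>x. frechet_derivative f (at (g x)) (frechet_derivative g (at x) v))"
      by (rule Ck_on_cong[OF assms(1), rotated]) auto
  qed (rule assms)
qed

lemma Cinf_on_compose:
  assumes "open U" "open V" "Cinf_on V f" "Cinf_on U g" "g ` U \<subseteq> V"
  shows "Cinf_on U (\<lambda>x. f (g x))"
  unfolding Cinf_on_def
  by (rule allI, rule Ck_on_compose[OF assms(1,2) _ _ assms(5)]) (use assms(3,4) in \<open>simp_all only: Cinf_on_def\<close>)

lemma Ck_on_Suc_curve:
  assumes "open I" "\<And>t. t \<in> I \<Longrightarrow> (w has_vector_derivative w' t) (at t)" "Ck_on k I w'"
  shows "Ck_on (Suc k) I w"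
proof (rule Ck_on_SucI[where f' = "\<lambda>t s. s *\<^sub>R w' t"])
  show "Ck_on k I (\<lambda>t. v *\<^sub>R w' t)" for v
    by (intro Ck_on_scaleR Ck_on_const assms)
qed (use assms in \<open>auto simp: has_vector_derivative_def\<close>)

text \<open>Each pass through the differential equation gains one derivative.\<close>

lemma ode_solution_smooth:
  fixes w :: "real \<Rightarrow> 'e::euclidean_space"
  assumes "open I" "open V" "Cinf_on I a" "Cinf_on V h" "w ` I \<subseteq> V"
    and der: "\<And>t. t \<in> I \<Longrightarrow> (w has_vector_derivative a t *\<^sub>R h (w t)) (at t)"
  shows "Cinf_on I w"
  unfolding Cinf_on_def
proof
  fix k show "Ck_on k I w"
  proof (induction k)
    case 0
    show ?case
      using continuous_on_vector_derivative[of I w "\<lambda>t. a t *\<^sub>R h (w t)"] has_vector_derivative_at_within[OF der]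
      by auto
  next
    case (Suc k)
    show ?case
    proof (rule Ck_on_Suc_curve[OF assms(1) der])
      show "Ck_on k I (\<lambda>t. a t *\<^sub>R h (w t))"
        using assms(3,4) by (intro Ck_on_scaleR[OF assms(1)] Ck_on_compose[OF assms(1,2) _ Suc assms(5)])
          (auto simp: Cinf_on_def)
    qed
  qed
qed

lemma Cinf_on_subset: "Cinf_on U f \<Longrightarrow> V \<subseteq> U \<Longrightarrow> Cinf_on V f"
  unfolding Cinf_on_def using Ck_on_subset by blast

lemma Cinf_on_continuous: "Cinf_on U f \<Longrightarrow> continuous_on U f"
  unfolding Cinf_on_def using Ck_on_continuous by blast

lemma Cinf_on_derivative:
  assumes "Cinf_on U f" "x \<in> U"
  shows "(f has_derivative frechet_derivative f (at x)) (at x)"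
proof -
  have "Ck_on (Suc 0) U f" using assms(1) unfolding Cinf_on_def by (rule spec)
  then show ?thesis using assms(2) by (rule Ck_on_SucD(1))
qed

text \<open>The operator norm of the derivative is at most the sum of the norms of the partial
  derivatives, which is continuous and hence bounded on a closed ball.\<close>

lemma Cinf_on_local_lipschitz:
  fixes f :: "'e::euclidean_space \<Rightarrow> 'f::euclidean_space"
  assumes "Cinf_on U f" "open U" "x \<in> U"
  obtains \<rho> L where "\<rho> > 0" "cball x \<rho> \<subseteq> U" "L \<ge> 0"
    "\<And>y z. \<lbrakk>y \<in> cball x \<rho>; z \<in> cball x \<rho>\<rbrakk> \<Longrightarrow> norm (f y - f z) \<le> L * norm (y - z)"
proof -
  obtain \<rho> where \<rho>: "\<rho> > 0" "cball x \<rho> \<subseteq> U" using assms open_contains_cball by blast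
  define g where "g = (\<lambda>y. \<Sum>b\<in>Basis. norm (frechet_derivative f (at y) b))"
  have "Ck_on (Suc 0) U f" using assms(1) unfolding Cinf_on_def by blast
  then have "continuous_on U (\<lambda>y. frechet_derivative f (at y) b)" for b by auto
  then have "continuous_on (cball x \<rho>) g"
    unfolding g_def by (intro continuous_intros continuous_on_subset[OF _ \<rho>(2)])
  then have "bounded (g ` cball x \<rho>)" by (intro compact_imp_bounded compact_continuous_image) auto
  then obtain L where L: "\<And>y. y \<in> cball x \<rho> \<Longrightarrow> \<bar>g y\<bar> \<le> L" unfolding bounded_iff by (metis image_eqI real_norm_def)
  show thesis
  proof (rule that[OF \<rho>, of L])
    show "L \<ge> 0" using L[of x] \<rho> by force
    fix y z assume yz: "y \<in> cball x \<rho>" "z \<in> cball x \<rho>"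
    show "norm (f y - f z) \<le> L * norm (y - z)"
    proof (rule differentiable_bound[OF convex_cball _ _ yz])
      fix p assume p: "p \<in> cball x \<rho>"
      then have d: "(f has_derivative frechet_derivative f (at p)) (at p)"
        using Cinf_on_derivative[OF assms(1)] \<rho> by blast
      then show "(f has_derivative frechet_derivative f (at p)) (at p within cball x \<rho>)"
        by (rule has_derivative_at_withinI)
      show "onorm (frechet_derivative f (at p)) \<le> L"
        using onorm_componentwise[OF has_derivative_bounded_linear[OF d]] L[OF p] by (simp add: g_def)
    qed
  qed
qed

lemma smooth_onE:
  assumes "smooth_on S f" "x \<in> S"
  obtains U h where "open U" "x \<in> U" "Cinf_on U h" "\<And>y. y \<in> S \<Longrightarrow> y \<in> U \<Longrightarrow> h y = f y"
proof -
  obtain U h where "open U" "x \<in> U" "Cinf_on U h" "\<forall>y\<in>S \<inter> U. h y = f y"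
    using assms(1)[unfolded smooth_on_def, rule_format, OF assms(2)] by blast
  then show thesis by (intro that[of U h]) auto
qed

lemma smooth_on_subset:
  assumes "smooth_on S f" "T \<subseteq> S" shows "smooth_on T f"
  unfolding smooth_on_def
proof
  fix x assume "x \<in> T"
  then obtain U h where "open U" "x \<in> U" "Cinf_on U h" "\<And>y. y \<in> S \<Longrightarrow> y \<in> U \<Longrightarrow> h y = f y"
    using smooth_onE[OF assms(1)] assms(2) by (metis subsetD)
  then show "\<exists>U h. open U \<and> x \<in> U \<and> Cinf_on U h \<and> (\<forall>y\<in>T \<inter> U. h y = f y)"
    using assms(2) by (intro exI[of _ U] exI[of _ h]) auto
qed

lemma Cinf_on_imp_smooth_on: "open U \<Longrightarrow> Cinf_on U f \<Longrightarrow> smooth_on U f"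
  unfolding smooth_on_def by blast

lemma smooth_on_imp_continuous_on:
  assumes "smooth_on S f" shows "continuous_on S f"
  unfolding continuous_on_eq_continuous_within
proof
  fix x assume x: "x \<in> S"
  obtain U h where U: "open U" "x \<in> U" "Cinf_on U h" "\<And>y. y \<in> S \<Longrightarrow> y \<in> U \<Longrightarrow> h y = f y"
    using smooth_onE[OF assms x] by metis
  have "isCont h x" using Cinf_on_continuous[OF U(3)] U(1,2) by (simp add: continuous_on_eq_continuous_at)
  then have "continuous (at x within S) h" by (rule continuous_at_imp_continuous_at_within)
  moreover have "\<forall>\<^sub>F y in at x within S. h y = f y"
    using U unfolding eventually_at_topological by blast
  ultimately show "continuous (at x within S) f"
    using U(4)[OF x U(2)] unfolding continuous_within by (auto intro: Lim_transform_eventually)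
qed

lemma smooth_on_has_derivative:
  assumes "smooth_on S f" "x \<in> S"
  obtains D where "(f has_derivative D) (at x within S)"
proof -
  obtain U h where U: "open U" "x \<in> U" "Cinf_on U h" "\<And>y. y \<in> S \<Longrightarrow> y \<in> U \<Longrightarrow> h y = f y"
    using smooth_onE[OF assms] by metis
  have "(h has_derivative frechet_derivative h (at x)) (at x within S)"
    using Cinf_on_derivative[OF U(3,2)] by (rule has_derivative_at_withinI)
  then have "(f has_derivative frechet_derivative h (at x)) (at x within S)"
  proof (rule has_derivative_transform_eventually)
    show "\<forall>\<^sub>F y in at x within S. h y = f y" using U unfolding eventually_at_topological by blast
  qed (use U assms in auto)
  then show thesis by (rule that)
qed

lemma smooth_on_compose:
  assumes f: "smooth_on S f" and g: "smooth_on T g" and im: "g ` T \<subseteq> S"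
  shows "smooth_on T (\<lambda>x. f (g x))"
  unfolding smooth_on_def
proof
  fix x assume x: "x \<in> T"
  obtain U h where U: "open U" "x \<in> U" "Cinf_on U h" "\<And>y. y \<in> T \<Longrightarrow> y \<in> U \<Longrightarrow> h y = g y"
    using smooth_onE[OF g x] by metis
  obtain V k where V: "open V" "g x \<in> V" "Cinf_on V k" "\<And>y. y \<in> S \<Longrightarrow> y \<in> V \<Longrightarrow> k y = f y"
    using smooth_onE[OF f, of "g x"] im x by blast
  define W where "W = U \<inter> h -` V"
  have W: "open W" unfolding W_def
    using continuous_open_preimage[OF Cinf_on_continuous[OF U(3)] U(1) V(1)] .
  have "Cinf_on W (\<lambda>x. k (h x))"
    by (rule Cinf_on_compose[OF W V(1,3) Cinf_on_subset[OF U(3)]]) (auto simp: W_def)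
  moreover have "x \<in> W" using U V x by (auto simp: W_def)
  moreover have "\<forall>y\<in>T \<inter> W. k (h y) = f (g y)"
  proof
    fix y assume y: "y \<in> T \<inter> W"
    then have "h y = g y" using U(4) by (auto simp: W_def)
    moreover have "k (g y) = f (g y)" using V(4)[of "g y"] y im calculation by (auto simp: W_def)
    ultimately show "k (h y) = f (g y)" by simp
  qed
  ultimately show "\<exists>U h. open U \<and> x \<in> U \<and> Cinf_on U h \<and> (\<forall>y\<in>T \<inter> U. h y = f (g y))"
    using W by blast
qed

lemma Cinf_on_affine:
  fixes g :: "'x::euclidean_space \<Rightarrow> 'y::euclidean_space"
  assumes "bounded_linear g"
  shows "Cinf_on UNIV (\<lambda>x. c + g x)"
  unfolding Cinf_on_def
  by (rule allI, rule Ck_on_add[OF open_UNIV Ck_on_const[OF open_UNIV] Ck_on_linear[OF open_UNIV assms]])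

section \<open>Curves in a manifold\<close>

text \<open>Let z be the component of w orthogonal to E. The inner product of z with f vanishes near
  t, so z is orthogonal to w, which forces z = 0.\<close>

lemma vector_derivative_in_subspace:
  fixes f :: "real \<Rightarrow> 'e::euclidean_space"
  assumes "subspace E" "(f has_vector_derivative w) (at t)" "\<forall>\<^sub>F s in nhds t. f s \<in> E"
  shows "w \<in> E"
proof -
  obtain y z where yz: "y \<in> span E" "\<And>v. v \<in> span E \<Longrightarrow> orthogonal z v" "w = y + z"
    using orthogonal_subspace_decomp_exists[of E w] by metis
  have sp: "span E = E" using assms(1) by (simp add: span_eq_iff)
  have d: "((\<lambda>s. z \<bullet> f s) has_vector_derivative z \<bullet> w) (at t)"
    using bounded_linear.has_vector_derivative[OF bounded_linear_inner_right assms(2)] .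
  have ev: "\<forall>\<^sub>F s in nhds t. z \<bullet> f s = 0"
    using assms(3) by eventually_elim (use yz(2) sp in \<open>simp add: orthogonal_def\<close>)
  then obtain U where U: "open U" "t \<in> U" "\<And>s. s \<in> U \<Longrightarrow> z \<bullet> f s = 0"
    unfolding eventually_nhds by blast
  have "((\<lambda>s. 0::real) has_vector_derivative z \<bullet> w) (at t)"
    by (rule has_vector_derivative_transform_within_open[OF d U(1,2)]) (rule U(3))
  then have "z \<bullet> w = 0" using vector_derivative_unique_at has_vector_derivative_const by blast
  moreover have "z \<bullet> y = 0" using yz(1,2) by (simp add: orthogonal_def)
  ultimately have "z = 0" using yz(3) by (simp add: inner_add_right)
  then show ?thesis using yz(1,3) sp by simp
qed

locale smooth_mfd =
  fixes M :: "('a, 'e::euclidean_space) manifold"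
  assumes manifold: "smooth_manifold M"
begin

abbreviation mtop :: "'a topology" where "mtop \<equiv> manifold_topology M"
abbreviation tfib :: "'a \<Rightarrow> ('a, 'e) tangent set" where "tfib \<equiv> fibre (tangent_bundle M)"

lemma atlas: "smooth_atlas M" and Hausdorff: "Hausdorff_space mtop"
  using manifold by (auto simp: smooth_manifold_def)

lemma subspace_model: "subspace (model M)"
  using atlas by (simp add: smooth_atlas_def)

lemma closed_model: "closed (model M)"
  by (rule closed_subspace[OF subspace_model])

lemmas chart_inj = smooth_atlasD(1)[OF atlas]
lemmas cimage_openin = smooth_atlasD(2)[OF atlas]
lemmas cinv_cmap = smooth_atlasD(3)[OF atlas]
lemmas cdom_subset = smooth_atlasD(4)[OF atlas]
lemmas overlap_openin = smooth_atlasD(5)[OF atlas]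
lemmas transition_smooth = smooth_atlasD(6)[OF atlas]
lemmas topspace_mtop = topspace_manifold_topology[OF atlas]
lemmas openin_mtop = openin_manifold_topology[OF atlas]

lemma chart_around: "p \<in> points M \<Longrightarrow> \<exists>c\<in>charts M. p \<in> cdom c"
  by (auto simp: points_def)

lemma cimage_subset_model: "c \<in> charts M \<Longrightarrow> cimage c \<subseteq> model M"
  using cimage_openin openin_imp_subset by blast

lemma cmap_cinv:
  assumes "c \<in> charts M" "x \<in> cimage c" shows "cinv c x \<in> cdom c" "cmap c (cinv c x) = x"
proof -
  obtain p where p: "p \<in> cdom c" "x = cmap c p" using assms(2) by (auto simp: cimage_def)
  then have "cinv c x = p" using cinv_cmap[OF assms(1)] by simp
  then show "cinv c x \<in> cdom c" "cmap c (cinv c x) = x" using p by auto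
qed

lemma cmap_in_cimage: "p \<in> cdom c \<Longrightarrow> cmap c p \<in> cimage c"
  by (simp add: cimage_def)

lemma cmap_in_model: "c \<in> charts M \<Longrightarrow> p \<in> cdom c \<Longrightarrow> cmap c p \<in> model M"
  by (rule subsetD[OF cimage_subset_model cmap_in_cimage])

lemma openin_cdom:
  assumes "c \<in> charts M" shows "openin mtop (cdom c)"
  unfolding openin_mtop
proof (intro conjI ballI)
  show "cdom c \<subseteq> points M" by (rule cdom_subset[OF assms])
  fix c' assume c': "c' \<in> charts M"
  show "openin (top_of_set (model M)) (cmap c' ` (cdom c \<inter> cdom c'))"
    using overlap_openin[OF c' assms] by (simp add: Int_commute)
qed

text \<open>Openness has to be tested in every chart c'. There the image of W is its preimage under
  the transition map, which is continuous on a relatively open set.\<close>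

lemma openin_cinv_image:
  assumes c: "c \<in> charts M" and W: "openin (top_of_set (model M)) W" "W \<subseteq> cimage c"
  shows "openin mtop (cinv c ` W)"
  unfolding openin_mtop
proof (intro conjI ballI)
  show "cinv c ` W \<subseteq> points M" using cmap_cinv(1)[OF c] cdom_subset[OF c] W(2) by blast
  fix c' assume c': "c' \<in> charts M"
  define O' where "O' = cmap c' ` (cdom c' \<inter> cdom c)"
  have O': "openin (top_of_set (model M)) O'" unfolding O'_def by (rule overlap_openin[OF c' c])
  have "continuous_on O' (cmap c \<circ> cinv c')"
    unfolding O'_def by (rule smooth_on_imp_continuous_on[OF transition_smooth[OF c' c]])
  moreover have "(cmap c \<circ> cinv c') ` O' \<subseteq> model M"
    unfolding O'_def using cinv_cmap[OF c'] cmap_in_model[OF c] by auto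
  ultimately have "openin (top_of_set O') (O' \<inter> (cmap c \<circ> cinv c') -` W)"
    using continuous_openin_preimage[of O' "cmap c \<circ> cinv c'" "model M" W] W(1) by blast
  then have "openin (top_of_set (model M)) (O' \<inter> (cmap c \<circ> cinv c') -` W)"
    using O' openin_trans by blast
  also have "O' \<inter> (cmap c \<circ> cinv c') -` W = cmap c' ` (cinv c ` W \<inter> cdom c')"
  proof (intro equalityI subsetI)
    fix y assume "y \<in> O' \<inter> (cmap c \<circ> cinv c') -` W"
    then obtain p where p: "p \<in> cdom c'" "p \<in> cdom c" "y = cmap c' p" "cmap c (cinv c' y) \<in> W"
      unfolding O'_def by auto
    then have "cmap c p \<in> W" using cinv_cmap[OF c'] by simp
    then have "p \<in> cinv c ` W" using cinv_cmap[OF c p(2)] by (metis imageI)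
    then show "y \<in> cmap c' ` (cinv c ` W \<inter> cdom c')" using p by blast
  next
    fix y assume "y \<in> cmap c' ` (cinv c ` W \<inter> cdom c')"
    then obtain x where x: "x \<in> W" "cinv c x \<in> cdom c'" "y = cmap c' (cinv c x)" by blast
    then have "cinv c x \<in> cdom c" "cmap c (cinv c x) = x" using cmap_cinv[OF c] W(2) by auto
    then show "y \<in> O' \<inter> (cmap c \<circ> cinv c') -` W"
      using x cinv_cmap[OF c' x(2)] unfolding O'_def by auto
  qed
  finally show "openin (top_of_set (model M)) (cmap c' ` (cinv c ` W \<inter> cdom c'))" .
qed

lemma chart_ball:
  assumes c: "c \<in> charts M" and p: "p \<in> cdom c" and U: "openin mtop U" "p \<in> U"
  obtains \<rho> where "\<rho> > 0" "cball (cmap c p) \<rho> \<inter> model M \<subseteq> cmap c ` (U \<inter> cdom c)"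
proof -
  have "openin (top_of_set (model M)) (cmap c ` (U \<inter> cdom c))" using U(1) c openin_mtop by blast
  moreover have "cmap c p \<in> cmap c ` (U \<inter> cdom c)" using p U by blast
  ultimately obtain \<rho> where "\<rho> > 0" "cball (cmap c p) \<rho> \<inter> model M \<subseteq> cmap c ` (U \<inter> cdom c)"
    unfolding openin_contains_cball by blast
  then show thesis by (rule that)
qed

text \<open>The points form a bare type without a topology of its own, so convergence is always
  \<open>limitin mtop\<close>; one chart around the limit reduces it to convergence in the Euclidean
  space. The filter is arbitrary, so that sequences and curves are treated alike.\<close>

lemma limitin_chart:
  assumes c: "c \<in> charts M" and l: "l \<in> cdom c"
  shows "limitin mtop f l F \<longleftrightarrow> (\<forall>\<^sub>F x in F. f x \<in> cdom c) \<and> ((\<lambda>x. cmap c (f x)) \<longlongrightarrow> cmap c l) F"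
proof (intro iffI conjI)
  assume L: "limitin mtop f l F"
  show "\<forall>\<^sub>F x in F. f x \<in> cdom c" by (rule limitinD[OF L openin_cdom[OF c] l])
  show "((\<lambda>x. cmap c (f x)) \<longlongrightarrow> cmap c l) F"
  proof (rule topological_tendstoI)
    fix N assume N: "open N" "cmap c l \<in> N"
    define W where "W = N \<inter> cimage c"
    have "openin (top_of_set (model M)) W"
      unfolding W_def using openin_Int[OF _ cimage_openin[OF c]] N(1) cimage_openin[OF c]
      by (metis inf_commute openin_Int_open)
    then have "openin mtop (cinv c ` W)" by (rule openin_cinv_image[OF c]) (simp add: W_def)
    moreover have "l \<in> cinv c ` W"
      using N(2) cmap_in_cimage[OF l] cinv_cmap[OF c l] unfolding W_def by (metis IntI imageI)
    ultimately have "\<forall>\<^sub>F x in F. f x \<in> cinv c ` W" using limitinD[OF L] by blast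
    then show "\<forall>\<^sub>F x in F. cmap c (f x) \<in> N"
    proof (rule eventually_mono)
      fix x assume "f x \<in> cinv c ` W"
      then show "cmap c (f x) \<in> N" using cmap_cinv(2)[OF c] unfolding W_def by auto
    qed
  qed
next
  assume A: "(\<forall>\<^sub>F x in F. f x \<in> cdom c) \<and> ((\<lambda>x. cmap c (f x)) \<longlongrightarrow> cmap c l) F"
  show "limitin mtop f l F"
    unfolding limitin_def
  proof (intro conjI allI impI)
    show "l \<in> topspace mtop" using l cdom_subset[OF c] topspace_mtop by blast
    fix U assume U: "openin mtop U \<and> l \<in> U"
    then have "openin (top_of_set (model M)) (cmap c ` (U \<inter> cdom c))" using openin_mtop c by blast
    then obtain N where N: "open N" "cmap c ` (U \<inter> cdom c) = model M \<inter> N" by (auto simp: openin_open)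
    have "cmap c l \<in> N" using N(2) U l by blast
    then have "\<forall>\<^sub>F x in F. cmap c (f x) \<in> N" using A N(1) by (blast dest: topological_tendstoD)
    with conjunct1[OF A] show "\<forall>\<^sub>F x in F. f x \<in> U"
    proof eventually_elim
      case (elim x)
      then have "cmap c (f x) \<in> cmap c ` (U \<inter> cdom c)" using N(2) cmap_in_model[OF c] by blast
      then obtain q where "q \<in> U" "q \<in> cdom c" "cmap c (f x) = cmap c q" by blast
      then show ?case using inj_onD[OF chart_inj[OF c]] elim by metis
    qed
  qed
qed

definition curve_on :: "'x::topological_space set \<Rightarrow> ('x \<Rightarrow> 'a) \<Rightarrow> bool" where
  "curve_on S \<gamma> \<longleftrightarrow> (\<forall>t\<in>S. limitin mtop \<gamma> (\<gamma> t) (at t within S))"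

lemma curve_on_subset:
  assumes "curve_on S \<gamma>" "T \<subseteq> S" shows "curve_on T \<gamma>"
  unfolding curve_on_def limitin_def
proof (intro ballI conjI allI impI)
  fix t assume "t \<in> T"
  then have L: "limitin mtop \<gamma> (\<gamma> t) (at t within S)" using assms unfolding curve_on_def by blast
  show "\<gamma> t \<in> topspace mtop" by (rule limitin_topspace[OF L])
  fix U assume "openin mtop U \<and> \<gamma> t \<in> U"
  then have "\<forall>\<^sub>F s in at t within S. \<gamma> s \<in> U" using limitinD[OF L] by blast
  then show "\<forall>\<^sub>F s in at t within T. \<gamma> s \<in> U" by (rule filter_leD[OF at_le[OF assms(2)]])
qed

lemma curve_on_points: "curve_on S \<gamma> \<Longrightarrow> t \<in> S \<Longrightarrow> \<gamma> t \<in> points M"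
  using limitin_topspace[of mtop \<gamma> "\<gamma> t" "at t within S"] by (simp add: curve_on_def topspace_mtop)

lemma curve_on_cmap_continuous:
  assumes "curve_on S \<gamma>" "T \<subseteq> S" "c \<in> charts M" "\<gamma> ` T \<subseteq> cdom c"
  shows "continuous_on T (\<lambda>t. cmap c (\<gamma> t))"
  unfolding continuous_on
proof
  fix t assume t: "t \<in> T"
  have "limitin mtop \<gamma> (\<gamma> t) (at t within T)"
    using curve_on_subset[OF assms(1,2)] t by (simp add: curve_on_def)
  then show "((\<lambda>t. cmap c (\<gamma> t)) \<longlongrightarrow> cmap c (\<gamma> t)) (at t within T)"
    using limitin_chart[OF assms(3)] assms(4) t by blast
qed

lemma smooth_into_curve_on:
  assumes "smooth_into M S f" shows "curve_on S f"
  unfolding curve_on_def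
proof
  fix t assume t: "t \<in> S"
  then obtain c where c: "c \<in> charts M" "f t \<in> cdom c"
    using assms chart_around unfolding smooth_into_def by blast
  define T where "T = S \<inter> f -` cdom c"
  have T: "openin (top_of_set S) T" "smooth_on T (cmap c \<circ> f)"
    using assms c(1) unfolding smooth_into_def T_def by blast+
  have tT: "t \<in> T" using t c by (simp add: T_def)
  obtain N where N: "open N" "T = S \<inter> N" using T(1) by (auto simp: openin_open)
  have ev: "\<forall>\<^sub>F s in at t within S. s \<in> T"
    unfolding N(2) eventually_at_topological using N tT by blast
  show "limitin mtop f (f t) (at t within S)"
    unfolding limitin_chart[OF c]
  proof
    show "\<forall>\<^sub>F x in at t within S. f x \<in> cdom c"
      using ev by eventually_elim (simp add: T_def)
    have "((cmap c \<circ> f) \<longlongrightarrow> (cmap c \<circ> f) t) (at t within T)"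
      using smooth_on_imp_continuous_on[OF T(2)] tT unfolding continuous_on by blast
    moreover have "at t within T = at t within S"
      by (rule at_within_nhd[of t N]) (use N tT in auto)
    ultimately show "((\<lambda>x. cmap c (f x)) \<longlongrightarrow> cmap c (f t)) (at t within S)" by (simp add: o_def)
  qed
qed

section \<open>Tangent vectors and velocities\<close>

lemma mem_tfib: "\<xi> \<in> tfib p \<longleftrightarrow> \<xi> \<in> tangent_vectors M \<and> fst \<xi> = p"
  by (simp add: fibre_def tangent_bundle_def)

lemma tfib_points: "\<xi> \<in> tfib p \<Longrightarrow> p \<in> points M"
  by (auto simp: mem_tfib tangent_vectors_def)

lemma tfib_model:
  assumes "\<xi> \<in> tfib p" "c \<in> charts M" "p \<in> cdom c" shows "snd \<xi> c \<in> model M"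
proof -
  have "(p, snd \<xi>) \<in> tangent_vectors M" using assms(1) by (auto simp: mem_tfib)
  then show ?thesis using assms(2,3) unfolding tangent_vectors_def by blast
qed

lemma tfib_outside:
  assumes "\<xi> \<in> tfib p" "\<not> (c \<in> charts M \<and> p \<in> cdom c)" shows "snd \<xi> c = 0"
proof -
  have "(p, snd \<xi>) \<in> tangent_vectors M" using assms(1) by (auto simp: mem_tfib)
  then show ?thesis using assms(2) unfolding tangent_vectors_def by blast
qed

lemma tfib_transition:
  assumes "\<xi> \<in> tfib p" "c \<in> charts M" "c' \<in> charts M" "p \<in> cdom c" "p \<in> cdom c'"
  obtains D where "((cmap c' \<circ> cinv c) has_derivative D) (at (cmap c p) within cmap c ` (cdom c \<inter> cdom c'))"
    "snd \<xi> c' = D (snd \<xi> c)"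
proof -
  obtain v where v: "\<xi> = (p, v)" using assms(1) by (cases \<xi>) (auto simp: mem_tfib)
  then have "(p, v) \<in> tangent_vectors M" using assms(1) by (simp add: mem_tfib)
  then have "\<exists>D. ((cmap c' \<circ> cinv c) has_derivative D) (at (cmap c p) within cmap c ` (cdom c \<inter> cdom c')) \<and> v c' = D (v c)"
    using assms(2-5) unfolding tangent_vectors_def by blast
  then show thesis using that v by auto
qed

text \<open>The derivative of the transition map is taken within the overlap, which lies in the
  model subspace and need not be open in the Euclidean space. The chain rule therefore runs along
  the curve, whose coordinates stay in the overlap near t.\<close>

lemma chart_change_derivative:
  assumes c: "c \<in> charts M" "c' \<in> charts M" and ev: "\<forall>\<^sub>F s in nhds t. \<gamma> s \<in> cdom c" "\<forall>\<^sub>F s in nhds t. \<gamma> s \<in> cdom c'"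
    and d: "((cmap c \<circ> \<gamma>) has_vector_derivative w) (at t)"
    and D: "((cmap c' \<circ> cinv c) has_derivative D) (at (cmap c (\<gamma> t)) within cmap c ` (cdom c \<inter> cdom c'))"
  shows "((cmap c' \<circ> \<gamma>) has_vector_derivative D w) (at t)"
proof -
  obtain N where N: "open N" "t \<in> N" "\<And>s. s \<in> N \<Longrightarrow> \<gamma> s \<in> cdom c \<and> \<gamma> s \<in> cdom c'"
    using eventually_conj[OF ev] unfolding eventually_nhds by blast
  have sub: "(cmap c \<circ> \<gamma>) ` N \<subseteq> cmap c ` (cdom c \<inter> cdom c')" using N(3) by auto
  have 1: "((cmap c \<circ> \<gamma>) has_derivative (\<lambda>s. s *\<^sub>R w)) (at t within N)"
    using d unfolding has_vector_derivative_def by (rule has_derivative_at_withinI)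
  have "((cmap c' \<circ> cinv c) \<circ> (cmap c \<circ> \<gamma>) has_derivative D \<circ> (\<lambda>s. s *\<^sub>R w)) (at t within N)"
    by (rule diff_chain_within[OF 1]) (use has_derivative_subset[OF _ sub] D in simp)
  moreover have "D \<circ> (\<lambda>s. s *\<^sub>R w) = (\<lambda>s. s *\<^sub>R D w)"
    using linear_scale[OF has_derivative_linear[OF D]] by auto
  ultimately have "((cmap c' \<circ> cinv c) \<circ> (cmap c \<circ> \<gamma>) has_vector_derivative D w) (at t)"
    unfolding has_vector_derivative_def using at_within_open[OF N(2,1)] by simp
  then show ?thesis
  proof (rule has_vector_derivative_transform_within_open[OF _ N(1,2)])
    fix s assume "s \<in> N"
    then show "((cmap c' \<circ> cinv c) \<circ> (cmap c \<circ> \<gamma>)) s = (cmap c' \<circ> \<gamma>) s"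
      using N(3) cinv_cmap[OF c(1)] by simp
  qed
qed

lemma limitin_nhds_cdom:
  assumes "limitin mtop \<gamma> (\<gamma> t) (at t)" "c \<in> charts M" "\<gamma> t \<in> cdom c"
  shows "\<forall>\<^sub>F s in nhds t. \<gamma> s \<in> cdom c"
  using limitinD[OF assms(1) openin_cdom[OF assms(2)] assms(3)] unfolding eventually_at_filter
  by (rule eventually_mono) (use assms(3) in auto)

lemma has_velocity_cdom:
  assumes "has_velocity M \<gamma> \<xi> t" "c \<in> charts M" "\<gamma> t \<in> cdom c"
  shows "\<forall>\<^sub>F s in nhds t. \<gamma> s \<in> cdom c" "((cmap c \<circ> \<gamma>) has_vector_derivative snd \<xi> c) (at t)"
proof -
  have "(\<forall>\<^sub>F s in nhds t. \<gamma> s \<in> cdom c) \<and> ((cmap c \<circ> \<gamma>) has_vector_derivative snd \<xi> c) (at t)"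
    using conjunct2[OF assms(1)[unfolded has_velocity_def], THEN bspec, OF assms(2), THEN mp, OF assms(3)] .
  then show "\<forall>\<^sub>F s in nhds t. \<gamma> s \<in> cdom c" "((cmap c \<circ> \<gamma>) has_vector_derivative snd \<xi> c) (at t)"
    by simp_all
qed

lemma has_velocity_tfib: "has_velocity M \<gamma> \<xi> t \<Longrightarrow> \<xi> \<in> tfib (\<gamma> t)"
  unfolding has_velocity_def by (rule conjunct1)

lemma limitin_from_chart_derivative:
  assumes "c \<in> charts M" "\<forall>\<^sub>F s in nhds t. \<gamma> s \<in> cdom c" "((cmap c \<circ> \<gamma>) has_vector_derivative w) (at t)"
  shows "limitin mtop \<gamma> (\<gamma> t) (at t)"
proof -
  have g: "\<gamma> t \<in> cdom c" using assms(2) by (rule eventually_nhds_x_imp_x)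
  have "isCont (cmap c \<circ> \<gamma>) t" using has_vector_derivative_continuous[OF assms(3)] .
  then show ?thesis
    unfolding limitin_chart[OF assms(1) g] isCont_def o_def
    using eventually_nhds_conv_at[THEN iffD1, OF assms(2)] by simp
qed

lemma has_velocity_continuous:
  assumes "has_velocity M \<gamma> \<xi> t" shows "limitin mtop \<gamma> (\<gamma> t) (at t)"
proof -
  obtain c where c: "c \<in> charts M" "\<gamma> t \<in> cdom c"
    using chart_around[OF tfib_points[OF has_velocity_tfib[OF assms]]] by blast
  show ?thesis by (rule limitin_from_chart_derivative[OF c(1) has_velocity_cdom[OF assms c]])
qed

lemma has_velocity_unique:
  assumes "has_velocity M \<gamma> \<xi> t" "has_velocity M \<gamma> \<eta> t" shows "\<xi> = \<eta>"
proof (rule prod_eqI)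
  show "fst \<xi> = fst \<eta>" using assms[THEN has_velocity_tfib] by (simp add: mem_tfib)
  show "snd \<xi> = snd \<eta>"
  proof
    fix c
    show "snd \<xi> c = snd \<eta> c"
    proof (cases "c \<in> charts M \<and> \<gamma> t \<in> cdom c")
      case True
      then have "c \<in> charts M" "\<gamma> t \<in> cdom c" by auto
      from vector_derivative_unique_at[OF has_velocity_cdom(2)[OF assms(1) this] has_velocity_cdom(2)[OF assms(2) this]]
      show ?thesis .
    next
      case False
      then show ?thesis
        using tfib_outside[OF has_velocity_tfib[OF assms(1)]] tfib_outside[OF has_velocity_tfib[OF assms(2)]] by simp
    qed
  qed
qed

text \<open>One chart suffices: as \<xi> is a tangent vector, its coordinates in the other charts
  are the transforms that the chain rule produces for the curve.\<close>

lemma has_velocityI: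
  assumes c: "c \<in> charts M" and ev: "\<forall>\<^sub>F s in nhds t. \<gamma> s \<in> cdom c"
    and d: "((cmap c \<circ> \<gamma>) has_vector_derivative snd \<xi> c) (at t)" and \<xi>: "\<xi> \<in> tfib (\<gamma> t)"
  shows "has_velocity M \<gamma> \<xi> t"
  unfolding has_velocity_def
proof (intro conjI ballI impI)
  fix c' assume c': "c' \<in> charts M" "\<gamma> t \<in> cdom c'"
  have g: "\<gamma> t \<in> cdom c" using ev by (rule eventually_nhds_x_imp_x)
  show ev': "\<forall>\<^sub>F s in nhds t. \<gamma> s \<in> cdom c'"
    by (rule limitin_nhds_cdom[OF limitin_from_chart_derivative[OF c ev d] c'])
  obtain D where D: "((cmap c' \<circ> cinv c) has_derivative D) (at (cmap c (\<gamma> t)) within cmap c ` (cdom c \<inter> cdom c'))"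
    "snd \<xi> c' = D (snd \<xi> c)"
    by (rule tfib_transition[OF \<xi> c c'(1) g c'(2)])
  show "((cmap c' \<circ> \<gamma>) has_vector_derivative snd \<xi> c') (at t)"
    unfolding D(2) by (rule chart_change_derivative[OF c c'(1) ev ev' d D(1)])
qed (rule \<xi>)

text \<open>The coordinate derivatives of the curve in all charts around \<gamma>(t) are collected
  into one tangent vector; the transformation rule between them holds by uniqueness of
  derivatives.\<close>

lemma has_velocity_exists:
  assumes c: "c \<in> charts M" and ev: "\<forall>\<^sub>F s in nhds t. \<gamma> s \<in> cdom c"
    and d: "((cmap c \<circ> \<gamma>) has_vector_derivative w) (at t)"
  obtains \<xi> where "has_velocity M \<gamma> \<xi> t" "snd \<xi> c = w"
proof -
  have g: "\<gamma> t \<in> cdom c" using ev by (rule eventually_nhds_x_imp_x)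
  note lim = limitin_from_chart_derivative[OF c ev d]
  have "\<exists>v. ((cmap c' \<circ> \<gamma>) has_vector_derivative v) (at t)" if c': "c' \<in> charts M" "\<gamma> t \<in> cdom c'" for c'
  proof -
    obtain D where "((cmap c' \<circ> cinv c) has_derivative D) (at (cmap c (\<gamma> t)) within cmap c ` (cdom c \<inter> cdom c'))"
      by (rule smooth_on_has_derivative[OF transition_smooth[OF c c'(1)], of "cmap c (\<gamma> t)"]) (use g c' in auto)
    then show ?thesis using chart_change_derivative[OF c c'(1) ev limitin_nhds_cdom[OF lim c'] d] by blast
  qed
  then obtain v0 where v0: "\<And>c'. c' \<in> charts M \<Longrightarrow> \<gamma> t \<in> cdom c' \<Longrightarrow> ((cmap c' \<circ> \<gamma>) has_vector_derivative v0 c') (at t)"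
    by metis
  define v where "v = (\<lambda>c'. if c' \<in> charts M \<and> \<gamma> t \<in> cdom c' then v0 c' else 0)"
  have v: "((cmap c' \<circ> \<gamma>) has_vector_derivative v c') (at t)" if "c' \<in> charts M" "\<gamma> t \<in> cdom c'" for c'
    using v0[OF that] that by (simp add: v_def)
  have vc: "v c = w" using vector_derivative_unique_at[OF v[OF c g] d] .
  have "(\<gamma> t, v) \<in> tangent_vectors M"
    unfolding tangent_vectors_def
  proof (intro CollectI case_prodI conjI allI impI ballI)
    show "\<gamma> t \<in> points M" using cdom_subset[OF c] g by blast
    show "v c' \<in> model M" if "c' \<in> charts M \<and> \<gamma> t \<in> cdom c'" for c'
    proof (rule vector_derivative_in_subspace[OF subspace_model v])
      show "\<forall>\<^sub>F s in nhds t. (cmap c' \<circ> \<gamma>) s \<in> model M"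
        using limitin_nhds_cdom[OF lim, of c'] that cmap_in_model[of c']
        by (intro eventually_mono[OF limitin_nhds_cdom[OF lim, of c']]) auto
    qed (use that in auto)
    show "v c' = 0" if "\<not> (c' \<in> charts M \<and> \<gamma> t \<in> cdom c')" for c' using that by (simp only: v_def if_False)
    fix c1 c2 assume c12: "c1 \<in> charts M" "c2 \<in> charts M" "\<gamma> t \<in> cdom c1 \<inter> cdom c2"
    then have g12: "\<gamma> t \<in> cdom c1" "\<gamma> t \<in> cdom c2" by auto
    obtain D where D: "((cmap c2 \<circ> cinv c1) has_derivative D) (at (cmap c1 (\<gamma> t)) within cmap c1 ` (cdom c1 \<inter> cdom c2))"
      by (rule smooth_on_has_derivative[OF transition_smooth[OF c12(1,2)], of "cmap c1 (\<gamma> t)"]) (use c12 in auto)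
    have "((cmap c2 \<circ> \<gamma>) has_vector_derivative D (v c1)) (at t)"
      by (rule chart_change_derivative[OF c12(1,2) limitin_nhds_cdom[OF lim] limitin_nhds_cdom[OF lim] v D])
        (use c12 g12 in auto)
    then have "v c2 = D (v c1)" using vector_derivative_unique_at v[OF c12(2) g12(2)] by blast
    then show "\<exists>D. ((cmap c2 \<circ> cinv c1) has_derivative D) (at (cmap c1 (\<gamma> t)) within cmap c1 ` (cdom c1 \<inter> cdom c2)) \<and> v c2 = D (v c1)"
      using D by blast
  qed
  then have "(\<gamma> t, v) \<in> tfib (\<gamma> t)" by (simp add: mem_tfib)
  from has_velocityI[OF c ev _ this] v[OF c g] have "has_velocity M \<gamma> (\<gamma> t, v) t" by simp
  then show thesis by (rule that) (simp add: vc)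
qed

text \<open>A straight line in a chart, the standard curve with prescribed velocity at 0. Through
  it, facts on tangent vectors reduce to uniqueness of derivatives.\<close>

definition chart_line :: "('a, 'e) chart \<Rightarrow> 'a \<Rightarrow> 'e \<Rightarrow> real \<Rightarrow> 'a" where
  "chart_line c p w s = cinv c (cmap c p + s *\<^sub>R w)"

lemma chart_line:
  assumes c: "c \<in> charts M" and p: "p \<in> cdom c" and w: "w \<in> model M"
  shows "chart_line c p w 0 = p" "\<forall>\<^sub>F s in nhds 0. chart_line c p w s \<in> cdom c"
    "((cmap c \<circ> chart_line c p w) has_vector_derivative w) (at 0)"
proof -
  show 0: "chart_line c p w 0 = p" using cinv_cmap[OF c p] by (simp add: chart_line_def)
  obtain N where N: "open N" "cimage c = model M \<inter> N" using cimage_openin[OF c] by (auto simp: openin_open)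
  define I where "I = (\<lambda>s::real. cmap c p + s *\<^sub>R w) -` N"
  have I: "open I" unfolding I_def by (intro open_vimage N(1) continuous_intros)
  have 0: "0 \<in> I" using cmap_in_cimage[OF p] N(2) by (simp add: I_def)
  have im: "cmap c p + s *\<^sub>R w \<in> cimage c" if "s \<in> I" for s
    using that N(2) cmap_in_model[OF c p] w subspace_model by (simp add: I_def subspace_add subspace_scale)
  show "\<forall>\<^sub>F s in nhds 0. chart_line c p w s \<in> cdom c"
    unfolding eventually_nhds chart_line_def using I 0 im cmap_cinv(1)[OF c] by blast
  show "((cmap c \<circ> chart_line c p w) has_vector_derivative w) (at 0)"
  proof (rule has_vector_derivative_transform_within_open[OF _ I 0])
    show "((\<lambda>s. cmap c p + s *\<^sub>R w) has_vector_derivative w) (at 0)" by (auto intro!: derivative_eq_intros)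
    show "cmap c p + s *\<^sub>R w = (cmap c \<circ> chart_line c p w) s" if "s \<in> I" for s
      using cmap_cinv(2)[OF c im[OF that]] by (simp add: chart_line_def)
  qed
qed

lemma tfib_eqI:
  assumes "\<xi> \<in> tfib p" "\<eta> \<in> tfib p" "c \<in> charts M" "p \<in> cdom c" "snd \<xi> c = snd \<eta> c"
  shows "\<xi> = \<eta>"
proof -
  note l = chart_line[OF assms(3,4) tfib_model[OF assms(1,3,4)]]
  have "has_velocity M (chart_line c p (snd \<xi> c)) \<xi> 0"
    by (rule has_velocityI[OF assms(3) l(2,3)]) (use l(1) assms in simp)
  moreover have "has_velocity M (chart_line c p (snd \<xi> c)) \<eta> 0"
    by (rule has_velocityI[OF assms(3) l(2)]) (use l(1,3) assms in simp_all)
  ultimately show ?thesis by (rule has_velocity_unique)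
qed

lemma coord_tangent_unique:
  assumes "\<xi> \<in> tfib p" "c \<in> charts M" "p \<in> cdom c" shows "coord_tangent M c p (snd \<xi> c) = \<xi>"
  unfolding coord_tangent_def
proof (rule the_equality)
  fix \<eta> assume "\<eta> \<in> tfib p \<and> snd \<eta> c = snd \<xi> c"
  then show "\<eta> = \<xi>" using tfib_eqI[OF _ assms, of \<eta>] by blast
qed (use assms in simp)

lemma coord_tangent:
  assumes "c \<in> charts M" "p \<in> cdom c" "w \<in> model M"
  shows "coord_tangent M c p w \<in> tfib p" "snd (coord_tangent M c p w) c = w"
proof -
  note l = chart_line[OF assms]
  obtain \<xi> where \<xi>: "has_velocity M (chart_line c p w) \<xi> 0" "snd \<xi> c = w"
    by (rule has_velocity_exists[OF assms(1) l(2,3)])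
  then have "\<xi> \<in> tfib p" using has_velocity_tfib l(1) by metis
  then have "coord_tangent M c p w = \<xi>" using coord_tangent_unique[OF _ assms(1,2), of \<xi>] \<xi>(2) by simp
  then show "coord_tangent M c p w \<in> tfib p" "snd (coord_tangent M c p w) c = w"
    using \<xi> \<open>\<xi> \<in> tfib p\<close> by auto
qed

abbreviation sc :: "real \<Rightarrow> ('a, 'e) tangent \<Rightarrow> ('a, 'e) tangent" where
  "sc \<equiv> fscale (tangent_bundle M)"

lemma sc_simps [simp]: "fst (sc a \<xi>) = fst \<xi>" "snd (sc a \<xi>) c = a *\<^sub>R snd \<xi> c"
  by (simp_all add: tangent_bundle_def)

lemma sc_1 [simp]: "sc 1 \<xi> = \<xi>"
  by (simp add: tangent_bundle_def)

lemma sc_tfib: "\<xi> \<in> tfib p \<Longrightarrow> sc a \<xi> \<in> tfib p"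
  by (rule fibre_tangent_bundle[OF atlas])

lemma has_velocity_cong:
  assumes "open N" "t \<in> N" "\<And>s. s \<in> N \<Longrightarrow> \<gamma> s = \<gamma>' s" "has_velocity M \<gamma> \<xi> t"
  shows "has_velocity M \<gamma>' \<xi> t"
proof -
  have g: "\<gamma> t = \<gamma>' t" using assms by blast
  obtain c where c: "c \<in> charts M" "\<gamma> t \<in> cdom c"
    using chart_around[OF tfib_points[OF has_velocity_tfib[OF assms(4)]]] by blast
  note v = has_velocity_cdom[OF assms(4) c]
  have evN: "\<forall>\<^sub>F s in nhds t. s \<in> N" using assms(1,2) by (rule eventually_nhds_in_open)
  show ?thesis
  proof (rule has_velocityI[OF c(1)])
    show "\<forall>\<^sub>F s in nhds t. \<gamma>' s \<in> cdom c"
      using v(1) evN by eventually_elim (use assms(3) in auto)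
    show "((cmap c \<circ> \<gamma>') has_vector_derivative snd \<xi> c) (at t)"
      by (rule has_vector_derivative_transform_within_open[OF v(2) assms(1,2)]) (use assms(3) in auto)
    show "\<xi> \<in> tfib (\<gamma>' t)" using has_velocity_tfib[OF assms(4)] g by simp
  qed
qed

lemma has_velocity_reparam:
  assumes v: "has_velocity M \<gamma> \<xi> (s t)" and s: "(s has_real_derivative k) (at t)"
  shows "has_velocity M (\<lambda>u. \<gamma> (s u)) (sc k \<xi>) t"
proof -
  obtain c where c: "c \<in> charts M" "\<gamma> (s t) \<in> cdom c"
    using chart_around[OF tfib_points[OF has_velocity_tfib[OF v]]] by blast
  note w = has_velocity_cdom[OF v c]
  have lim: "filterlim s (nhds (s t)) (nhds t)"
    using DERIV_isCont[OF s] unfolding isCont_def by (simp add: tendsto_nhds_iff)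
  show ?thesis
  proof (rule has_velocityI[OF c(1)])
    show "\<forall>\<^sub>F u in nhds t. \<gamma> (s u) \<in> cdom c"
      by (rule eventually_compose_filterlim[OF w(1) lim])
    have "((cmap c \<circ> \<gamma>) \<circ> s has_vector_derivative k *\<^sub>R snd \<xi> c) (at t)"
      by (rule vector_diff_chain_at) (use s w(2) in \<open>simp_all add: has_real_derivative_iff_has_vector_derivative\<close>)
    then show "((cmap c \<circ> (\<lambda>u. \<gamma> (s u))) has_vector_derivative snd (sc k \<xi>) c) (at t)"
      by (simp add: o_def)
    show "sc k \<xi> \<in> tfib (\<gamma> (s t))" by (rule sc_tfib[OF has_velocity_tfib[OF v]])
  qed
qed

lemma has_velocity_shift:
  assumes "has_velocity M \<gamma> \<xi> (t + s)" shows "has_velocity M (\<lambda>u. \<gamma> (u + s)) \<xi> t"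
proof -
  have "((\<lambda>u. u + s) has_real_derivative 1) (at t)" by (auto intro!: derivative_eq_intros)
  from has_velocity_reparam[OF assms this] show ?thesis by simp
qed

end

section \<open>The flow of a vector field\<close>

locale smooth_vf = smooth_mfd M
  for M :: "('a, 'e::euclidean_space) manifold" +
  fixes X :: "'a \<Rightarrow> ('a, 'e) tangent"
  assumes vector_field: "smooth_vector_field M X"
begin

lemma X_tfib: "p \<in> points M \<Longrightarrow> X p \<in> tfib p"
  using vector_field by (simp add: smooth_vector_field_def smooth_section_def tangent_bundle_def)

definition vfc :: "('a, 'e) chart \<Rightarrow> 'e \<Rightarrow> 'e" where
  "vfc c z = snd (X (cinv c z)) c"

lemma vfc_cmap: "c \<in> charts M \<Longrightarrow> p \<in> cdom c \<Longrightarrow> vfc c (cmap c p) = snd (X p) c"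
  by (simp add: vfc_def cinv_cmap)

lemma vfc_model:
  assumes "c \<in> charts M" "z \<in> cimage c" shows "vfc c z \<in> model M"
proof -
  note z = cmap_cinv(1)[OF assms]
  show ?thesis unfolding vfc_def by (rule tfib_model[OF X_tfib[OF subsetD[OF cdom_subset[OF assms(1)] z]] assms(1) z])
qed

text \<open>The coordinate expression of X is the second component of its expression in the bundle
  chart that uses c for both the base point and the fibre.\<close>

lemma vfc_smooth:
  assumes c: "c \<in> charts M" shows "smooth_on (cimage c) (vfc c)"
proof -
  let ?T = "total_manifold (tangent_bundle M)"
  define C :: "('a \<times> ('a set \<times> ('a \<Rightarrow> 'e) \<Rightarrow> 'e)) set \<times> ('a \<times> ('a set \<times> ('a \<Rightarrow> 'e) \<Rightarrow> 'e) \<Rightarrow> 'e \<times> 'e)"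
    where "C = ({v \<in> tangent_vectors M. fst v \<in> cdom c \<inter> cdom c}, \<lambda>v. (cmap c (fst v), snd v c))"
  have C: "C \<in> charts ?T" unfolding charts_tangent_bundle C_def using c by blast
  have "smooth_map M ?T X"
    using vector_field by (simp add: smooth_vector_field_def smooth_section_def tangent_bundle_def)
  then have "smooth_into ?T (cimage c) (X \<circ> cinv c)" using c unfolding smooth_map_def by (rule bspec)
  then have s: "smooth_on (cimage c \<inter> (X \<circ> cinv c) -` cdom C) (cmap C \<circ> (X \<circ> cinv c))"
    using C unfolding smooth_into_def by blast
  have eq: "cimage c \<inter> (X \<circ> cinv c) -` cdom C = cimage c"
  proof -
    have "X (cinv c z) \<in> cdom C" if "z \<in> cimage c" for z
    proof -
      have d: "cinv c z \<in> cdom c" by (rule cmap_cinv(1)[OF c that])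
      then have "X (cinv c z) \<in> tfib (cinv c z)" using X_tfib cdom_subset[OF c] by blast
      then show ?thesis using d by (simp add: C_def mem_tfib)
    qed
    then show ?thesis by auto
  qed
  have "smooth_on (cimage c) (\<lambda>z. snd ((cmap C \<circ> (X \<circ> cinv c)) z))"
    by (rule smooth_on_linear_compose[OF bounded_linear_snd]) (use s eq in \<open>simp add: o_def\<close>)
  then show ?thesis by (rule smooth_on_cong[rotated]) (simp add: C_def vfc_def)
qed

text \<open>Smoothness on a subset means local extendability, so the Lipschitz estimate comes from
  an extension to an open set and holds on the slice of a ball by the model subspace.\<close>

lemma vfc_local_lipschitz:
  assumes c: "c \<in> charts M" and p: "p \<in> cdom c"
  obtains \<rho> L B where "\<rho> > 0" "L \<ge> 0" "B \<ge> 0" "cball (cmap c p) \<rho> \<inter> model M \<subseteq> cimage c"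
    "\<forall>y\<in>cball (cmap c p) \<rho> \<inter> model M. \<forall>z\<in>cball (cmap c p) \<rho> \<inter> model M.
       norm (vfc c y - vfc c z) \<le> L * norm (y - z)"
    "\<forall>y\<in>cball (cmap c p) \<rho> \<inter> model M. norm (vfc c y) \<le> B"
proof -
  let ?x = "cmap c p"
  obtain U h where U: "open U" "?x \<in> U" "Cinf_on U h" "\<And>y. y \<in> cimage c \<Longrightarrow> y \<in> U \<Longrightarrow> h y = vfc c y"
    using smooth_onE[OF vfc_smooth[OF c] cmap_in_cimage[OF p]] by metis
  obtain \<rho>1 L where 1: "\<rho>1 > 0" "cball ?x \<rho>1 \<subseteq> U" "L \<ge> 0"
    "\<And>y z. \<lbrakk>y \<in> cball ?x \<rho>1; z \<in> cball ?x \<rho>1\<rbrakk> \<Longrightarrow> norm (h y - h z) \<le> L * norm (y - z)"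
    using Cinf_on_local_lipschitz[OF U(3,1,2)] by metis
  obtain \<rho>2 where 2: "\<rho>2 > 0" "cball ?x \<rho>2 \<inter> model M \<subseteq> cmap c ` (cdom c \<inter> cdom c)"
    by (rule chart_ball[OF c p openin_cdom[OF c] p])
  define \<rho> where "\<rho> = min \<rho>1 \<rho>2"
  have sub: "cball ?x \<rho> \<subseteq> cball ?x \<rho>1" "cball ?x \<rho> \<subseteq> cball ?x \<rho>2" by (auto simp: \<rho>_def)
  have im: "cball ?x \<rho> \<inter> model M \<subseteq> cimage c" using sub(2) 2(2) unfolding cimage_def by auto
  have hv: "h y = vfc c y" if "y \<in> cball ?x \<rho> \<inter> model M" for y
  proof (rule U(4))
    show "y \<in> cimage c" using im that by (rule subsetD)
    show "y \<in> U" using that sub(1) 1(2) by blast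
  qed
  have lip: "norm (vfc c y - vfc c z) \<le> L * norm (y - z)"
    if y: "y \<in> cball ?x \<rho> \<inter> model M" and z: "z \<in> cball ?x \<rho> \<inter> model M" for y z
    using 1(4)[of y z] hv[OF y] hv[OF z] subsetD[OF sub(1), of y] subsetD[OF sub(1), of z] y z by simp
  have x: "?x \<in> cball ?x \<rho> \<inter> model M" using 1(1) 2(1) cmap_in_model[OF c p] by (simp add: \<rho>_def)
  show thesis
  proof (rule that[of \<rho> L "norm (vfc c ?x) + L * \<rho>"]; (rule ballI)?)
    fix y assume y: "y \<in> cball ?x \<rho> \<inter> model M"
    have "norm (vfc c y - vfc c ?x) \<le> L * \<rho>"
      using order_trans[OF lip[OF y x] mult_left_mono[OF _ 1(3), of "norm (y - ?x)" \<rho>]] y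
      by (simp add: dist_norm norm_minus_commute)
    then show "norm (vfc c y) \<le> norm (vfc c ?x) + L * \<rho>"
      using norm_triangle_ineq2[of "vfc c y" "vfc c ?x"] by linarith
  qed (use 1 2 im lip in \<open>auto simp: \<rho>_def\<close>)
qed

text \<open>Uniqueness for the non-autonomous equation \<open>\<gamma>' = b X(\<gamma>)\<close>; it covers both the flow and
  $A$-paths, whose velocity is undefined at finitely many parameters.\<close>

lemma scaled_curves_unique:
  assumes cu: "curve_on {\<alpha>..\<beta>} \<gamma>1" "curve_on {\<alpha>..\<beta>} \<gamma>2" and fin: "finite P"
    and b: "\<And>t. \<bar>b t\<bar> \<le> B"
    and v1: "\<And>t. t \<in> {\<alpha><..<\<beta>} - P \<Longrightarrow> has_velocity M \<gamma>1 (sc (b t) (X (\<gamma>1 t))) t"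
    and v2: "\<And>t. t \<in> {\<alpha><..<\<beta>} - P \<Longrightarrow> has_velocity M \<gamma>2 (sc (b t) (X (\<gamma>2 t))) t"
    and t0: "t0 \<in> {\<alpha>..\<beta>}" "\<gamma>1 t0 = \<gamma>2 t0" and t: "t \<in> {\<alpha>..\<beta>}"
  shows "\<gamma>1 t = \<gamma>2 t"
proof -
  \<comment> \<open>Agreement and disagreement of the curves both persist nearby, the former by
    Gronwall in a chart, the latter by the Hausdorff property. The interval being connected, one
    instance of agreement spreads to all of it.\<close>
  have "(\<gamma>1 t0 = \<gamma>2 t0) = (\<gamma>1 t = \<gamma>2 t)"
  proof (rule connected_local_const[where f = "\<lambda>s. \<gamma>1 s = \<gamma>2 s", OF connected_Icc t0(1) t], rule ballI)
    fix a assume a: "a \<in> {\<alpha>..\<beta>}"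
    have L: "limitin mtop \<gamma>1 (\<gamma>1 a) (at a within {\<alpha>..\<beta>})" "limitin mtop \<gamma>2 (\<gamma>2 a) (at a within {\<alpha>..\<beta>})"
      using cu a by (simp_all add: curve_on_def)
    have pts: "\<gamma>1 a \<in> points M" "\<gamma>2 a \<in> points M" using curve_on_points[OF cu(1) a] curve_on_points[OF cu(2) a] .
    show "\<forall>\<^sub>F s in at a within {\<alpha>..\<beta>}. (\<gamma>1 a = \<gamma>2 a) = (\<gamma>1 s = \<gamma>2 s)"
    proof (cases "\<gamma>1 a = \<gamma>2 a")
      case False
      then obtain U V where UV: "openin mtop U" "openin mtop V" "\<gamma>1 a \<in> U" "\<gamma>2 a \<in> V" "disjnt U V"
        using Hausdorff pts unfolding Hausdorff_space_def topspace_mtop by metis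
      show ?thesis
        using limitinD[OF L(1) UV(1,3)] limitinD[OF L(2) UV(2,4)]
        by eventually_elim (use False UV(5) in \<open>auto simp: disjnt_iff\<close>)
    next
      case True
      obtain c where c: "c \<in> charts M" "\<gamma>1 a \<in> cdom c" using chart_around[OF pts(1)] by blast
      obtain \<rho> K C where \<rho>: "\<rho> > 0" "K \<ge> 0" "C \<ge> 0" "cball (cmap c (\<gamma>1 a)) \<rho> \<inter> model M \<subseteq> cimage c"
        "\<forall>y\<in>cball (cmap c (\<gamma>1 a)) \<rho> \<inter> model M. \<forall>z\<in>cball (cmap c (\<gamma>1 a)) \<rho> \<inter> model M.
           norm (vfc c y - vfc c z) \<le> K * norm (y - z)"
        "\<forall>y\<in>cball (cmap c (\<gamma>1 a)) \<rho> \<inter> model M. norm (vfc c y) \<le> C"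
        by (rule vfc_local_lipschitz[OF c])
      have ev: "\<forall>\<^sub>F s in at a within {\<alpha>..\<beta>}. \<gamma> s \<in> cdom c \<and> cmap c (\<gamma> s) \<in> cball (cmap c (\<gamma>1 a)) \<rho>"
        if "limitin mtop \<gamma> (\<gamma>1 a) (at a within {\<alpha>..\<beta>})" for \<gamma>
      proof -
        note l = that[unfolded limitin_chart[OF c]]
        have "\<forall>\<^sub>F s in at a within {\<alpha>..\<beta>}. dist (cmap c (\<gamma> s)) (cmap c (\<gamma>1 a)) < \<rho>"
          using l \<rho>(1) by (blast dest: tendstoD)
        with conjunct1[OF l] show ?thesis by eventually_elim (simp add: dist_commute)
      qed
      have "\<forall>\<^sub>F s in at a within {\<alpha>..\<beta>}. (\<gamma>1 s \<in> cdom c \<and> cmap c (\<gamma>1 s) \<in> cball (cmap c (\<gamma>1 a)) \<rho>) \<and>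
          (\<gamma>2 s \<in> cdom c \<and> cmap c (\<gamma>2 s) \<in> cball (cmap c (\<gamma>1 a)) \<rho>)"
        using eventually_conj[OF ev[OF L(1)] ev[OF L(2)[folded True]]] .
      then obtain e where e: "e > 0" "\<And>s. \<lbrakk>s \<in> {\<alpha>..\<beta>}; s \<noteq> a; dist s a < e\<rbrakk> \<Longrightarrow>
          (\<gamma>1 s \<in> cdom c \<and> cmap c (\<gamma>1 s) \<in> cball (cmap c (\<gamma>1 a)) \<rho>) \<and>
          (\<gamma>2 s \<in> cdom c \<and> cmap c (\<gamma>2 s) \<in> cball (cmap c (\<gamma>1 a)) \<rho>)"
        unfolding eventually_at by blast
      have near: "\<gamma>1 s \<in> cdom c" "cmap c (\<gamma>1 s) \<in> cball (cmap c (\<gamma>1 a)) \<rho> \<inter> model M"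
        "\<gamma>2 s \<in> cdom c" "cmap c (\<gamma>2 s) \<in> cball (cmap c (\<gamma>1 a)) \<rho> \<inter> model M"
        if s: "s \<in> {\<alpha>..\<beta>}" "\<bar>s - a\<bar> < e" for s
      proof -
        have "\<gamma>1 s \<in> cdom c \<and> cmap c (\<gamma>1 s) \<in> cball (cmap c (\<gamma>1 a)) \<rho> \<and>
          \<gamma>2 s \<in> cdom c \<and> cmap c (\<gamma>2 s) \<in> cball (cmap c (\<gamma>1 a)) \<rho>"
        proof (cases "s = a")
          case True
          then show ?thesis using c(2) \<open>\<gamma>1 a = \<gamma>2 a\<close> \<rho>(1) by simp
        next
          case False
          then show ?thesis using e(2)[OF s(1) False] s(2) by (simp add: dist_real_def)
        qed
        then show "\<gamma>1 s \<in> cdom c" "cmap c (\<gamma>1 s) \<in> cball (cmap c (\<gamma>1 a)) \<rho> \<inter> model M"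
          "\<gamma>2 s \<in> cdom c" "cmap c (\<gamma>2 s) \<in> cball (cmap c (\<gamma>1 a)) \<rho> \<inter> model M"
          using cmap_in_model[OF c(1)] by blast+
      qed
      have "\<gamma>1 s = \<gamma>2 s" if s: "s \<in> {\<alpha>..\<beta>}" "\<bar>s - a\<bar> < e/2" for s
      proof -
        \<comment> \<open>Half of the radius, so that the closed interval around a lies where both
          curves are in the chart; its ends are cut off at \<alpha> and \<beta>, as a may be an
          endpoint.\<close>
        define lo where "lo = max \<alpha> (a - e/2)"
        define hi where "hi = min \<beta> (a + e/2)"
        have I: "u \<in> {\<alpha>..\<beta>}" "\<bar>u - a\<bar> < e" if "u \<in> {lo..hi}" for u
          using that e(1) by (auto simp: lo_def hi_def)
        have se: "a - e/2 \<le> s" "s \<le> a + e/2" using s(2) by linarith+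
        have Io: "u \<in> {\<alpha><..<\<beta>}" if "u \<in> {lo<..<hi}" for u
          using that by (auto simp: lo_def hi_def)
        have "(\<lambda>u. cmap c (\<gamma>1 u) - cmap c (\<gamma>2 u)) s = 0"
        proof (rule gronwall_zero[where z = "\<lambda>u. cmap c (\<gamma>1 u) - cmap c (\<gamma>2 u)" and t = s and a = lo and b = hi and t0 = a and P = P and L = "B * K"
              and z' = "\<lambda>u. b u *\<^sub>R (vfc c (cmap c (\<gamma>1 u)) - vfc c (cmap c (\<gamma>2 u)))"])
          show "continuous_on {lo..hi} (\<lambda>u. cmap c (\<gamma>1 u) - cmap c (\<gamma>2 u))"
            by (intro continuous_on_diff curve_on_cmap_continuous[OF cu(1) _ c(1)]
                curve_on_cmap_continuous[OF cu(2) _ c(1)] subsetI image_subsetI I near)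
          fix u assume u: "u \<in> {lo<..<hi} - P"
          then have u1: "u \<in> {lo..hi}" "u \<in> {\<alpha><..<\<beta>} - P" using Io by auto
          note n = near[OF I[OF u1(1)]]
          have "((cmap c \<circ> \<gamma>1) has_vector_derivative b u *\<^sub>R vfc c (cmap c (\<gamma>1 u))) (at u)"
            using has_velocity_cdom(2)[OF v1[OF u1(2)] c(1) n(1)] by (simp add: vfc_cmap[OF c(1) n(1)])
          moreover have "((cmap c \<circ> \<gamma>2) has_vector_derivative b u *\<^sub>R vfc c (cmap c (\<gamma>2 u))) (at u)"
            using has_velocity_cdom(2)[OF v2[OF u1(2)] c(1) n(3)] by (simp add: vfc_cmap[OF c(1) n(3)])
          ultimately show "((\<lambda>u. cmap c (\<gamma>1 u) - cmap c (\<gamma>2 u)) has_vector_derivative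
              b u *\<^sub>R (vfc c (cmap c (\<gamma>1 u)) - vfc c (cmap c (\<gamma>2 u)))) (at u)"
            using has_vector_derivative_diff by (fastforce simp: o_def scaleR_diff_right)
          have "norm (b u *\<^sub>R (vfc c (cmap c (\<gamma>1 u)) - vfc c (cmap c (\<gamma>2 u)))) \<le>
              B * (K * norm (cmap c (\<gamma>1 u) - cmap c (\<gamma>2 u)))"
            unfolding norm_scaleR
            by (intro mult_mono b \<rho>(5)[rule_format] n) (use order_trans[OF abs_ge_zero b] in auto)
          then show "norm (b u *\<^sub>R (vfc c (cmap c (\<gamma>1 u)) - vfc c (cmap c (\<gamma>2 u)))) \<le>
              B * K * norm (cmap c (\<gamma>1 u) - cmap c (\<gamma>2 u))" by (simp add: mult.assoc)
        qed (use fin a True e(1) s(1) se in \<open>auto simp: lo_def hi_def\<close>)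
        moreover have "\<bar>s - a\<bar> < e" using s(2) e(1) by linarith
        ultimately show ?thesis using inj_onD[OF chart_inj[OF c(1)]] near[OF s(1)] by simp
      qed
      then show ?thesis unfolding eventually_at using e(1) True
        by (intro exI[of _ "e/2"]) (auto simp: dist_real_def)
    qed
  qed
  then show ?thesis using t0 by simp
qed

text \<open>The coordinate field lives on the chart only, while \<open>picard\<close> needs a
  Lipschitz field on the whole space. Precomposition with the nearest-point projection to a closed
  convex piece K of the chart provides one with the same constant. Solutions that start in the half
  ball remain in K for a short time, and there they solve the original equation.\<close>

lemma local_flow:
  assumes p: "p \<in> points M"
  obtains U a \<Phi> where "openin mtop U" "p \<in> U" "a > 0" "\<And>x. x \<in> U \<Longrightarrow> \<Phi> x 0 = x"
    "\<And>x t. \<lbrakk>x \<in> U; \<bar>t\<bar> < a\<rbrakk> \<Longrightarrow> has_velocity M (\<Phi> x) (X (\<Phi> x t)) t"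
    "\<And>x t f \<tau>. \<lbrakk>x \<in> U; \<bar>t\<bar> < a; limitin mtop f x sequentially; \<tau> \<longlonglongrightarrow> t\<rbrakk> \<Longrightarrow>
       limitin mtop (\<lambda>n::nat. \<Phi> (f n) (\<tau> n)) (\<Phi> x t) sequentially"
proof -
  obtain c where c: "c \<in> charts M" "p \<in> cdom c" using chart_around[OF p] by blast
  let ?z = "cmap c p"
  obtain \<rho> L B where \<rho>: "\<rho> > 0" "L \<ge> 0" "B \<ge> 0" "cball ?z \<rho> \<inter> model M \<subseteq> cimage c"
    "\<forall>y\<in>cball ?z \<rho> \<inter> model M. \<forall>z\<in>cball ?z \<rho> \<inter> model M.
       norm (vfc c y - vfc c z) \<le> L * norm (y - z)"
    "\<forall>y\<in>cball ?z \<rho> \<inter> model M. norm (vfc c y) \<le> B"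
    by (rule vfc_local_lipschitz[OF c])
  define K where "K = cball ?z \<rho> \<inter> model M"
  have zK: "?z \<in> K" using \<rho>(1) cmap_in_model[OF c] by (simp add: K_def)
  have K: "closed K" "convex K" "K \<noteq> {}" "K \<subseteq> cimage c"
  proof -
    show "K \<noteq> {}" using zK by blast
  qed (use closed_model subspace_imp_convex[OF subspace_model] \<rho>(4) in \<open>auto simp: K_def intro: convex_Int\<close>)
  define F where "F = (\<lambda>y. vfc c (closest_point K y))"
  have cp: "closest_point K y \<in> K" for y by (rule closest_point_in_set[OF K(1,3)])
  have F: "dist (F x) (F y) \<le> L * dist x y" for x y
  proof -
    have "dist (F x) (F y) \<le> L * dist (closest_point K x) (closest_point K y)"
      using \<rho>(5) cp unfolding F_def K_def dist_norm by blast
    also have "\<dots> \<le> L * dist x y"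
      by (intro mult_left_mono closest_point_lipschitz K \<rho>)
    finally show ?thesis .
  qed
  have FB: "norm (F y) \<le> B" and Fm: "F y \<in> model M" for y
  proof -
    show "norm (F y) \<le> B" using \<rho>(6) cp unfolding F_def K_def by blast
    show "F y \<in> model M" unfolding F_def by (rule vfc_model[OF c(1) subsetD[OF K(4) cp]])
  qed
  \<comment> \<open>The first bound makes the integral operator contract, the second keeps the
    displacement below \<rho>/2, as the field is bounded by B. Adding 1 covers the cases L = 0 and B
    = 0.\<close>
  define a where "a = min (1 / (2 * (L + 1))) (\<rho> / (2 * (B + 1)))"
  have a: "a > 0" using \<rho> by (simp add: a_def)
  have aL: "a * L \<le> 1/2"
  proof -
    have "a * L \<le> 1 / (2 * (L + 1)) * L" using \<rho>(2) by (intro mult_right_mono) (auto simp: a_def)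
    also have "\<dots> \<le> 1/2" using \<rho>(2) by (simp add: field_simps)
    finally show ?thesis .
  qed
  have aB: "B * a < \<rho>/2"
  proof -
    have "B * a \<le> B * (\<rho> / (2 * (B + 1)))" using \<rho>(3) by (intro mult_left_mono) (auto simp: a_def)
    also have "\<dots> < \<rho>/2" using \<rho>(1,3) by (simp add: field_simps)
    finally show ?thesis .
  qed
  obtain u where u: "\<And>x. u x 0 = x" "\<And>x. continuous_on {-a..a} (u x)"
    "\<And>x t. t \<in> {-a<..<a} \<Longrightarrow> (u x has_vector_derivative F (u x t)) (at t)"
    "\<And>x y t. t \<in> {-a..a} \<Longrightarrow> dist (u x t) (u y t) \<le> 2 * dist x y"
    using picard[OF F \<rho>(2) a aL] by metis
  have uK: "u x t \<in> K" if x: "x \<in> ball ?z (\<rho>/2) \<inter> model M" and t: "\<bar>t\<bar> < a" for x t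
  proof -
    have tI: "t \<in> {-a<..<a}" "0 \<in> {-a<..<a}" using t a by auto
    have "norm (u x t - u x 0) \<le> B * \<bar>t - 0\<bar>"
      by (rule vector_derivative_bound[where S = "{-a<..<a}" and f' = "\<lambda>t. F (u x t)"])
        (use u(3) FB tI in \<open>auto intro: has_vector_derivative_at_within\<close>)
    also have "\<dots> \<le> B * a" using t \<rho>(3) by (intro mult_left_mono) auto
    finally have "dist x (u x t) < \<rho>/2" using aB u(1)[of x] by (simp add: dist_norm norm_minus_commute)
    then have "dist ?z (u x t) < \<rho>" using x dist_triangle[of ?z "u x t" x] by simp
    \<comment> \<open>F takes values in the model subspace, so the orthogonal component of the
      solution is constant, and it vanishes at the start.\<close>
    moreover have "u x t \<in> model M"
    proof -
      obtain y z where yz: "y \<in> span (model M)" "\<And>v. v \<in> span (model M) \<Longrightarrow> orthogonal z v" "u x t = y + z"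
        using orthogonal_subspace_decomp_exists[of "model M" "u x t"] by metis
      have sp: "span (model M) = model M" using subspace_model by (simp add: span_eq_iff)
      have d: "((\<lambda>s. z \<bullet> u x s) has_vector_derivative 0) (at s within {-a<..<a})" if "s \<in> {-a<..<a}" for s
      proof -
        have "((\<lambda>s. z \<bullet> u x s) has_vector_derivative z \<bullet> F (u x s)) (at s)"
          using bounded_linear.has_vector_derivative[OF bounded_linear_inner_right u(3)[OF that]] .
        moreover have "z \<bullet> F (u x s) = 0" using yz(2)[of "F (u x s)"] Fm sp by (simp add: orthogonal_def)
        ultimately show ?thesis by (simp add: has_vector_derivative_at_within)
      qed
      have "norm (z \<bullet> u x t - z \<bullet> u x 0) \<le> 0 * \<bar>t - 0\<bar>"
        by (rule vector_derivative_bound[OF d]) (use tI in auto)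
      then have "z \<bullet> u x t = z \<bullet> x" using u(1)[of x] by simp
      also have "z \<bullet> x = 0" using yz(2)[of x] x sp by (simp add: orthogonal_def)
      finally have "z = 0" using yz(1,2,3) by (simp add: inner_add_right orthogonal_def)
      then show ?thesis using yz sp by simp
    qed
    ultimately show ?thesis by (simp add: K_def)
  qed
  define W where "W = ball ?z (\<rho>/2) \<inter> model M"
  have W: "openin (top_of_set (model M)) W" "W \<subseteq> cimage c" "W \<subseteq> ball ?z (\<rho>/2) \<inter> model M"
    using \<rho>(1,4) openin_open_Int[of "ball ?z (\<rho>/2)" "model M"] by (auto simp: W_def Int_commute)
  define \<Phi> where "\<Phi> = (\<lambda>x t. cinv c (u (cmap c x) t))"
  have inW: "cmap c x \<in> ball ?z (\<rho>/2) \<inter> model M" "x \<in> cdom c" if xW: "x \<in> cinv c ` W" for x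
  proof -
    obtain z where z: "z \<in> W" "x = cinv c z" using xW by blast
    then have "cmap c x = z" "x \<in> cdom c" using cmap_cinv[OF c(1) subsetD[OF W(2) z(1)]] by simp_all
    then show "cmap c x \<in> ball ?z (\<rho>/2) \<inter> model M" "x \<in> cdom c" using z(1) W(3) by blast+
  qed
  have \<Phi>: "\<Phi> x t \<in> cdom c" "cmap c (\<Phi> x t) = u (cmap c x) t" if "x \<in> cinv c ` W" "\<bar>t\<bar> < a" for x t
    using cmap_cinv[OF c(1) subsetD[OF K(4) uK[OF inW(1)[OF that(1)] that(2)]]] by (simp_all add: \<Phi>_def)
  show thesis
  proof (rule that[of "cinv c ` W" a \<Phi>])
    show "openin mtop (cinv c ` W)" by (rule openin_cinv_image[OF c(1) W(1,2)])
    have "?z \<in> W" using \<rho>(1) cmap_in_model[OF c] by (simp add: W_def)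
    then show "p \<in> cinv c ` W" using cinv_cmap[OF c] by (metis imageI)
    show "a > 0" by (rule a)
    show "\<Phi> x 0 = x" if "x \<in> cinv c ` W" for x
      using u(1) cinv_cmap[OF c(1) inW(2)[OF that]] by (simp add: \<Phi>_def)
    show "has_velocity M (\<Phi> x) (X (\<Phi> x t)) t" if x: "x \<in> cinv c ` W" and t: "\<bar>t\<bar> < a" for x t
    proof (rule has_velocityI[OF c(1)])
      have ev: "\<forall>\<^sub>F s in nhds t. s \<in> {-a<..<a}" using t by (intro eventually_nhds_in_open) auto
      then show "\<forall>\<^sub>F s in nhds t. \<Phi> x s \<in> cdom c"
        by eventually_elim (use \<Phi>(1)[OF x] in \<open>simp add: abs_less_iff\<close>)
      have "closest_point K (u (cmap c x) t) = u (cmap c x) t"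
        using closest_point_self[OF uK[OF inW(1)[OF x] t]] .
      then have Fu: "F (u (cmap c x) t) = snd (X (\<Phi> x t)) c"
        unfolding F_def by (simp add: vfc_cmap[OF c(1) \<Phi>(1)[OF x t], symmetric] \<Phi>(2)[OF x t])
      have tI: "t \<in> {-a<..<a}" using t by auto
      show "((cmap c \<circ> \<Phi> x) has_vector_derivative snd (X (\<Phi> x t)) c) (at t)"
      proof (rule has_vector_derivative_transform_within_open[of "u (cmap c x)" _ _ "{-a<..<a}"])
        show "(u (cmap c x) has_vector_derivative snd (X (\<Phi> x t)) c) (at t)"
          using u(3)[OF tI, of "cmap c x"] Fu by simp
        show "u (cmap c x) s = (cmap c \<circ> \<Phi> x) s" if "s \<in> {-a<..<a}" for s
          using \<Phi>(2)[OF x, of s] that by (simp add: abs_less_iff)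
      qed (use tI in auto)
      show "X (\<Phi> x t) \<in> tfib (\<Phi> x t)"
        by (rule X_tfib[OF subsetD[OF cdom_subset[OF c(1)] \<Phi>(1)[OF x t]]])
    qed
    show "limitin mtop (\<lambda>n::nat. \<Phi> (f n) (\<tau> n)) (\<Phi> x t) sequentially"
      if x: "x \<in> cinv c ` W" and t: "\<bar>t\<bar> < a" and f: "limitin mtop f x sequentially" and \<tau>: "\<tau> \<longlonglongrightarrow> t"
      for x t f \<tau>
      unfolding limitin_chart[OF c(1) \<Phi>(1)[OF x t]]
    proof
      have evt: "\<forall>\<^sub>F n in sequentially. \<tau> n \<in> {-a<..<a}"
        using t by (intro topological_tendstoD[OF \<tau>]) auto
      have evf: "\<forall>\<^sub>F n in sequentially. f n \<in> cinv c ` W"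
        by (rule limitinD[OF f openin_cinv_image[OF c(1) W(1,2)] x])
      have fc: "(\<lambda>n. cmap c (f n)) \<longlonglongrightarrow> cmap c x"
        using f limitin_chart[OF c(1) inW(2)[OF x]] by blast
      show "\<forall>\<^sub>F n in sequentially. \<Phi> (f n) (\<tau> n) \<in> cdom c"
        using evt evf by eventually_elim (simp add: \<Phi>(1) abs_less_iff)
      have ut: "(\<lambda>n. u (cmap c x) (\<tau> n)) \<longlonglongrightarrow> u (cmap c x) t"
      proof (rule isCont_tendsto_compose[OF _ \<tau>])
        show "isCont (u (cmap c x)) t"
          using has_vector_derivative_continuous[OF u(3)] t by (simp add: abs_less_iff)
      qed
      have lim0: "(\<lambda>n. 2 * dist (cmap c (f n)) (cmap c x) + dist (u (cmap c x) (\<tau> n)) (u (cmap c x) t)) \<longlonglongrightarrow> 2 * 0 + 0"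
        using fc ut by (intro tendsto_add tendsto_mult tendsto_const) (simp_all add: tendsto_dist_iff[symmetric])
      show "(\<lambda>n. cmap c (\<Phi> (f n) (\<tau> n))) \<longlonglongrightarrow> cmap c (\<Phi> x t)"
        unfolding tendsto_dist_iff[of _ "cmap c (\<Phi> x t)"]
      proof (rule Lim_null_comparison)
        show "\<forall>\<^sub>F n in sequentially. norm (dist (cmap c (\<Phi> (f n) (\<tau> n))) (cmap c (\<Phi> x t))) \<le>
            2 * dist (cmap c (f n)) (cmap c x) + dist (u (cmap c x) (\<tau> n)) (u (cmap c x) t)"
          using evt evf
        proof eventually_elim
          case (elim n)
          have "cmap c (\<Phi> (f n) (\<tau> n)) = u (cmap c (f n)) (\<tau> n)" using \<Phi>(2) elim by (simp add: abs_less_iff)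
          moreover have "dist (u (cmap c (f n)) (\<tau> n)) (u (cmap c x) (\<tau> n)) \<le> 2 * dist (cmap c (f n)) (cmap c x)"
            using u(4) elim by simp
          ultimately show ?case
            using dist_triangle[of "u (cmap c (f n)) (\<tau> n)" "u (cmap c x) t" "u (cmap c x) (\<tau> n)"] \<Phi>(2)[OF x t] by simp
        qed
      qed (use lim0 in simp)
    qed
  qed
qed

end

section \<open>Completeness and continuity of the flow\<close>

locale compact_vf = smooth_vf +
  assumes compact: "compact_space mtop"
begin

definition solves :: "real \<Rightarrow> (real \<Rightarrow> 'a) \<Rightarrow> bool" where
  "solves b \<gamma> \<longleftrightarrow> (\<forall>t. \<bar>t\<bar> < b \<longrightarrow> has_velocity M \<gamma> (X (\<gamma> t)) t)"

lemma solves_mono: "solves b \<gamma> \<Longrightarrow> b' \<le> b \<Longrightarrow> solves b' \<gamma>"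
  by (simp add: solves_def)

lemma solves_curve_on:
  assumes "solves b \<gamma>" "\<And>t. t \<in> S \<Longrightarrow> \<bar>t\<bar> < b" shows "curve_on S \<gamma>"
proof -
  have "curve_on {-b<..<b} \<gamma>"
    unfolding curve_on_def
  proof
    fix t assume t: "t \<in> {-b<..<b}"
    then have "\<bar>t\<bar> < b" by auto
    then have "has_velocity M \<gamma> (X (\<gamma> t)) t" using assms(1) by (simp add: solves_def)
    from has_velocity_continuous[OF this] show "limitin mtop \<gamma> (\<gamma> t) (at t within {-b<..<b})"
      using at_within_open[OF t] by simp
  qed
  then show ?thesis by (rule curve_on_subset) (use assms(2) in \<open>force simp: abs_less_iff\<close>)
qed

lemma solves_unique:
  assumes "solves b \<gamma>" "solves b \<gamma>'" "\<gamma> 0 = \<gamma>' 0" "\<bar>t\<bar> < b" shows "\<gamma> t = \<gamma>' t"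
proof (rule scaled_curves_unique[where \<alpha> = "-\<bar>t\<bar>" and \<beta> = "\<bar>t\<bar>" and P = "{}" and b = "\<lambda>_. 1" and B = 1 and ?t0.0 = 0])
  show "curve_on {-\<bar>t\<bar>..\<bar>t\<bar>} \<gamma>" by (rule solves_curve_on[OF assms(1)]) (use assms(4) in auto)
  show "curve_on {-\<bar>t\<bar>..\<bar>t\<bar>} \<gamma>'" by (rule solves_curve_on[OF assms(2)]) (use assms(4) in auto)
  show "has_velocity M \<gamma> (sc 1 (X (\<gamma> s))) s" if "s \<in> {-\<bar>t\<bar><..<\<bar>t\<bar>} - {}" for s
  proof -
    have "\<bar>s\<bar> < b" using that assms(4) by auto
    then show ?thesis using assms(1) by (simp add: solves_def)
  qed
  show "has_velocity M \<gamma>' (sc 1 (X (\<gamma>' s))) s" if "s \<in> {-\<bar>t\<bar><..<\<bar>t\<bar>} - {}" for s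
  proof -
    have "\<bar>s\<bar> < b" using that assms(4) by auto
    then show ?thesis using assms(2) by (simp add: solves_def)
  qed
qed (use assms(3) in auto)

lemma solves_shift:
  assumes "solves b \<gamma>" "\<bar>s\<bar> \<le> b" shows "solves (b - \<bar>s\<bar>) (\<lambda>t. \<gamma> (t + s))"
  unfolding solves_def
proof (intro allI impI)
  fix t assume "\<bar>t\<bar> < b - \<bar>s\<bar>"
  then have "\<bar>t + s\<bar> < b" by linarith
  then show "has_velocity M (\<lambda>t. \<gamma> (t + s)) (X (\<gamma> (t + s))) t"
    using assms(1) by (intro has_velocity_shift) (simp add: solves_def)
qed

text \<open>Local existence times depend on the point; finitely many of the neighbourhoods cover the
  compact manifold, and a time below all of theirs works everywhere.\<close>

lemma uniform_local_flow:
  obtains a where "a > 0"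
    "\<And>p. p \<in> points M \<Longrightarrow> \<exists>U \<Phi>. openin mtop U \<and> p \<in> U \<and> (\<forall>x\<in>U. \<Phi> x 0 = x \<and> solves a (\<Phi> x)) \<and>
      (\<forall>x\<in>U. \<forall>t f \<tau>. \<bar>t\<bar> < a \<longrightarrow> limitin mtop f x sequentially \<longrightarrow> \<tau> \<longlonglongrightarrow> t \<longrightarrow>
         limitin mtop (\<lambda>n::nat. \<Phi> (f n) (\<tau> n)) (\<Phi> x t) sequentially)"
proof -
  define Q where "Q = (\<lambda>a U \<Phi>. openin mtop U \<and> (\<forall>x\<in>U. \<Phi> x 0 = x \<and> solves a (\<Phi> x)) \<and>
      (\<forall>x\<in>U. \<forall>t f \<tau>. \<bar>t\<bar> < a \<longrightarrow> limitin mtop f x sequentially \<longrightarrow> \<tau> \<longlonglongrightarrow> t \<longrightarrow>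
         limitin mtop (\<lambda>n::nat. \<Phi> (f n) (\<tau> n)) (\<Phi> x t) sequentially))"
  have "\<exists>U a \<Phi>. p \<in> U \<and> a > 0 \<and> Q a U \<Phi>" if "p \<in> points M" for p
  proof (rule local_flow[OF that])
    fix U a \<Phi>
    assume "openin mtop U" "p \<in> U" "0 < a" "\<And>x. x \<in> U \<Longrightarrow> \<Phi> x 0 = x"
      "\<And>x t. \<lbrakk>x \<in> U; \<bar>t\<bar> < a\<rbrakk> \<Longrightarrow> has_velocity M (\<Phi> x) (X (\<Phi> x t)) t"
      "\<And>x t f \<tau>. \<lbrakk>x \<in> U; \<bar>t\<bar> < a; limitin mtop f x sequentially; \<tau> \<longlonglongrightarrow> t\<rbrakk> \<Longrightarrow>
       limitin mtop (\<lambda>n::nat. \<Phi> (f n) (\<tau> n)) (\<Phi> x t) sequentially"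
    then show "\<exists>U a \<Phi>. p \<in> U \<and> a > 0 \<and> Q a U \<Phi>"
      unfolding Q_def solves_def by (intro exI[of _ U] exI[of _ a] exI[of _ \<Phi>]) auto
  qed
  then obtain U a \<Phi> where *: "\<And>p. p \<in> points M \<Longrightarrow> p \<in> U p \<and> a p > (0::real) \<and> Q (a p) (U p) (\<Phi> p)" by metis
  have "\<exists>\<F>. finite \<F> \<and> \<F> \<subseteq> U ` points M \<and> topspace mtop \<subseteq> \<Union>\<F>"
  proof (rule compactinD[OF compact[unfolded compact_space_def]])
    show "openin mtop V" if "V \<in> U ` points M" for V using that * unfolding Q_def by blast
    show "topspace mtop \<subseteq> \<Union> (U ` points M)" using * unfolding topspace_mtop by blast
  qed
  then obtain \<F> where F: "finite \<F>" "\<F> \<subseteq> U ` points M" "points M \<subseteq> \<Union>\<F>" unfolding topspace_mtop by blast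
  obtain I where "I \<subseteq> points M" "finite I" "\<F> = U ` I" using finite_subset_image[OF F(1,2)] by blast
  then have I: "finite I" "I \<subseteq> points M" "points M \<subseteq> (\<Union>p\<in>I. U p)" using F(3) by simp_all
  \<comment> \<open>Inserting 1 keeps the minimum meaningful when M is empty.\<close>
  define a0 where "a0 = Min (insert 1 (a ` I))"
  show thesis
  proof (rule that[of a0])
    show "a0 > 0" unfolding a0_def using I * by (subst Min_gr_iff) auto
    fix p assume "p \<in> points M"
    then obtain q where q: "q \<in> I" "p \<in> U q" using I(3) by blast
    have "a0 \<le> a q" unfolding a0_def using I(1) q(1) by (intro Min_le) auto
    moreover have "Q (a q) (U q) (\<Phi> q)" using * I(2) q(1) by blast
    ultimately show "\<exists>U \<Phi>. openin mtop U \<and> p \<in> U \<and> (\<forall>x\<in>U. \<Phi> x 0 = x \<and> solves a0 (\<Phi> x)) \<and>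
      (\<forall>x\<in>U. \<forall>t f \<tau>. \<bar>t\<bar> < a0 \<longrightarrow> limitin mtop f x sequentially \<longrightarrow> \<tau> \<longlonglongrightarrow> t \<longrightarrow>
         limitin mtop (\<lambda>n::nat. \<Phi> (f n) (\<tau> n)) (\<Phi> x t) sequentially)"
      using q(2) unfolding Q_def by (intro exI[of _ "U q"] exI[of _ "\<Phi> q"]) (auto intro: solves_mono)
  qed
qed

text \<open>Restarting at the times b/2 and -b/2, each for time b, prolongs a solution to (-3b/2,
  3b/2); uniqueness makes the pieces agree on the overlaps. Iterating the factor 3/2 gives
  completeness.\<close>

lemma solves_extend:
  assumes b: "b > 0" and ex: "\<And>x. x \<in> points M \<Longrightarrow> \<exists>\<gamma>. \<gamma> 0 = x \<and> solves b \<gamma>" and x: "x \<in> points M"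
  shows "\<exists>\<gamma>. \<gamma> 0 = x \<and> solves (3/2 * b) \<gamma>"
proof -
  obtain \<gamma> where \<gamma>: "\<gamma> 0 = x" "solves b \<gamma>" using ex[OF x] by blast
  have pt: "\<gamma> t \<in> points M" if "\<bar>t\<bar> < b" for t
    by (rule tfib_points[OF has_velocity_tfib]) (use \<gamma>(2) that in \<open>auto simp: solves_def\<close>)
  have "\<bar>b/2\<bar> < b" "\<bar>-b/2\<bar> < b" using b by auto
  then obtain \<beta> \<delta> where \<beta>: "\<beta> 0 = \<gamma> (b/2)" "solves b \<beta>" and \<delta>: "\<delta> 0 = \<gamma> (-b/2)" "solves b \<delta>"
    using ex[OF pt[of "b/2"]] ex[OF pt[of "-b/2"]] by blast
  have eq\<beta>: "\<gamma> t = \<beta> (t - b/2)" if "0 < t" "t < b" for t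
  proof -
    have "\<gamma> ((t - b/2) + b/2) = \<beta> (t - b/2)"
    proof (rule solves_unique[of "b/2" "\<lambda>t. \<gamma> (t + b/2)"])
      show "solves (b/2) (\<lambda>t. \<gamma> (t + b/2))" using solves_shift[OF \<gamma>(2), of "b/2"] b by simp
      show "\<bar>t - b/2\<bar> < b/2" using that by linarith
    qed (use solves_mono[OF \<beta>(2)] \<beta>(1) b in auto)
    then show ?thesis by simp
  qed
  have eq\<delta>: "\<gamma> t = \<delta> (t + b/2)" if "-b < t" "t < 0" for t
  proof -
    have "\<gamma> ((t + b/2) + (-b/2)) = \<delta> (t + b/2)"
    proof (rule solves_unique[of "b/2" "\<lambda>t. \<gamma> (t + (-b/2))"])
      show "solves (b/2) (\<lambda>t. \<gamma> (t + (-b/2)))" using solves_shift[OF \<gamma>(2), of "-b/2"] b by simp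
      show "\<bar>t + b/2\<bar> < b/2" using that by linarith
    qed (use solves_mono[OF \<delta>(2)] \<delta>(1) b in auto)
    then show ?thesis by simp
  qed
  define G where "G = (\<lambda>t. if \<bar>t\<bar> < b then \<gamma> t else if t > 0 then \<beta> (t - b/2) else \<delta> (t + b/2))"
  have "has_velocity M G (X (G t)) t" if t: "\<bar>t\<bar> < 3/2 * b" for t
  proof -
    consider "\<bar>t\<bar> < b" | "t \<ge> b" | "t \<le> -b" by linarith
    then show ?thesis
    proof cases
      case 1
      show ?thesis
        by (rule has_velocity_cong[of "{-b<..<b}" _ \<gamma>])
          (use 1 \<gamma>(2) in \<open>auto simp: G_def solves_def abs_less_iff\<close>)
    next
      case 2
      have G: "G s = \<beta> (s + (- b/2))" if "s \<in> {0<..<3/2*b}" for s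
        using eq\<beta>[of s] that b by (auto simp: G_def abs_less_iff)
      have "has_velocity M \<beta> (X (\<beta> (t + (-b/2)))) (t + (-b/2))"
        using \<beta>(2) t 2 b by (simp add: solves_def abs_less_iff)
      from has_velocity_shift[OF this] show ?thesis
        using G[of t] t 2 b
        by (intro has_velocity_cong[of "{0<..<3/2*b}" t "\<lambda>s. \<beta> (s + (-b/2))" G]) (auto simp: G abs_less_iff)
    next
      case 3
      have G: "G s = \<delta> (s + b/2)" if "s \<in> {-3/2*b<..<0}" for s
        using eq\<delta>[of s] that b by (auto simp: G_def abs_less_iff)
      have "has_velocity M \<delta> (X (\<delta> (t + b/2))) (t + b/2)"
        using \<delta>(2) t 3 b by (simp add: solves_def abs_less_iff)
      from has_velocity_shift[OF this] show ?thesis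
        using G[of t] t 3 b
        by (intro has_velocity_cong[of "{-3/2*b<..<0}" t "\<lambda>s. \<delta> (s + b/2)" G]) (auto simp: G abs_less_iff)
    qed
  qed
  moreover have "G 0 = x" using b \<gamma>(1) by (simp add: G_def)
  ultimately show ?thesis unfolding solves_def by blast
qed

lemma solves_exists:
  assumes "x \<in> points M" shows "\<exists>\<gamma>. \<gamma> 0 = x \<and> solves b \<gamma>"
proof -
  obtain a where a: "a > 0" "\<And>p. p \<in> points M \<Longrightarrow> \<exists>U \<Phi>. openin mtop U \<and> p \<in> U \<and> (\<forall>x\<in>U. \<Phi> x 0 = x \<and> solves a (\<Phi> x)) \<and>
      (\<forall>x\<in>U. \<forall>t f \<tau>. \<bar>t\<bar> < a \<longrightarrow> limitin mtop f x sequentially \<longrightarrow> \<tau> \<longlonglongrightarrow> t \<longrightarrow>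
         limitin mtop (\<lambda>n::nat. \<Phi> (f n) (\<tau> n)) (\<Phi> x t) sequentially)"
    by (rule uniform_local_flow) (rule that)
  have *: "\<forall>x\<in>points M. \<exists>\<gamma>. \<gamma> 0 = x \<and> solves ((3/2)^n * a) \<gamma>" for n
  proof (induction n)
    case 0
    show ?case
    proof
      fix x assume "x \<in> points M"
      from a(2)[OF this] obtain U \<Phi> where "x \<in> U" "\<forall>x\<in>U. \<Phi> x 0 = x \<and> solves a (\<Phi> x)" by blast
      then show "\<exists>\<gamma>. \<gamma> 0 = x \<and> solves ((3/2)^0 * a) \<gamma>" by (intro exI[of _ "\<Phi> x"]) simp
    qed
  next
    case (Suc n)
    then show ?case using solves_extend[of "(3/2)^n * a"] a(1) by (simp add: mult.assoc)
  qed
  obtain n where n: "b / a < (3/2)^n" using real_arch_pow[of "3/2" "b/a"] by auto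
  then have "b \<le> (3/2)^n * a" using a(1) by (simp add: field_simps)
  then show ?thesis using *[of n] assms solves_mono by blast
qed

text \<open>\<open>flow\<close> is a definite description over global integral curves. Such a curve
  is obtained by reading off, at time t, a solution that lives on (-|t|-1, |t|+1); every partial
  solution on a symmetric interval coincides with it.\<close>

lemma flow_curve:
  assumes x: "x \<in> points M"
  shows "\<And>t. has_velocity M (\<lambda>t. flow M X t x) (X (flow M X t x)) t" "flow M X 0 x = x"
    "\<And>b \<gamma> t. \<lbrakk>solves b \<gamma>; \<gamma> 0 = x; \<bar>t\<bar> < b\<rbrakk> \<Longrightarrow> flow M X t x = \<gamma> t"
proof -
  obtain g where g: "\<And>b. g b 0 = x" "\<And>b. solves b (g b)" using solves_exists[OF x] by metis
  define G where "G = (\<lambda>t. g (\<bar>t\<bar> + 1) t)"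
  have G: "G t = \<gamma> t" if "solves b \<gamma>" "\<gamma> 0 = x" "\<bar>t\<bar> < b" for b \<gamma> t
    unfolding G_def
    by (rule solves_unique[of "min b (\<bar>t\<bar> + 1)"])
      (use that g solves_mono[OF g(2)] solves_mono[OF that(1)] in auto)
  have v: "has_velocity M G (X (G t)) t" for t
  proof (rule has_velocity_cong[of "{- (\<bar>t\<bar> + 1)<..<\<bar>t\<bar> + 1}" _ "g (\<bar>t\<bar> + 1)"])
    show "g (\<bar>t\<bar> + 1) s = G s" if "s \<in> {- (\<bar>t\<bar> + 1)<..<\<bar>t\<bar> + 1}" for s
      using G[OF g(2,1), of s "\<bar>t\<bar> + 1"] that by (auto simp: abs_less_iff)
    show "has_velocity M (g (\<bar>t\<bar> + 1)) (X (G t)) t"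
      using g(2)[of "\<bar>t\<bar> + 1"] by (simp add: solves_def G_def)
  qed auto
  have G0: "G 0 = x" by (simp add: G_def g)
  have fl: "flow M X t x = G t" for t
    unfolding flow_def
  proof (rule the_equality)
    show "\<exists>\<gamma>. integral_curve M X \<gamma> \<and> \<gamma> 0 = x \<and> \<gamma> t = G t"
      using v G0 by (intro exI[of _ G]) (simp add: integral_curve_def)
    fix y assume "\<exists>\<gamma>. integral_curve M X \<gamma> \<and> \<gamma> 0 = x \<and> \<gamma> t = y"
    then obtain \<gamma> where "integral_curve M X \<gamma>" "\<gamma> 0 = x" "\<gamma> t = y" by blast
    then show "y = G t" using G[of "\<bar>t\<bar> + 1" \<gamma> t] by (simp add: integral_curve_def solves_def)
  qed
  then have fG: "(\<lambda>t. flow M X t x) = G" by (rule ext)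
  show "\<And>t. has_velocity M (\<lambda>t. flow M X t x) (X (flow M X t x)) t" unfolding fG fl by (rule v)
  show "flow M X 0 x = x" unfolding fl by (rule G0)
  show "\<And>b \<gamma> t. \<lbrakk>solves b \<gamma>; \<gamma> 0 = x; \<bar>t\<bar> < b\<rbrakk> \<Longrightarrow> flow M X t x = \<gamma> t" unfolding fl by (rule G)
qed

lemma flow_points: "x \<in> points M \<Longrightarrow> flow M X t x \<in> points M"
  by (rule tfib_points[OF has_velocity_tfib[OF flow_curve(1)]])

lemma flow_solves: "x \<in> points M \<Longrightarrow> solves b (\<lambda>t. flow M X t x)"
  using flow_curve(1) by (simp add: solves_def)

lemma flow_plus:
  assumes x: "x \<in> points M" shows "flow M X (s + t) x = flow M X s (flow M X t x)"
proof -
  have "solves (\<bar>s\<bar> + 1) (\<lambda>u. flow M X (u + t) x)"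
    using solves_shift[OF flow_solves[OF x, of "\<bar>s\<bar> + 1 + \<bar>t\<bar>"], of t] by simp
  from flow_curve(3)[OF flow_points[OF x] this, of t s] show ?thesis by simp
qed

text \<open>For small times this is continuity of the local flows. The time range is doubled by
  writing \<phi>_t as the square of \<phi>_{t/2}: the statement for the inner half supplies the
  convergent sequence for the outer one.\<close>

lemma flow_limitin:
  assumes "x \<in> points M" "limitin mtop f x sequentially" "\<tau> \<longlonglongrightarrow> t"
  shows "limitin mtop (\<lambda>n::nat. flow M X (\<tau> n) (f n)) (flow M X t x) sequentially"
proof -
  obtain a where a: "a > 0" "\<And>p. p \<in> points M \<Longrightarrow> \<exists>U \<Phi>. openin mtop U \<and> p \<in> U \<and> (\<forall>x\<in>U. \<Phi> x 0 = x \<and> solves a (\<Phi> x)) \<and>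
      (\<forall>x\<in>U. \<forall>t f \<tau>. \<bar>t\<bar> < a \<longrightarrow> limitin mtop f x sequentially \<longrightarrow> \<tau> \<longlonglongrightarrow> t \<longrightarrow>
         limitin mtop (\<lambda>n::nat. \<Phi> (f n) (\<tau> n)) (\<Phi> x t) sequentially)"
    by (rule uniform_local_flow) (rule that)
  have evp: "\<forall>\<^sub>F n in sequentially. f n \<in> points M" if "limitin mtop f x sequentially" for f :: "nat \<Rightarrow> 'a" and x
    using limitinD[OF that openin_topspace limitin_topspace[OF that]] by (simp add: topspace_mtop)
  have "\<forall>x\<in>points M. \<forall>t f \<tau>. \<bar>t\<bar> < 2^k * a \<longrightarrow> limitin mtop f x sequentially \<longrightarrow> \<tau> \<longlonglongrightarrow> t \<longrightarrow>
      limitin mtop (\<lambda>n::nat. flow M X (\<tau> n) (f n)) (flow M X t x) sequentially" for k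
  proof (induction k)
    case 0
    show ?case
    proof (intro ballI allI impI)
      fix x t f \<tau> assume x: "x \<in> points M" and t: "\<bar>t\<bar> < 2^0 * a"
        and f: "limitin mtop f x sequentially" and \<tau>: "\<tau> \<longlonglongrightarrow> t"
      from a(2)[OF x] obtain U \<Phi> where U: "openin mtop U" "x \<in> U" "\<forall>x\<in>U. \<Phi> x 0 = x \<and> solves a (\<Phi> x)"
        "\<forall>x\<in>U. \<forall>t f \<tau>. \<bar>t\<bar> < a \<longrightarrow> limitin mtop f x sequentially \<longrightarrow> \<tau> \<longlonglongrightarrow> t \<longrightarrow>
           limitin mtop (\<lambda>n::nat. \<Phi> (f n) (\<tau> n)) (\<Phi> x t) sequentially" by blast
      have fl: "flow M X s y = \<Phi> y s" if "y \<in> U" "\<bar>s\<bar> < a" for y s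
      proof (rule flow_curve(3))
        show "y \<in> points M" using openin_subset[OF U(1)] that(1) topspace_mtop by blast
      qed (use U(3) that in auto)
      have "\<forall>\<^sub>F n in sequentially. \<tau> n \<in> {-a<..<a}"
        using t by (intro topological_tendstoD[OF \<tau>]) auto
      then have ev: "\<forall>\<^sub>F n in sequentially. \<Phi> (f n) (\<tau> n) = flow M X (\<tau> n) (f n)"
        using limitinD[OF f U(1,2)] by eventually_elim (simp add: fl abs_less_iff)
      have "limitin mtop (\<lambda>n. \<Phi> (f n) (\<tau> n)) (\<Phi> x t) sequentially"
        using U(4)[rule_format, OF U(2) _ f \<tau>] t by simp
      from limitin_transform_eventually[OF ev this]
      show "limitin mtop (\<lambda>n. flow M X (\<tau> n) (f n)) (flow M X t x) sequentially"
        using fl[OF U(2)] t by simp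
    qed
  next
    case (Suc k)
    show ?case
    proof (intro ballI allI impI)
      fix x t f \<tau> assume x: "x \<in> points M" and t: "\<bar>t\<bar> < 2^Suc k * a"
        and f: "limitin mtop f x sequentially" and \<tau>: "\<tau> \<longlonglongrightarrow> t"
      have t2: "\<bar>t/2\<bar> < 2^k * a" using t by simp
      have \<tau>2: "(\<lambda>n. \<tau> n / 2) \<longlonglongrightarrow> t/2" using \<tau> by (intro tendsto_divide tendsto_const) auto
      have 1: "limitin mtop (\<lambda>n. flow M X (\<tau> n / 2) (f n)) (flow M X (t/2) x) sequentially"
        using Suc[rule_format, OF x t2 f \<tau>2] .
      have 2: "limitin mtop (\<lambda>n. flow M X (\<tau> n / 2) (flow M X (\<tau> n / 2) (f n))) (flow M X (t/2) (flow M X (t/2) x)) sequentially"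
        using Suc[rule_format, OF flow_points[OF x] t2 1 \<tau>2] .
      have h: "flow M X (s/2) (flow M X (s/2) y) = flow M X s y" if "y \<in> points M" for s y
        using flow_plus[OF that, of "s/2" "s/2"] by simp
      have "\<forall>\<^sub>F n in sequentially. flow M X (\<tau> n / 2) (flow M X (\<tau> n / 2) (f n)) = flow M X (\<tau> n) (f n)"
        using evp[OF f] by eventually_elim (rule h)
      from limitin_transform_eventually[OF this 2]
      show "limitin mtop (\<lambda>n. flow M X (\<tau> n) (f n)) (flow M X t x) sequentially" by (simp add: h[OF x])
    qed
  qed
  moreover obtain k where "\<bar>t\<bar> / a < 2^k" using real_arch_pow[of 2 "\<bar>t\<bar> / a"] by auto
  ultimately show ?thesis using assms a(1) by (simp add: field_simps)
qed

end

section \<open>The Riemannian distance\<close>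

lemma bounded_image_compact_local:
  fixes f :: "'x::metric_space \<Rightarrow> 'y::metric_space"
  assumes "compact S" "\<And>x. x \<in> S \<Longrightarrow> \<exists>e>0. bounded (f ` (ball x e \<inter> T))"
  shows "bounded (f ` (S \<inter> T))"
proof -
  obtain e where e: "\<And>x. x \<in> S \<Longrightarrow> e x > 0 \<and> bounded (f ` (ball x (e x) \<inter> T))" using assms(2) by metis
  obtain C where C: "C \<subseteq> S" "finite C" "S \<subseteq> (\<Union>x\<in>C. ball x (e x))"
  proof (rule compactE_image[OF assms(1), of S "\<lambda>x. ball x (e x)"])
    show "S \<subseteq> (\<Union>x\<in>S. ball x (e x))" using e by (auto intro!: bexI centre_in_ball[THEN iffD2])
  qed auto
  have "bounded (\<Union>x\<in>C. f ` (ball x (e x) \<inter> T))" using C e by (intro bounded_UN) auto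
  then show ?thesis by (rule bounded_subset) (use C(3) in blast)
qed

text \<open>The values at the endpoints are arbitrary, as is the speed of a curve at the ends of a
  smooth piece.\<close>

lemma integrable_bounded_continuous_open:
  fixes f :: "real \<Rightarrow> real"
  assumes "continuous_on {a<..<b} f" "bounded (f ` {a<..<b})"
  shows "f integrable_on {a..b}"
proof -
  obtain B where B: "\<And>t. t \<in> {a<..<b} \<Longrightarrow> \<bar>f t\<bar> \<le> B"
    using assms(2) unfolding bounded_iff by (metis image_eqI real_norm_def)
  have "f integrable_on {a<..<b}"
  proof (rule measurable_bounded_by_integrable_imp_integrable[where g = "\<lambda>_. B"])
    show "f \<in> borel_measurable (lebesgue_on {a<..<b})"
      by (rule continuous_imp_measurable_on_sets_lebesgue[OF assms(1)]) simp
    show "(\<lambda>_. B) integrable_on {a<..<b}"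
      using integrable_const_ivl[of B a b] integrable_on_open_interval[of "\<lambda>_. B" a b] by simp
  qed (use B in auto)
  then show ?thesis using integrable_on_open_interval[of f a b] by simp
qed

section \<open>Coordinate vectors and smooth pieces in charts\<close>

context smooth_mfd
begin

text \<open>Tangent vectors are defined with some derivative D of the transition map, and D is
  determined only on the model subspace. Any D gives the same value, since the vector is the
  velocity of a chart line.\<close>

lemma tfib_transition_any:
  assumes "\<xi> \<in> tfib p" "c \<in> charts M" "c' \<in> charts M" "p \<in> cdom c" "p \<in> cdom c'"
    and D: "((cmap c' \<circ> cinv c) has_derivative D) (at (cmap c p) within cmap c ` (cdom c \<inter> cdom c'))"
  shows "snd \<xi> c' = D (snd \<xi> c)"
proof -
  note l = chart_line[OF assms(2,4) tfib_model[OF assms(1,2,4)]]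
  have v: "has_velocity M (chart_line c p (snd \<xi> c)) \<xi> 0"
    by (rule has_velocityI[OF assms(2) l(2,3)]) (use l(1) assms in simp)
  note v' = has_velocity_cdom[OF v assms(3)]
  have "((cmap c' \<circ> chart_line c p (snd \<xi> c)) has_vector_derivative D (snd \<xi> c)) (at 0)"
    by (rule chart_change_derivative[OF assms(2,3) l(2) v'(1) l(3)]) (use l(1) assms(5) D in simp_all)
  then show ?thesis using vector_derivative_unique_at v'(2) l(1) assms(5) by metis
qed

lemma coord_tangent_add:
  assumes c: "c \<in> charts M" "p \<in> cdom c" and u: "u \<in> model M" "w \<in> model M"
  shows "coord_tangent M c p (u + w) = fadd (tangent_bundle M) (coord_tangent M c p u) (coord_tangent M c p w)"
proof -
  have uw: "u + w \<in> model M" using u subspace_model by (simp add: subspace_add)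
  note ct = coord_tangent[OF c u(1)] coord_tangent[OF c u(2)] coord_tangent[OF c uw]
  show ?thesis
  proof (rule prod_eqI)
    show "fst (coord_tangent M c p (u + w)) = fst (fadd (tangent_bundle M) (coord_tangent M c p u) (coord_tangent M c p w))"
    proof -
      have "fst (coord_tangent M c p (u + w)) = p" "fst (coord_tangent M c p u) = p"
        using ct(1,5) unfolding mem_tfib by blast+
      then show ?thesis by (simp add: tangent_bundle_def)
    qed
    show "snd (coord_tangent M c p (u + w)) = snd (fadd (tangent_bundle M) (coord_tangent M c p u) (coord_tangent M c p w))"
    proof
      fix c'
      have "snd (coord_tangent M c p (u + w)) c' = snd (coord_tangent M c p u) c' + snd (coord_tangent M c p w) c'"
      proof (cases "c' \<in> charts M \<and> p \<in> cdom c'")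
        case True
        then have c': "c' \<in> charts M" "p \<in> cdom c'" by auto
        obtain D where D: "((cmap c' \<circ> cinv c) has_derivative D) (at (cmap c p) within cmap c ` (cdom c \<inter> cdom c'))"
          by (rule smooth_on_has_derivative[OF transition_smooth[OF c(1) c'(1)], of "cmap c p"]) (use c c' in auto)
        note tr = tfib_transition_any[OF _ c(1) c'(1) c(2) c'(2) D]
        show ?thesis
          unfolding tr[OF ct(1)] tr[OF ct(3)] tr[OF ct(5)] ct(2,4,6)
          by (rule linear_add[OF has_derivative_linear[OF D]])
      next
        case False
        show ?thesis
          using tfib_outside[OF ct(1) False] tfib_outside[OF ct(3) False] tfib_outside[OF ct(5) False] by simp
      qed
      then show "snd (coord_tangent M c p (u + w)) c' =
          snd (fadd (tangent_bundle M) (coord_tangent M c p u) (coord_tangent M c p w)) c'"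
        by (simp add: tangent_bundle_def)
    qed
  qed
qed

lemma coord_tangent_scale:
  assumes c: "c \<in> charts M" "p \<in> cdom c" and u: "u \<in> model M"
  shows "coord_tangent M c p (a *\<^sub>R u) = sc a (coord_tangent M c p u)"
proof -
  note ct = coord_tangent[OF c u]
  have "coord_tangent M c p (snd (sc a (coord_tangent M c p u)) c) = sc a (coord_tangent M c p u)"
    by (rule coord_tangent_unique[OF sc_tfib[OF ct(1)] c])
  then show ?thesis by (simp add: ct(2))
qed

text \<open>The extension h lives on a full ball around t0, also when t0 is an endpoint; this gives
  estimates up to the ends of a piece.\<close>

lemma smooth_into_local:
  assumes sm: "smooth_into M {a..b} \<gamma>" and t0: "t0 \<in> {a..b}" and c: "c \<in> charts M" "\<gamma> t0 \<in> cdom c"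
  obtains e h where "e > 0" "Cinf_on (ball t0 e) h"
    "\<And>t. t \<in> ball t0 e \<inter> {a..b} \<Longrightarrow> \<gamma> t \<in> cdom c \<and> h t = cmap c (\<gamma> t)"
proof -
  define T where "T = {a..b} \<inter> \<gamma> -` cdom c"
  have T: "openin (top_of_set {a..b}) T" "smooth_on T (cmap c \<circ> \<gamma>)"
    using sm c(1) unfolding smooth_into_def T_def by blast+
  have t: "t0 \<in> T" using t0 c(2) by (simp add: T_def)
  obtain U h where U: "open U" "t0 \<in> U" "Cinf_on U h" "\<And>y. y \<in> T \<Longrightarrow> y \<in> U \<Longrightarrow> h y = (cmap c \<circ> \<gamma>) y"
    using smooth_onE[OF T(2) t] by metis
  obtain N where N: "open N" "T = {a..b} \<inter> N" using T(1) by (auto simp: openin_open)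
  have "open (U \<inter> N)" "t0 \<in> U \<inter> N" using U N t by auto
  then obtain e where e: "e > 0" "ball t0 e \<subseteq> U \<inter> N" unfolding open_contains_ball by blast
  show thesis
  proof (rule that[OF e(1) Cinf_on_subset[OF U(3)], of])
    show "ball t0 e \<subseteq> U" using e(2) by blast
    fix t assume t: "t \<in> ball t0 e \<inter> {a..b}"
    then have "t \<in> T" "t \<in> U" using e(2) N(2) by blast+
    then show "\<gamma> t \<in> cdom c \<and> h t = cmap c (\<gamma> t)" using U(4)[of t] by (simp add: T_def)
  qed
qed

lemma smooth_into_velocity:
  assumes e: "e > 0" and h: "Cinf_on (ball t0 e) h" and c: "c \<in> charts M"
    and eq: "\<And>t. t \<in> ball t0 e \<inter> {a..b} \<Longrightarrow> \<gamma> t \<in> cdom c \<and> h t = cmap c (\<gamma> t)"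
    and t: "t \<in> ball t0 e \<inter> {a<..<b}"
  obtains \<xi> where "has_velocity M \<gamma> \<xi> t" "snd \<xi> c = frechet_derivative h (at t) 1"
proof -
  define N where "N = ball t0 e \<inter> {a<..<b}"
  have N: "open N" "t \<in> N" "\<And>s. s \<in> N \<Longrightarrow> \<gamma> s \<in> cdom c \<and> h s = cmap c (\<gamma> s)"
    using t eq by (auto simp: N_def)
  have d: "(h has_derivative frechet_derivative h (at t)) (at t)"
    by (rule Cinf_on_derivative[OF h]) (use t in auto)
  have "frechet_derivative h (at t) s = s *\<^sub>R frechet_derivative h (at t) 1" for s :: real
    using linear_scale[OF has_derivative_linear[OF d], of s 1] by simp
  then have "(h has_vector_derivative frechet_derivative h (at t) 1) (at t)"
    unfolding has_vector_derivative_def using d by (metis (no_types, lifting) ext)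
  then have "((cmap c \<circ> \<gamma>) has_vector_derivative frechet_derivative h (at t) 1) (at t)"
    by (rule has_vector_derivative_transform_within_open[OF _ N(1,2)]) (use N(3) in auto)
  moreover have "\<forall>\<^sub>F s in nhds t. \<gamma> s \<in> cdom c"
    by (rule eventually_mono[OF eventually_nhds_in_open[OF N(1,2)]]) (use N(3) in blast)
  ultimately show thesis using has_velocity_exists[OF c] that by metis
qed

end

section \<open>The metric in charts and the speed of a curve\<close>

locale riemannian = smooth_mfd M
  for M :: "('a, 'e::euclidean_space) manifold" +
  fixes g :: "('a, 'e) tangent \<Rightarrow> ('a, 'e) tangent \<Rightarrow> real"
  assumes metric: "riemannian_metric M g"
begin

lemma g_props:
  assumes "\<xi> \<in> tfib p" "\<eta> \<in> tfib p" "\<zeta> \<in> tfib p"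
  shows "g \<xi> \<eta> = g \<eta> \<xi>" "g (fadd (tangent_bundle M) \<xi> \<eta>) \<zeta> = g \<xi> \<zeta> + g \<eta> \<zeta>" "g (sc a \<xi>) \<eta> = a * g \<xi> \<eta>"
    "snd \<xi> \<noteq> (\<lambda>_. 0) \<Longrightarrow> g \<xi> \<xi> > 0"
proof -
  note m = conjunct1[OF metric[unfolded riemannian_metric_def], THEN bspec, OF tfib_points[OF assms(1)], THEN bspec, OF assms(1)]
  note m1 = conjunct1[OF m, THEN bspec, OF assms(2)]
  show "g \<xi> \<eta> = g \<eta> \<xi>" by (rule conjunct1[OF m1])
  show "g (fadd (tangent_bundle M) \<xi> \<eta>) \<zeta> = g \<xi> \<zeta> + g \<eta> \<zeta>"
    by (rule conjunct1[OF conjunct2[OF m1], THEN bspec, OF assms(3)])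
  show "g (sc a \<xi>) \<eta> = a * g \<xi> \<eta>" by (rule conjunct2[OF conjunct2[OF m1], THEN spec])
  show "snd \<xi> \<noteq> (\<lambda>_. 0) \<Longrightarrow> g \<xi> \<xi> > 0" by (rule conjunct2[OF m, THEN mp])
qed

definition gc :: "('a, 'e) chart \<Rightarrow> 'e \<Rightarrow> 'e \<Rightarrow> 'e \<Rightarrow> real" where
  "gc c z u w = g (coord_tangent M c (cinv c z) u) (coord_tangent M c (cinv c z) w)"

lemma g_eq_gc:
  assumes "\<xi> \<in> tfib p" "c \<in> charts M" "p \<in> cdom c"
  shows "g \<xi> \<xi> = gc c (cmap c p) (snd \<xi> c) (snd \<xi> c)"
  by (simp add: gc_def cinv_cmap[OF assms(2,3)] coord_tangent_unique[OF assms])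

lemma gc_bilinear:
  assumes c: "c \<in> charts M" "z \<in> cimage c" and u: "u \<in> model M" "v \<in> model M" "w \<in> model M"
  shows "gc c z u w = gc c z w u" "gc c z (u + v) w = gc c z u w + gc c z v w" "gc c z (a *\<^sub>R u) w = a * gc c z u w"
proof -
  have p: "cinv c z \<in> cdom c" by (rule cmap_cinv(1)[OF c])
  note ct = coord_tangent(1)[OF c(1) p]
  note gp = g_props[OF ct[OF u(1)] ct[OF u(3)] ct[OF u(3)]] g_props[OF ct[OF u(1)] ct[OF u(2)] ct[OF u(3)]]
  show "gc c z u w = gc c z w u" unfolding gc_def by (rule gp(1))
  show "gc c z (u + v) w = gc c z u w + gc c z v w"
    unfolding gc_def coord_tangent_add[OF c(1) p u(1,2)] by (rule gp(6))
  show "gc c z (a *\<^sub>R u) w = a * gc c z u w"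
    unfolding gc_def coord_tangent_scale[OF c(1) p u(1)] by (rule gp(3))
qed

lemma gc_pos:
  assumes c: "c \<in> charts M" "z \<in> cimage c" and u: "u \<in> model M" "u \<noteq> 0" shows "gc c z u u > 0"
proof -
  have p: "cinv c z \<in> cdom c" by (rule cmap_cinv(1)[OF c])
  note ct = coord_tangent[OF c(1) p u(1)]
  have "snd (coord_tangent M c (cinv c z) u) \<noteq> (\<lambda>_. 0)" using ct(2) u(2) by auto
  then show ?thesis unfolding gc_def by (rule g_props(4)[OF ct(1) ct(1) ct(1)])
qed

lemma gc_sum:
  assumes c: "c \<in> charts M" "z \<in> cimage c" and w: "w \<in> model M" and A: "finite A" "A \<subseteq> model M"
  shows "(\<Sum>b\<in>A. f b *\<^sub>R b) \<in> model M" "gc c z (\<Sum>b\<in>A. f b *\<^sub>R b) w = (\<Sum>b\<in>A. f b * gc c z b w)"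
proof -
  have "(\<Sum>b\<in>A. f b *\<^sub>R b) \<in> model M \<and> gc c z (\<Sum>b\<in>A. f b *\<^sub>R b) w = (\<Sum>b\<in>A. f b * gc c z b w)"
    using A
  proof (induction A rule: finite_induct)
    case empty
    have "gc c z (0 *\<^sub>R w) w = 0 * gc c z w w" by (rule gc_bilinear(3)[OF c w w w])
    then show ?case using subspace_0[OF subspace_model] by simp
  next
    case (insert b A)
    then have b: "f b *\<^sub>R b \<in> model M" "b \<in> model M" using subspace_scale[OF subspace_model] by auto
    have IH: "(\<Sum>b\<in>A. f b *\<^sub>R b) \<in> model M" "gc c z (\<Sum>b\<in>A. f b *\<^sub>R b) w = (\<Sum>b\<in>A. f b * gc c z b w)"
      using insert by auto
    show ?case
      using insert(1,2) subspace_add[OF subspace_model b(1) IH(1)] gc_bilinear(2)[OF c b(1) IH(1) w] gc_bilinear(3)[OF c b(2) w w, of "f b"] IH(2)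
      by simp
  qed
  then show "(\<Sum>b\<in>A. f b *\<^sub>R b) \<in> model M" "gc c z (\<Sum>b\<in>A. f b *\<^sub>R b) w = (\<Sum>b\<in>A. f b * gc c z b w)" by auto
qed

text \<open>The metric is given as smooth in z for each fixed pair of vectors. Joint continuity in z
  and u follows by expanding u in an orthonormal basis of the model.\<close>

lemma gc_continuous:
  assumes c: "c \<in> charts M"
  shows "continuous_on (cimage c \<times> model M) (\<lambda>(z, u). gc c z u u)"
proof -
  obtain B where B: "B \<subseteq> model M" "pairwise orthogonal B" "\<And>x. x \<in> B \<Longrightarrow> norm x = 1" "independent B" "span B = model M"
    using orthonormal_basis_subspace[OF subspace_model] by metis
  have fin: "finite B" by (rule independent_imp_finite[OF B(4)])
  have eq: "(\<Sum>b\<in>B. \<Sum>b'\<in>B. (snd zu \<bullet> b) * ((snd zu \<bullet> b') * gc c (fst zu) b' b)) = (case zu of (z, u) \<Rightarrow> gc c z u u)"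
    if zu: "zu \<in> cimage c \<times> model M" for zu
  proof -
    obtain z u where *: "zu = (z, u)" "z \<in> cimage c" "u \<in> model M" using zu by auto
    have ue: "(\<Sum>b\<in>B. (u \<bullet> b) *\<^sub>R b) = u"
      by (rule orthonormal_basis_expand[OF B(2,3) _ fin]) (use B(5) *(3) in auto)
    have "gc c z u u = (\<Sum>b\<in>B. (u \<bullet> b) * gc c z b u)"
      using gc_sum(2)[OF c *(2,3) fin B(1), of "\<lambda>b. u \<bullet> b"] unfolding ue .
    also have "\<dots> = (\<Sum>b\<in>B. (u \<bullet> b) * (\<Sum>b'\<in>B. (u \<bullet> b') * gc c z b' b))"
    proof (rule sum.cong[OF refl])
      fix b assume "b \<in> B"
      then have b: "b \<in> model M" using B(1) by auto
      have "gc c z b u = gc c z u b" by (rule gc_bilinear(1)[OF c *(2) b b *(3)])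
      also have "\<dots> = (\<Sum>b'\<in>B. (u \<bullet> b') * gc c z b' b)"
        using gc_sum(2)[OF c *(2) b fin B(1), of "\<lambda>b. u \<bullet> b"] unfolding ue .
      finally show "(u \<bullet> b) * gc c z b u = (u \<bullet> b) * (\<Sum>b'\<in>B. (u \<bullet> b') * gc c z b' b)" by simp
    qed
    finally show ?thesis by (simp add: *(1) sum_distrib_left)
  qed
  have "continuous_on (cimage c \<times> model M) (\<lambda>zu. \<Sum>b\<in>B. \<Sum>b'\<in>B. (snd zu \<bullet> b) * ((snd zu \<bullet> b') * gc c (fst zu) b' b))"
  proof (intro continuous_intros)
    fix b b' assume b: "b \<in> B" "b' \<in> B"
    then have bm: "b \<in> model M" "b' \<in> model M" using B(1) by auto
    have "smooth_on (cimage c) (\<lambda>z. gc c z b' b)"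
      unfolding gc_def using conjunct2[OF metric[unfolded riemannian_metric_def]] c bm by simp
    then have "continuous_on (cimage c) (\<lambda>z. gc c z b' b)" by (rule smooth_on_imp_continuous_on)
    then show "continuous_on (cimage c \<times> model M) (\<lambda>zu. gc c (fst zu) b' b)"
      by (rule continuous_on_compose2) (auto intro: continuous_intros)
  qed
  then show ?thesis by (rule continuous_on_eq) (use eq in auto)
qed

text \<open>The Riemannian and the Euclidean norm are equivalent uniformly on K: the bounds are the
  extrema over K times the unit sphere of the model, extended by homogeneity.\<close>

lemma gc_bounds:
  assumes c: "c \<in> charts M" and K: "compact K" "K \<subseteq> cimage c"
  obtains m C where "m > 0" "C \<ge> 0"
    "\<forall>z\<in>K. \<forall>u\<in>model M. m * norm u \<le> sqrt (gc c z u u) \<and> sqrt (gc c z u u) \<le> C * norm u"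
proof -
  define Q where "Q = K \<times> (sphere 0 1 \<inter> model M)"
  have Q: "compact Q" unfolding Q_def by (intro compact_Times K(1) compact_Int_closed closed_model) auto
  define f where "f = (\<lambda>(z, u). sqrt (gc c z u u))"
  have "continuous_on (cimage c \<times> model M) f"
    using continuous_on_real_sqrt[OF gc_continuous[OF c]] by (simp add: f_def case_prod_unfold)
  then have f: "continuous_on Q f" by (rule continuous_on_subset) (use K in \<open>auto simp: Q_def\<close>)
  have pos: "f q > 0" if "q \<in> Q" for q
    using that K(2) gc_pos[OF c] by (force simp: Q_def f_def)
  have "\<exists>m C. m > 0 \<and> C \<ge> 0 \<and> (\<forall>q\<in>Q. m \<le> f q \<and> f q \<le> C)"
  \<comment> \<open>Q is empty if K is empty or the model is the zero space.\<close>
  proof (cases "Q = {}")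
    case True then show ?thesis by (intro exI[of _ 1]) auto
  next
    case False
    obtain a where a: "a \<in> Q" "\<And>q. q \<in> Q \<Longrightarrow> f a \<le> f q" using continuous_attains_inf[OF Q False f] by blast
    obtain b where b: "b \<in> Q" "\<And>q. q \<in> Q \<Longrightarrow> f q \<le> f b" using continuous_attains_sup[OF Q False f] by blast
    show ?thesis using a b pos[OF a(1)] pos[OF b(1)] by (intro exI[of _ "f a"] exI[of _ "f b"]) auto
  qed
  then obtain m C where mC: "m > 0" "C \<ge> 0" "\<And>q. q \<in> Q \<Longrightarrow> m \<le> f q \<and> f q \<le> C" by blast
  show thesis
  proof (rule that[OF mC(1,2)], intro ballI)
    fix z u assume z: "z \<in> K" and u: "u \<in> model M"
    have zi: "z \<in> cimage c" using z K(2) by blast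
    define v where "v = (if norm u = 0 then 0 else (1 / norm u) *\<^sub>R u)"
    have v: "v \<in> model M" "u = norm u *\<^sub>R v"
      using subspace_scale[OF subspace_model u] subspace_0[OF subspace_model] by (auto simp: v_def)
    have "gc c z u u = gc c z (norm u *\<^sub>R v) (norm u *\<^sub>R v)" using v(2) by simp
    also have "\<dots> = norm u * gc c z v (norm u *\<^sub>R v)"
      by (rule gc_bilinear(3)[OF c zi v(1) v(1)]) (use v(2) u in simp)
    also have "gc c z v (norm u *\<^sub>R v) = gc c z (norm u *\<^sub>R v) v"
      by (rule gc_bilinear(1)[OF c zi v(1) v(1)]) (use v(2) u in simp)
    also have "\<dots> = norm u * gc c z v v" by (rule gc_bilinear(3)[OF c zi v(1) v(1) v(1)])
    finally have e: "sqrt (gc c z u u) = norm u * sqrt (gc c z v v)"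
      by (simp add: real_sqrt_mult)
    show "m * norm u \<le> sqrt (gc c z u u) \<and> sqrt (gc c z u u) \<le> C * norm u"
    proof (cases "u = 0")
      case True then show ?thesis using e by simp
    next
      case False
      then have "(z, v) \<in> Q" using z v(1) by (simp add: Q_def v_def)
      from mC(3)[OF this] have "m \<le> sqrt (gc c z v v)" "sqrt (gc c z v v) \<le> C" by (simp_all add: f_def)
      then have "norm u * m \<le> norm u * sqrt (gc c z v v)" "norm u * sqrt (gc c z v v) \<le> norm u * C"
        by (auto intro: mult_left_mono)
      then show ?thesis unfolding e by (simp add: mult.commute)
    qed
  qed
qed

definition speed :: "(real \<Rightarrow> 'a) \<Rightarrow> real \<Rightarrow> real" where
  "speed \<gamma> t = (let \<xi> = (THE \<xi>. has_velocity M \<gamma> \<xi> t) in sqrt (g \<xi> \<xi>))"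

lemma speed_eq:
  assumes "has_velocity M \<gamma> \<xi> t" shows "speed \<gamma> t = sqrt (g \<xi> \<xi>)"
proof -
  have "(THE \<xi>. has_velocity M \<gamma> \<xi> t) = \<xi>" using assms has_velocity_unique by (intro the_equality)
  then show ?thesis by (simp add: speed_def)
qed

lemma speed_chart:
  assumes "has_velocity M \<gamma> \<xi> t" "c \<in> charts M" "\<gamma> t \<in> cdom c"
  shows "speed \<gamma> t = sqrt (gc c (cmap c (\<gamma> t)) (snd \<xi> c) (snd \<xi> c))"
  unfolding speed_eq[OF assms(1)] g_eq_gc[OF has_velocity_tfib[OF assms(1)] assms(2,3)] ..

text \<open>The two-sided velocity may fail to exist at the ends, where the speed is then an
  arbitrary value. Inside it is continuous, and near the ends it is bounded because the curve has a
  smooth extension past them in a chart.\<close>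

lemma smooth_into_speed_integrable:
  assumes sm: "smooth_into M {a..b} \<gamma>"
  shows "speed \<gamma> integrable_on {a..b}" "\<And>t. t \<in> {a<..<b} \<Longrightarrow> \<exists>\<xi>. has_velocity M \<gamma> \<xi> t"
proof -
  have loc: "\<exists>e>0. continuous_on (ball t0 e \<inter> {a<..<b}) (speed \<gamma>) \<and> bounded (speed \<gamma> ` (ball t0 e \<inter> {a<..<b})) \<and>
      (\<forall>t\<in>ball t0 e \<inter> {a<..<b}. \<exists>\<xi>. has_velocity M \<gamma> \<xi> t)" if t0: "t0 \<in> {a..b}" for t0
  proof -
    obtain c where c: "c \<in> charts M" "\<gamma> t0 \<in> cdom c"
      using chart_around[OF curve_on_points[OF smooth_into_curve_on[OF sm] t0]] by blast
    obtain e h where e: "e > 0" and h: "Cinf_on (ball t0 e) h"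
      and eq: "\<And>t. t \<in> ball t0 e \<inter> {a..b} \<Longrightarrow> \<gamma> t \<in> cdom c \<and> h t = cmap c (\<gamma> t)"
      using smooth_into_local[OF sm t0 c] by metis
    define D where "D = (\<lambda>t. frechet_derivative h (at t) 1)"
    have "Ck_on (Suc 0) (ball t0 e) h" using h unfolding Cinf_on_def by (rule spec)
    then have contD: "continuous_on (ball t0 e) D" unfolding D_def by simp
    have conth: "continuous_on (ball t0 e) h" by (rule Cinf_on_continuous[OF h])
    define I where "I = cball t0 (e/2) \<inter> {a..b}"
    have I: "compact I" "I \<subseteq> ball t0 e" unfolding I_def using e by (auto intro: compact_Int_closed)
    have "compact (h ` I)" "compact (D ` I)"
      using I contD conth by (auto intro!: compact_continuous_image intro: continuous_on_subset)
    moreover have "h ` I \<subseteq> cimage c"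
    proof (rule image_subsetI)
      fix t assume "t \<in> I"
      then have "t \<in> ball t0 e \<inter> {a..b}" using I(2) by (auto simp: I_def)
      from eq[OF this] show "h t \<in> cimage c" using cmap_in_cimage[of "\<gamma> t" c] by simp
    qed
    ultimately obtain m C where C: "C \<ge> 0" "\<forall>z\<in>h ` I. \<forall>u\<in>model M. m * norm u \<le> sqrt (gc c z u u) \<and> sqrt (gc c z u u) \<le> C * norm u"
      using gc_bounds[OF c(1), of "h ` I"] by metis
    obtain B where B: "\<And>t. t \<in> I \<Longrightarrow> norm (D t) \<le> B"
      using compact_imp_bounded[OF \<open>compact (D ` I)\<close>] unfolding bounded_iff by (metis image_eqI)
    define J where "J = ball t0 (e/2) \<inter> {a<..<b}"
    have J: "t \<in> I" "t \<in> ball t0 e \<inter> {a<..<b}" "t \<in> ball t0 e \<inter> {a..b}" if "t \<in> J" for t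
      using that e by (auto simp: J_def I_def)
    have vel: "\<exists>\<xi>. has_velocity M \<gamma> \<xi> t \<and> snd \<xi> c = D t" if "t \<in> J" for t
      using smooth_into_velocity[OF e h c(1) eq J(2)[OF that]] unfolding D_def by metis
    have Dm: "D t \<in> model M" and sp: "speed \<gamma> t = sqrt (gc c (h t) (D t) (D t))" if t: "t \<in> J" for t
    proof -
      obtain \<xi> where \<xi>: "has_velocity M \<gamma> \<xi> t" "snd \<xi> c = D t" using vel[OF t] by blast
      note q = eq[OF J(3)[OF t]]
      show "D t \<in> model M" using tfib_model[OF has_velocity_tfib[OF \<xi>(1)] c(1)] q \<xi>(2) by simp
      show "speed \<gamma> t = sqrt (gc c (h t) (D t) (D t))" using speed_chart[OF \<xi>(1) c(1)] q \<xi>(2) by simp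
    qed
    have "continuous_on J (\<lambda>t. (h t, D t))"
      by (intro continuous_on_Pair continuous_on_subset[OF conth] continuous_on_subset[OF contD]) (use J in blast)+
    moreover have "(\<lambda>t. (h t, D t)) ` J \<subseteq> cimage c \<times> model M"
    proof (rule image_subsetI)
      fix t assume t: "t \<in> J"
      show "(h t, D t) \<in> cimage c \<times> model M"
        using Dm[OF t] eq[OF J(3)[OF t]] cmap_in_cimage[of "\<gamma> t" c] by simp
    qed
    ultimately have "continuous_on J (\<lambda>t. case (h t, D t) of (z, u) \<Rightarrow> gc c z u u)"
      by (rule continuous_on_compose2[OF gc_continuous[OF c(1)]])
    then have "continuous_on J (\<lambda>t. sqrt (gc c (h t) (D t) (D t)))" by (simp add: continuous_on_real_sqrt)
    then have "continuous_on J (speed \<gamma>)" by (rule continuous_on_eq) (simp add: sp)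
    moreover have "bounded (speed \<gamma> ` J)"
    proof (rule boundedI[of _ "C * B"])
      fix s assume "s \<in> speed \<gamma> ` J"
      then obtain t where t: "t \<in> J" "s = speed \<gamma> t" by blast
      have gt: "m * norm (D t) \<le> sqrt (gc c (h t) (D t) (D t))" "sqrt (gc c (h t) (D t) (D t)) \<le> C * norm (D t)"
        using C(2) J(1)[OF t(1)] Dm[OF t(1)] by auto
      have "0 \<le> gc c (h t) (D t) (D t)"
      proof (cases "D t = 0")
        case True
        have "gc c (h t) (0 *\<^sub>R D t) (D t) = 0 * gc c (h t) (D t) (D t)"
          by (rule gc_bilinear(3)[OF c(1) _ Dm[OF t(1)] Dm[OF t(1)] Dm[OF t(1)]])
            (use \<open>h ` I \<subseteq> cimage c\<close> J(1)[OF t(1)] in blast)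
        then show ?thesis using True by simp
      next
        case False
        show ?thesis by (rule less_imp_le[OF gc_pos[OF c(1) _ Dm[OF t(1)] False]])
            (use \<open>h ` I \<subseteq> cimage c\<close> J(1)[OF t(1)] in blast)
      qed
      then have "norm s \<le> C * norm (D t)" using gt(2) t sp[OF t(1)] by simp
      also have "\<dots> \<le> C * B" using B[OF J(1)[OF t(1)]] C(1) by (rule mult_left_mono)
      finally show "norm s \<le> C * B" .
    qed
    moreover have "\<forall>t\<in>J. \<exists>\<xi>. has_velocity M \<gamma> \<xi> t" using vel by blast
    ultimately show ?thesis using half_gt_zero[OF e] unfolding J_def by blast
  qed
  show ex: "\<And>t. t \<in> {a<..<b} \<Longrightarrow> \<exists>\<xi>. has_velocity M \<gamma> \<xi> t"
  proof -
    fix t assume t: "t \<in> {a<..<b}"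
    then have "t \<in> {a..b}" by auto
    from loc[OF this] obtain e where "e > 0" "\<forall>t\<in>ball t e \<inter> {a<..<b}. \<exists>\<xi>. has_velocity M \<gamma> \<xi> t" by blast
    then show "\<exists>\<xi>. has_velocity M \<gamma> \<xi> t" using t by auto
  qed
  show "speed \<gamma> integrable_on {a..b}"
  proof (rule integrable_bounded_continuous_open)
    show "continuous_on {a<..<b} (speed \<gamma>)"
      unfolding continuous_on_eq_continuous_at[OF open_greaterThanLessThan]
    proof
      fix t assume t: "t \<in> {a<..<b}"
      then have "t \<in> {a..b}" by auto
      from loc[OF this] obtain e where e: "e > 0" "continuous_on (ball t e \<inter> {a<..<b}) (speed \<gamma>)" by blast
      have "open (ball t e \<inter> {a<..<b})" "t \<in> ball t e \<inter> {a<..<b}" using t e(1) by auto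
      then show "isCont (speed \<gamma>) t" using e(2) continuous_on_eq_continuous_at by blast
    qed
    have "bounded (speed \<gamma> ` ({a..b} \<inter> {a<..<b}))"
      by (rule bounded_image_compact_local) (use loc in blast)+
    moreover have "{a..b} \<inter> {a<..<b} = {a<..<b}" by auto
    ultimately show "bounded (speed \<gamma> ` {a<..<b})" by simp
  qed
qed

end

section \<open>Piecewise smooth curves on arbitrary intervals\<close>

context smooth_mfd
begin

lemma smooth_into_compose:
  assumes f: "smooth_into M S \<gamma>" and h: "smooth_on S' h" "h ` S' \<subseteq> S"
  shows "smooth_into M S' (\<lambda>t. \<gamma> (h t))"
  unfolding smooth_into_def
proof (intro conjI ballI)
  show "(\<lambda>t. \<gamma> (h t)) ` S' \<subseteq> points M" using f h(2) unfolding smooth_into_def by blast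
  fix c assume c: "c \<in> charts M"
  have o: "openin (top_of_set S) (S \<inter> \<gamma> -` cdom c)" and s: "smooth_on (S \<inter> \<gamma> -` cdom c) (cmap c \<circ> \<gamma>)"
    using f c unfolding smooth_into_def by blast+
  have e: "S' \<inter> (\<lambda>t. \<gamma> (h t)) -` cdom c = S' \<inter> h -` (S \<inter> \<gamma> -` cdom c)" using h(2) by auto
  show "openin (top_of_set S') (S' \<inter> (\<lambda>t. \<gamma> (h t)) -` cdom c)"
    unfolding e
    by (rule continuous_openin_preimage[OF smooth_on_imp_continuous_on[OF h(1)] _ o]) (use h(2) in auto)
  have "smooth_on (S' \<inter> h -` (S \<inter> \<gamma> -` cdom c)) (\<lambda>t. (cmap c \<circ> \<gamma>) (h t))"
    by (rule smooth_on_compose[OF s smooth_on_subset[OF h(1)]]) auto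
  then show "smooth_on (S' \<inter> (\<lambda>t. \<gamma> (h t)) -` cdom c) (cmap c \<circ> (\<lambda>t. \<gamma> (h t)))"
    unfolding e by (simp add: o_def)
qed

lemma smooth_into_cong:
  assumes "smooth_into M S \<gamma>" "\<And>t. t \<in> S \<Longrightarrow> \<gamma> t = \<gamma>' t" shows "smooth_into M S \<gamma>'"
proof -
  have e: "S \<inter> \<gamma>' -` D = S \<inter> \<gamma> -` D" for D using assms(2) by auto
  have i: "\<gamma>' ` S = \<gamma> ` S" using assms(2) by auto
  show ?thesis
    unfolding smooth_into_def e i
  proof (intro conjI ballI)
    show "\<gamma> ` S \<subseteq> points M" using assms(1) unfolding smooth_into_def by blast
    fix c assume c: "c \<in> charts M"
    show "openin (top_of_set S) (S \<inter> \<gamma> -` cdom c)" using assms(1) c unfolding smooth_into_def by blast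
    have "smooth_on (S \<inter> \<gamma> -` cdom c) (cmap c \<circ> \<gamma>)" using assms(1) c unfolding smooth_into_def by blast
    then show "smooth_on (S \<inter> \<gamma> -` cdom c) (cmap c \<circ> \<gamma>')" by (rule smooth_on_cong[rotated]) (use assms(2) in auto)
  qed
qed

lemma smooth_on_affine_real: "smooth_on S (\<lambda>t::real. k * t + l)"
proof -
  have "bounded_linear (\<lambda>t::real. k * t)" by (rule bounded_linear_mult_right)
  from Cinf_on_imp_smooth_on[OF open_UNIV Cinf_on_affine[OF this, of l]]
  have "smooth_on UNIV (\<lambda>t::real. k * t + l)" by (simp add: add.commute)
  then show ?thesis by (rule smooth_on_subset) simp
qed

lemma smooth_into_chart_segment:
  assumes c: "c \<in> charts M" and S: "\<And>t. t \<in> S \<Longrightarrow> z + t *\<^sub>R w \<in> cimage c"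
  shows "smooth_into M S (\<lambda>t::real. cinv c (z + t *\<^sub>R w))"
proof (rule smooth_into_compose[of "cimage c" "cinv c"])
  show "smooth_into M (cimage c) (cinv c)"
    unfolding smooth_into_def
  proof (intro conjI ballI)
    show "cinv c ` cimage c \<subseteq> points M" using cmap_cinv(1)[OF c] cdom_subset[OF c] by auto
    fix c' assume c': "c' \<in> charts M"
    have e: "cimage c \<inter> cinv c -` cdom c' = cmap c ` (cdom c \<inter> cdom c')"
    proof (intro equalityI subsetI)
      fix x assume "x \<in> cimage c \<inter> cinv c -` cdom c'"
      then show "x \<in> cmap c ` (cdom c \<inter> cdom c')" using cmap_cinv[OF c, of x] by (auto intro!: image_eqI)
    next
      fix x assume "x \<in> cmap c ` (cdom c \<inter> cdom c')"
      then show "x \<in> cimage c \<inter> cinv c -` cdom c'" using cinv_cmap[OF c] by (auto simp: cimage_def)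
    qed
    show "openin (top_of_set (cimage c)) (cimage c \<inter> cinv c -` cdom c')"
      unfolding e by (rule openin_subset_trans[OF overlap_openin[OF c c']])
        (use cimage_subset_model[OF c] in \<open>auto simp: cimage_def\<close>)
    show "smooth_on (cimage c \<inter> cinv c -` cdom c') (cmap c' \<circ> cinv c)"
      unfolding e by (rule transition_smooth[OF c c'])
  qed
  have "bounded_linear (\<lambda>t::real. t *\<^sub>R w)" by (rule bounded_linear_scaleR_left)
  from Cinf_on_imp_smooth_on[OF open_UNIV Cinf_on_affine[OF this, of z]]
  show "smooth_on S (\<lambda>t. z + t *\<^sub>R w)" by (rule smooth_on_subset) simp
qed (use S in auto)

text \<open>Piecewise smoothness in the form of a list of pieces. In contrast to partitions of
  [0,1], concatenation and affine changes of parameter are handled by direct induction.\<close>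

inductive psm :: "(real \<Rightarrow> 'a) \<Rightarrow> real \<Rightarrow> real \<Rightarrow> bool" for \<gamma> where
  psm_refl: "psm \<gamma> a a"
| psm_step: "\<lbrakk>a < b; smooth_into M {a..b} \<gamma>; psm \<gamma> b c\<rbrakk> \<Longrightarrow> psm \<gamma> a c"

lemma psm_single: "a < b \<Longrightarrow> smooth_into M {a..b} \<gamma> \<Longrightarrow> psm \<gamma> a b"
  by (rule psm_step[OF _ _ psm_refl])

lemma psm_le: "psm \<gamma> a b \<Longrightarrow> a \<le> b"
  by (induction rule: psm.induct) auto

lemma psm_trans: "psm \<gamma> a b \<Longrightarrow> psm \<gamma> b c \<Longrightarrow> psm \<gamma> a c"
  by (induction rule: psm.induct) (auto intro: psm_step)

lemma psm_cong:
  assumes "psm \<gamma> a b" "\<And>t. t \<in> {a..b} \<Longrightarrow> \<gamma> t = \<gamma>' t" shows "psm \<gamma>' a b"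
  using assms
proof (induction rule: psm.induct)
  case (psm_step a b c)
  have bc: "b \<le> c" by (rule psm_le[OF psm_step(3)])
  show ?case
  proof (rule psm.psm_step[OF psm_step(1)])
    show "smooth_into M {a..b} \<gamma>'" by (rule smooth_into_cong[OF psm_step(2)]) (use bc psm_step(5) in auto)
    show "psm \<gamma>' b c" by (rule psm_step(4)) (use psm_step(1,5) in auto)
  qed
qed (rule psm_refl)

lemma psm_affine_pos:
  assumes "psm \<gamma> a b" "k > 0" shows "psm (\<lambda>t. \<gamma> (k * t + l)) ((a - l)/k) ((b - l)/k)"
  using assms(1)
proof (induction rule: psm.induct)
  case (psm_step a b c)
  show ?case
  proof (rule psm.psm_step[OF _ _ psm_step(4)])
    show "(a - l)/k < (b - l)/k" using psm_step(1) assms(2) by (simp add: divide_strict_right_mono)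
    show "smooth_into M {(a - l)/k..(b - l)/k} (\<lambda>t. \<gamma> (k * t + l))"
      by (rule smooth_into_compose[OF psm_step(2) smooth_on_affine_real])
        (use assms(2) in \<open>auto simp: field_simps\<close>)
  qed
qed (rule psm_refl)

lemma psm_reverse:
  assumes "psm \<gamma> a b" shows "psm (\<lambda>t. \<gamma> (l - t)) (l - b) (l - a)"
  using assms
proof (induction rule: psm.induct)
  case (psm_step a b c)
  show ?case
  proof (rule psm_trans[OF psm_step(4) psm_single])
    show "smooth_into M {l - b..l - a} (\<lambda>t. \<gamma> (l - t))"
      using smooth_into_compose[OF psm_step(2) smooth_on_affine_real[of "{l - b..l - a}" "-1" l]] by auto
  qed (use psm_step(1) in simp)
qed (rule psm_refl)

lemma psm_imp_partition:
  assumes "psm \<gamma> a b"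
  shows "\<exists>n \<tau>. \<tau> 0 = a \<and> \<tau> n = b \<and> (\<forall>i<n. \<tau> i < \<tau> (Suc i)) \<and> (\<forall>i<n. smooth_into M {\<tau> i..\<tau> (Suc i)} \<gamma>)"
  using assms
proof (induction rule: psm.induct)
  case (psm_refl a)
  show ?case by (rule exI[of _ 0], rule exI[of _ "\<lambda>_. a"]) simp
next
  case (psm_step a b c)
  then obtain n \<tau> where \<tau>: "\<tau> 0 = b" "\<tau> n = c" "\<forall>i<n. \<tau> i < \<tau> (Suc i)" "\<forall>i<n. smooth_into M {\<tau> i..\<tau> (Suc i)} \<gamma>"
    by blast
  show ?case
    by (rule exI[of _ "Suc n"], rule exI[of _ "\<lambda>i. case i of 0 \<Rightarrow> a | Suc j \<Rightarrow> \<tau> j"])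
      (use \<tau> psm_step(1,2) in \<open>auto split: nat.split simp: less_Suc_eq_0_disj\<close>)
qed

lemma piecewise_smooth_path_iff: "piecewise_smooth_path M \<gamma> \<longleftrightarrow> psm \<gamma> 0 1"
proof
  assume "psm \<gamma> 0 1"
  then show "piecewise_smooth_path M \<gamma>"
    using psm_imp_partition unfolding piecewise_smooth_path_def partition01_def by blast
next
  assume "piecewise_smooth_path M \<gamma>"
  then obtain n \<tau> where \<tau>: "\<tau> 0 = 0" "\<tau> n = 1" "\<forall>i<n. \<tau> i < \<tau> (Suc i)" "\<forall>i<n. smooth_into M {\<tau> i..\<tau> (Suc i)} \<gamma>"
    unfolding piecewise_smooth_path_def partition01_def by blast
  have "psm \<gamma> (\<tau> 0) (\<tau> i)" if "i \<le> n" for i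
    using that
  proof (induction i)
    case (Suc i)
    then show ?case using \<tau>(3,4) by (intro psm_trans[OF Suc.IH psm_single]) auto
  qed (rule psm_refl)
  from this[of n] show "psm \<gamma> 0 1" using \<tau> by simp
qed

lemma psm_curve_on:
  assumes "psm \<gamma> a b" "a < b" shows "curve_on {a..b} \<gamma>"
proof -
  have "a < b \<longrightarrow> curve_on {a..b} \<gamma>"
    using assms(1)
  proof (induction rule: psm.induct)
    case (psm_step a b c)
    have c1: "curve_on {a..b} \<gamma>" by (rule smooth_into_curve_on[OF psm_step(2)])
    show ?case
    proof (cases "b = c")
      case False
      then have bc: "b < c" using psm_le[OF psm_step(3)] by simp
      then have c2: "curve_on {b..c} \<gamma>" using psm_step(4) by simp
      have "curve_on {a..c} \<gamma>"
        unfolding curve_on_def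
      proof
        fix t assume t: "t \<in> {a..c}"
        have tp: "\<gamma> t \<in> topspace mtop"
        proof (cases "t \<le> b")
          case True then show ?thesis using curve_on_points[OF c1, of t] t by (simp add: topspace_mtop)
        next
          case False then show ?thesis using curve_on_points[OF c2, of t] t by (simp add: topspace_mtop)
        qed
        have "\<forall>\<^sub>F s in at t within {a..c}. \<gamma> s \<in> U" if U: "openin mtop U" "\<gamma> t \<in> U" for U
        proof -
          have 1: "\<forall>\<^sub>F s in at t within {a..b}. \<gamma> s \<in> U"
          proof (cases "t \<le> b")
            case True then show ?thesis using c1 t U unfolding curve_on_def limitin_def by simp
          next
            case False
            have "\<forall>\<^sub>F s in nhds t. s \<in> {b<..}" using False by (intro eventually_nhds_in_open) auto
            then show ?thesis unfolding eventually_at_filter by (rule eventually_mono) auto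
          qed
          have 2: "\<forall>\<^sub>F s in at t within {b..c}. \<gamma> s \<in> U"
          proof (cases "b \<le> t")
            case True then show ?thesis using c2 t U unfolding curve_on_def limitin_def by simp
          next
            case False
            have "\<forall>\<^sub>F s in nhds t. s \<in> {..<b}" using False by (intro eventually_nhds_in_open) auto
            then show ?thesis unfolding eventually_at_filter by (rule eventually_mono) auto
          qed
          have "\<forall>\<^sub>F s in nhds t. (s \<noteq> t \<longrightarrow> s \<in> {a..b} \<longrightarrow> \<gamma> s \<in> U) \<and> (s \<noteq> t \<longrightarrow> s \<in> {b..c} \<longrightarrow> \<gamma> s \<in> U)"
            using eventually_conj[OF 1[unfolded eventually_at_filter] 2[unfolded eventually_at_filter]] .
          then show ?thesis unfolding eventually_at_filter
            by (rule eventually_mono) (use psm_step(1) bc in auto)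
        qed
        then show "limitin mtop \<gamma> (\<gamma> t) (at t within {a..c})" using tp by (simp add: limitin_def)
      qed
      then show ?thesis by simp
    qed (use c1 in simp)
  qed simp
  then show ?thesis using assms(2) by blast
qed

end

section \<open>Lengths of curves\<close>

context riemannian
begin

lemma speed_nonneg:
  assumes "has_velocity M \<gamma> \<xi> t" shows "speed \<gamma> t \<ge> 0"
proof -
  note f = has_velocity_tfib[OF assms]
  have "g \<xi> \<xi> \<ge> 0"
  proof (cases "snd \<xi> = (\<lambda>_. 0)")
    case True
    have "sc 0 \<xi> = \<xi>" using True by (intro prod_eqI) (auto simp: tangent_bundle_def)
    then have "g \<xi> \<xi> = 0 * g \<xi> \<xi>" using g_props(3)[OF f f f, of 0] by simp
    then show ?thesis by simp
  qed (use g_props(4)[OF f f f] in simp)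
  then show ?thesis by (simp add: speed_eq[OF assms])
qed

lemma speed_reparam:
  assumes "has_velocity M \<gamma> \<xi> (k * t + l)" shows "speed (\<lambda>u. \<gamma> (k * u + l)) t = \<bar>k\<bar> * speed \<gamma> (k * t + l)"
proof -
  note f = has_velocity_tfib[OF assms]
  have "((\<lambda>u. k * u + l) has_real_derivative k) (at t)" by (auto intro!: derivative_eq_intros)
  from has_velocity_reparam[OF assms this]
  have "speed (\<lambda>u. \<gamma> (k * u + l)) t = sqrt (g (sc k \<xi>) (sc k \<xi>))" by (rule speed_eq)
  also have "g (sc k \<xi>) (sc k \<xi>) = k * g \<xi> (sc k \<xi>)"
    by (rule g_props(3)[OF f sc_tfib[OF f] f])
  also have "g \<xi> (sc k \<xi>) = g (sc k \<xi>) \<xi>" by (rule g_props(1)[OF f sc_tfib[OF f] f])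
  also have "\<dots> = k * g \<xi> \<xi>" by (rule g_props(3)[OF f f f])
  finally show ?thesis by (simp add: speed_eq[OF assms] real_sqrt_mult power2_eq_square[symmetric] mult.assoc[symmetric])
qed

lemma psm_speed:
  assumes "psm \<gamma> a b"
  shows "speed \<gamma> integrable_on {a..b} \<and> (\<exists>P. finite P \<and> (\<forall>t\<in>{a..b} - P. \<exists>\<xi>. has_velocity M \<gamma> \<xi> t))"
  using assms
proof (induction rule: psm.induct)
  case (psm_refl a)
  show ?case
    using integrable_on_refl[of "speed \<gamma>" a, unfolded cbox_interval] by (intro conjI exI[of _ "{a}"]) auto
next
  case (psm_step a b c)
  from psm_step(4) obtain P where P: "speed \<gamma> integrable_on {b..c}" "finite P"
    "\<forall>t\<in>{b..c} - P. \<exists>\<xi>. has_velocity M \<gamma> \<xi> t" by blast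
  note s = smooth_into_speed_integrable[OF psm_step(2)]
  have "speed \<gamma> integrable_on {a..c}"
    by (rule Henstock_Kurzweil_Integration.integrable_combine[OF _ psm_le[OF psm_step(3)] s(1) P(1)])
      (use psm_step(1) in simp)
  moreover have "\<forall>t\<in>{a..c} - insert a (insert b P). \<exists>\<xi>. has_velocity M \<gamma> \<xi> t"
  proof
    fix t assume t: "t \<in> {a..c} - insert a (insert b P)"
    show "\<exists>\<xi>. has_velocity M \<gamma> \<xi> t"
    proof (cases "t < b")
      case True then show ?thesis using t by (intro s(2)) auto
    next
      case False
      then have "t \<in> {b..c} - P" using t by auto
      then show ?thesis using P(3) by (rule bspec[rotated])
    qed
  qed
  ultimately show ?case using P(2) by (intro conjI exI[of _ "insert a (insert b P)"]) simp_all
qed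

definition len :: "(real \<Rightarrow> 'a) \<Rightarrow> real \<Rightarrow> real \<Rightarrow> real" where
  "len \<gamma> a b = integral {a..b} (speed \<gamma>)"

lemma path_length_eq: "path_length M g \<gamma> = len \<gamma> 0 1"
  by (simp add: path_length_def len_def speed_def[abs_def])

lemma len_nonneg: assumes "psm \<gamma> a b" shows "len \<gamma> a b \<ge> 0"
proof -
  obtain P where P: "finite P" "\<forall>t\<in>{a..b} - P. \<exists>\<xi>. has_velocity M \<gamma> \<xi> t" using psm_speed[OF assms] by blast
  have "integral {a..b} (\<lambda>t. if t \<in> P then 0 else speed \<gamma> t) = integral {a..b} (speed \<gamma>)"
    by (rule integral_spike[OF negligible_finite[OF P(1)]]) auto
  moreover have "integral {a..b} (\<lambda>t. if t \<in> P then 0 else speed \<gamma> t) \<ge> 0"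
  proof (rule integral_nonneg)
    show "(\<lambda>t. if t \<in> P then 0 else speed \<gamma> t) integrable_on {a..b}"
      by (rule integrable_spike[OF conjunct1[OF psm_speed[OF assms]] negligible_finite[OF P(1)]]) auto
    fix t assume "t \<in> {a..b}"
    then show "0 \<le> (if t \<in> P then 0 else speed \<gamma> t)" using P(2) speed_nonneg by (metis DiffI order_refl)
  qed
  ultimately show ?thesis by (simp add: len_def)
qed

lemma len_trans:
  assumes "psm \<gamma> a b" "psm \<gamma> b c" shows "len \<gamma> a c = len \<gamma> a b + len \<gamma> b c"
  unfolding len_def
  using Henstock_Kurzweil_Integration.integral_combine[OF psm_le[OF assms(1)] psm_le[OF assms(2)]
    conjunct1[OF psm_speed[OF psm_trans[OF assms]]]] by simp

lemma len_cong:
  assumes "\<And>t. t \<in> {a<..<b} \<Longrightarrow> \<gamma> t = \<gamma>' t" "psm \<gamma> a b" shows "len \<gamma> a b = len \<gamma>' a b"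
proof -
  obtain P where P: "finite P" "\<forall>t\<in>{a..b} - P. \<exists>\<xi>. has_velocity M \<gamma> \<xi> t" using psm_speed[OF assms(2)] by blast
  show ?thesis unfolding len_def
  proof (rule integral_spike[of "insert a (insert b P)"])
    fix t assume "t \<in> {a..b} - insert a (insert b P)"
    then have t: "t \<in> {a<..<b}" "t \<in> {a..b} - P" by auto
    then obtain \<xi> where \<xi>: "has_velocity M \<gamma> \<xi> t" using P(2) by blast
    from has_velocity_cong[OF open_greaterThanLessThan t(1) assms(1) \<xi>]
    have "has_velocity M \<gamma>' \<xi> t" .
    then show "speed \<gamma>' t = speed \<gamma> t" using \<xi> speed_eq by simp
  qed (use P(1) in \<open>simp add: negligible_finite\<close>)
qed

text \<open>k may be negative, so that reversal (k = -1) is covered as well as the halves of a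
  concatenation (k = 2); \<open>ab\<close> names the resulting interval in either
  orientation.\<close>

lemma len_affine:
  assumes "psm \<gamma> a b" "k \<noteq> 0" "psm (\<lambda>t. \<gamma> (k * t + l)) a' b'"
    and ab: "(\<lambda>t. (1/k) * t + - ((1/k) * l)) ` {a..b} = {a'..b'}"
  shows "len (\<lambda>t. \<gamma> (k * t + l)) a' b' = len \<gamma> a b"
proof -
  obtain P where P: "finite P" "\<forall>t\<in>{a..b} - P. \<exists>\<xi>. has_velocity M \<gamma> \<xi> t" using psm_speed[OF assms(1)] by blast
  have "(speed \<gamma> has_integral len \<gamma> a b) (cbox a b)"
    using psm_speed[OF assms(1)] by (simp add: len_def integrable_integral)
  from has_integral_affinity[OF this assms(2), of l]
  have "((\<lambda>t. speed \<gamma> (k * t + l)) has_integral (1/\<bar>k\<bar>) * len \<gamma> a b) {a'..b'}"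
    using ab by simp
  from has_integral_mult_right[OF this, of "\<bar>k\<bar>"] assms(2)
  have *: "((\<lambda>t. \<bar>k\<bar> * speed \<gamma> (k * t + l)) has_integral len \<gamma> a b) {a'..b'}" by simp
  define Q where "Q = (\<lambda>t. (t - l)/k) ` P"
  have "((speed (\<lambda>t. \<gamma> (k * t + l))) has_integral len \<gamma> a b) {a'..b'}"
  proof (rule has_integral_spike_finite[OF _ _ *, of Q])
    show "finite Q" using P(1) by (simp add: Q_def)
    fix t assume t: "t \<in> {a'..b'} - Q"
    have "k * t + l \<notin> P"
    proof
      assume "k * t + l \<in> P"
      moreover have "t = ((k * t + l) - l)/k" using assms(2) by simp
      ultimately have "t \<in> Q" unfolding Q_def by (rule rev_image_eqI)
      then show False using t by simp
    qed
    moreover have "k * t + l \<in> {a..b}"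
    proof -
      have "t \<in> (\<lambda>t. (1/k) * t + - ((1/k) * l)) ` {a..b}" using t ab by simp
      then obtain s where "s \<in> {a..b}" "t = (1/k) * s + - ((1/k) * l)" by blast
      then show ?thesis using assms(2) by (simp add: field_simps)
    qed
    ultimately obtain \<xi> where "has_velocity M \<gamma> \<xi> (k * t + l)" using P(2) by blast
    then show "speed (\<lambda>t. \<gamma> (k * t + l)) t = \<bar>k\<bar> * speed \<gamma> (k * t + l)" by (rule speed_reparam)
  qed
  then show ?thesis unfolding len_def by (rule integral_unique)
qed

abbreviation rd :: "'a \<Rightarrow> 'a \<Rightarrow> real" where "rd \<equiv> riemannian_dist M g"

definition lengths :: "'a \<Rightarrow> 'a \<Rightarrow> real set" where
  "lengths x y = {len \<gamma> 0 1 | \<gamma>. psm \<gamma> 0 1 \<and> \<gamma> 0 = x \<and> \<gamma> 1 = y}"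

lemma rd_eq: "rd x y = Inf (lengths x y)"
  by (simp add: riemannian_dist_def lengths_def path_length_eq piecewise_smooth_path_iff)

lemma lengths_nonneg: "l \<in> lengths x y \<Longrightarrow> l \<ge> 0"
  using len_nonneg by (auto simp: lengths_def)

lemma rd_le: "l \<in> lengths x y \<Longrightarrow> rd x y \<le> l"
  unfolding rd_eq by (rule cInf_lower) (auto intro!: bdd_belowI[of _ 0] lengths_nonneg)

lemma lengths_sym:
  assumes "l \<in> lengths x y" shows "l \<in> lengths y x"
proof -
  obtain \<gamma> where \<gamma>: "psm \<gamma> 0 1" "\<gamma> 0 = x" "\<gamma> 1 = y" "l = len \<gamma> 0 1" using assms by (auto simp: lengths_def)
  have p: "psm (\<lambda>t. \<gamma> (1 - t)) 0 1" using psm_reverse[OF \<gamma>(1), of 1] by simp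
  have e: "(\<lambda>t. \<gamma> (1 - t)) = (\<lambda>t. \<gamma> (-1 * t + 1))" by (simp add: algebra_simps)
  have im: "(\<lambda>t. (1/(-1)) * t + - ((1/(-1)) * (1::real))) ` {0..1} = {0..1}"
    using image_affinity_atLeastAtMost[of "-1" 1 0 1] by simp
  have "len (\<lambda>t. \<gamma> (1 - t)) 0 1 = len \<gamma> 0 1"
    unfolding e by (rule len_affine[OF \<gamma>(1) _ p[unfolded e] im]) simp
  then show ?thesis using p \<gamma> unfolding lengths_def by (intro CollectI exI[of _ "\<lambda>t. \<gamma> (1 - t)"]) simp
qed

lemma lengths_add:
  assumes "l \<in> lengths x y" "l' \<in> lengths y z" shows "l + l' \<in> lengths x z"
proof -
  obtain \<gamma> where \<gamma>: "psm \<gamma> 0 1" "\<gamma> 0 = x" "\<gamma> 1 = y" "l = len \<gamma> 0 1" using assms(1) by (auto simp: lengths_def)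
  obtain \<gamma>' where \<gamma>': "psm \<gamma>' 0 1" "\<gamma>' 0 = y" "\<gamma>' 1 = z" "l' = len \<gamma>' 0 1" using assms(2) by (auto simp: lengths_def)
  define \<mu> where "\<mu> = (\<lambda>t. if t \<le> 1/2 then \<gamma> (2 * t + 0) else \<gamma>' (2 * t + -1))"
  have 1: "psm (\<lambda>t. \<gamma> (2 * t + 0)) 0 (1/2)" using psm_affine_pos[OF \<gamma>(1), of 2 0] by simp
  have 2: "psm (\<lambda>t. \<gamma>' (2 * t + -1)) (1/2) 1" using psm_affine_pos[OF \<gamma>'(1), of 2 "-1"] by simp
  have e1: "\<gamma> (2 * t + 0) = \<mu> t" if "t \<in> {0..1/2}" for t using that by (simp add: \<mu>_def)
  have e2: "\<gamma>' (2 * t + -1) = \<mu> t" if "t \<in> {1/2..1}" for t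
  proof (cases "t = 1/2")
    case True show ?thesis using \<gamma>(3) \<gamma>'(2) unfolding True \<mu>_def by simp
  next
    case False then show ?thesis using that by (simp add: \<mu>_def)
  qed
  have p: "psm \<mu> 0 (1/2)" "psm \<mu> (1/2) 1" using psm_cong[OF 1 e1] psm_cong[OF 2 e2] by auto
  have i1: "(\<lambda>t. (1/2) * t + - ((1/2) * (0::real))) ` {0..1} = {0..1/2}"
    using image_affinity_atLeastAtMost[of "1/2" 0 0 1] by simp
  have i2: "(\<lambda>t. (1/2) * t + - ((1/2) * (-1::real))) ` {0..1} = {1/2..1}"
    using image_affinity_atLeastAtMost[of "1/2" "1/2" 0 1] by simp
  have "len \<mu> 0 1 = len \<mu> 0 (1/2) + len \<mu> (1/2) 1" by (rule len_trans[OF p])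
  also have "len \<mu> 0 (1/2) = len (\<lambda>t. \<gamma> (2 * t + 0)) 0 (1/2)" by (rule len_cong[symmetric, OF _ 1]) (rule e1, auto)
  also have "\<dots> = l" unfolding \<gamma>(4) by (rule len_affine[OF \<gamma>(1) _ 1 i1]) simp
  also have "len \<mu> (1/2) 1 = len (\<lambda>t. \<gamma>' (2 * t + -1)) (1/2) 1" by (rule len_cong[symmetric, OF _ 2]) (rule e2, auto)
  also have "\<dots> = l'" unfolding \<gamma>'(4) by (rule len_affine[OF \<gamma>'(1) _ 2 i2]) simp
  finally have "len \<mu> 0 1 = l + l'" .
  moreover have "\<mu> 0 = x" "\<mu> 1 = z" using \<gamma> \<gamma>' by (simp_all add: \<mu>_def)
  ultimately show ?thesis
    using psm_trans[OF p] unfolding lengths_def by (intro CollectI exI[of _ \<mu>]) simp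
qed

text \<open>The curve is the coordinate segment from x to y. Convexity of K keeps it in the region
  where the metric is bounded by C.\<close>

lemma lengths_chart_segment:
  assumes c: "c \<in> charts M" and K: "K \<subseteq> cimage c" "convex K"
    and C: "\<forall>z\<in>K. \<forall>u\<in>model M. sqrt (gc c z u u) \<le> C * norm u"
    and xy: "x \<in> cdom c" "y \<in> cdom c" "cmap c x \<in> K" "cmap c y \<in> K"
  obtains l where "l \<in> lengths x y" "l \<le> C * norm (cmap c x - cmap c y)"
proof -
  define w where "w = cmap c y - cmap c x"
  define \<gamma> where "\<gamma> = (\<lambda>t. cinv c (cmap c x + t *\<^sub>R w))"
  have seg: "cmap c x + t *\<^sub>R w \<in> K" if "t \<in> {0..1}" for t
  proof -
    have "(1 - t) *\<^sub>R cmap c x + t *\<^sub>R cmap c y \<in> K" using that by (intro convexD[OF K(2) xy(3,4)]) auto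
    then show ?thesis by (simp add: w_def algebra_simps)
  qed
  have sm: "smooth_into M {0..1} \<gamma>"
    unfolding \<gamma>_def by (rule smooth_into_chart_segment[OF c]) (use seg K in blast)
  then have p: "psm \<gamma> 0 1" by (intro psm_single) auto
  have ends: "\<gamma> 0 = x" "\<gamma> 1 = y" using cinv_cmap[OF c] xy by (simp_all add: \<gamma>_def w_def)
  have sp: "speed \<gamma> t \<le> C * norm w" if t: "t \<in> {0<..<1}" for t
  proof -
    obtain \<xi> where \<xi>: "has_velocity M \<gamma> \<xi> t" using smooth_into_speed_integrable(2)[OF sm t] by blast
    have im: "cmap c x + s *\<^sub>R w \<in> cimage c" if "s \<in> {0<..<1}" for s using seg[of s] K(1) that by auto
    have g: "\<gamma> s \<in> cdom c" "cmap c (\<gamma> s) = cmap c x + s *\<^sub>R w" if "s \<in> {0<..<1}" for s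
      using cmap_cinv[OF c im[OF that]] by (simp_all add: \<gamma>_def)
    have "((cmap c \<circ> \<gamma>) has_vector_derivative w) (at t)"
    proof (rule has_vector_derivative_transform_within_open[OF _ open_greaterThanLessThan t])
      show "((\<lambda>s. cmap c x + s *\<^sub>R w) has_vector_derivative w) (at t)" by (auto intro!: derivative_eq_intros)
    qed (simp add: g)
    then have "snd \<xi> c = w" using vector_derivative_unique_at has_velocity_cdom(2)[OF \<xi> c g(1)[OF t]] by metis
    moreover have "snd \<xi> c \<in> model M" by (rule tfib_model[OF has_velocity_tfib[OF \<xi>] c g(1)[OF t]])
    ultimately show ?thesis
      using speed_chart[OF \<xi> c g(1)[OF t]] C seg[of t] t g(2)[OF t] by simp
  qed
  have "len \<gamma> 0 1 = integral {0..1} (\<lambda>t. if t \<in> {0<..<1} then speed \<gamma> t else C * norm w)"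
    unfolding len_def by (rule integral_spike[of "{0,1}"]) auto
  also have "\<dots> \<le> integral {0..1} (\<lambda>_::real. C * norm w)"
  proof (rule integral_le)
    show "(\<lambda>t. if t \<in> {0<..<1} then speed \<gamma> t else C * norm w) integrable_on {0..1}"
      by (rule integrable_spike[OF conjunct1[OF psm_speed[OF p]], of "{0,1}"]) auto
  qed (use sp in auto)
  finally have "len \<gamma> 0 1 \<le> C * norm (cmap c x - cmap c y)" by (simp add: w_def norm_minus_commute)
  then show thesis using that p ends unfolding lengths_def by blast
qed

lemma chart_ball_metric:
  assumes c: "c \<in> charts M" "p \<in> cdom c" and U: "openin mtop U" "p \<in> U"
  obtains \<rho> m C where "\<rho> > 0" "m > 0" "C \<ge> 0" "cball (cmap c p) \<rho> \<inter> model M \<subseteq> cmap c ` (U \<inter> cdom c)"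
    "cball (cmap c p) \<rho> \<inter> model M \<subseteq> cimage c"
    "\<forall>z\<in>cball (cmap c p) \<rho> \<inter> model M. \<forall>u\<in>model M. m * norm u \<le> sqrt (gc c z u u) \<and> sqrt (gc c z u u) \<le> C * norm u"
proof -
  obtain \<rho> where \<rho>: "\<rho> > 0" "cball (cmap c p) \<rho> \<inter> model M \<subseteq> cmap c ` (U \<inter> cdom c)"
    by (rule chart_ball[OF c U])
  have K: "cball (cmap c p) \<rho> \<inter> model M \<subseteq> cimage c" using \<rho>(2) unfolding cimage_def by blast
  obtain m C where "m > 0" "C \<ge> 0"
    "\<forall>z\<in>cball (cmap c p) \<rho> \<inter> model M. \<forall>u\<in>model M. m * norm u \<le> sqrt (gc c z u u) \<and> sqrt (gc c z u u) \<le> C * norm u"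
    by (rule gc_bounds[OF c(1) compact_Int_closed[OF compact_cball closed_model] K])
  then show thesis using that \<rho> K by metis
qed

lemma lengths_near:
  assumes c: "c \<in> charts M" "p \<in> cdom c"
    and K: "cball (cmap c p) \<rho> \<inter> model M \<subseteq> cimage c"
    and C: "\<forall>z\<in>cball (cmap c p) \<rho> \<inter> model M. \<forall>u\<in>model M. m * norm u \<le> sqrt (gc c z u u) \<and> sqrt (gc c z u u) \<le> C * norm u"
    and y: "y \<in> cdom c" "cmap c y \<in> cball (cmap c p) \<rho>"
  obtains l where "l \<in> lengths y p" "l \<le> C * norm (cmap c y - cmap c p)"
proof -
  have "dist (cmap c p) (cmap c y) \<le> \<rho>" using y(2) by simp
  then have \<rho>: "0 \<le> \<rho>" using order_trans[OF zero_le_dist] by blast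
  have C': "\<forall>z\<in>cball (cmap c p) \<rho> \<inter> model M. \<forall>u\<in>model M. sqrt (gc c z u u) \<le> C * norm u" using C by blast
  have K': "cmap c y \<in> cball (cmap c p) \<rho> \<inter> model M" "cmap c p \<in> cball (cmap c p) \<rho> \<inter> model M"
    using y cmap_in_model[OF c(1)] c(2) \<rho> by simp_all
  show thesis
    by (rule lengths_chart_segment[OF c(1) K convex_Int[OF convex_cball subspace_imp_convex[OF subspace_model]] C' y(1) c(2) K'])
      (rule that)
qed

text \<open>The coordinate displacement is the integral of the coordinate velocity, and the lower
  metric bound compares m times its norm with the speed. Only the length up to t enters; the rest is
  nonnegative.\<close>

lemma displacement_le_len:
  assumes c: "c \<in> charts M" and p: "psm \<gamma> 0 1" and t: "0 \<le> t" "t \<le> 1" and m: "m > 0"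
    and K: "\<And>s. \<lbrakk>0 \<le> s; s \<le> t\<rbrakk> \<Longrightarrow> \<gamma> s \<in> cdom c \<and> cmap c (\<gamma> s) \<in> K"
    and b: "\<forall>z\<in>K. \<forall>u\<in>model M. m * norm u \<le> sqrt (gc c z u u)"
  shows "m * norm (cmap c (\<gamma> t) - cmap c (\<gamma> 0)) \<le> len \<gamma> 0 1"
proof -
  obtain P where P: "speed \<gamma> integrable_on {0..1}" "finite P" "\<forall>t\<in>{0..1} - P. \<exists>\<xi>. has_velocity M \<gamma> \<xi> t"
    using psm_speed[OF p] by blast
  define vel where "vel = (\<lambda>s. snd (THE \<xi>. has_velocity M \<gamma> \<xi> s) c)"
  have vel: "((cmap c \<circ> \<gamma>) has_vector_derivative vel s) (at s)" "m * norm (vel s) \<le> speed \<gamma> s"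
    if s: "s \<in> {0..t} - P" for s
  proof -
    have sd: "\<gamma> s \<in> cdom c" "cmap c (\<gamma> s) \<in> K" using K s by auto
    have "s \<in> {0..1} - P" using s t by auto
    then obtain \<xi> where \<xi>: "has_velocity M \<gamma> \<xi> s" using P(3) by blast
    have "(THE \<xi>. has_velocity M \<gamma> \<xi> s) = \<xi>" using \<xi> has_velocity_unique by (intro the_equality)
    then have v: "vel s = snd \<xi> c" by (simp add: vel_def)
    show "((cmap c \<circ> \<gamma>) has_vector_derivative vel s) (at s)"
      unfolding v by (rule has_velocity_cdom(2)[OF \<xi> c sd(1)])
    show "m * norm (vel s) \<le> speed \<gamma> s"
      unfolding v speed_chart[OF \<xi> c sd(1)] using b sd(2) tfib_model[OF has_velocity_tfib[OF \<xi>] c sd(1)] by blast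
  qed
  define f where "f = (\<lambda>s. if s \<in> P then 0 else vel s)"
  define h where "h = (\<lambda>s. if s \<in> P then 0 else speed \<gamma> s)"
  have "(f has_integral (cmap c \<circ> \<gamma>) t - (cmap c \<circ> \<gamma>) 0) {0..t}"
  proof (rule fundamental_theorem_of_calculus_interior_strong[OF P(2) t(1)])
    show "((cmap c \<circ> \<gamma>) has_vector_derivative f s) (at s)" if "s \<in> {0<..<t} - P" for s
      using vel(1)[of s] that by (simp add: f_def)
    have "continuous_on {0..t} (\<lambda>s. cmap c (\<gamma> s))"
      by (rule curve_on_cmap_continuous[OF psm_curve_on[OF p] _ c]) (use K t in auto)
    then show "continuous_on {0..t} (cmap c \<circ> \<gamma>)" by (simp add: o_def)
  qed
  then have f: "f integrable_on {0..t}" "integral {0..t} f = cmap c (\<gamma> t) - cmap c (\<gamma> 0)"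
    by (auto simp: has_integral_integrable_integral)
  have hi: "h integrable_on {0..1}"
    by (rule integrable_spike[OF P(1) negligible_finite[OF P(2)]]) (simp add: h_def)
  have h0: "h s \<ge> 0" if "s \<in> {0..1}" for s
    using P(3) that speed_nonneg unfolding h_def by (metis DiffI order_refl)
  have ht: "h integrable_on {0..t}" by (rule integrable_on_subinterval[OF hi]) (use t in auto)
  have "norm (integral {0..t} (\<lambda>s. m *\<^sub>R f s)) \<le> integral {0..t} h"
  proof (rule integral_norm_bound_integral[OF _ ht])
    show "(\<lambda>s. m *\<^sub>R f s) integrable_on {0..t}" by (intro integrable_cmul f)
    fix s assume "s \<in> {0..t}"
    then show "norm (m *\<^sub>R f s) \<le> h s" using vel(2)[of s] m by (cases "s \<in> P") (auto simp: f_def h_def)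
  qed
  also have "\<dots> \<le> integral {0..1} h"
    by (rule integral_subset_le[OF _ ht hi]) (use t h0 in auto)
  also have "integral {0..1} h = len \<gamma> 0 1"
    unfolding len_def by (rule integral_spike[OF negligible_finite[OF P(2)]]) (simp add: h_def)
  finally show ?thesis using f m by (simp add: norm_minus_commute)
qed

text \<open>If the curve were shorter, then up to the first exit time it would stay in a closed ball
  of radius less than \<rho>. By compactness its coordinates accumulate there as the exit time is
  approached, and by the Hausdorff property the exit point itself lies in the open ball. In a
  non-Hausdorff space the curve could leave the chart through a doubled point.\<close>

lemma len_ge_exit:
  assumes c: "c \<in> charts M" "p \<in> cdom c" and m: "m > 0" "\<rho> > 0"
    and K: "cball (cmap c p) \<rho> \<inter> model M \<subseteq> cimage c"
    and b: "\<forall>z\<in>cball (cmap c p) \<rho> \<inter> model M. \<forall>u\<in>model M. m * norm u \<le> sqrt (gc c z u u)"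
    and \<gamma>: "psm \<gamma> 0 1" "\<gamma> 0 = p" and y: "\<gamma> 1 \<notin> cinv c ` (ball (cmap c p) \<rho> \<inter> model M)"
  shows "m * \<rho> \<le> len \<gamma> 0 1"
proof (rule ccontr)
  assume "\<not> ?thesis"
  then have lt: "len \<gamma> 0 1 / m < \<rho>" using m by (simp add: field_simps)
  define W where "W = ball (cmap c p) \<rho> \<inter> model M"
  have W: "openin (top_of_set (model M)) W" "W \<subseteq> cimage c" "W \<subseteq> cball (cmap c p) \<rho> \<inter> model M"
    using K openin_open_Int[of "ball (cmap c p) \<rho>" "model M"] by (auto simp: W_def Int_commute)
  define V where "V = cinv c ` W"
  have V: "openin mtop V" unfolding V_def by (rule openin_cinv_image[OF c(1) W(1,2)])
  have inV: "q \<in> cdom c" "cmap c q \<in> W" if qV: "q \<in> V" for q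
  proof -
    obtain z where z: "z \<in> W" "q = cinv c z" using qV unfolding V_def by blast
    then show "q \<in> cdom c" "cmap c q \<in> W" using cmap_cinv[OF c(1) subsetD[OF W(2) z(1)]] by simp_all
  qed
  have cu: "curve_on {0..1} \<gamma>" by (rule psm_curve_on[OF \<gamma>(1)]) simp
  define Z where "Z = {t \<in> {0..1}. \<gamma> t \<notin> V}"
  have "closed Z"
  proof -
    have "openin (top_of_set {0..1}) {t \<in> {0..1}. \<gamma> t \<in> V}"
    proof (subst openin_subopen, intro ballI)
      fix t assume "t \<in> {t \<in> {0..1}. \<gamma> t \<in> V}"
      then have t: "t \<in> {0..1}" "\<gamma> t \<in> V" by auto
      then have "\<forall>\<^sub>F s in at t within {0..1}. \<gamma> s \<in> V"
        using cu V unfolding curve_on_def limitin_def by blast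
      then obtain N where N: "open N" "t \<in> N" "\<And>s. \<lbrakk>s \<in> N; s \<noteq> t; s \<in> {0..1}\<rbrakk> \<Longrightarrow> \<gamma> s \<in> V"
        unfolding eventually_at_topological by blast
      show "\<exists>T. openin (top_of_set {0..1}) T \<and> t \<in> T \<and> T \<subseteq> {t \<in> {0..1}. \<gamma> t \<in> V}"
      proof (intro exI conjI)
        show "openin (top_of_set {0..1}) ({0..1} \<inter> N)" by (rule openin_open_Int[OF N(1)])
        show "t \<in> {0..1} \<inter> N" using t N by blast
        show "{0..1} \<inter> N \<subseteq> {t \<in> {0..1}. \<gamma> t \<in> V}" using N(3) t(2) by blast
      qed
    qed
    then have "closedin (top_of_set {0..1}) ({0..1} - {t \<in> {0..1}. \<gamma> t \<in> V})" by (simp add: closedin_diff)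
    moreover have "{0..1} - {t \<in> {0..1}. \<gamma> t \<in> V} = Z" by (auto simp: Z_def)
    ultimately show ?thesis using closedin_closed_trans[of "{0..1}" Z] by simp
  qed
  moreover have "1 \<in> Z" using y by (simp add: Z_def V_def W_def)
  moreover have bdd: "bdd_below Z" by (rule bdd_belowI[of _ 0]) (simp add: Z_def)
  ultimately have "Inf Z \<in> Z" using closed_contains_Inf by blast
  define t1 where "t1 = Inf Z"
  have t1: "t1 \<in> {0..1}" "\<gamma> t1 \<notin> V" using \<open>Inf Z \<in> Z\<close> by (auto simp: t1_def Z_def)
  have pV: "p \<in> V"
  proof -
    have "cmap c p \<in> W" using m(2) cmap_in_model[OF c] by (simp add: W_def)
    then show ?thesis unfolding V_def using cinv_cmap[OF c] by (metis imageI)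
  qed
  have t1pos: "t1 > 0"
  proof -
    have "t1 \<noteq> 0" using t1(2) \<gamma>(2) pV by metis
    then show ?thesis using t1(1) by simp
  qed
  have before: "\<gamma> t \<in> V" if "0 \<le> t" "t < t1" for t
  proof (rule ccontr)
    assume "\<gamma> t \<notin> V"
    then have "t \<in> Z" using that t1(1) by (simp add: Z_def)
    then have "t1 \<le> t" unfolding t1_def by (rule cInf_lower[OF _ bdd])
    then show False using that by simp
  qed
  have bound: "cmap c (\<gamma> t) \<in> cball (cmap c p) (len \<gamma> 0 1 / m) \<inter> model M" if t: "0 \<le> t" "t < t1" for t
  proof -
    have "m * norm (cmap c (\<gamma> t) - cmap c (\<gamma> 0)) \<le> len \<gamma> 0 1"
    proof (rule displacement_le_len[OF c(1) \<gamma>(1) t(1) _ m(1) _ b])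
      show "t \<le> 1" using t t1(1) by simp
      show "\<gamma> s \<in> cdom c \<and> cmap c (\<gamma> s) \<in> cball (cmap c p) \<rho> \<inter> model M" if "0 \<le> s" "s \<le> t" for s
        using inV[OF before[of s]] that t W(3) by auto
    qed
    then show ?thesis
      using m(1) \<gamma>(2) cmap_in_model[OF c(1) inV(1)[OF before[OF t]]]
      by (simp add: field_simps dist_norm norm_minus_commute)
  qed
  \<comment> \<open>Times that tend to the exit time from strictly below, where the bound is
    available.\<close>
  define \<tau> where "\<tau> = (\<lambda>n::nat. t1 - t1 / (real n + 2))"
  have \<tau>: "0 \<le> \<tau> n" "\<tau> n < t1" for n using t1pos by (auto simp: \<tau>_def field_simps)
  have "(\<lambda>n. t1 - t1 * inverse (real (Suc (Suc n)))) \<longlonglongrightarrow> t1 - t1 * 0"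
    by (rule tendsto_diff[OF tendsto_const tendsto_mult[OF tendsto_const LIMSEQ_Suc[OF LIMSEQ_inverse_real_of_nat]]])
  then have \<tau>lim: "\<tau> \<longlonglongrightarrow> t1" by (simp add: \<tau>_def divide_inverse add_ac)
  obtain z k where zk: "z \<in> cball (cmap c p) (len \<gamma> 0 1 / m) \<inter> model M" "strict_mono (k::nat\<Rightarrow>nat)"
    "((\<lambda>n. cmap c (\<gamma> (\<tau> n))) \<circ> k) \<longlonglongrightarrow> z"
  proof -
    have "seq_compact (cball (cmap c p) (len \<gamma> 0 1 / m) \<inter> model M)"
      by (simp add: compact_imp_seq_compact compact_Int_closed closed_model)
    moreover have "\<forall>n. cmap c (\<gamma> (\<tau> n)) \<in> cball (cmap c p) (len \<gamma> 0 1 / m) \<inter> model M" using bound[OF \<tau>] by blast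
    ultimately show thesis by (rule seq_compactE) (rule that)
  qed
  have zW: "z \<in> W" using zk(1) lt by (auto simp: W_def)
  then have zc: "cinv c z \<in> cdom c" "cmap c (cinv c z) = z" using cmap_cinv[OF c(1) subsetD[OF W(2)]] by auto
  have "limitin mtop (\<lambda>n. \<gamma> (\<tau> (k n))) (cinv c z) sequentially"
    unfolding limitin_chart[OF c(1) zc(1)] zc(2)
    using zk(3) inV(1)[OF before[OF \<tau>]] by (simp add: o_def)
  moreover have "limitin mtop (\<lambda>n. \<gamma> (\<tau> (k n))) (\<gamma> t1) sequentially"
  proof -
    have L: "limitin mtop \<gamma> (\<gamma> t1) (at t1 within {0..1})" using cu t1(1) by (simp add: curve_on_def)
    have f: "filterlim (\<lambda>n. \<tau> (k n)) (at t1 within {0..1}) sequentially"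
      unfolding filterlim_at
    proof (intro conjI always_eventually allI)
      show "(\<lambda>n. \<tau> (k n)) \<longlonglongrightarrow> t1" using LIMSEQ_subseq_LIMSEQ[OF \<tau>lim zk(2)] by (simp add: o_def)
      show "\<tau> (k n) \<in> {0..1}" for n using \<tau>[of "k n"] t1(1) by simp
      show "\<tau> (k n) \<noteq> t1" for n using \<tau>(2)[of "k n"] by simp
    qed
    show ?thesis unfolding limitin_def
    proof (intro conjI allI impI)
      show "\<gamma> t1 \<in> topspace mtop" by (rule limitin_topspace[OF L])
      fix U assume "openin mtop U \<and> \<gamma> t1 \<in> U"
      then have "\<forall>\<^sub>F s in at t1 within {0..1}. \<gamma> s \<in> U" using limitinD[OF L] by blast
      then show "\<forall>\<^sub>F n in sequentially. \<gamma> (\<tau> (k n)) \<in> U" by (rule eventually_compose_filterlim[OF _ f])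
    qed
  qed
  ultimately have "cinv c z = \<gamma> t1" using limitin_Hausdorff_unique[OF _ _ trivial_limit_sequentially Hausdorff] by metis
  then show False using t1(2) zW by (metis V_def imageI)
qed

end

section \<open>The distance and its topology\<close>

locale connected_riemannian = riemannian +
  assumes connected: "connected_space mtop"
begin

text \<open>The points that can be joined to x form an open and closed set, since chart segments
  join each point to a whole neighbourhood. This makes the infimum of the lengths
  meaningful.\<close>

lemma lengths_nonempty:
  assumes x: "x \<in> points M" and y: "y \<in> points M" shows "lengths x y \<noteq> {}"
proof -
  have nb: "\<exists>T. openin mtop T \<and> p \<in> T \<and> (\<forall>q\<in>T. lengths q p \<noteq> {})" if p: "p \<in> points M" for p
  proof -
    obtain c where c: "c \<in> charts M" "p \<in> cdom c" using chart_around[OF p] by blast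
    obtain \<rho> m C where \<rho>: "\<rho> > 0" "m > 0" "C \<ge> 0" "cball (cmap c p) \<rho> \<inter> model M \<subseteq> cmap c ` (cdom c \<inter> cdom c)"
      "cball (cmap c p) \<rho> \<inter> model M \<subseteq> cimage c"
      "\<forall>z\<in>cball (cmap c p) \<rho> \<inter> model M. \<forall>u\<in>model M. m * norm u \<le> sqrt (gc c z u u) \<and> sqrt (gc c z u u) \<le> C * norm u"
      by (rule chart_ball_metric[OF c openin_cdom[OF c(1)] c(2)])
    define W where "W = ball (cmap c p) \<rho> \<inter> model M"
    have W: "openin (top_of_set (model M)) W" "W \<subseteq> cimage c"
      using \<rho>(5) openin_open_Int[of "ball (cmap c p) \<rho>" "model M"] by (auto simp: W_def Int_commute)
    have "cmap c p \<in> W" using \<rho>(1) cmap_in_model[OF c] by (simp add: W_def)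
    then have "p \<in> cinv c ` W" using cinv_cmap[OF c] by (metis imageI)
    moreover have "lengths q p \<noteq> {}" if q: "q \<in> cinv c ` W" for q
    proof -
      obtain z where z: "z \<in> W" "q = cinv c z" using q by blast
      then have qc: "q \<in> cdom c" "cmap c q = z" using cmap_cinv[OF c(1) subsetD[OF W(2) z(1)]] by simp_all
      have "cmap c q \<in> cball (cmap c p) \<rho>" using z(1) qc(2) by (simp add: W_def)
      then obtain l where "l \<in> lengths q p" using lengths_near[OF c \<rho>(5,6) qc(1)] by metis
      then show ?thesis by blast
    qed
    ultimately show ?thesis using openin_cinv_image[OF c(1) W] by blast
  qed
  define R where "R = {y \<in> points M. lengths x y \<noteq> {}}"
  have tr: "lengths a c \<noteq> {}" if "lengths a b \<noteq> {}" "lengths b c \<noteq> {}" for a b c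
    using that lengths_add by (metis all_not_in_conv)
  have sy: "lengths a b \<noteq> {}" if "lengths b a \<noteq> {}" for a b using that lengths_sym by blast
  have "openin mtop R"
  proof (subst openin_subopen, intro ballI)
    fix p assume p: "p \<in> R"
    then obtain T where T: "openin mtop T" "p \<in> T" "\<forall>q\<in>T. lengths q p \<noteq> {}" using nb[of p] by (auto simp: R_def)
    have "T \<subseteq> R"
    proof
      fix q assume q: "q \<in> T"
      have "q \<in> points M" using openin_subset[OF T(1)] q topspace_mtop by blast
      moreover have "lengths x q \<noteq> {}"
      proof (rule tr)
        show "lengths x p \<noteq> {}" using p by (simp add: R_def)
        show "lengths p q \<noteq> {}" by (rule sy) (use T(3) q in blast)
      qed
      ultimately show "q \<in> R" by (simp add: R_def)
    qed
    then show "\<exists>T. openin mtop T \<and> p \<in> T \<and> T \<subseteq> R" using T by blast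
  qed
  moreover have "openin mtop (points M - R)"
  proof (subst openin_subopen, intro ballI)
    fix p assume p: "p \<in> points M - R"
    then obtain T where T: "openin mtop T" "p \<in> T" "\<forall>q\<in>T. lengths q p \<noteq> {}" using nb[of p] by auto
    have "T \<subseteq> points M - R"
    proof
      fix q assume q: "q \<in> T"
      have "q \<in> points M" using openin_subset[OF T(1)] q topspace_mtop by blast
      moreover have "lengths x q = {}"
      proof (rule ccontr)
        assume "lengths x q \<noteq> {}"
        from tr[OF this] T(3) q have "lengths x p \<noteq> {}" by blast
        then show False using p by (simp add: R_def)
      qed
      ultimately show "q \<in> points M - R" by (simp add: R_def)
    qed
    then show "\<exists>T. openin mtop T \<and> p \<in> T \<and> T \<subseteq> points M - R" using T by blast
  qed
  then have "closedin mtop R" by (simp add: closedin_def topspace_mtop R_def)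
  ultimately have "R = {} \<or> R = points M" using connected unfolding connected_space_clopen_in topspace_mtop by blast
  moreover have "x \<in> R"
    using nb[OF x] x unfolding R_def by blast
  ultimately show ?thesis using y by (auto simp: R_def)
qed

lemma rd_nonneg: "x \<in> points M \<Longrightarrow> y \<in> points M \<Longrightarrow> 0 \<le> rd x y"
  unfolding rd_eq by (rule cInf_greatest[OF lengths_nonempty lengths_nonneg])

lemma rd_sym: "rd x y = rd y x"
proof -
  have "lengths x y = lengths y x" using lengths_sym by blast
  then show ?thesis by (simp add: rd_eq)
qed

lemma rd_triangle:
  assumes "x \<in> points M" "y \<in> points M" "z \<in> points M" shows "rd x z \<le> rd x y + rd y z"
proof (rule field_le_epsilon)
  fix e :: real assume e: "e > 0"
  obtain l where l: "l \<in> lengths x y" "l < rd x y + e/2"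
    using cInf_lessD[OF lengths_nonempty[OF assms(1,2)], of "rd x y + e/2"] e unfolding rd_eq by auto
  obtain l' where l': "l' \<in> lengths y z" "l' < rd y z + e/2"
    using cInf_lessD[OF lengths_nonempty[OF assms(2,3)], of "rd y z + e/2"] e unfolding rd_eq by auto
  show "rd x z \<le> rd x y + rd y z + e" using rd_le[OF lengths_add[OF l(1) l'(1)]] l(2) l'(2) by simp
qed

text \<open>The distance induces the manifold topology. Chart segments bound it above by the
  coordinate distance; conversely, points outside of U are at distance at least m \<rho> by
  \<open>len_ge_exit\<close>.\<close>

lemma limitin_rd:
  "limitin mtop f l F \<longleftrightarrow> l \<in> points M \<and> (\<forall>\<^sub>F x in F. f x \<in> points M) \<and> ((\<lambda>x. rd (f x) l) \<longlongrightarrow> 0) F"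
proof (intro iffI conjI)
  assume L: "limitin mtop f l F"
  show l: "l \<in> points M" using limitin_topspace[OF L] by (simp add: topspace_mtop)
  show ev: "\<forall>\<^sub>F x in F. f x \<in> points M"
    using limitinD[OF L openin_topspace limitin_topspace[OF L]] by (simp add: topspace_mtop)
  obtain c where c: "c \<in> charts M" "l \<in> cdom c" using chart_around[OF l] by blast
  obtain \<rho> m C where \<rho>: "\<rho> > 0" "m > 0" "C \<ge> 0" "cball (cmap c l) \<rho> \<inter> model M \<subseteq> cmap c ` (cdom c \<inter> cdom c)"
    "cball (cmap c l) \<rho> \<inter> model M \<subseteq> cimage c"
    "\<forall>z\<in>cball (cmap c l) \<rho> \<inter> model M. \<forall>u\<in>model M. m * norm u \<le> sqrt (gc c z u u) \<and> sqrt (gc c z u u) \<le> C * norm u"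
    by (rule chart_ball_metric[OF c openin_cdom[OF c(1)] c(2)])
  have lc: "\<forall>\<^sub>F x in F. f x \<in> cdom c" "((\<lambda>x. cmap c (f x)) \<longlongrightarrow> cmap c l) F"
    using L[unfolded limitin_chart[OF c]] by auto
  have "\<forall>\<^sub>F x in F. dist (cmap c (f x)) (cmap c l) < \<rho>" by (rule tendstoD[OF lc(2) \<rho>(1)])
  then have "\<forall>\<^sub>F x in F. norm (rd (f x) l) \<le> C * norm (cmap c (f x) - cmap c l)"
    using lc(1) ev
  proof eventually_elim
    case (elim x)
    have "cmap c (f x) \<in> cball (cmap c l) \<rho>" using elim(1) by (simp add: dist_commute)
    then obtain k where "k \<in> lengths (f x) l" "k \<le> C * norm (cmap c (f x) - cmap c l)"
      using lengths_near[OF c \<rho>(5,6) elim(2)] by metis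
    then show ?case using rd_le[of k "f x" l] rd_nonneg[OF elim(3) l] by simp
  qed
  moreover have "((\<lambda>x. C * norm (cmap c (f x) - cmap c l)) \<longlongrightarrow> C * norm (cmap c l - cmap c l)) F"
    by (intro tendsto_intros lc(2))
  then have "((\<lambda>x. C * norm (cmap c (f x) - cmap c l)) \<longlongrightarrow> 0) F" by simp
  ultimately show "((\<lambda>x. rd (f x) l) \<longlongrightarrow> 0) F" by (rule Lim_null_comparison)
next
  assume A: "l \<in> points M \<and> (\<forall>\<^sub>F x in F. f x \<in> points M) \<and> ((\<lambda>x. rd (f x) l) \<longlongrightarrow> 0) F"
  then have l: "l \<in> points M" by blast
  show "limitin mtop f l F"
    unfolding limitin_def
  proof (intro conjI allI impI)
    show "l \<in> topspace mtop" using l by (simp add: topspace_mtop)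
    fix U assume "openin mtop U \<and> l \<in> U"
    then have U: "openin mtop U" "l \<in> U" by auto
    obtain c where c: "c \<in> charts M" "l \<in> cdom c" using chart_around[OF l] by blast
    obtain \<rho> m C where \<rho>: "\<rho> > 0" "m > 0" "C \<ge> 0" "cball (cmap c l) \<rho> \<inter> model M \<subseteq> cmap c ` (U \<inter> cdom c)"
      "cball (cmap c l) \<rho> \<inter> model M \<subseteq> cimage c"
      "\<forall>z\<in>cball (cmap c l) \<rho> \<inter> model M. \<forall>u\<in>model M. m * norm u \<le> sqrt (gc c z u u) \<and> sqrt (gc c z u u) \<le> C * norm u"
      by (rule chart_ball_metric[OF c U])
    have "\<forall>\<^sub>F x in F. rd (f x) l < m * \<rho>" using A \<rho>(1,2) by (auto intro: order_tendstoD)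
    with conjunct1[OF conjunct2[OF A]] show "\<forall>\<^sub>F x in F. f x \<in> U"
    proof eventually_elim
      case (elim x)
      show ?case
      proof (rule ccontr)
        assume N: "f x \<notin> U"
        have out: "f x \<notin> cinv c ` (ball (cmap c l) \<rho> \<inter> model M)"
        proof
          assume "f x \<in> cinv c ` (ball (cmap c l) \<rho> \<inter> model M)"
          then obtain z where "z \<in> ball (cmap c l) \<rho> \<inter> model M" "f x = cinv c z" by blast
          then have z: "z \<in> cball (cmap c l) \<rho> \<inter> model M" "f x = cinv c z" by auto
          then obtain q where "q \<in> U" "q \<in> cdom c" "z = cmap c q" using \<rho>(4) by blast
          then show False using N z(2) cinv_cmap[OF c(1)] by simp
        qed
        have b: "\<forall>z\<in>cball (cmap c l) \<rho> \<inter> model M. \<forall>u\<in>model M. m * norm u \<le> sqrt (gc c z u u)" using \<rho>(6) by blast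
        have "m * \<rho> \<le> rd l (f x)"
          unfolding rd_eq
        proof (rule cInf_greatest[OF lengths_nonempty[OF l elim(1)]])
          fix k assume "k \<in> lengths l (f x)"
          then obtain \<gamma> where \<gamma>: "k = len \<gamma> 0 1" "psm \<gamma> 0 1" "\<gamma> 0 = l" "\<gamma> 1 = f x" by (auto simp: lengths_def)
          show "m * \<rho> \<le> k" unfolding \<gamma>(1)
            by (rule len_ge_exit[OF c \<rho>(2,1,5) b \<gamma>(2,3)]) (use out \<gamma>(4) in simp)
        qed
        then show False using elim(2) rd_sym[of l "f x"] by simp
      qed
    qed
  qed
qed

text \<open>At distance 0 the constant sequence x converges to y, and limits in a Hausdorff space
  are unique.\<close>

lemma rd_zero:
  assumes "x \<in> points M" "y \<in> points M" shows "rd x y = 0 \<longleftrightarrow> x = y"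
proof
  assume "rd x y = 0"
  then have "limitin mtop (\<lambda>_::nat. x) y sequentially" unfolding limitin_rd using assms by simp
  moreover have "limitin mtop (\<lambda>_::nat. x) x sequentially" using assms by (simp add: topspace_mtop)
  ultimately show "x = y" using limitin_Hausdorff_unique[OF _ _ trivial_limit_sequentially Hausdorff] by metis
next
  assume "x = y"
  have "limitin mtop (\<lambda>_::nat. x) x sequentially" using assms by (simp add: topspace_mtop)
  then have "(\<lambda>_::nat. rd x x) \<longlonglongrightarrow> 0" unfolding limitin_rd by blast
  then show "rd x y = 0" using LIMSEQ_unique[OF tendsto_const] \<open>x = y\<close> by blast
qed

end

section \<open>Paths of the structure of a vector field\<close>

lemma AE_unit_interval_iff:
  "(AE t in lebesgue_on {0..1::real}. Q t) \<longleftrightarrow> (\<exists>N. negligible N \<and> (\<forall>t\<in>{0..1} - N. Q t))"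
proof
  assume "AE t in lebesgue_on {0..1::real}. Q t"
  then obtain N where N: "N \<in> null_sets (lebesgue_on {0..1})" "{t \<in> space (lebesgue_on {0..1}). \<not> Q t} \<subseteq> N"
    unfolding eventually_ae_filter by blast
  have "N \<in> null_sets lebesgue" using N(1) by (simp add: null_sets_restrict_space)
  then have "negligible N" by (simp add: negligible_iff_null_sets)
  moreover have "\<forall>t\<in>{0..1} - N. Q t" using N(2) by (auto simp: space_restrict_space)
  ultimately show "\<exists>N. negligible N \<and> (\<forall>t\<in>{0..1} - N. Q t)" by blast
next
  assume "\<exists>N. negligible N \<and> (\<forall>t\<in>{0..1} - N. Q t)"
  then obtain N where N: "negligible N" "\<forall>t\<in>{0..1} - N. Q t" by blast
  have "AE t in lebesgue. t \<notin> N" using N(1) by (intro AE_not_in) (simp add: negligible_iff_null_sets)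
  then have "AE t in lebesgue. t \<in> {0..1} \<longrightarrow> Q t" by (rule eventually_mono) (use N(2) in blast)
  then show "AE t in lebesgue_on {0..1::real}. Q t" by (subst AE_restrict_space_iff) auto
qed

text \<open>A nonempty open set is not negligible. This upgrades the almost-everywhere velocity
  equation of an A-path to all interior points of its pieces.\<close>

lemma continuous_zero_off_negligible:
  fixes f :: "real \<Rightarrow> 'b::real_normed_vector"
  assumes "open J" "continuous_on J f" "negligible N" "\<And>s. s \<in> J - N \<Longrightarrow> f s = 0" "t \<in> J"
  shows "f t = 0"
proof (rule ccontr)
  assume "f t \<noteq> 0"
  define U where "U = J \<inter> f -` (- {0})"
  have "open U" unfolding U_def by (rule continuous_open_preimage[OF assms(2,1)]) (simp add: open_Compl)
  moreover have "t \<in> U" using assms(5) \<open>f t \<noteq> 0\<close> by (simp add: U_def)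
  ultimately have "\<not> negligible U" using open_not_negligible by blast
  moreover have "U \<subseteq> N" using assms(4) by (auto simp: U_def)
  ultimately show False using negligible_subset[OF assms(3)] by blast
qed

lemma smooth_on_pair:
  assumes "smooth_on S f" "smooth_on S h" shows "smooth_on S (\<lambda>x. (f x, h x))"
  unfolding smooth_on_def
proof
  fix x assume x: "x \<in> S"
  obtain U f' where U: "open U" "x \<in> U" "Cinf_on U f'" "\<And>y. y \<in> S \<Longrightarrow> y \<in> U \<Longrightarrow> f' y = f y"
    using smooth_onE[OF assms(1) x] by metis
  obtain V h' where V: "open V" "x \<in> V" "Cinf_on V h'" "\<And>y. y \<in> S \<Longrightarrow> y \<in> V \<Longrightarrow> h' y = h y"
    using smooth_onE[OF assms(2) x] by metis
  have "Cinf_on (U \<inter> V) f'" "Cinf_on (U \<inter> V) h'"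
    using Cinf_on_subset[OF U(3)] Cinf_on_subset[OF V(3)] by auto
  then have "Cinf_on (U \<inter> V) (\<lambda>x. (f' x, h' x))"
    unfolding Cinf_on_def using Ck_on_Pair[OF open_Int[OF U(1) V(1)]] by fast
  then show "\<exists>W k. open W \<and> x \<in> W \<and> Cinf_on W k \<and> (\<forall>y\<in>S \<inter> W. k y = (f y, h y))"
    using U V by (intro exI[of _ "U \<inter> V"] exI[of _ "\<lambda>x. (f' x, h' x)"]) auto
qed

text \<open>The coefficient of an $A$-path in terms of the unit section. It need not be continuous and is
  arbitrary at the break points.\<close>

definition piecewise_smooth_real :: "nat \<Rightarrow> (nat \<Rightarrow> real) \<Rightarrow> (real \<Rightarrow> real) \<Rightarrow> bool" where
  "piecewise_smooth_real n \<tau> a \<longleftrightarrow> partition01 n \<tau> \<and>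
     (\<forall>i<n. \<exists>ai. smooth_on {\<tau> i..\<tau> (Suc i)} ai \<and> (\<forall>t\<in>{\<tau> i<..<\<tau> (Suc i)}. a t = ai t))"

lemma partition01_mono:
  assumes "partition01 n \<tau>" "i \<le> j" "j \<le> n" shows "\<tau> i \<le> \<tau> j"
  using assms(2,3)
proof (induction j)
  case (Suc j)
  show ?case
  proof (cases "i = Suc j")
    case False
    then have "\<tau> i \<le> \<tau> j" using Suc by simp
    moreover have "\<tau> j < \<tau> (Suc j)" using assms(1) Suc.prems(2) by (simp add: partition01_def)
    ultimately show ?thesis by simp
  qed simp
qed simp

lemma partition01_locate:
  assumes "partition01 n \<tau>" "t \<in> {0..1} - \<tau> ` {..n}"
  obtains i where "i < n" "t \<in> {\<tau> i<..<\<tau> (Suc i)}"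
proof -
  define i where "i = (LEAST i. t < \<tau> i)"
  have "t < \<tau> n" using assms by (auto simp: partition01_def less_le)
  then have i: "t < \<tau> i" "i \<le> n" unfolding i_def by (rule LeastI, rule Least_le)
  have "\<tau> 0 = 0" using assms(1) by (simp add: partition01_def)
  then have "i \<noteq> 0" using i(1) assms(2) by (metis DiffD1 atLeastAtMost_iff not_less)
  then obtain j where j: "i = Suc j" by (cases i) auto
  have "\<not> t < \<tau> j" using not_less_Least[of j "\<lambda>i. t < \<tau> i"] j unfolding i_def by simp
  moreover have "t \<noteq> \<tau> j" using assms(2) i(2) j by auto
  ultimately show thesis using that[of j] i j by simp
qed

section \<open>Primitives of piecewise smooth functions\<close>

definition primitive :: "(real \<Rightarrow> real) \<Rightarrow> real \<Rightarrow> real" where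
  "primitive a t = integral {0..t} a"

lemma primitive_0 [simp]: "primitive a 0 = 0"
  by (simp add: primitive_def)

lemma primitive_const: "t \<ge> 0 \<Longrightarrow> primitive (\<lambda>_. r) t = r * t"
  by (simp add: primitive_def)

context
  fixes n \<tau> a assumes pw: "piecewise_smooth_real n \<tau> a"
begin

lemma pw_partition: "partition01 n \<tau>"
  using pw by (simp add: piecewise_smooth_real_def)

lemma pw_piece:
  assumes "i < n"
  obtains ai where "smooth_on {\<tau> i..\<tau> (Suc i)} ai" "\<And>t. t \<in> {\<tau> i<..<\<tau> (Suc i)} \<Longrightarrow> a t = ai t"
  using pw assms unfolding piecewise_smooth_real_def by metis

lemma pw_piece_subset: "i < n \<Longrightarrow> {\<tau> i..\<tau> (Suc i)} \<subseteq> {0..1}"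
  using partition01_mono[OF pw_partition, of 0 i] partition01_mono[OF pw_partition, of "Suc i" n] pw_partition
  by (auto simp: partition01_def)

lemma pw_integrable: "a integrable_on {0..1}"
proof -
  have "a integrable_on {\<tau> 0..\<tau> i}" if "i \<le> n" for i
    using that
  proof (induction i)
    case 0
    show ?case using integrable_on_refl[of a "\<tau> 0", unfolded cbox_interval] .
  next
    case (Suc i)
    then have i: "i < n" by simp
    obtain ai where ai: "smooth_on {\<tau> i..\<tau> (Suc i)} ai" "\<And>t. t \<in> {\<tau> i<..<\<tau> (Suc i)} \<Longrightarrow> a t = ai t"
      using pw_piece[OF i] by metis
    have "ai integrable_on {\<tau> i..\<tau> (Suc i)}"
      by (rule integrable_continuous_real[OF smooth_on_imp_continuous_on[OF ai(1)]])
    then have "a integrable_on {\<tau> i..\<tau> (Suc i)}"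
      by (rule integrable_spike[of _ _ "{\<tau> i, \<tau> (Suc i)}"]) (use ai(2) in auto)
    then show ?case
      using Suc partition01_mono[OF pw_partition, of 0 i] partition01_mono[OF pw_partition, of i "Suc i"]
      by (intro Henstock_Kurzweil_Integration.integrable_combine[of "\<tau> 0" "\<tau> i" "\<tau> (Suc i)" a]) auto
  qed
  from this[of n] show ?thesis using pw_partition by (simp add: partition01_def)
qed

lemma primitive_continuous: "continuous_on {0..1} (primitive a)"
  unfolding primitive_def by (rule indefinite_integral_continuous_1[OF pw_integrable])

lemma primitive_diff:
  assumes "0 \<le> u" "u \<le> v" "v \<le> 1" shows "primitive a v - primitive a u = integral {u..v} a"
proof -
  have "a integrable_on {0..v}" by (rule integrable_on_subinterval[OF pw_integrable]) (use assms in auto)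
  from Henstock_Kurzweil_Integration.integral_combine[OF assms(1,2) this] show ?thesis by (simp add: primitive_def)
qed

text \<open>An antiderivative of a smooth extension of a runs smoothly beyond the end of the piece.
  It agrees with the primitive up to the ends, but its derivative agrees with a only inside, as the
  value of a at a break point is arbitrary.\<close>

lemma primitive_local_smooth:
  assumes i: "i < n" and t0: "t0 \<in> {\<tau> i..\<tau> (Suc i)}"
  obtains e s' a' where "e > 0" "Cinf_on (ball t0 e) a'"
    "\<And>t. t \<in> ball t0 e \<Longrightarrow> (s' has_real_derivative a' t) (at t)"
    "\<And>t. t \<in> ball t0 e \<inter> {\<tau> i..\<tau> (Suc i)} \<Longrightarrow> s' t = primitive a t"
    "\<And>t. t \<in> ball t0 e \<inter> {\<tau> i<..<\<tau> (Suc i)} \<Longrightarrow> a' t = a t"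
proof -
  obtain ai where ai: "smooth_on {\<tau> i..\<tau> (Suc i)} ai" "\<And>t. t \<in> {\<tau> i<..<\<tau> (Suc i)} \<Longrightarrow> a t = ai t"
    using pw_piece[OF i] by metis
  obtain U a' where U: "open U" "t0 \<in> U" "Cinf_on U a'" "\<And>t. t \<in> {\<tau> i..\<tau> (Suc i)} \<Longrightarrow> t \<in> U \<Longrightarrow> a' t = ai t"
    using smooth_onE[OF ai(1) t0] by metis
  obtain e where e: "e > 0" "ball t0 e \<subseteq> U" using U(1,2) open_contains_ball by blast
  have ca: "Cinf_on (ball t0 e) a'" by (rule Cinf_on_subset[OF U(3) e(2)])
  have eqa: "a' t = a t" if "t \<in> ball t0 e \<inter> {\<tau> i<..<\<tau> (Suc i)}" for t
    using ai(2)[of t] U(4)[of t] that e(2) by auto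
  have bi: "ball t0 e = {t0 - e<..<t0 + e}" by (auto simp: dist_real_def)
  have "\<exists>F. \<forall>x. ereal (t0 - e) < ereal x \<longrightarrow> ereal x < ereal (t0 + e) \<longrightarrow> (F has_vector_derivative a' x) (at x)"
  proof (rule einterval_antiderivative)
    show "ereal (t0 - e) < ereal (t0 + e)" using e(1) by simp
    show "isCont a' x" if "ereal (t0 - e) < ereal x" "ereal x < ereal (t0 + e)" for x
      using Cinf_on_continuous[OF ca] that continuous_on_eq_continuous_at[OF open_ball, of t0 e a'] unfolding bi by auto
  qed
  then obtain F where F: "\<And>x. x \<in> ball t0 e \<Longrightarrow> (F has_vector_derivative a' x) (at x)" unfolding bi by auto
  have inc: "primitive a v - primitive a u = F v - F u"
    if uv: "u \<in> ball t0 e \<inter> {\<tau> i..\<tau> (Suc i)}" "v \<in> ball t0 e \<inter> {\<tau> i..\<tau> (Suc i)}" "u \<le> v" for u v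
  proof -
    have sub: "{u..v} \<subseteq> ball t0 e" using uv unfolding bi by auto
    have "(a' has_integral F v - F u) {u..v}"
      by (rule fundamental_theorem_of_calculus[OF uv(3)])
        (rule has_vector_derivative_at_within[OF F[OF subsetD[OF sub]]])
    then have "(a has_integral F v - F u) {u..v}"
    proof (rule has_integral_spike_finite[of "{u, v}", rotated 2])
      show "a t = a' t" if "t \<in> {u..v} - {u, v}" for t
      proof (rule eqa[symmetric])
        have "t \<in> {u<..<v}" using that by auto
        moreover have "t \<in> ball t0 e" using subsetD[OF sub, of t] that by blast
        ultimately show "t \<in> ball t0 e \<inter> {\<tau> i<..<\<tau> (Suc i)}" using uv by auto
      qed
    qed simp
    then have "integral {u..v} a = F v - F u" by (rule integral_unique)
    moreover have "primitive a v - primitive a u = integral {u..v} a"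
      by (rule primitive_diff) (use uv pw_piece_subset[OF i] in auto)
    ultimately show ?thesis by simp
  qed
  show thesis
  proof (rule that[OF e(1) ca, of "\<lambda>t. primitive a t0 + (F t - F t0)"])
    show "((\<lambda>t. primitive a t0 + (F t - F t0)) has_real_derivative a' t) (at t)" if "t \<in> ball t0 e" for t
      using F[OF that] unfolding has_real_derivative_iff_has_vector_derivative[symmetric]
      by (auto intro!: derivative_eq_intros)
    show "primitive a t0 + (F t - F t0) = primitive a t" if t: "t \<in> ball t0 e \<inter> {\<tau> i..\<tau> (Suc i)}" for t
    proof (cases "t0 \<le> t")
      case True
      then show ?thesis using inc[of t0 t] t t0 e(1) by simp
    next
      case False
      then show ?thesis using inc[of t t0] t t0 e(1) by simp
    qed
  qed (rule eqa)
qed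

lemma primitive_derivative:
  assumes i: "i < n" and t: "t \<in> {\<tau> i<..<\<tau> (Suc i)}"
  shows "(primitive a has_real_derivative a t) (at t)"
proof -
  have "t \<in> {\<tau> i..\<tau> (Suc i)}" using t by auto
  from primitive_local_smooth[OF i this]
  obtain e s' a' where e: "e > 0" "Cinf_on (ball t e) a'"
    "\<And>u. u \<in> ball t e \<Longrightarrow> (s' has_real_derivative a' u) (at u)"
    "\<And>u. u \<in> ball t e \<inter> {\<tau> i..\<tau> (Suc i)} \<Longrightarrow> s' u = primitive a u"
    "\<And>u. u \<in> ball t e \<inter> {\<tau> i<..<\<tau> (Suc i)} \<Longrightarrow> a' u = a u" by metis
  have "(s' has_real_derivative a t) (at t)" using e(1) e(3)[of t] e(5)[of t] t by simp
  then show ?thesis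
    by (rule has_field_derivative_transform_within_open[of _ _ _ "ball t e \<inter> {\<tau> i<..<\<tau> (Suc i)}"])
      (use e(1,4) t in auto)
qed

text \<open>This puts the orbit times of a path of speed at most r into [-r,r].\<close>

lemma primitive_bound:
  assumes "negligible N" "\<And>t. t \<in> {0..1} - N \<Longrightarrow> \<bar>a t\<bar> \<le> r" "0 \<le> r" "t \<in> {0..1}"
  shows "\<bar>primitive a t\<bar> \<le> r"
proof -
  have int: "a integrable_on {0..t}" by (rule integrable_on_subinterval[OF pw_integrable]) (use assms in auto)
  define b where "b = (\<lambda>s. if s \<in> N then 0 else a s)"
  have "primitive a t = integral {0..t} b"
    unfolding primitive_def by (rule integral_spike[OF assms(1)]) (simp add: b_def)
  also have "norm (integral {0..t} b) \<le> integral {0..t} (\<lambda>_. r)"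
  proof (rule integral_norm_bound_integral)
    show "b integrable_on {0..t}" by (rule integrable_spike[OF int assms(1)]) (simp add: b_def)
    show "norm (b s) \<le> r" if "s \<in> {0..t}" for s using assms(2)[of s] assms(3,4) that by (auto simp: b_def)
  qed (rule integrable_const_ivl)
  also have "integral {0..t} (\<lambda>_. r) = r * t" using assms(4) by simp
  also have "\<dots> \<le> r" using assms(3,4) by (simp add: mult_left_le)
  finally show ?thesis by simp
qed

lemma pw_bounded: "\<exists>B. \<forall>t\<in>{0..1} - \<tau> ` {..n}. \<bar>a t\<bar> \<le> B"
proof -
  have "\<exists>B. \<forall>t\<in>{\<tau> i<..<\<tau> (Suc i)}. \<bar>a t\<bar> \<le> B" if i: "i < n" for i
  proof -
    obtain ai where ai: "smooth_on {\<tau> i..\<tau> (Suc i)} ai" "\<And>t. t \<in> {\<tau> i<..<\<tau> (Suc i)} \<Longrightarrow> a t = ai t"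
      using pw_piece[OF i] by metis
    have "bounded (ai ` {\<tau> i..\<tau> (Suc i)})"
      by (intro compact_imp_bounded compact_continuous_image smooth_on_imp_continuous_on ai) simp
    then obtain B where "\<And>t. t \<in> {\<tau> i..\<tau> (Suc i)} \<Longrightarrow> \<bar>ai t\<bar> \<le> B"
      unfolding bounded_iff by (metis image_eqI real_norm_def)
    then show ?thesis using ai(2) by (intro exI[of _ B]) auto
  qed
  then obtain B where B: "\<And>i t. i < n \<Longrightarrow> t \<in> {\<tau> i<..<\<tau> (Suc i)} \<Longrightarrow> \<bar>a t\<bar> \<le> B i" by metis
  show ?thesis
  proof (intro exI ballI)
    fix t assume t: "t \<in> {0..1} - \<tau> ` {..n}"
    obtain i where i: "i < n" "t \<in> {\<tau> i<..<\<tau> (Suc i)}" by (rule partition01_locate[OF pw_partition t])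
    have "\<bar>a t\<bar> \<le> \<bar>B i\<bar>" using B[OF i] by simp
    also have "\<dots> \<le> (\<Sum>i<n. \<bar>B i\<bar>)" using i(1) by (intro member_le_sum) auto
    finally show "\<bar>a t\<bar> \<le> (\<Sum>i<n. \<bar>B i\<bar>)" .
  qed
qed

end

lemma piecewise_smooth_const: "piecewise_smooth_real 1 real (\<lambda>_. r)"
proof -
  have "smooth_on {0..1} (\<lambda>t::real. 0 * t + r)"
  proof -
    have "bounded_linear (\<lambda>t::real. 0 * t)" by (rule bounded_linear_mult_right)
    from Cinf_on_imp_smooth_on[OF open_UNIV Cinf_on_affine[OF this, of r]]
    have "smooth_on UNIV (\<lambda>t::real. 0 * t + r)" by (simp add: add.commute)
    then show ?thesis by (rule smooth_on_subset) simp
  qed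
  then show ?thesis by (auto simp: piecewise_smooth_real_def partition01_def)
qed

lemma smooth_on_locally:
  assumes "\<And>x. x \<in> S \<Longrightarrow> \<exists>T. openin (top_of_set S) T \<and> x \<in> T \<and> smooth_on T f"
  shows "smooth_on S f"
  unfolding smooth_on_def
proof
  fix x assume "x \<in> S"
  then obtain T where T: "openin (top_of_set S) T" "x \<in> T" "smooth_on T f" using assms by blast
  obtain W where W: "open W" "T = S \<inter> W" using T(1) unfolding openin_open by blast
  obtain U h where U: "open U" "x \<in> U" "Cinf_on U h" "\<And>y. y \<in> T \<Longrightarrow> y \<in> U \<Longrightarrow> h y = f y"
    using smooth_onE[OF T(3,2)] by metis
  have "Cinf_on (U \<inter> W) h" by (rule Cinf_on_subset[OF U(3)]) simp
  then show "\<exists>U h. open U \<and> x \<in> U \<and> Cinf_on U h \<and> (\<forall>y\<in>S \<inter> U. h y = f y)"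
    using U W T(2) by (intro exI[of _ "U \<inter> W"] exI[of _ h]) auto
qed

lemma (in smooth_mfd) curve_on_preimage:
  fixes \<gamma> :: "real \<Rightarrow> 'a"
  assumes cu: "curve_on S \<gamma>" and U: "openin mtop U"
  shows "openin (top_of_set S) (S \<inter> \<gamma> -` U)"
  unfolding openin_euclidean_subtopology_iff
proof (intro conjI ballI)
  fix t assume t: "t \<in> S \<inter> \<gamma> -` U"
  then have "limitin mtop \<gamma> (\<gamma> t) (at t within S)" using cu unfolding curve_on_def by blast
  then have "\<forall>\<^sub>F s in at t within S. \<gamma> s \<in> U" using U t unfolding limitin_def by blast
  then obtain e where e: "e > 0" "\<And>s. s \<in> S \<Longrightarrow> s \<noteq> t \<Longrightarrow> dist s t < e \<Longrightarrow> \<gamma> s \<in> U"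
    unfolding eventually_at by blast
  show "\<exists>e>0. \<forall>s\<in>S. dist s t < e \<longrightarrow> s \<in> S \<inter> \<gamma> -` U"
  proof (intro exI conjI ballI impI)
    fix s assume s: "s \<in> S" "dist s t < e"
    show "s \<in> S \<inter> \<gamma> -` U" by (cases "s = t") (use e(2) s t in auto)
  qed (rule e(1))
qed auto

lemma smooth_into_vf_structureI:
  assumes \<mu>: "smooth_into M S \<mu>" and a: "smooth_on S a"
  shows "smooth_into (total_manifold (vf_structure M X)) S (\<lambda>t. (a t, \<mu> t))"
  unfolding smooth_into_def charts_vf_structure points_vf_structure
proof (intro conjI ballI)
  show "(\<lambda>t. (a t, \<mu> t)) ` S \<subseteq> UNIV \<times> points M" using \<mu> by (auto simp: smooth_into_def)
  fix C assume "C \<in> (\<lambda>c. ((UNIV :: real set) \<times> cdom c, \<lambda>v. (cmap c (snd v), fst v :: real))) ` charts M"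
  then obtain c where c: "c \<in> charts M"
    and C: "C = ((UNIV :: real set) \<times> cdom c, \<lambda>v. (cmap c (snd v), fst v :: real))" by blast
  have eq: "S \<inter> (\<lambda>t. (a t, \<mu> t)) -` cdom C = S \<inter> \<mu> -` cdom c" by (auto simp: C)
  have m: "openin (top_of_set S) (S \<inter> \<mu> -` cdom c)" "smooth_on (S \<inter> \<mu> -` cdom c) (cmap c \<circ> \<mu>)"
    using \<mu> c unfolding smooth_into_def by blast+
  show "openin (top_of_set S) (S \<inter> (\<lambda>t. (a t, \<mu> t)) -` cdom C)" unfolding eq by (rule m)
  have "smooth_on (S \<inter> \<mu> -` cdom c) (\<lambda>t. ((cmap c \<circ> \<mu>) t, a t))"
    by (rule smooth_on_pair[OF m(2) smooth_on_subset[OF a]]) simp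
  then show "smooth_on (S \<inter> (\<lambda>t. (a t, \<mu> t)) -` cdom C) (cmap C \<circ> (\<lambda>t. (a t, \<mu> t)))"
    unfolding eq by (simp add: C o_def)
qed

lemma smooth_into_vf_structureD:
  assumes \<Gamma>: "smooth_into (total_manifold (vf_structure M X)) S \<Gamma>"
  shows "smooth_on S (\<lambda>t. fst (\<Gamma> t))"
proof (rule smooth_on_locally)
  fix t assume t: "t \<in> S"
  have "\<Gamma> t \<in> UNIV \<times> points M"
    using \<Gamma> t unfolding smooth_into_def points_vf_structure by blast
  then obtain c where c: "c \<in> charts M" "snd (\<Gamma> t) \<in> cdom c" unfolding points_def by auto
  define C where "C = ((UNIV :: real set) \<times> cdom c, \<lambda>v. (cmap c (snd v), fst v :: real))"
  have "C \<in> charts (total_manifold (vf_structure M X))"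
    unfolding charts_vf_structure C_def using c(1) by blast
  then have T: "openin (top_of_set S) (S \<inter> \<Gamma> -` cdom C)" "smooth_on (S \<inter> \<Gamma> -` cdom C) (cmap C \<circ> \<Gamma>)"
    using \<Gamma> unfolding smooth_into_def by blast+
  have "smooth_on (S \<inter> \<Gamma> -` cdom C) (\<lambda>t. snd ((cmap C \<circ> \<Gamma>) t))"
    by (rule smooth_on_linear_compose[OF bounded_linear_snd T(2)])
  then have "smooth_on (S \<inter> \<Gamma> -` cdom C) (\<lambda>t. fst (\<Gamma> t))" by (simp add: C_def)
  moreover have "t \<in> S \<inter> \<Gamma> -` cdom C" using t c(2) by (simp add: C_def mem_Times_iff)
  ultimately show "\<exists>T. openin (top_of_set S) T \<and> t \<in> T \<and> smooth_on T (\<lambda>t. fst (\<Gamma> t))" using T(1) by blast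
qed

section \<open>Reparametrized orbits as A-paths\<close>

context compact_vf
begin

lemma curve_on_flow:
  fixes s :: "real \<Rightarrow> real"
  assumes s: "continuous_on S s" and y: "y \<in> points M"
  shows "curve_on S (\<lambda>t. flow M X (s t) y)"
  unfolding curve_on_def
proof
  fix t assume t: "t \<in> S"
  obtain c where c: "c \<in> charts M" "flow M X (s t) y \<in> cdom c"
    using chart_around[OF flow_points[OF y]] by blast
  note w = has_velocity_cdom[OF flow_curve(1)[OF y] c]
  have lim: "filterlim s (nhds (s t)) (at t within S)"
    using s t unfolding continuous_on_def by blast
  have "isCont (\<lambda>u. cmap c (flow M X u y)) (s t)"
    using has_vector_derivative_continuous[OF w(2)] by (simp add: o_def)
  then have "((\<lambda>u. cmap c (flow M X (s u) y)) \<longlongrightarrow> cmap c (flow M X (s t) y)) (at t within S)"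
    by (rule isCont_tendsto_compose[OF _ lim])
  moreover have "\<forall>\<^sub>F u in at t within S. flow M X (s u) y \<in> cdom c"
    by (rule eventually_compose_filterlim[OF w(1) lim])
  ultimately show "limitin mtop (\<lambda>t. flow M X (s t) y) (flow M X (s t) y) (at t within S)"
    unfolding limitin_chart[OF c] by blast
qed

text \<open>Smoothness is required on closed pieces, so near t0 the primitive is replaced by its
  smooth extension s'. The curve \<nu>(t) = \<phi>_{s'(t)} y then solves \<nu>' = a' X(\<nu>) on an
  open interval, and in a chart \<open>ode_solution_smooth\<close> applies.\<close>

lemma smooth_into_flow:
  assumes pw: "piecewise_smooth_real n \<tau> a" and i: "i < n" and y: "y \<in> points M"
  shows "smooth_into M {\<tau> i..\<tau> (Suc i)} (\<lambda>t. flow M X (primitive a t) y)"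
  unfolding smooth_into_def
proof (intro conjI ballI)
  let ?\<mu> = "\<lambda>t. flow M X (primitive a t) y" and ?S = "{\<tau> i..\<tau> (Suc i)}"
  show "?\<mu> ` ?S \<subseteq> points M" using flow_points[OF y] by blast
  have cu: "curve_on ?S ?\<mu>"
    by (rule curve_on_flow[OF continuous_on_subset[OF primitive_continuous[OF pw] pw_piece_subset[OF pw i]] y])
  fix c assume c: "c \<in> charts M"
  show "openin (top_of_set ?S) (?S \<inter> ?\<mu> -` cdom c)"
    by (rule curve_on_preimage[OF cu openin_cdom[OF c]])
  show "smooth_on (?S \<inter> ?\<mu> -` cdom c) (cmap c \<circ> ?\<mu>)"
    unfolding smooth_on_def
  proof
    fix t0 assume t0: "t0 \<in> ?S \<inter> ?\<mu> -` cdom c"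
    then have t0S: "t0 \<in> ?S" by blast
    obtain e s' a' where e: "e > 0" "Cinf_on (ball t0 e) a'"
      and s': "\<And>t. t \<in> ball t0 e \<Longrightarrow> (s' has_real_derivative a' t) (at t)"
      and eqs: "\<And>t. t \<in> ball t0 e \<inter> ?S \<Longrightarrow> s' t = primitive a t"
      using primitive_local_smooth[OF pw i t0S] by metis
    define \<nu> where "\<nu> = (\<lambda>t. flow M X (s' t) y)"
    have \<nu>0: "\<nu> t0 \<in> cdom c" using t0 eqs[of t0] e(1) by (simp add: \<nu>_def)
    have vel: "has_velocity M \<nu> (sc (a' t) (X (\<nu> t))) t" if "t \<in> ball t0 e" for t
      unfolding \<nu>_def by (rule has_velocity_reparam[OF flow_curve(1)[OF y] s'[OF that]])
    obtain V h where V: "open V" "cmap c (\<nu> t0) \<in> V" "Cinf_on V h"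
      "\<And>z. z \<in> cimage c \<Longrightarrow> z \<in> V \<Longrightarrow> h z = vfc c z"
      using smooth_onE[OF vfc_smooth[OF c] cmap_in_cimage[OF \<nu>0]] by metis
    have t0b: "t0 \<in> ball t0 e" using e(1) by simp
    note w0 = has_velocity_cdom[OF vel[OF t0b] c \<nu>0]
    have "((\<lambda>t. cmap c (\<nu> t)) \<longlongrightarrow> cmap c (\<nu> t0)) (nhds t0)"
      using has_vector_derivative_continuous[OF w0(2)] tendsto_at_iff_tendsto_nhds[of "\<lambda>t. cmap c (\<nu> t)" t0]
      by (simp add: o_def continuous_at)
    then have "\<forall>\<^sub>F t in nhds t0. cmap c (\<nu> t) \<in> V" by (rule topological_tendstoD[OF _ V(1,2)])
    with w0(1) eventually_nhds_in_open[OF open_ball t0b]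
    have "\<forall>\<^sub>F t in nhds t0. \<nu> t \<in> cdom c \<and> cmap c (\<nu> t) \<in> V \<and> t \<in> ball t0 e"
      by eventually_elim blast
    then obtain I where I: "open I" "t0 \<in> I" "\<And>t. t \<in> I \<Longrightarrow> \<nu> t \<in> cdom c \<and> cmap c (\<nu> t) \<in> V \<and> t \<in> ball t0 e"
      unfolding eventually_nhds by blast
    have "Cinf_on I (\<lambda>t. cmap c (\<nu> t))"
    proof (rule ode_solution_smooth[OF I(1) V(1) Cinf_on_subset[OF e(2)] V(3)])
      show "((\<lambda>t. cmap c (\<nu> t)) has_vector_derivative a' t *\<^sub>R h (cmap c (\<nu> t))) (at t)" if t: "t \<in> I" for t
      proof -
        have n: "\<nu> t \<in> cdom c" "cmap c (\<nu> t) \<in> V" "t \<in> ball t0 e" using I(3)[OF t] by auto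
        have "h (cmap c (\<nu> t)) = snd (X (\<nu> t)) c"
          unfolding V(4)[OF cmap_in_cimage[OF n(1)] n(2)] by (rule vfc_cmap[OF c n(1)])
        then show ?thesis using has_velocity_cdom(2)[OF vel[OF n(3)] c n(1)] by (simp add: o_def)
      qed
    qed (use I(3) in auto)
    moreover have "cmap c (\<nu> t) = (cmap c \<circ> ?\<mu>) t" if "t \<in> (?S \<inter> ?\<mu> -` cdom c) \<inter> I" for t
      using eqs[of t] I(3)[of t] that by (simp add: \<nu>_def)
    ultimately show "\<exists>U h. open U \<and> t0 \<in> U \<and> Cinf_on U h \<and>
        (\<forall>t\<in>?S \<inter> ?\<mu> -` cdom c \<inter> U. h t = (cmap c \<circ> ?\<mu>) t)"
      using I(1,2) by blast
  qed
qed

abbreviation G where "G \<equiv> vf_structure M X"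

lemma base_G [simp]: "base G = M" "fnorm G v = \<bar>fst v\<bar>" "anchor G v = sc (fst v) (X (snd v))"
  by (simp_all add: vf_structure_def split_beta)

lemma fibre_G: "v \<in> fibre G p \<longleftrightarrow> p \<in> points M \<and> snd v = p"
  by (cases v) (auto simp: fibre_def vf_structure_def)

lemma flow_A_path:
  assumes pw: "piecewise_smooth_real n \<tau> a" and y: "y \<in> points M"
    and N: "negligible N" "\<And>t. t \<in> {0..1} - N \<Longrightarrow> ereal \<bar>a t\<bar> \<le> r"
  shows "(\<lambda>t. flow M X (primitive a t) y) \<in> A_paths G y r"
proof -
  let ?\<mu> = "\<lambda>t. flow M X (primitive a t) y" and ?\<Gamma> = "\<lambda>t. (a t, flow M X (primitive a t) y)"
  note part = pw_partition[OF pw] and pts = flow_points[OF y]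
  have 1: "piecewise_smooth_path M ?\<mu>"
    unfolding piecewise_smooth_path_def
    by (intro exI[of _ n] exI[of _ \<tau>] conjI part allI impI smooth_into_flow[OF pw _ y])
  have 2: "piecewise_smooth_discont (total_manifold G) ?\<Gamma>"
    unfolding piecewise_smooth_discont_def points_vf_structure
  proof (intro conjI exI[of _ n] exI[of _ \<tau>] allI impI)
    show "partition01 n \<tau>" by (rule part)
    fix i assume i: "i < n"
    obtain ai where ai: "smooth_on {\<tau> i..\<tau> (Suc i)} ai" "\<And>t. t \<in> {\<tau> i<..<\<tau> (Suc i)} \<Longrightarrow> a t = ai t"
      using pw_piece[OF pw i] by metis
    have "smooth_into (total_manifold G) {\<tau> i..\<tau> (Suc i)} (\<lambda>t. (ai t, ?\<mu> t))"
      by (rule smooth_into_vf_structureI[OF smooth_into_flow[OF pw i y] ai(1)])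
    moreover have "\<forall>t\<in>{\<tau> i<..<\<tau> (Suc i)}. ?\<Gamma> t = (ai t, ?\<mu> t)" using ai(2) by simp
    ultimately show "\<exists>\<Gamma>'. smooth_into (total_manifold G) {\<tau> i..\<tau> (Suc i)} \<Gamma>' \<and>
        (\<forall>t\<in>{\<tau> i<..<\<tau> (Suc i)}. ?\<Gamma> t = \<Gamma>' t)" by blast
  qed (use pts in auto)
  have 3: "AE t in lebesgue_on {0..1}. has_velocity M ?\<mu> (anchor G (?\<Gamma> t)) t"
    unfolding AE_unit_interval_iff
  proof (intro exI conjI ballI)
    show "negligible (\<tau> ` {..n})" by (simp add: negligible_finite)
    fix t assume "t \<in> {0..1} - \<tau> ` {..n}"
    then obtain i where i: "i < n" "t \<in> {\<tau> i<..<\<tau> (Suc i)}" by (rule partition01_locate[OF part])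
    show "has_velocity M ?\<mu> (anchor G (?\<Gamma> t)) t"
      using has_velocity_reparam[OF flow_curve(1)[OF y] primitive_derivative[OF pw i]] by simp
  qed
  have 4: "AE t in lebesgue_on {0..1}. ereal (fnorm G (?\<Gamma> t)) \<le> r"
    unfolding AE_unit_interval_iff using N by auto
  show ?thesis
    unfolding A_paths_def base_G mem_Collect_eq
  proof (intro conjI exI[of _ ?\<Gamma>] ballI)
    show "?\<mu> 0 = y" by (simp add: flow_curve(2)[OF y])
    show "?\<Gamma> t \<in> fibre G (?\<mu> t)" for t by (simp add: fibre_G pts)
  qed (rule 1 2 3[unfolded base_G] 4[unfolded base_G])+
qed

end

locale riemannian_flow = compact_vf M X + connected_riemannian M g
  for M :: "('a, 'e::euclidean_space) manifold" and X and g
begin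

text \<open>The coefficient a is the first component of \<Gamma>, and the time change is its
  primitive. The velocity equation is given almost everywhere only; inside the common pieces of
  \<gamma> and \<Gamma> both sides are continuous, so it holds off finitely many points, and
  uniqueness of solutions identifies \<gamma> with the reparametrized orbit.\<close>

lemma A_path_flow:
  assumes \<gamma>: "\<gamma> \<in> A_paths G x r"
  obtains n \<tau> a N where "piecewise_smooth_real n \<tau> a" "negligible N"
    "\<forall>t\<in>{0..1} - N. ereal \<bar>a t\<bar> \<le> r" "\<forall>t\<in>{0..1}. \<gamma> t = flow M X (primitive a t) x"
proof -
  obtain \<Gamma> where ps: "piecewise_smooth_path M \<gamma>" and \<gamma>0: "\<gamma> 0 = x"
    and disc: "piecewise_smooth_discont (total_manifold G) \<Gamma>"
    and fib: "\<And>t. t \<in> {0..1} \<Longrightarrow> \<Gamma> t \<in> fibre G (\<gamma> t)"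
    and vel: "AE t in lebesgue_on {0..1}. has_velocity M \<gamma> (anchor G (\<Gamma> t)) t"
    and spd: "AE t in lebesgue_on {0..1}. ereal (fnorm G (\<Gamma> t)) \<le> r"
    using \<gamma> unfolding A_paths_def base_G(1) mem_Collect_eq by blast
  define a where "a = (\<lambda>t. fst (\<Gamma> t))"
  have an: "anchor G (\<Gamma> t) = sc (a t) (X (\<gamma> t))" "\<gamma> t \<in> points M" if "t \<in> {0..1}" for t
    using fib[OF that] by (simp_all add: a_def fibre_G)
  obtain n1 \<tau>1 where part1: "partition01 n1 \<tau>1"
    and pieces: "\<forall>i<n1. \<exists>\<Gamma>'. smooth_into (total_manifold G) {\<tau>1 i..\<tau>1 (Suc i)} \<Gamma>' \<and>
           (\<forall>t\<in>{\<tau>1 i<..<\<tau>1 (Suc i)}. \<Gamma> t = \<Gamma>' t)"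
    using disc unfolding piecewise_smooth_discont_def by blast
  have pw: "piecewise_smooth_real n1 \<tau>1 a"
    unfolding piecewise_smooth_real_def
  proof (intro conjI part1 allI impI)
    fix i assume "i < n1"
    with pieces obtain \<Gamma>' where \<Gamma>': "smooth_into (total_manifold G) {\<tau>1 i..\<tau>1 (Suc i)} \<Gamma>'"
      "\<forall>t\<in>{\<tau>1 i<..<\<tau>1 (Suc i)}. \<Gamma> t = \<Gamma>' t" by blast
    show "\<exists>ai. smooth_on {\<tau>1 i..\<tau>1 (Suc i)} ai \<and> (\<forall>t\<in>{\<tau>1 i<..<\<tau>1 (Suc i)}. a t = ai t)"
      using smooth_into_vf_structureD[OF \<Gamma>'(1)] \<Gamma>'(2) unfolding a_def
      by (intro exI[of _ "\<lambda>t. fst (\<Gamma>' t)"]) simp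
  qed
  obtain n2 \<tau>2 where part2: "partition01 n2 \<tau>2" and sm: "\<forall>i<n2. smooth_into M {\<tau>2 i..\<tau>2 (Suc i)} \<gamma>"
    using ps unfolding piecewise_smooth_path_def by blast
  obtain N where N: "negligible N" "\<forall>t\<in>{0..1} - N. has_velocity M \<gamma> (anchor G (\<Gamma> t)) t"
    using vel unfolding AE_unit_interval_iff by blast
  obtain N' where N': "negligible N'" "\<forall>t\<in>{0..1} - N'. ereal (fnorm G (\<Gamma> t)) \<le> r"
    using spd unfolding AE_unit_interval_iff by blast
  \<comment> \<open>The break points of \<gamma> and of \<Gamma>, whose partitions need not
    coincide.\<close>
  define P where "P = \<tau>1 ` {..n1} \<union> \<tau>2 ` {..n2}"
  have all: "has_velocity M \<gamma> (sc (a t) (X (\<gamma> t))) t" if tP: "t \<in> {0..1} - P" for t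
  proof -
    obtain i where i: "i < n1" "t \<in> {\<tau>1 i<..<\<tau>1 (Suc i)}"
      using tP by (elim partition01_locate[OF part1, rotated]) (auto simp: P_def)
    obtain j where j: "j < n2" "t \<in> {\<tau>2 j<..<\<tau>2 (Suc j)}"
      using tP by (elim partition01_locate[OF part2, rotated]) (auto simp: P_def)
    obtain ai where ai: "smooth_on {\<tau>1 i..\<tau>1 (Suc i)} ai" "\<And>s. s \<in> {\<tau>1 i<..<\<tau>1 (Suc i)} \<Longrightarrow> a s = ai s"
      using pw_piece[OF pw i(1)] by metis
    have smj: "smooth_into M {\<tau>2 j..\<tau>2 (Suc j)} \<gamma>" using sm j(1) by blast
    have t01: "t \<in> {0..1}" using tP by blast
    obtain c where c: "c \<in> charts M" "\<gamma> t \<in> cdom c" using chart_around[OF an(2)[OF t01]] by blast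
    have tj: "t \<in> {\<tau>2 j..\<tau>2 (Suc j)}" using j(2) by simp
    obtain e h where e: "e > 0" and h: "Cinf_on (ball t e) h"
      and hc: "\<And>s. s \<in> ball t e \<inter> {\<tau>2 j..\<tau>2 (Suc j)} \<Longrightarrow> \<gamma> s \<in> cdom c \<and> h s = cmap c (\<gamma> s)"
      using smooth_into_local[OF smj tj c] by metis
    define J where "J = ball t e \<inter> {\<tau>2 j<..<\<tau>2 (Suc j)} \<inter> {\<tau>1 i<..<\<tau>1 (Suc i)}"
    have J: "open J" "t \<in> J" unfolding J_def using e i j by (auto intro!: open_Int)
    have Js: "J \<subseteq> ball t e" "J \<subseteq> {\<tau>1 i<..<\<tau>1 (Suc i)}" "J \<subseteq> {\<tau>2 j<..<\<tau>2 (Suc j)}" by (auto simp: J_def)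
    have J01: "J \<subseteq> {0..1}" using Js(2) pw_piece_subset[OF pw i(1)] by fastforce
    have hJ: "\<gamma> s \<in> cdom c" "h s = cmap c (\<gamma> s)" if "s \<in> J" for s
      using hc[of s] that by (simp_all add: J_def)
    have vJ: "\<exists>\<xi>. has_velocity M \<gamma> \<xi> s \<and> snd \<xi> c = frechet_derivative h (at s) 1" if "s \<in> J" for s
    proof -
      have "s \<in> ball t e \<inter> {\<tau>2 j<..<\<tau>2 (Suc j)}" using that by (simp add: J_def)
      from smooth_into_velocity[OF e h c(1) hc this] show ?thesis by blast
    qed
    have "Ck_on (Suc 0) (ball t e) h" using h unfolding Cinf_on_def by (rule spec)
    then have "continuous_on (ball t e) (\<lambda>s. frechet_derivative h (at s) 1)" by simp
    then have c1: "continuous_on J (\<lambda>s. frechet_derivative h (at s) 1)" by (rule continuous_on_subset[OF _ Js(1)])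
    have c2: "continuous_on J (\<lambda>s. vfc c (h s))"
    proof (rule continuous_on_compose2[OF smooth_on_imp_continuous_on[OF vfc_smooth[OF c(1)]]])
      show "continuous_on J h" by (rule continuous_on_subset[OF Cinf_on_continuous[OF h] Js(1)])
      show "h ` J \<subseteq> cimage c"
      proof
        fix z assume "z \<in> h ` J"
        then obtain s where "s \<in> J" "z = h s" by blast
        then show "z \<in> cimage c" using cmap_in_cimage[OF hJ(1)] hJ(2) by simp
      qed
    qed
    have c3: "continuous_on J ai"
      by (rule continuous_on_subset[OF smooth_on_imp_continuous_on[OF ai(1)]]) (use Js(2) in auto)
    have "frechet_derivative h (at t) 1 - ai t *\<^sub>R vfc c (h t) = 0"
    proof (rule continuous_zero_off_negligible[OF J(1) _ N(1) _ J(2)])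
      show "continuous_on J (\<lambda>s. frechet_derivative h (at s) 1 - ai s *\<^sub>R vfc c (h s))"
        by (intro continuous_intros c1 c2 c3)
      fix s assume s: "s \<in> J - N"
      then have sJ: "s \<in> J" and s01: "s \<in> {0..1}" using J01 by auto
      have "has_velocity M \<gamma> (anchor G (\<Gamma> s)) s" using N(2) s s01 by blast
      then have "has_velocity M \<gamma> (sc (a s) (X (\<gamma> s))) s" unfolding an(1)[OF s01] .
      moreover obtain \<xi> where "has_velocity M \<gamma> \<xi> s" "snd \<xi> c = frechet_derivative h (at s) 1" using vJ[OF sJ] by blast
      ultimately have "frechet_derivative h (at s) 1 = a s *\<^sub>R snd (X (\<gamma> s)) c"
        using has_velocity_unique by fastforce
      then show "frechet_derivative h (at s) 1 - ai s *\<^sub>R vfc c (h s) = 0"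
        using ai(2)[of s] Js(2) sJ vfc_cmap[OF c(1) hJ(1)[OF sJ]] hJ(2)[OF sJ] by auto
    qed
    then have eq: "frechet_derivative h (at t) 1 = snd (sc (a t) (X (\<gamma> t))) c"
      using ai(2)[OF i(2)] vfc_cmap[OF c] hJ(2)[OF J(2)] by simp
    obtain \<xi> where \<xi>: "has_velocity M \<gamma> \<xi> t" "snd \<xi> c = frechet_derivative h (at t) 1" using vJ[OF J(2)] by blast
    have "\<xi> = sc (a t) (X (\<gamma> t))"
      by (rule tfib_eqI[OF has_velocity_tfib[OF \<xi>(1)] sc_tfib[OF X_tfib[OF an(2)[OF t01]]] c \<xi>(2)[unfolded eq]])
    then show ?thesis using \<xi>(1) by simp
  qed
  obtain B where B: "\<forall>t\<in>{0..1} - \<tau>1 ` {..n1}. \<bar>a t\<bar> \<le> B" using pw_bounded[OF pw] by blast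
  \<comment> \<open>The coefficient a is arbitrary at the break points and outside of [0,1]; setting
    b to 0 there makes it bounded everywhere, as \<open>scaled_curves_unique\<close> asks.\<close>
  define b where "b = (\<lambda>t. if t \<in> {0..1} - P then a t else 0)"
  have x: "x \<in> points M" using an(2)[of 0] \<gamma>0 by simp
  have "\<gamma> t = flow M X (primitive a t) x" if t: "t \<in> {0..1}" for t
  proof (rule scaled_curves_unique[of 0 1 \<gamma> "\<lambda>t. flow M X (primitive a t) x" P b "max 0 B" 0])
    show "curve_on {0..1} \<gamma>" using ps unfolding piecewise_smooth_path_iff by (rule psm_curve_on) simp
    show "curve_on {0..1} (\<lambda>t. flow M X (primitive a t) x)" by (rule curve_on_flow[OF primitive_continuous[OF pw] x])
    show "finite P" by (simp add: P_def)
    show "\<bar>b t\<bar> \<le> max 0 B" for t using B by (auto simp: b_def P_def max_def)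
    show "has_velocity M \<gamma> (sc (b t) (X (\<gamma> t))) t" if "t \<in> {0<..<1} - P" for t
    proof -
      have "t \<in> {0..1} - P" using that by auto
      then show ?thesis using all[of t] by (simp only: b_def if_True)
    qed
    show "has_velocity M (\<lambda>t. flow M X (primitive a t) x) (sc (b t) (X (flow M X (primitive a t) x))) t"
      if "t \<in> {0<..<1} - P" for t
    proof -
      have t: "t \<in> {0..1} - P" using that by auto
      then have "t \<in> {0..1} - \<tau>1 ` {..n1}" by (auto simp: P_def)
      then obtain i where i: "i < n1" "t \<in> {\<tau>1 i<..<\<tau>1 (Suc i)}" by (rule partition01_locate[OF part1])
      have "b t = a t" unfolding b_def using t by (rule if_P)
      then show ?thesis
        using has_velocity_reparam[OF flow_curve(1)[OF x] primitive_derivative[OF pw i]] by simp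
    qed
  qed (use t \<gamma>0 flow_curve(2)[OF x] in auto)
  moreover have "ereal \<bar>a t\<bar> \<le> r" if "t \<in> {0..1} - N'" for t using N'(2) that by (simp add: a_def)
  ultimately show thesis using that[OF pw N'(1)] by blast
qed

end

text \<open>The bridge from topological compactness to sequential compactness and total boundedness.
  Outside of M the infimum of lengths is uncontrolled, so d' is set to 0 there, which makes it
  nonnegative and symmetric on the whole type.\<close>

lemma (in connected_riemannian) metric_space_rd:
  obtains d' where "Metric_space (points M) d'" "\<And>x y. x \<in> points M \<Longrightarrow> y \<in> points M \<Longrightarrow> d' x y = rd x y"
    "Metric_space.mtopology (points M) d' = mtop"
proof -
  define d' where "d' x y = (if x \<in> points M \<and> y \<in> points M then rd x y else 0)" for x y
  have d': "d' x y = rd x y" if "x \<in> points M" "y \<in> points M" for x y using that by (simp add: d'_def)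
  interpret Metric_space "points M" d'
  proof
    show "0 \<le> d' x y" for x y by (simp add: d'_def rd_nonneg)
    show "d' x y = d' y x" for x y by (simp add: d'_def rd_sym[of x y])
    show "d' x y = 0 \<longleftrightarrow> x = y" if "x \<in> points M" "y \<in> points M" for x y
      using that by (simp add: d' rd_zero)
    show "d' x z \<le> d' x y + d' y z" if "x \<in> points M" "y \<in> points M" "z \<in> points M" for x y z
      using that by (simp add: d' rd_triangle)
  qed
  have "openin mtopology U \<longleftrightarrow> openin mtop U" for U
  proof
    assume U: "openin mtopology U"
    show "openin mtop U"
    proof (subst openin_subopen, intro ballI)
      fix x assume x: "x \<in> U"
      then obtain r where r: "r > 0" "mball x r \<subseteq> U" and xp: "x \<in> points M"
        using U unfolding openin_mtopology by blast
      have "limitin mtop (\<lambda>y. y) x (nhdsin mtop x)"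
        unfolding limitin_def topspace_mtop eventually_nhdsin using xp by blast
      then have "\<forall>\<^sub>F y in nhdsin mtop x. y \<in> points M" "((\<lambda>y. rd y x) \<longlongrightarrow> 0) (nhdsin mtop x)"
        unfolding limitin_rd by blast+
      then have "\<forall>\<^sub>F y in nhdsin mtop x. y \<in> points M \<and> rd y x < r"
        using order_tendstoD(2)[OF _ r(1)] by (intro eventually_conj)
      then obtain V where V: "openin mtop V" "x \<in> V" "\<forall>y\<in>V. y \<in> points M \<and> rd y x < r"
        unfolding eventually_nhdsin topspace_mtop using xp by blast
      have "V \<subseteq> mball x r"
      proof
        fix y assume "y \<in> V"
        then have "y \<in> points M" "rd y x < r" using V(3) by auto
        then show "y \<in> mball x r" using xp by (simp add: d' rd_sym[of x y])
      qed
      then show "\<exists>T. openin mtop T \<and> x \<in> T \<and> T \<subseteq> U" using V(1,2) r(2) by blast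
    qed
  next
    assume U: "openin mtop U"
    then have Up: "U \<subseteq> points M" using openin_subset topspace_mtop by metis
    have "\<exists>r>0. mball x r \<subseteq> U" if x: "x \<in> U" for x
    proof -
      have xp: "x \<in> points M" using x Up by blast
      \<comment> \<open>The filter of points of M whose distance to x tends to 0. Applied to the
        identity along this filter, \<open>limitin_rd\<close> says that small balls around x lie in
        U.\<close>
      define F where "F = inf (filtercomap (\<lambda>y. rd y x) (nhds 0)) (principal (points M))"
      have "((\<lambda>y. rd y x) \<longlongrightarrow> 0) F"
        unfolding F_def filterlim_def by (rule order_trans[OF filtermap_mono[OF inf_le1] filtermap_filtercomap])
      moreover have "\<forall>\<^sub>F y in F. y \<in> points M"
        unfolding F_def eventually_inf_principal by simp
      ultimately have "limitin mtop (\<lambda>y. y) x F" unfolding limitin_rd using xp by blast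
      then have "\<forall>\<^sub>F y in F. y \<in> U" using U x unfolding limitin_def by blast
      then obtain Q where Q: "eventually Q (nhds 0)" "\<And>y. Q (rd y x) \<Longrightarrow> y \<in> points M \<Longrightarrow> y \<in> U"
        unfolding F_def eventually_inf_principal eventually_filtercomap by blast
      from Q(1) obtain r where r: "r > 0" "\<And>s. dist s 0 < r \<Longrightarrow> Q s" unfolding eventually_nhds_metric by blast
      have "mball x r \<subseteq> U"
      proof
        fix y assume "y \<in> mball x r"
        then have y: "y \<in> points M" "d' x y < r" by simp_all
        then have "rd y x < r" unfolding d'[OF xp y(1)] rd_sym[of y x] by blast
        have "Q (rd y x)" by (rule r(2)) (use \<open>rd y x < r\<close> rd_nonneg[OF y(1) xp] in simp)
        then show "y \<in> U" by (rule Q(2)[OF _ y(1)])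
      qed
      then show ?thesis using r(1) by blast
    qed
    then show "openin mtopology U" unfolding openin_mtopology using Up by blast
  qed
  then have "mtopology = mtop" by (simp add: topology_eq)
  then show thesis using that[of d'] d' Metric_space_axioms by blast
qed

section \<open>The path distances of the structure of X\<close>

context riemannian_flow
begin

lemma limitin_rd_seq:
  fixes f :: "nat \<Rightarrow> 'a"
  assumes "range f \<subseteq> points M" "l \<in> points M"
  shows "limitin mtop f l sequentially \<longleftrightarrow> (\<lambda>n. rd (f n) l) \<longlonglongrightarrow> 0"
proof -
  have "\<forall>\<^sub>F n in sequentially. f n \<in> points M" using assms(1) by (intro always_eventually) auto
  then show ?thesis unfolding limitin_rd using assms(2) by simp
qed

sublocale compact_flow "points M" rd "flow M X"
proof
  obtain d' where ms: "Metric_space (points M) d'"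
    and d': "\<And>x y. x \<in> points M \<Longrightarrow> y \<in> points M \<Longrightarrow> d' x y = rd x y"
    and top: "Metric_space.mtopology (points M) d' = mtop"
    using metric_space_rd by metis
  interpret ms: Metric_space "points M" d' by (rule ms)
  have cs: "compact_space ms.mtopology" using compact top by simp
  show "\<exists>l\<in>points M. \<exists>k. strict_mono k \<and> (\<lambda>n. rd (f (k n)) l) \<longlonglongrightarrow> 0"
    if f: "range f \<subseteq> points M" for f :: "nat \<Rightarrow> 'a"
  proof -
    obtain l k where l: "l \<in> points M" "strict_mono k" "limitin ms.mtopology (f \<circ> k) l sequentially"
      using cs f unfolding ms.compact_space_sequentially by blast
    have "limitin mtop (f \<circ> k) l sequentially" using l(3) unfolding top .
    then have "(\<lambda>n. rd ((f \<circ> k) n) l) \<longlonglongrightarrow> 0" unfolding limitin_rd by blast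
    then show ?thesis using l(1,2) by (auto simp: o_def)
  qed
  have tb: "ms.mtotally_bounded (points M)"
    by (rule ms.compactin_imp_mtotally_bounded[OF cs[unfolded compact_space_def ms.topspace_mtopology]])
  show "\<exists>C. finite C \<and> C \<subseteq> points M \<and> (\<forall>x\<in>points M. \<exists>c\<in>C. rd x c < e)" if e: "e > 0" for e
  proof -
    obtain C where C: "finite C" "C \<subseteq> points M" "points M \<subseteq> (\<Union>x\<in>C. ms.mball x e)"
      using tb[unfolded ms.mtotally_bounded_def, rule_format, OF e] by blast
    have "\<exists>c\<in>C. rd x c < e" if x: "x \<in> points M" for x
    proof -
      obtain c where c: "c \<in> C" "x \<in> ms.mball c e" using C(3) x by blast
      then have "rd c x < e" using d'[of c x] by simp
      then have "rd x c < e" unfolding rd_sym[of x c] .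
      then show ?thesis using c(1) by blast
    qed
    then show ?thesis using C(1,2) by blast
  qed
  show "(\<lambda>n. rd (flow M X (\<tau> n) (f n)) (flow M X t l)) \<longlonglongrightarrow> 0"
    if "range f \<subseteq> points M" "l \<in> points M" "(\<lambda>n. rd (f n) l) \<longlonglongrightarrow> 0" "\<tau> \<longlonglongrightarrow> t"
    for f :: "nat \<Rightarrow> 'a" and l \<tau> t
  proof -
    have "limitin mtop f l sequentially" using limitin_rd_seq[OF that(1,2)] that(3) by blast
    from flow_limitin[OF that(2) this that(4)] show ?thesis unfolding limitin_rd by blast
  qed
qed (rule rd_nonneg rd_zero rd_sym rd_triangle flow_points flow_curve(2) flow_plus; assumption)+

lemma flow_const_A_path:
  assumes "y \<in> points M" "\<bar>k\<bar> \<le> r"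
  shows "(\<lambda>t. flow M X (primitive (\<lambda>_. k) t) y) \<in> A_paths G y (ereal r)"
  by (rule flow_A_path[OF piecewise_smooth_const assms(1) negligible_empty]) (use assms(2) in simp)

lemma A_paths_points: "\<gamma> \<in> A_paths G x r \<Longrightarrow> t \<in> {0..1} \<Longrightarrow> \<gamma> t \<in> points M"
  unfolding A_paths_def base_G(1) mem_Collect_eq fibre_G by blast

lemma A_paths_unrestricted: "A_paths G x r \<subseteq> A_paths G x \<infinity>"
  unfolding A_paths_def by auto

lemma D_paths_le_d_paths: "D_paths G rd r x y \<le> d_paths G rd r x y"
  unfolding D_paths_def d_paths_def delta_paths_def
  by (intro add_mono SUP_mono' INF_superset_mono A_paths_unrestricted order_refl)

text \<open>A supremum over an empty set of paths would be -\<infinity>; the constant-speed orbit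
  shows that there is a path. Nonnegativity lets one summand of D_r be bounded by the sum.\<close>

lemma delta_paths_nonneg:
  assumes x: "x \<in> points M" and r: "r > 0"
  shows "0 \<le> delta_paths G rd (ereal r) s x y"
proof -
  let ?\<gamma> = "\<lambda>t. flow M X (primitive (\<lambda>_. r) t) x"
  have \<gamma>: "?\<gamma> \<in> A_paths G x (ereal r)" by (rule flow_const_A_path[OF x]) (use r in simp)
  have "0 \<le> (INF \<mu>\<in>A_paths G y s. SUP t\<in>{0..1}. ereal (rd (?\<gamma> t) (\<mu> t)))"
  proof (rule INF_greatest)
    fix \<mu> assume \<mu>: "\<mu> \<in> A_paths G y s"
    have "0 \<le> ereal (rd (?\<gamma> 0) (\<mu> 0))"
      using rd_nonneg[OF A_paths_points[OF \<gamma>, of 0] A_paths_points[OF \<mu>, of 0]] by simp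
    then show "0 \<le> (SUP t\<in>{0..1}. ereal (rd (?\<gamma> t) (\<mu> t)))" by (rule SUP_upper2[rotated]) simp
  qed
  also have "\<dots> \<le> delta_paths G rd (ereal r) s x y" unfolding delta_paths_def by (rule SUP_upper[OF \<gamma>])
  finally show ?thesis .
qed

text \<open>The competitor from y uses the same time change as the given path from x, so at each
  parameter both paths are at the same orbit time in [-r,r].\<close>

lemma delta_paths_le:
  assumes x: "x \<in> points M" and y: "y \<in> points M" and r: "r > 0"
  shows "delta_paths G rd (ereal r) (ereal r) x y \<le> (SUP t\<in>{-r..r}. ereal (rd (flow M X t x) (flow M X t y)))"
  unfolding delta_paths_def
proof (rule SUP_least)
  fix \<gamma> assume "\<gamma> \<in> A_paths G x (ereal r)"
  then obtain n \<tau> a N where pw: "piecewise_smooth_real n \<tau> a" and N: "negligible N"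
    "\<forall>t\<in>{0..1} - N. ereal \<bar>a t\<bar> \<le> ereal r" and eq: "\<forall>t\<in>{0..1}. \<gamma> t = flow M X (primitive a t) x"
    by (rule A_path_flow)
  have \<mu>: "(\<lambda>t. flow M X (primitive a t) y) \<in> A_paths G y (ereal r)" by (rule flow_A_path[OF pw y N(1)]) (use N(2) in blast)
  show "(INF \<mu>\<in>A_paths G y (ereal r). SUP t\<in>{0..1}. ereal (rd (\<gamma> t) (\<mu> t)))
      \<le> (SUP t\<in>{-r..r}. ereal (rd (flow M X t x) (flow M X t y)))"
  proof (rule INF_lower2[OF \<mu>], rule SUP_least)
    fix t :: real assume t: "t \<in> {0..1}"
    have "\<bar>primitive a t\<bar> \<le> r" by (rule primitive_bound[OF pw N(1) _ _ t]) (use N(2) r in auto)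
    then have "primitive a t \<in> {-r..r}" by auto
    then show "ereal (rd (\<gamma> t) (flow M X (primitive a t) y)) \<le> (SUP t\<in>{-r..r}. ereal (rd (flow M X t x) (flow M X t y)))"
      unfolding bspec[OF eq t] by (rule SUP_upper)
  qed
qed

lemma d_paths_le:
  assumes x: "x \<in> points M" and y: "y \<in> points M" and r: "r > 0"
  shows "d_paths G rd r x y \<le> 2 * (SUP t\<in>{-r..r}. ereal (rd (flow M X t x) (flow M X t y)))"
proof -
  let ?B = "SUP t\<in>{-r..r}. ereal (rd (flow M X t x) (flow M X t y))"
  have "delta_paths G rd (ereal r) (ereal r) y x \<le> ?B"
    using delta_paths_le[OF y x r] by (simp only: rd_sym[of "flow M X _ y"])
  then have "d_paths G rd r x y \<le> ?B + ?B"
    unfolding d_paths_def by (intro add_mono delta_paths_le[OF x y r])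
  also have "b + b = 2 * b" for b :: ereal by (cases b) auto
  finally show ?thesis .
qed

text \<open>The path with constant coefficient kr traverses the orbit of x for time r, forwards or
  backwards. An approximating path from y is a reparametrized orbit, and rescaling [0,1] to [0,r]
  turns its primitive into the time change.\<close>

lemma constant_speed_shadow:
  assumes x: "x \<in> points M" and k: "\<bar>k\<bar> = 1" and r: "r > 0"
    and lt: "delta_paths G rd (ereal r) \<infinity> x y < ereal \<eta>"
  obtains s where "continuous_on {0..r} s" "s 0 = 0" "\<forall>t\<in>{0..r}. rd (flow M X (k * t) x) (flow M X (s t) y) < \<eta>"
proof -
  let ?\<gamma> = "\<lambda>t. flow M X (primitive (\<lambda>_. k * r) t) x"
  have \<gamma>: "?\<gamma> \<in> A_paths G x (ereal r)" by (rule flow_const_A_path[OF x]) (use k r in \<open>simp add: abs_mult\<close>)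
  have "(INF \<mu>\<in>A_paths G y \<infinity>. SUP t\<in>{0..1}. ereal (rd (?\<gamma> t) (\<mu> t))) < ereal \<eta>"
    using SUP_upper[OF \<gamma>] lt unfolding delta_paths_def by (rule le_less_trans)
  then obtain \<mu> where \<mu>: "\<mu> \<in> A_paths G y \<infinity>" "(SUP t\<in>{0..1}. ereal (rd (?\<gamma> t) (\<mu> t))) < ereal \<eta>"
    unfolding INF_less_iff by blast
  obtain n \<tau> b N where pw: "piecewise_smooth_real n \<tau> b" and "negligible N"
    "\<forall>t\<in>{0..1} - N. ereal \<bar>b t\<bar> \<le> \<infinity>" and eq: "\<forall>t\<in>{0..1}. \<mu> t = flow M X (primitive b t) y"
    using \<mu>(1) by (rule A_path_flow)
  show thesis
  proof (rule that[of "\<lambda>t. primitive b (t / r)"])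
    show "continuous_on {0..r} (\<lambda>t. primitive b (t / r))"
      by (rule continuous_on_compose2[OF primitive_continuous[OF pw]])
        (use r in \<open>auto intro!: continuous_intros\<close>)
    show "\<forall>t\<in>{0..r}. rd (flow M X (k * t) x) (flow M X (primitive b (t / r)) y) < \<eta>"
    proof
      fix t assume "t \<in> {0..r}"
      then have t: "t / r \<in> {0..1}" using r by simp
      have "ereal (rd (?\<gamma> (t / r)) (\<mu> (t / r))) \<le> (SUP t\<in>{0..1}. ereal (rd (?\<gamma> t) (\<mu> t)))" by (rule SUP_upper[OF t])
      from le_less_trans[OF this \<mu>(2)] have "rd (?\<gamma> (t / r)) (\<mu> (t / r)) < \<eta>" by simp
      then show "rd (flow M X (k * t) x) (flow M X (primitive b (t / r)) y) < \<eta>"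
        using bspec[OF eq t] t r by (simp add: primitive_const)
    qed
  qed simp
qed

lemma entropies:
  "growth_rate (points M) (d_paths G rd) = growth_rate (points M) (D_paths G rd) \<and>
   growth_rate (points M) (D_paths G rd) = 2 * growth_rate (points M) (bowen_dist M X rd)"
proof -
  have "bowen_dist M X rd = bowen" by (intro ext) (simp add: bowen_dist_def bowen_def)
  moreover have "growth_rate (points M) (d_paths G rd) = growth_rate (points M) (D_paths G rd) \<and>
     growth_rate (points M) (D_paths G rd) = 2 * growth_rate (points M) bowen"
  proof (rule entropy_comparison)
    show "D_paths G rd r x y \<le> d_paths G rd r x y" for r x y by (rule D_paths_le_d_paths)
    show "d_paths G rd r x y \<le> 2 * (SUP t\<in>{-r..r}. ereal (rd (flow M X t x) (flow M X t y)))"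
      if "r > 0" "x \<in> points M" "y \<in> points M" for r x y by (rule d_paths_le[OF that(2,3,1)])
    show "D_paths G rd r x y = D_paths G rd r y x" for r x y by (simp add: D_paths_def add.commute)
    fix r \<eta> :: real and x y
    assume r: "r > 0" and x: "x \<in> points M" and y: "y \<in> points M" and lt: "D_paths G rd r x y < ereal \<eta>"
    \<comment> \<open>One summand of D_r gives both directions: the two constant-speed test paths
      start at x, and both are approximated by paths from y.\<close>
    have "delta_paths G rd (ereal r) \<infinity> x y \<le> D_paths G rd r x y"
      unfolding D_paths_def using delta_paths_nonneg[OF y r, of \<infinity> x] by (rule add_increasing2) simp
    then have lt': "delta_paths G rd (ereal r) \<infinity> x y < ereal \<eta>" using lt by (rule le_less_trans)
    obtain s where s: "continuous_on {0..r} s" "s 0 = 0" "\<forall>t\<in>{0..r}. rd (flow M X (1 * t) x) (flow M X (s t) y) < \<eta>"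
      by (rule constant_speed_shadow[OF x _ r lt', of 1]) auto
    obtain s' where s': "continuous_on {0..r} s'" "s' 0 = 0" "\<forall>t\<in>{0..r}. rd (flow M X (-1 * t) x) (flow M X (s' t) y) < \<eta>"
      by (rule constant_speed_shadow[OF x _ r lt', of "-1"]) auto
    have "shadows r \<eta> y x s" unfolding shadows_def using s by simp
    \<comment> \<open>The time change is negated because the reversed flow at time -s'(t) is the
      flow at time s'(t).\<close>
    moreover have "compact_flow.shadows rd (\<lambda>t. flow M X (- t)) r \<eta> y x (\<lambda>t. - s' t)"
      unfolding compact_flow.shadows_def[OF reverse_flow] using s' by (auto intro: continuous_on_minus)
    ultimately show "(\<exists>\<sigma>. shadows r \<eta> y x \<sigma>) \<and>
       (\<exists>\<sigma>. compact_flow.shadows rd (\<lambda>t. flow M X (- t)) r \<eta> y x \<sigma>)" by (intro conjI exI)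
  qed
  ultimately show ?thesis by simp
qed

end

theorem theorem3p7:
  fixes M :: "('a, 'e::euclidean_space) manifold"
    and X :: "'a \<Rightarrow> ('a, 'e) tangent"
    and g :: "('a, 'e) tangent \<Rightarrow> ('a, 'e) tangent \<Rightarrow> real"
  assumes "smooth_manifold M"
    and "compact_space (manifold_topology M)"
    and "connected_space (manifold_topology M)"
    and "smooth_vector_field M X"
    and "riemannian_metric M g"
  shows "h_entropy (vf_structure M X) g = H_entropy (vf_structure M X) g \<and>
    H_entropy (vf_structure M X) g = 2 * topological_entropy M X g"
proof -
  interpret riemannian_flow M X g by unfold_locales (rule assms)+
  show ?thesis
    using entropies by (simp add: h_entropy_def H_entropy_def topological_entropy_def)
qed

end
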